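(* Let $F$ be a nondegenerate holomorphic function on an open subset $U\subset\mathbb{C}^n$. Then the (totally complex) holomorphic immersion $\phi=dF:U\to V=T^*\mathbb{C}^n$ defines on $U$ the structure of a special Kähler manifold $(U,J,\nabla,\omega)$ of complex dimension $n$, where $J$ is the complex structure of $U$ and $\nabla,\omega$ are the connection and symplectic form induced by $\phi$. Conversely, any special Kähler manifold of complex dimension $n$ can be locally obtained in this way, i.e. every point has an open neighbourhood which is isomorphic, as a special Kähler manifold, to one defined by a nondegenerate holomorphic function on an open subset of $\mathbb{C}^n$.
   Context: Kähler metrics are allowed to be indefinite. A special complex manifold $(M,J,\nabla)$ is a complex manifold $(M,J)$ together with a flat torsionfree connection $\nabla$ on its real tangent bundle such that $d^\nabla J=0$, i.e. $(\nabla_XJ)Y=(\nabla_YJ)X$ for all $X,Y$. A special Kähler manifold $(M,J,\nabla,\omega)$ is a special complex manifold together with a $\nabla$-parallel symplectic form $\omega$ which is $J$-invariant (of type $(1,1)$); its special Kähler metric is $g=\omega(J\cdot,\cdot)$. An isomorphism is a biholomorphic map identifying the connections and the symplectic forms. A holomorphic function $F$ on an open set $U\subset\mathbb{C}^n$ is called nondegenerate if the real matrix $\left(\mathrm{Im}\,\partial^2F/\partial z^i\partial z^j\right)$ is invertible (at every point of $U$). The holomorphic $1$-form $dF$ is considered as a holomorphic immersion $U\to V=T^*\mathbb{C}^n$: in the canonical coordinates $(z^1,\dots,z^n,w_1,\dots,w_n)$ of $V$ it is $z\mapsto(z,\partial F/\partial z^1,\dots,\partial F/\partial z^n)$. An immersion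 $\phi$ into $V$ is totally complex if $T^*\mathbb{R}^n\cap d\phi(T_pU)=0$ for all $p$, where $T^*\mathbb{R}^n=\mathbb{R}^{2n}\subset\mathbb{C}^{2n}=V$. Put $x^i=\mathrm{Re}\,z^i$, $y_i=\mathrm{Re}\,w_i$. For a totally complex holomorphic immersion $\phi$, the functions $x^i\circ\phi,\ y_j\circ\phi$ are local coordinates around each point; the induced connection $\nabla$ is the flat torsionfree connection for which these functions are affine, and the induced symplectic form is $\omega=2\phi^*(\sum dx^i\wedge dy_i)$. *)

theory Defs
  imports "HOL-Analysis.Analysis"
begin

section \<open>Smooth and holomorphic functions on open sets\<close>

primrec times_differentiable_on ::
  "nat \<Rightarrow> 'v set \<Rightarrow> ('v::real_normed_vector \<Rightarrow> 'w::real_normed_vector) \<Rightarrow> bool" where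
  "times_differentiable_on 0 S f \<longleftrightarrow> continuous_on S f"
| "times_differentiable_on (Suc k) S f \<longleftrightarrow>
     (\<forall>x\<in>S. f differentiable (at x)) \<and>
     (\<forall>v. times_differentiable_on k S (\<lambda>x. frechet_derivative f (at x) v))"

definition smooth_on :: "'v set \<Rightarrow> ('v::real_normed_vector \<Rightarrow> 'w::real_normed_vector) \<Rightarrow> bool" where
  "smooth_on S f \<longleftrightarrow> open S \<and> (\<forall>k. times_differentiable_on k S f)"

definition holomorphic_fun :: "(complex^'n::finite) set \<Rightarrow> (complex^'n \<Rightarrow> complex) \<Rightarrow> bool" where
  "holomorphic_fun S f \<longleftrightarrow> open S \<and>
     (\<forall>z\<in>S. \<exists>f'. (f has_derivative f') (at z) \<and> (\<forall>c v. f' (c *s v) = c * f' v))"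

definition cpartial :: "'n::finite \<Rightarrow> (complex^'n \<Rightarrow> complex) \<Rightarrow> complex^'n \<Rightarrow> complex" where
  "cpartial i f z = deriv (\<lambda>t. f (z + t *s axis i 1)) 0"

section \<open>Complex manifolds\<close>

text \<open>A chart is a pair of its domain and its coordinate map; values of the coordinate map
  outside the domain are irrelevant.\<close>

type_synonym ('a, 'n) chart = "'a set \<times> ('a \<Rightarrow> complex^'n)"
type_synonym ('a, 'n) atlas = "('a, 'n) chart set"

abbreviation inv_chart :: "('a, 'n) chart \<Rightarrow> complex^'n \<Rightarrow> 'a" where
  "inv_chart c \<equiv> inv_into (fst c) (snd c)"

locale complex_manifold =
  fixes M :: "'a topology" and A :: "('a, 'n::finite) atlas"
  assumes Hausdorff: "Hausdorff_space M"
    and second_countable: "second_countable M"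
    and chart_domain: "c \<in> A \<Longrightarrow> openin M (fst c)"
    and chart_image: "c \<in> A \<Longrightarrow> open (snd c ` fst c)"
    and chart_homeomorphic:
      "c \<in> A \<Longrightarrow> homeomorphic_map (subtopology M (fst c)) (top_of_set (snd c ` fst c)) (snd c)"
    and atlas_covers: "(\<Union>c\<in>A. fst c) = topspace M"
    and transition_holomorphic:
      "c \<in> A \<Longrightarrow> d \<in> A \<Longrightarrow>
        holomorphic_fun (snd c ` (fst c \<inter> fst d)) (\<lambda>z. snd d (inv_chart c z) $ i)"

definition holomorphic_on_manifold :: "'a topology \<Rightarrow> ('a, 'n::finite) atlas \<Rightarrow> ('a \<Rightarrow> complex) \<Rightarrow> bool" where
  "holomorphic_on_manifold M A f \<longleftrightarrow>
     (\<forall>c\<in>A. holomorphic_fun (snd c ` fst c) (\<lambda>z. f (inv_chart c z)))"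

definition holomorphic_map ::
  "'a topology \<Rightarrow> ('a, 'n::finite) atlas \<Rightarrow> 'b topology \<Rightarrow> ('b, 'm::finite) atlas \<Rightarrow> ('a \<Rightarrow> 'b) \<Rightarrow> bool" where
  "holomorphic_map M A N B \<psi> \<longleftrightarrow> continuous_map M N \<psi> \<and>
     (\<forall>c\<in>A. \<forall>d\<in>B. \<forall>i. holomorphic_fun (snd c ` {p \<in> fst c. \<psi> p \<in> fst d})
        (\<lambda>z. snd d (\<psi> (inv_chart c z)) $ i))"

definition biholomorphic_map ::
  "'a topology \<Rightarrow> ('a, 'n::finite) atlas \<Rightarrow> 'b topology \<Rightarrow> ('b, 'm::finite) atlas \<Rightarrow> ('a \<Rightarrow> 'b) \<Rightarrow> bool" where
  "biholomorphic_map M A N B \<psi> \<longleftrightarrow>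
     bij_betw \<psi> (topspace M) (topspace N) \<and>
     holomorphic_map M A N B \<psi> \<and>
     holomorphic_map N B M A (inv_into (topspace M) \<psi>)"

text \<open>The open submanifold on \<open>W\<close> carries the topology \<open>subtopology M W\<close> and this atlas.\<close>

definition restrict_atlas :: "'a set \<Rightarrow> ('a, 'n) atlas \<Rightarrow> ('a, 'n) atlas" where
  "restrict_atlas W A = (\<lambda>c. (fst c \<inter> W, snd c)) ` A"

definition std_atlas :: "(complex^'n) set \<Rightarrow> (complex^'n, 'n) atlas" where
  "std_atlas U = {(U, \<lambda>z. z)}"

section \<open>Real tangent vectors and vector fields\<close>

definition smooth_fun :: "'a topology \<Rightarrow> ('a, 'n::finite) atlas \<Rightarrow> 'a set \<Rightarrow> ('a \<Rightarrow> real) \<Rightarrow> bool" where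
  "smooth_fun M A W f \<longleftrightarrow> openin M W \<and>
     (\<forall>c\<in>A. smooth_on (snd c ` (fst c \<inter> W)) (\<lambda>z. f (inv_chart c z)))"

definition smooth_near :: "'a topology \<Rightarrow> ('a, 'n::finite) atlas \<Rightarrow> 'a \<Rightarrow> ('a \<Rightarrow> real) \<Rightarrow> bool" where
  "smooth_near M A p f \<longleftrightarrow> (\<exists>W. p \<in> W \<and> smooth_fun M A W f)"

text \<open>Tangent vectors at \<open>p\<close> are directional derivatives of functions that are smooth near \<open>p\<close>.
  On all other functions they are set to zero, so that equality of tangent vectors is
  equality of functionals. Being germ-local, they do not have to be changed when passing to an
  open submanifold.\<close>

type_synonym 'a tvec = "('a \<Rightarrow> real) \<Rightarrow> real"
type_synonym 'a vfield = "'a \<Rightarrow> 'a tvec"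

definition chart_vec ::
  "'a topology \<Rightarrow> ('a, 'n::finite) atlas \<Rightarrow> ('a, 'n) chart \<Rightarrow> 'a \<Rightarrow> complex^'n \<Rightarrow> 'a tvec" where
  "chart_vec M A c p a = (\<lambda>f. if smooth_near M A p f
     then frechet_derivative (\<lambda>z. f (inv_chart c z)) (at (snd c p)) a else 0)"

definition tangent_space :: "'a topology \<Rightarrow> ('a, 'n::finite) atlas \<Rightarrow> 'a \<Rightarrow> 'a tvec set" where
  "tangent_space M A p = {chart_vec M A c p a | c a. c \<in> A \<and> p \<in> fst c}"

definition complex_structure ::
  "'a topology \<Rightarrow> ('a, 'n::finite) atlas \<Rightarrow> 'a \<Rightarrow> 'a tvec \<Rightarrow> 'a tvec" where
  "complex_structure M A p v = (THE w. \<exists>c a. c \<in> A \<and> p \<in> fst c \<and>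
     v = chart_vec M A c p a \<and> w = chart_vec M A c p (\<i> *s a))"

definition smooth_vfield :: "'a topology \<Rightarrow> ('a, 'n::finite) atlas \<Rightarrow> 'a set \<Rightarrow> 'a vfield \<Rightarrow> bool" where
  "smooth_vfield M A W X \<longleftrightarrow> openin M W \<and> (\<forall>p\<in>W. X p \<in> tangent_space M A p) \<and>
     (\<forall>V f. V \<subseteq> W \<and> smooth_fun M A V f \<longrightarrow> smooth_fun M A V (\<lambda>p. X p f))"

definition vf_add :: "'a vfield \<Rightarrow> 'a vfield \<Rightarrow> 'a vfield" where
  "vf_add X Y = (\<lambda>p f. X p f + Y p f)"

definition vf_scale :: "('a \<Rightarrow> real) \<Rightarrow> 'a vfield \<Rightarrow> 'a vfield" where
  "vf_scale h X = (\<lambda>p f. h p * X p f)"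

definition vf_J :: "'a topology \<Rightarrow> ('a, 'n::finite) atlas \<Rightarrow> 'a vfield \<Rightarrow> 'a vfield" where
  "vf_J M A X = (\<lambda>p. complex_structure M A p (X p))"

text \<open>Without the case distinction, the commutator could be nonzero on a function that is not
  smooth near \<open>p\<close>, and would not be a tangent vector in the above sense.\<close>

definition lie_bracket ::
  "'a topology \<Rightarrow> ('a, 'n::finite) atlas \<Rightarrow> 'a vfield \<Rightarrow> 'a vfield \<Rightarrow> 'a vfield" where
  "lie_bracket M A X Y = (\<lambda>p f. if smooth_near M A p f
     then X p (\<lambda>q. Y q f) - Y p (\<lambda>q. X q f) else 0)"

section \<open>Connections\<close>

text \<open>A connection on the real tangent bundle is given by its covariant derivative of smooth
  vector fields over arbitrary open subsets; \<open>D X Y\<close> is the derivative of \<open>Y\<close> along \<open>X\<close>.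
  By \<open>local\<close> the operator over \<open>W\<close> depends only on the fields over \<open>W\<close>. Nothing is
  required of \<open>D\<close> on fields which are not smooth.\<close>

type_synonym 'a conn = "'a vfield \<Rightarrow> 'a vfield \<Rightarrow> 'a vfield"

locale connection = complex_manifold M A
  for M :: "'a topology" and A :: "('a, 'n::finite) atlas" +
  fixes D :: "'a conn"
  assumes smooth:
      "\<lbrakk>smooth_vfield M A W X; smooth_vfield M A W Y\<rbrakk> \<Longrightarrow> smooth_vfield M A W (D X Y)"
    and local:
      "\<lbrakk>smooth_vfield M A W X; smooth_vfield M A W Y;
        smooth_vfield M A W X'; smooth_vfield M A W Y';
        \<forall>q\<in>W. X q = X' q; \<forall>q\<in>W. Y q = Y' q; p \<in> W\<rbrakk> \<Longrightarrow> D X Y p = D X' Y' p"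
    and add_left:
      "\<lbrakk>smooth_vfield M A W X; smooth_vfield M A W X'; smooth_vfield M A W Y; p \<in> W\<rbrakk> \<Longrightarrow>
        D (vf_add X X') Y p = vf_add (D X Y) (D X' Y) p"
    and scale_left:
      "\<lbrakk>smooth_fun M A W h; smooth_vfield M A W X; smooth_vfield M A W Y; p \<in> W\<rbrakk> \<Longrightarrow>
        D (vf_scale h X) Y p = vf_scale h (D X Y) p"
    and add_right:
      "\<lbrakk>smooth_vfield M A W X; smooth_vfield M A W Y; smooth_vfield M A W Y'; p \<in> W\<rbrakk> \<Longrightarrow>
        D X (vf_add Y Y') p = vf_add (D X Y) (D X Y') p"
    and Leibniz:
      "\<lbrakk>smooth_fun M A W h; smooth_vfield M A W X; smooth_vfield M A W Y; p \<in> W\<rbrakk> \<Longrightarrow>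
        D X (vf_scale h Y) p = vf_add (vf_scale (\<lambda>q. X q h) Y) (vf_scale h (D X Y)) p"

locale flat_torsionfree_connection = connection M A D
  for M :: "'a topology" and A :: "('a, 'n::finite) atlas" and D :: "'a conn" +
  assumes flat:
      "\<lbrakk>smooth_vfield M A W X; smooth_vfield M A W Y; smooth_vfield M A W Z; p \<in> W\<rbrakk> \<Longrightarrow>
        D X (D Y Z) p f - D Y (D X Z) p f - D (lie_bracket M A X Y) Z p f = 0"
    and torsionfree:
      "\<lbrakk>smooth_vfield M A W X; smooth_vfield M A W Y; p \<in> W\<rbrakk> \<Longrightarrow>
        D X Y p f - D Y X p f = lie_bracket M A X Y p f"

definition same_connection ::
  "'a topology \<Rightarrow> ('a, 'n::finite) atlas \<Rightarrow> 'a conn \<Rightarrow> 'a conn \<Rightarrow> bool" where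
  "same_connection M A D D' \<longleftrightarrow>
     (\<forall>W X Y. smooth_vfield M A W X \<and> smooth_vfield M A W Y \<longrightarrow> (\<forall>p\<in>W. D X Y p = D' X Y p))"

text \<open>A function \<open>f\<close> is affine if its differential is parallel.\<close>

definition affine_fun :: "'a topology \<Rightarrow> ('a, 'n::finite) atlas \<Rightarrow> 'a conn \<Rightarrow> ('a \<Rightarrow> real) \<Rightarrow> bool" where
  "affine_fun M A D f \<longleftrightarrow> smooth_fun M A (topspace M) f \<and>
     (\<forall>W X Y. smooth_vfield M A W X \<and> smooth_vfield M A W Y \<longrightarrow>
        (\<forall>p\<in>W. X p (\<lambda>q. Y q f) - D X Y p f = 0))"

section \<open>Special complex and special Kaehler manifolds\<close>

locale special_complex_manifold = flat_torsionfree_connection M A D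
  for M :: "'a topology" and A :: "('a, 'n::finite) atlas" and D :: "'a conn" +
  assumes d_nabla_J:
      "\<lbrakk>smooth_vfield M A W X; smooth_vfield M A W Y; p \<in> W\<rbrakk> \<Longrightarrow>
        D X (vf_J M A Y) p f - vf_J M A (D X Y) p f = D Y (vf_J M A X) p f - vf_J M A (D Y X) p f"

type_synonym 'a two_form = "'a \<Rightarrow> 'a tvec \<Rightarrow> 'a tvec \<Rightarrow> real"

definition symplectic_form :: "'a topology \<Rightarrow> ('a, 'n::finite) atlas \<Rightarrow> 'a two_form \<Rightarrow> bool" where
  "symplectic_form M A \<omega> \<longleftrightarrow>
     (\<forall>p\<in>topspace M. \<forall>u\<in>tangent_space M A p. \<forall>v\<in>tangent_space M A p. \<forall>w\<in>tangent_space M A p.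
        \<forall>r s. \<omega> p (\<lambda>f. r * u f + s * v f) w = r * \<omega> p u w + s * \<omega> p v w) \<and>
     (\<forall>p\<in>topspace M. \<forall>v\<in>tangent_space M A p. \<forall>w\<in>tangent_space M A p. \<omega> p v w = - \<omega> p w v) \<and>
     (\<forall>W X Y. smooth_vfield M A W X \<and> smooth_vfield M A W Y \<longrightarrow>
        smooth_fun M A W (\<lambda>p. \<omega> p (X p) (Y p))) \<and>
     (\<forall>p\<in>topspace M. \<forall>v\<in>tangent_space M A p.
        (\<forall>w\<in>tangent_space M A p. \<omega> p v w = 0) \<longrightarrow> v = (\<lambda>f. 0)) \<and>
     (\<forall>W X Y Z. smooth_vfield M A W X \<and> smooth_vfield M A W Y \<and> smooth_vfield M A W Z \<longrightarrow>
        (\<forall>p\<in>W. X p (\<lambda>q. \<omega> q (Y q) (Z q)) + Y p (\<lambda>q. \<omega> q (Z q) (X q)) + Z p (\<lambda>q. \<omega> q (X q) (Y q))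
          - \<omega> p (lie_bracket M A X Y p) (Z p) - \<omega> p (lie_bracket M A Y Z p) (X p)
          - \<omega> p (lie_bracket M A Z X p) (Y p) = 0))"

text \<open>The metric \<open>g v w = \<omega> (J v) w\<close> may be indefinite, so no positivity is required.\<close>

locale special_kahler_manifold = special_complex_manifold M A D
  for M :: "'a topology" and A :: "('a, 'n::finite) atlas" and D :: "'a conn" +
  fixes \<omega> :: "'a two_form"
  assumes symplectic: "symplectic_form M A \<omega>"
    and parallel:
      "\<lbrakk>smooth_vfield M A W X; smooth_vfield M A W Y; smooth_vfield M A W Z; p \<in> W\<rbrakk> \<Longrightarrow>
        X p (\<lambda>q. \<omega> q (Y q) (Z q)) = \<omega> p (D X Y p) (Z p) + \<omega> p (Y p) (D X Z p)"
    and J_invariant: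
      "\<lbrakk>p \<in> topspace M; v \<in> tangent_space M A p; w \<in> tangent_space M A p\<rbrakk> \<Longrightarrow>
        \<omega> p (complex_structure M A p v) (complex_structure M A p w) = \<omega> p v w"

definition push_vec :: "('a \<Rightarrow> 'b) \<Rightarrow> 'a tvec \<Rightarrow> 'b tvec" where
  "push_vec \<psi> v = (\<lambda>g. v (\<lambda>p. g (\<psi> p)))"

definition push_vfield :: "'a topology \<Rightarrow> ('a \<Rightarrow> 'b) \<Rightarrow> 'a vfield \<Rightarrow> 'b vfield" where
  "push_vfield M \<psi> X = (\<lambda>q. push_vec \<psi> (X (inv_into (topspace M) \<psi> q)))"

definition special_kahler_isomorphism ::
  "'a topology \<Rightarrow> ('a, 'n::finite) atlas \<Rightarrow> 'a conn \<Rightarrow> 'a two_form \<Rightarrow>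
   'b topology \<Rightarrow> ('b, 'm::finite) atlas \<Rightarrow> 'b conn \<Rightarrow> 'b two_form \<Rightarrow> ('a \<Rightarrow> 'b) \<Rightarrow> bool" where
  "special_kahler_isomorphism M A D \<omega> N B D' \<omega>' \<psi> \<longleftrightarrow>
     biholomorphic_map M A N B \<psi> \<and>
     (\<forall>W X Y. smooth_vfield M A W X \<and> smooth_vfield M A W Y \<longrightarrow>
        (\<forall>p\<in>W. push_vec \<psi> (D X Y p) = D' (push_vfield M \<psi> X) (push_vfield M \<psi> Y) (\<psi> p))) \<and>
     (\<forall>p\<in>topspace M. \<forall>v\<in>tangent_space M A p. \<forall>w\<in>tangent_space M A p.
        \<omega>' (\<psi> p) (push_vec \<psi> v) (push_vec \<psi> w) = \<omega> p v w)"

section \<open>Immersions into the cotangent bundle of complex coordinate space\<close>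

text \<open>\<open>V = T\<^sup>*\<complex>\<^sup>n\<close> is the space of pairs \<open>(z, w)\<close> and \<open>T\<^sup>*\<real>\<^sup>n\<close> its subset of real points.\<close>

type_synonym 'n cotangent = "(complex^'n) \<times> (complex^'n)"

definition real_points :: "('n::finite) cotangent set" where
  "real_points = {(z, w). \<forall>i. z $ i \<in> \<real> \<and> w $ i \<in> \<real>}"

definition differential :: "('a \<Rightarrow> ('n::finite) cotangent) \<Rightarrow> 'a tvec \<Rightarrow> 'n cotangent" where
  "differential \<phi> v =
     ((\<chi> i. Complex (v (\<lambda>p. Re (fst (\<phi> p) $ i))) (v (\<lambda>p. Im (fst (\<phi> p) $ i)))),
      (\<chi> i. Complex (v (\<lambda>p. Re (snd (\<phi> p) $ i))) (v (\<lambda>p. Im (snd (\<phi> p) $ i)))))"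

definition holomorphic_immersion ::
  "'a topology \<Rightarrow> ('a, 'n::finite) atlas \<Rightarrow> ('a \<Rightarrow> 'n cotangent) \<Rightarrow> bool" where
  "holomorphic_immersion M A \<phi> \<longleftrightarrow>
     (\<forall>i. holomorphic_on_manifold M A (\<lambda>p. fst (\<phi> p) $ i) \<and>
          holomorphic_on_manifold M A (\<lambda>p. snd (\<phi> p) $ i)) \<and>
     (\<forall>p\<in>topspace M. inj_on (differential \<phi>) (tangent_space M A p))"

definition totally_complex ::
  "'a topology \<Rightarrow> ('a, 'n::finite) atlas \<Rightarrow> ('a \<Rightarrow> 'n cotangent) \<Rightarrow> bool" where
  "totally_complex M A \<phi> \<longleftrightarrow>
     (\<forall>p\<in>topspace M. real_points \<inter> differential \<phi> ` tangent_space M A p = {0})"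

definition induced_connection ::
  "'a topology \<Rightarrow> ('a, 'n::finite) atlas \<Rightarrow> ('a \<Rightarrow> 'n cotangent) \<Rightarrow> 'a conn \<Rightarrow> bool" where
  "induced_connection M A \<phi> D \<longleftrightarrow> flat_torsionfree_connection M A D \<and>
     (\<forall>i. affine_fun M A D (\<lambda>p. Re (fst (\<phi> p) $ i)) \<and> affine_fun M A D (\<lambda>p. Re (snd (\<phi> p) $ i)))"

definition dx_wedge_dy :: "('n::finite) cotangent \<Rightarrow> 'n cotangent \<Rightarrow> real" where
  "dx_wedge_dy a b =
     (\<Sum>i\<in>UNIV. Re (fst a $ i) * Re (snd b $ i) - Re (snd a $ i) * Re (fst b $ i))"

definition induced_form :: "('a \<Rightarrow> ('n::finite) cotangent) \<Rightarrow> 'a two_form" where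
  "induced_form \<phi> p v w = 2 * dx_wedge_dy (differential \<phi> v) (differential \<phi> w)"

definition nondegenerate_holomorphic :: "(complex^'n::finite) set \<Rightarrow> (complex^'n \<Rightarrow> complex) \<Rightarrow> bool" where
  "nondegenerate_holomorphic U F \<longleftrightarrow> holomorphic_fun U F \<and>
     (\<forall>z\<in>U. invertible ((\<chi> i j. Im (cpartial i (cpartial j F) z)) :: real^'n^'n))"

definition d_immersion :: "(complex^'n::finite \<Rightarrow> complex) \<Rightarrow> complex^'n \<Rightarrow> 'n cotangent" where
  "d_immersion F z = (z, \<chi> i. cpartial i F z)"

end

theory Submission
  imports Defs "HOL-Complex_Analysis.Cauchy_Integral_Formula"
begin

text \<open>A special Kaehler structure is controlled by its \<open>2n\<close> real affine coordinates, the real parts of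
  \<open>z\<^sub>i\<close> and \<open>w\<^sub>i = \<partial>\<^sub>iF\<close>. Given a nondegenerate \<open>F\<close>, invertibility of the imaginary part of the Hessian means
  exactly that a tangent vector is determined by its action on these functions, so that the connection
  is defined by \<open>(D X Y) f = X (Y f)\<close> for each of them, and all identities are tested on them.

  Conversely, flatness and torsion-freeness make the equation for a parallel \<open>1\<close>-form integrable, and
  the equation \<open>d\<^sup>\<nabla>J = 0\<close> says that \<open>\<alpha> \<circ> J\<close> is closed for such a form \<open>\<alpha>\<close>. Hence every covector at a
  point is the real part of \<open>dZ\<close> for a holomorphic \<open>Z\<close> with affine real part. Diagonalizing the Hermitian
  form of \<open>\<omega>\<close> at the point yields such functions \<open>z\<^sub>i\<close>, \<open>w\<^sub>i\<close> with \<open>\<omega> = 2 \<Sum> dx\<^sub>i \<and> dy\<^sub>i\<close> there, hence everywhere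
  nearby, both sides being parallel. Since \<open>\<omega>\<close> is of type \<open>(1,1)\<close>, the \<open>(2,0)\<close>-form \<open>\<Sum> dz\<^sub>i \<and> dw\<^sub>i\<close> vanishes, so
  \<open>\<Sum> w\<^sub>i dz\<^sub>i\<close> is closed and equals \<open>dF\<close> for a holomorphic \<open>F\<close>.\<close>

section \<open>Smooth functions\<close>

text \<open>The imaginary part of the Hessian enters because \<open>Re dw\<close> of a vector
  \<open>a\<close> is the real Hessian applied to \<open>Re a\<close> minus the imaginary Hessian
  applied to \<open>Im a\<close>: once \<open>Re a\<close> is known, \<open>Re dw\<close> determines
  \<open>Im a\<close> exactly if the latter matrix is invertible. In the converse an arbitrary
  Darboux basis of affine functions would not do, since the \<open>z\<close> must also be complex
  coordinates: their differentials have to be complex independent at the point. Hermitian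
  diagonalization achieves this. Its complex coordinates become the \<open>dz\<close> there, and
  \<open>dw\<close> is \<open>\<i> * \<epsilon> / 2\<close> times \<open>dz\<close>. A connection is
  an operator on fields over open sets. The converse therefore passes to one chart, where locality
  reduces \<open>D\<close> to Christoffel symbols, and each axiom becomes an identity for them by
  evaluation on constant fields, whose brackets vanish. Tangent vectors take the value 0 on
  functions that are not smooth near the point, so transporting them requires that smoothness be
  matched in both directions.\<close>

lemma times_differentiable_on_cong:
  assumes "open S" "\<And>x. x \<in> S \<Longrightarrow> f x = g x"
  shows "times_differentiable_on k S f \<longleftrightarrow> times_differentiable_on k S g"
  using assms(2)
proof (induction k arbitrary: f g)
  case 0
  then show ?case by (simp cong: continuous_on_cong)
next
  case (Suc k)
  have *: "(f has_derivative D) (at x) \<longleftrightarrow> (g has_derivative D) (at x)" if "x \<in> S" for x D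
    using has_derivative_transform_within_open[OF _ assms(1) that] Suc.prems by metis
  \<comment> \<open>Both functions have the same derivatives in the sense of
    \<open>has_derivative\<close>, so the choice operator in \<open>frechet_derivative_def\<close>
    selects the same map.\<close>
  then have "frechet_derivative f (at x) = frechet_derivative g (at x)" if "x \<in> S" for x
    using that unfolding frechet_derivative_def by simp
  moreover have "f differentiable (at x) \<longleftrightarrow> g differentiable (at x)" if "x \<in> S" for x
    using * that unfolding differentiable_def by simp
  ultimately show ?case
    using Suc.IH[of "\<lambda>x. frechet_derivative f (at x) v" "\<lambda>x. frechet_derivative g (at x) v" for v]
    by simp
qed

text \<open>Lets the closure proofs exhibit an explicit derivative formula in place of the chosen
  \<open>frechet_derivative\<close>; the two agree on \<open>S\<close> by uniqueness.\<close>

lemma times_differentiable_on_SucI: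
  assumes "open S" "\<And>x. x \<in> S \<Longrightarrow> (f has_derivative f' x) (at x)"
    "\<And>v. times_differentiable_on k S (\<lambda>x. f' x v)"
  shows "times_differentiable_on (Suc k) S f"
proof -
  have "frechet_derivative f (at x) = f' x" if "x \<in> S" for x
    using frechet_derivative_at assms(2) that by metis
  then have "times_differentiable_on k S (\<lambda>x. frechet_derivative f (at x) v)" for v
    using times_differentiable_on_cong[OF assms(1), of "\<lambda>x. frechet_derivative f (at x) v"] assms(3) by simp
  then show ?thesis
    using assms(2) unfolding times_differentiable_on.simps differentiable_def by blast
qed

lemma times_differentiable_on_SucD:
  assumes "times_differentiable_on (Suc k) S f"
  shows "x \<in> S \<Longrightarrow> (f has_derivative frechet_derivative f (at x)) (at x)"
    "times_differentiable_on k S (\<lambda>x. frechet_derivative f (at x) v)"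
  using assms frechet_derivative_works by auto

lemma times_differentiable_on_Suc_imp:
  "times_differentiable_on (Suc k) S f \<Longrightarrow> times_differentiable_on k S f"
proof (induction k arbitrary: f)
  case 0
  then show ?case
    by (auto intro!: continuous_at_imp_continuous_on differentiable_imp_continuous_within)
qed auto

lemma times_differentiable_on_subset:
  "times_differentiable_on k S f \<Longrightarrow> T \<subseteq> S \<Longrightarrow> times_differentiable_on k T f"
  by (induction k arbitrary: f) (auto intro: continuous_on_subset)

lemma times_differentiable_on_const:
  "open S \<Longrightarrow> times_differentiable_on k S (\<lambda>x. c)"
proof (induction k arbitrary: c)
  case (Suc k)
  then show ?case
    by (intro times_differentiable_on_SucI[where f' = "\<lambda>_ _. 0"]) auto
qed simp

lemma times_differentiable_on_linear:
  assumes "bounded_linear h" "open S" "times_differentiable_on k S f"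
  shows "times_differentiable_on k S (\<lambda>x. h (f x))"
  using assms(3)
proof (induction k arbitrary: f)
  case 0
  then show ?case
    using assms(1) by (auto intro: linear_continuous_on_compose bounded_linear.continuous_on)
next
  case (Suc k)
  show ?case
    by (rule times_differentiable_on_SucI[OF assms(2)])
      (auto intro!: bounded_linear.has_derivative[OF assms(1)] Suc.IH times_differentiable_on_SucD[OF Suc.prems])
qed

lemma times_differentiable_on_add:
  assumes "open S" "times_differentiable_on k S f" "times_differentiable_on k S g"
  shows "times_differentiable_on k S (\<lambda>x. f x + g x)"
  using assms(2,3)
proof (induction k arbitrary: f g)
  case 0
  then show ?case by (auto intro: continuous_on_add)
next
  case (Suc k)
  show ?case
    by (rule times_differentiable_on_SucI[OF assms(1)])
      (auto intro!: has_derivative_add Suc.IH times_differentiable_on_SucD[OF Suc.prems(1)]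
        times_differentiable_on_SucD[OF Suc.prems(2)])
qed

lemma times_differentiable_on_sum:
  assumes "open S" "\<And>i. i \<in> I \<Longrightarrow> times_differentiable_on k S (f i)"
  shows "times_differentiable_on k S (\<lambda>x. \<Sum>i\<in>I. f i x)"
proof (cases "finite I")
  case True
  then show ?thesis using assms(2)
    by (induction I rule: finite_induct)
      (auto intro: times_differentiable_on_const times_differentiable_on_add assms(1))
qed (auto intro: times_differentiable_on_const assms(1))

lemma times_differentiable_on_bilinear:
  assumes "bounded_bilinear h" "open S" "times_differentiable_on k S f" "times_differentiable_on k S g"
  shows "times_differentiable_on k S (\<lambda>x. h (f x) (g x))"
  using assms(3,4)
proof (induction k arbitrary: f g)
  case 0
  then show ?case using bounded_bilinear.continuous_on[OF assms(1)] by auto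
next
  case (Suc k)
  show ?case
    by (rule times_differentiable_on_SucI[OF assms(2) bounded_bilinear.FDERIV[OF assms(1)]])
      (auto intro!: times_differentiable_on_add assms(2) Suc.IH times_differentiable_on_SucD[OF Suc.prems(1)]
        times_differentiable_on_SucD[OF Suc.prems(2)] times_differentiable_on_Suc_imp[OF Suc.prems(1)]
        times_differentiable_on_Suc_imp[OF Suc.prems(2)] simp del: times_differentiable_on.simps)
qed

text \<open>In the chain rule the derivative of \<open>f\<close> is applied to the moving vector
  \<open>g' x v\<close>, while the definition controls derivatives in fixed directions only.
  Expanding this vector over \<open>Basis\<close> separates the two dependences, whence the finite
  dimension of the target of \<open>g\<close>.\<close>

lemma times_differentiable_on_compose:
  fixes g :: "'v::real_normed_vector \<Rightarrow> 'w::euclidean_space"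
  assumes "open S" "open T" "\<And>x. x \<in> S \<Longrightarrow> g x \<in> T"
    and "times_differentiable_on k T f" "times_differentiable_on k S g"
  shows "times_differentiable_on k S (\<lambda>x. f (g x))"
  using assms(4,5)
proof (induction k arbitrary: f)
  case 0
  then show ?case
    using assms(3) by (auto intro: continuous_on_compose2)
next
  case (Suc k)
  let ?f' = "\<lambda>y. frechet_derivative f (at y)" and ?g' = "\<lambda>x. frechet_derivative g (at x)"
  have f: "(f has_derivative ?f' (g x)) (at (g x))" if "x \<in> S" for x
    using times_differentiable_on_SucD(1)[OF Suc.prems(1)] assms(3) that by blast
  have g: "(g has_derivative ?g' x) (at x)" if "x \<in> S" for x
    using times_differentiable_on_SucD(1)[OF Suc.prems(2)] that by blast
  have eq: "?f' (g x) (?g' x v) = (\<Sum>b\<in>Basis. (?g' x v \<bullet> b) *\<^sub>R ?f' (g x) b)" if "x \<in> S" for x v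
  proof -
    have lin: "linear (?f' (g x))"
      using f[OF that] by (rule has_derivative_linear)
    have "?f' (g x) (?g' x v) = ?f' (g x) (\<Sum>b\<in>Basis. (?g' x v \<bullet> b) *\<^sub>R b)"
      by (simp only: euclidean_representation)
    then show ?thesis
      by (simp only: linear_sum[OF lin] linear_cmul[OF lin] o_def)
  qed
  show ?case
  proof (rule times_differentiable_on_SucI[OF assms(1)])
    show "((\<lambda>x. f (g x)) has_derivative (\<lambda>v. \<Sum>b\<in>Basis. (?g' x v \<bullet> b) *\<^sub>R ?f' (g x) b)) (at x)" if "x \<in> S" for x
      using has_derivative_compose[OF g[OF that] f[OF that]] eq[OF that] by simp
    show "times_differentiable_on k S (\<lambda>x. \<Sum>b\<in>Basis. (?g' x v \<bullet> b) *\<^sub>R ?f' (g x) b)" for v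
      by (intro times_differentiable_on_sum assms(1) times_differentiable_on_bilinear[OF bounded_bilinear_scaleR]
          times_differentiable_on_linear[OF bounded_linear_inner_left] times_differentiable_on_SucD(2)[OF Suc.prems(2)]
          Suc.IH times_differentiable_on_SucD(2)[OF Suc.prems(1)] times_differentiable_on_Suc_imp[OF Suc.prems(2)])
  qed
qed

text \<open>The derivative is a product of \<open>f'\<close> with two copies of
  \<open>inverse f\<close> itself, so the induction on the order closes.\<close>

lemma times_differentiable_on_inverse:
  fixes f :: "'v::real_normed_vector \<Rightarrow> real"
  assumes "open S" "\<And>x. x \<in> S \<Longrightarrow> f x \<noteq> 0" "times_differentiable_on k S f"
  shows "times_differentiable_on k S (\<lambda>x. inverse (f x))"
  using assms(3)
proof (induction k)
  case 0
  then show ?case using assms(2) by (auto intro: continuous_on_inverse)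
next
  case (Suc k)
  show ?case
  proof (rule times_differentiable_on_SucI[OF assms(1)])
    show "((\<lambda>x. inverse (f x)) has_derivative
        (\<lambda>v. (- 1) * (inverse (f x) * frechet_derivative f (at x) v * inverse (f x)))) (at x)" if "x \<in> S" for x
      using Deriv.has_derivative_inverse[OF assms(2)[OF that] times_differentiable_on_SucD(1)[OF Suc.prems that]] by simp
    show "times_differentiable_on k S (\<lambda>x. (- 1) * (inverse (f x) * frechet_derivative f (at x) v * inverse (f x)))" for v
      by (intro times_differentiable_on_bilinear[OF bounded_bilinear_mult] assms(1) times_differentiable_on_const
          Suc.IH times_differentiable_on_SucD(2)[OF Suc.prems] times_differentiable_on_Suc_imp[OF Suc.prems])
  qed
qed

section \<open>Closure properties of smooth functions\<close>

lemma smooth_on_open: "smooth_on S f \<Longrightarrow> open S"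
  by (simp add: smooth_on_def)

lemma smooth_on_cong: "(\<And>x. x \<in> S \<Longrightarrow> f x = g x) \<Longrightarrow> smooth_on S f \<longleftrightarrow> smooth_on S g"
  using times_differentiable_on_cong unfolding smooth_on_def by metis

lemma smooth_on_subset: "smooth_on S f \<Longrightarrow> open T \<Longrightarrow> T \<subseteq> S \<Longrightarrow> smooth_on T f"
  using times_differentiable_on_subset unfolding smooth_on_def by metis

lemma smooth_on_has_derivative:
  "smooth_on S f \<Longrightarrow> x \<in> S \<Longrightarrow> (f has_derivative frechet_derivative f (at x)) (at x)"
  using times_differentiable_on_SucD(1) unfolding smooth_on_def by metis

lemma smooth_on_frechet_derivative:
  "smooth_on S f \<Longrightarrow> smooth_on S (\<lambda>x. frechet_derivative f (at x) v)"
  using times_differentiable_on_SucD(2) unfolding smooth_on_def by metis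

lemma smooth_on_continuous_on: "smooth_on S f \<Longrightarrow> continuous_on S f"
  unfolding smooth_on_def using times_differentiable_on.simps(1) by metis

lemma smooth_on_derivative:
  assumes "smooth_on S f" "\<And>x. x \<in> S \<Longrightarrow> (f has_derivative f' x) (at x)"
  shows "smooth_on S (\<lambda>x. f' x v)"
proof -
  have "frechet_derivative f (at x) = f' x" if "x \<in> S" for x
    using frechet_derivative_at assms(2) that by metis
  then show ?thesis
    using smooth_on_cong[of S "\<lambda>x. frechet_derivative f (at x) v"] smooth_on_frechet_derivative[OF assms(1)]
    by auto
qed

lemma smooth_on_const: "open S \<Longrightarrow> smooth_on S (\<lambda>x. c)"
  by (simp add: smooth_on_def times_differentiable_on_const)

lemma smooth_on_linear: "bounded_linear h \<Longrightarrow> smooth_on S f \<Longrightarrow> smooth_on S (\<lambda>x. h (f x))"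
  by (simp add: smooth_on_def times_differentiable_on_linear)

lemma smooth_on_id: "open S \<Longrightarrow> smooth_on S (\<lambda>x. x)"
  unfolding smooth_on_def
proof (intro conjI allI)
  fix k assume "open S"
  then show "times_differentiable_on k S (\<lambda>x. x)"
    by (cases k)
      (auto intro!: times_differentiable_on_SucI[where f' = "\<lambda>_ v. v"] times_differentiable_on_const
        simp del: times_differentiable_on.simps(2))
qed

lemma smooth_on_add: "smooth_on S f \<Longrightarrow> smooth_on S g \<Longrightarrow> smooth_on S (\<lambda>x. f x + g x)"
  by (simp add: smooth_on_def times_differentiable_on_add)

lemma smooth_on_sum:
  "open S \<Longrightarrow> (\<And>i. i \<in> I \<Longrightarrow> smooth_on S (f i)) \<Longrightarrow> smooth_on S (\<lambda>x. \<Sum>i\<in>I. f i x)"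
  by (simp add: smooth_on_def times_differentiable_on_sum)

lemma smooth_on_bilinear:
  "bounded_bilinear h \<Longrightarrow> smooth_on S f \<Longrightarrow> smooth_on S g \<Longrightarrow> smooth_on S (\<lambda>x. h (f x) (g x))"
  by (simp add: smooth_on_def times_differentiable_on_bilinear)

lemmas smooth_on_mult = smooth_on_bilinear[OF bounded_bilinear_mult]
lemmas smooth_on_scaleR = smooth_on_bilinear[OF bounded_bilinear_scaleR]
lemmas smooth_on_minus = smooth_on_linear[OF bounded_linear_minus[OF bounded_linear_ident]]

lemma smooth_on_diff:
  "smooth_on S f \<Longrightarrow> smooth_on S g \<Longrightarrow> smooth_on S (\<lambda>x. f x - g x)"
  using smooth_on_add[OF _ smooth_on_minus, of S f g] by simp

lemma smooth_on_prod:
  fixes f :: "'i \<Rightarrow> 'v::real_normed_vector \<Rightarrow> real"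
  assumes "open S" "\<And>i. i \<in> I \<Longrightarrow> smooth_on S (f i)"
  shows "smooth_on S (\<lambda>x. \<Prod>i\<in>I. f i x)"
proof (cases "finite I")
  case True
  then show ?thesis using assms(2)
    by (induction I rule: finite_induct) (auto intro: smooth_on_const smooth_on_mult assms(1))
qed (auto intro: smooth_on_const assms(1))

lemma smooth_on_inverse:
  fixes f :: "'v::real_normed_vector \<Rightarrow> real"
  shows "smooth_on S f \<Longrightarrow> (\<And>x. x \<in> S \<Longrightarrow> f x \<noteq> 0) \<Longrightarrow> smooth_on S (\<lambda>x. inverse (f x))"
  by (simp add: smooth_on_def times_differentiable_on_inverse)

lemma smooth_on_compose:
  fixes g :: "'v::real_normed_vector \<Rightarrow> 'w::euclidean_space"
  shows "smooth_on T f \<Longrightarrow> smooth_on S g \<Longrightarrow> (\<And>x. x \<in> S \<Longrightarrow> g x \<in> T) \<Longrightarrow> smooth_on S (\<lambda>x. f (g x))"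
  unfolding smooth_on_def using times_differentiable_on_compose by blast

lemma smooth_on_euclidean:
  fixes f :: "'v::real_normed_vector \<Rightarrow> 'w::euclidean_space"
  assumes "open S" "\<And>b. b \<in> Basis \<Longrightarrow> smooth_on S (\<lambda>x. f x \<bullet> b)"
  shows "smooth_on S f"
proof -
  have "smooth_on S (\<lambda>x. \<Sum>b\<in>Basis. (f x \<bullet> b) *\<^sub>R b)"
    by (intro smooth_on_sum smooth_on_scaleR smooth_on_const assms)
  then show ?thesis by (simp add: euclidean_representation)
qed

lemma smooth_on_matrix_det:
  fixes f :: "'v::real_normed_vector \<Rightarrow> real^'m^'m"
  assumes "open S" "\<And>i j. smooth_on S (\<lambda>x. f x $ i $ j)"
  shows "smooth_on S (\<lambda>x. det (f x))"
  unfolding det_def by (intro smooth_on_sum smooth_on_mult smooth_on_const smooth_on_prod assms)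

text \<open>The mean value theorem applied twice to the second difference over a parallelogram:
  first in \<open>s\<close> to the difference of the two sides parallel to \<open>u\<close>, then in
  \<open>t\<close> to the resulting difference of derivatives.\<close>

lemma second_difference_mean_value:
  fixes f :: "'v::real_normed_vector \<Rightarrow> real"
  assumes S: "\<And>s t. 0 \<le> s \<Longrightarrow> s \<le> h \<Longrightarrow> 0 \<le> t \<Longrightarrow> t \<le> h \<Longrightarrow> x + s *\<^sub>R u + t *\<^sub>R v \<in> S"
    and f: "\<And>y. y \<in> S \<Longrightarrow> (f has_derivative f' y) (at y)"
    and f': "\<And>y. y \<in> S \<Longrightarrow> ((\<lambda>y. f' y u) has_derivative f'' y) (at y)"
    and h: "h > 0"
  shows "\<exists>s t. 0 \<le> s \<and> s \<le> h \<and> 0 \<le> t \<and> t \<le> h \<and>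
    f (x + h *\<^sub>R u + h *\<^sub>R v) - f (x + h *\<^sub>R u) - f (x + h *\<^sub>R v) + f x = h * h * f'' (x + s *\<^sub>R u + t *\<^sub>R v) v"
proof -
  have d1: "((\<lambda>s. f (x + s *\<^sub>R u + t *\<^sub>R v)) has_real_derivative f' (x + s *\<^sub>R u + t *\<^sub>R v) u) (at s)"
    if "0 \<le> s" "s \<le> h" "0 \<le> t" "t \<le> h" for s t
  proof -
    note fd = f[OF S[OF that]]
    have "((\<lambda>s. x + s *\<^sub>R u + t *\<^sub>R v) has_derivative (\<lambda>d. d *\<^sub>R u)) (at s)"
      by (auto intro!: derivative_eq_intros)
    from has_derivative_compose[OF this fd]
    have "((\<lambda>s. f (x + s *\<^sub>R u + t *\<^sub>R v)) has_derivative (\<lambda>d. f' (x + s *\<^sub>R u + t *\<^sub>R v) (d *\<^sub>R u))) (at s)" .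
    moreover have "(\<lambda>d. f' (x + s *\<^sub>R u + t *\<^sub>R v) (d *\<^sub>R u)) = (*) (f' (x + s *\<^sub>R u + t *\<^sub>R v) u)"
      using linear_cmul[OF has_derivative_linear[OF fd]] by auto
    ultimately show ?thesis unfolding has_field_derivative_def by simp
  qed
  have d2: "((\<lambda>t. f' (x + s *\<^sub>R u + t *\<^sub>R v) u) has_real_derivative f'' (x + s *\<^sub>R u + t *\<^sub>R v) v) (at t)"
    if "0 \<le> s" "s \<le> h" "0 \<le> t" "t \<le> h" for s t
  proof -
    note fd = f'[OF S[OF that]]
    have "((\<lambda>t. x + s *\<^sub>R u + t *\<^sub>R v) has_derivative (\<lambda>d. d *\<^sub>R v)) (at t)"
      by (auto intro!: derivative_eq_intros)
    from has_derivative_compose[OF this fd]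
    have "((\<lambda>t. f' (x + s *\<^sub>R u + t *\<^sub>R v) u) has_derivative (\<lambda>d. f'' (x + s *\<^sub>R u + t *\<^sub>R v) (d *\<^sub>R v))) (at t)" .
    moreover have "(\<lambda>d. f'' (x + s *\<^sub>R u + t *\<^sub>R v) (d *\<^sub>R v)) = (*) (f'' (x + s *\<^sub>R u + t *\<^sub>R v) v)"
      using linear_cmul[OF has_derivative_linear[OF fd]] by auto
    ultimately show ?thesis unfolding has_field_derivative_def by simp
  qed
  obtain s where s: "0 < s" "s < h" and
    1: "(f (x + h *\<^sub>R u + h *\<^sub>R v) - f (x + h *\<^sub>R u + 0 *\<^sub>R v)) - (f (x + 0 *\<^sub>R u + h *\<^sub>R v) - f (x + 0 *\<^sub>R u + 0 *\<^sub>R v))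
      = (h - 0) * (f' (x + s *\<^sub>R u + h *\<^sub>R v) u - f' (x + s *\<^sub>R u + 0 *\<^sub>R v) u)"
  proof -
    have "((\<lambda>s. f (x + s *\<^sub>R u + h *\<^sub>R v) - f (x + s *\<^sub>R u + 0 *\<^sub>R v)) has_real_derivative
        f' (x + s *\<^sub>R u + h *\<^sub>R v) u - f' (x + s *\<^sub>R u + 0 *\<^sub>R v) u) (at s)" if "0 \<le> s" "s \<le> h" for s
      using h that by (intro DERIV_diff d1) auto
    from MVT2[OF h this] show thesis using that by blast
  qed
  obtain t where t: "0 < t" "t < h" and
    2: "f' (x + s *\<^sub>R u + h *\<^sub>R v) u - f' (x + s *\<^sub>R u + 0 *\<^sub>R v) u = (h - 0) * f'' (x + s *\<^sub>R u + t *\<^sub>R v) v"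
  proof -
    have "((\<lambda>t. f' (x + s *\<^sub>R u + t *\<^sub>R v) u) has_real_derivative f'' (x + s *\<^sub>R u + t *\<^sub>R v) v) (at t)"
      if "0 \<le> t" "t \<le> h" for t
      using s that by (intro d2) auto
    from MVT2[OF h this] show thesis using that by blast
  qed
  have "f (x + h *\<^sub>R u + h *\<^sub>R v) - f (x + h *\<^sub>R u) - f (x + h *\<^sub>R v) + f x = h * h * f'' (x + s *\<^sub>R u + t *\<^sub>R v) v"
    using 1 unfolding 2 by simp
  then show ?thesis using s t by (intro exI[of _ s] exI[of _ t]) auto
qed

text \<open>The second difference is symmetric in \<open>u\<close> and \<open>v\<close>, so the two
  orders of differentiation give equal values at two points of one small parallelogram. If they
  differed at \<open>x\<close>, continuity would keep both within half of that difference of their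
  values at \<open>x\<close>, which is impossible.\<close>

lemma smooth_on_second_derivative_symmetric:
  fixes f :: "'v::real_normed_vector \<Rightarrow> real"
  assumes f: "smooth_on S f" and x: "x \<in> S"
  shows "frechet_derivative (\<lambda>y. frechet_derivative f (at y) u) (at x) v =
    frechet_derivative (\<lambda>y. frechet_derivative f (at y) v) (at x) u"
proof (rule ccontr)
  define P where "P y = frechet_derivative (\<lambda>y. frechet_derivative f (at y) u) (at y) v" for y
  define Q where "Q y = frechet_derivative (\<lambda>y. frechet_derivative f (at y) v) (at y) u" for y
  assume "\<not> ?thesis"
  then have ne: "dist (P x) (Q x) / 2 > 0" by (auto simp: P_def Q_def)
  have "isCont P x" "isCont Q x"
    using f x smooth_on_open[OF f] unfolding P_def Q_def
    by (auto intro!: smooth_on_continuous_on[THEN continuous_on_interior] smooth_on_frechet_derivative simp: interior_open)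
  then have P: "(P \<longlongrightarrow> P x) (nhds x)" and Q: "(Q \<longlongrightarrow> Q x) (nhds x)"
    by (simp_all add: isCont_def tendsto_at_iff_tendsto_nhds)
  have "\<forall>\<^sub>F y in nhds x. y \<in> S \<and> dist (P y) (P x) < dist (P x) (Q x) / 2 \<and> dist (Q y) (Q x) < dist (P x) (Q x) / 2"
    by (intro eventually_conj tendstoD[OF P ne] tendstoD[OF Q ne] eventually_nhds_in_open smooth_on_open[OF f] x)
  then have "\<exists>d>0. \<forall>y. dist y x < d \<longrightarrow>
      y \<in> S \<and> dist (P y) (P x) < dist (P x) (Q x) / 2 \<and> dist (Q y) (Q x) < dist (P x) (Q x) / 2"
    by (simp only: eventually_nhds_metric)
  then obtain d where d: "d > 0" and d': "\<forall>y. dist y x < d \<longrightarrow>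
      y \<in> S \<and> dist (P y) (P x) < dist (P x) (Q x) / 2 \<and> dist (Q y) (Q x) < dist (P x) (Q x) / 2"
    by (elim exE conjE)
  \<comment> \<open>Keeps the whole parallelogram within distance \<open>d / 2\<close> of
    \<open>x\<close>; the summand 1 prevents a zero denominator when both vectors vanish.\<close>
  define h where "h = d / (2 * (norm u + norm v + 1))"
  have h: "h > 0" unfolding h_def using d by (simp add: add_nonneg_pos)
  have near: "dist (x + s *\<^sub>R u + t *\<^sub>R v) x < d" if "0 \<le> s" "s \<le> h" "0 \<le> t" "t \<le> h" for s t
  proof -
    have "dist (x + s *\<^sub>R u + t *\<^sub>R v) x = norm (s *\<^sub>R u + t *\<^sub>R v)" by (simp add: dist_norm)
    also have "\<dots> \<le> s * norm u + t * norm v" using norm_triangle_ineq[of "s *\<^sub>R u" "t *\<^sub>R v"] that by simp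
    also have "\<dots> \<le> h * norm u + h * norm v" using that by (intro add_mono mult_right_mono) auto
    also have "\<dots> \<le> h * (norm u + norm v + 1)" using h by (simp add: algebra_simps)
    also have "\<dots> = d / 2"
    proof -
      have "norm u + norm v + 1 > 0" by (simp add: add_nonneg_pos)
      then show ?thesis unfolding h_def by (simp add: field_simps del: distrib_left_numeral)
    qed
    finally show ?thesis using d by simp
  qed
  have near': "dist (x + t *\<^sub>R v + s *\<^sub>R u) x < d" if "0 \<le> s" "s \<le> h" "0 \<le> t" "t \<le> h" for s t
    using near[OF that] by (simp only: add.assoc add.commute[of "t *\<^sub>R v"])
  have "\<exists>s t. 0 \<le> s \<and> s \<le> h \<and> 0 \<le> t \<and> t \<le> h \<and>
    f (x + h *\<^sub>R u + h *\<^sub>R v) - f (x + h *\<^sub>R u) - f (x + h *\<^sub>R v) + f x = h * h * P (x + s *\<^sub>R u + t *\<^sub>R v)"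
    unfolding P_def
  proof (rule second_difference_mean_value[where S = S and f' = "\<lambda>y. frechet_derivative f (at y)"
        and f'' = "\<lambda>y. frechet_derivative (\<lambda>y. frechet_derivative f (at y) u) (at y)"])
    show "x + s *\<^sub>R u + t *\<^sub>R v \<in> S" if "0 \<le> s" "s \<le> h" "0 \<le> t" "t \<le> h" for s t
      using d' near[OF that] by blast
    show "(f has_derivative frechet_derivative f (at y)) (at y)" if "y \<in> S" for y
      by (rule smooth_on_has_derivative[OF f that])
    show "((\<lambda>y. frechet_derivative f (at y) u) has_derivative
        frechet_derivative (\<lambda>y. frechet_derivative f (at y) u) (at y)) (at y)" if "y \<in> S" for y
      by (rule smooth_on_has_derivative[OF smooth_on_frechet_derivative[OF f] that])
  qed (rule h)
  then obtain sy ty where sty: "0 \<le> sy" "sy \<le> h" "0 \<le> ty" "ty \<le> h" and y: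
    "f (x + h *\<^sub>R u + h *\<^sub>R v) - f (x + h *\<^sub>R u) - f (x + h *\<^sub>R v) + f x = h * h * P (x + sy *\<^sub>R u + ty *\<^sub>R v)"
    by auto
  have "\<exists>s t. 0 \<le> s \<and> s \<le> h \<and> 0 \<le> t \<and> t \<le> h \<and>
    f (x + h *\<^sub>R v + h *\<^sub>R u) - f (x + h *\<^sub>R v) - f (x + h *\<^sub>R u) + f x = h * h * Q (x + s *\<^sub>R v + t *\<^sub>R u)"
    unfolding Q_def
  proof (rule second_difference_mean_value[where S = S and f' = "\<lambda>y. frechet_derivative f (at y)"
        and f'' = "\<lambda>y. frechet_derivative (\<lambda>y. frechet_derivative f (at y) v) (at y)"])
    show "x + s *\<^sub>R v + t *\<^sub>R u \<in> S" if "0 \<le> s" "s \<le> h" "0 \<le> t" "t \<le> h" for s t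
      using d' near'[OF that(3,4,1,2)] by blast
    show "(f has_derivative frechet_derivative f (at y)) (at y)" if "y \<in> S" for y
      by (rule smooth_on_has_derivative[OF f that])
    show "((\<lambda>y. frechet_derivative f (at y) v) has_derivative
        frechet_derivative (\<lambda>y. frechet_derivative f (at y) v) (at y)) (at y)" if "y \<in> S" for y
      by (rule smooth_on_has_derivative[OF smooth_on_frechet_derivative[OF f] that])
  qed (rule h)
  then obtain sz tz where stz: "0 \<le> sz" "sz \<le> h" "0 \<le> tz" "tz \<le> h" and z:
    "f (x + h *\<^sub>R v + h *\<^sub>R u) - f (x + h *\<^sub>R v) - f (x + h *\<^sub>R u) + f x = h * h * Q (x + sz *\<^sub>R v + tz *\<^sub>R u)"
    by auto
  have "x + h *\<^sub>R v + h *\<^sub>R u = x + h *\<^sub>R u + h *\<^sub>R v" by simp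
  from z[unfolded this] y have "h * h * P (x + sy *\<^sub>R u + ty *\<^sub>R v) = h * h * Q (x + sz *\<^sub>R v + tz *\<^sub>R u)"
    by linarith
  then have "P (x + sy *\<^sub>R u + ty *\<^sub>R v) = Q (x + sz *\<^sub>R v + tz *\<^sub>R u)" using h by simp
  moreover have "dist (P (x + sy *\<^sub>R u + ty *\<^sub>R v)) (P x) < dist (P x) (Q x) / 2"
    using d' near[OF sty] by blast
  moreover have "dist (Q (x + sz *\<^sub>R v + tz *\<^sub>R u)) (Q x) < dist (P x) (Q x) / 2"
    using d' near'[OF stz(3,4,1,2)] by blast
  ultimately show False
    using dist_triangle_half_r[of _ "P x" "dist (P x) (Q x)" "Q x"] by auto
qed

section \<open>Holomorphic functions of several variables\<close>

text \<open>\<open>leibniz_rule\<close> wants the derivative to be continuous as an operator. In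
  finite dimension continuity in each fixed direction is enough for that, and this is the form
  available for Frechet derivatives here.\<close>

lemma has_derivative_integral_param:
  fixes f :: "'a::euclidean_space \<Rightarrow> real \<Rightarrow> 'c::euclidean_space"
  assumes U: "open U" "convex U" "x0 \<in> U"
    and f: "\<And>x t. x \<in> U \<Longrightarrow> t \<in> {0..1} \<Longrightarrow> ((\<lambda>x. f x t) has_derivative f' x t) (at x)"
    and f_cont: "\<And>x. x \<in> U \<Longrightarrow> continuous_on {0..1} (f x)"
    and f'_cont: "\<And>v. continuous_on (U \<times> {0..1}) (\<lambda>(x, t). f' x t v)"
  shows "((\<lambda>x. integral {0..1} (f x)) has_derivative (\<lambda>v. integral {0..1} (\<lambda>t. f' x0 t v))) (at x0)"
proof -
  define F where "F x t = Blinfun (f' x t)" for x t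
  have F: "blinfun_apply (F x t) = f' x t" if "x \<in> U" "t \<in> {0..1}" for x t
    unfolding F_def using f[OF that] by (intro bounded_linear_Blinfun_apply has_derivative_bounded_linear)
  have F_cont: "continuous_on (U \<times> {0..1}) (\<lambda>(x, t). F x t)"
  proof (rule continuous_on_blinfun_componentwise)
    show "continuous_on (U \<times> {0..1}) (\<lambda>p. blinfun_apply (case p of (x, t) \<Rightarrow> F x t) i)" for i
      using f'_cont[of i] by (rule continuous_on_eq) (auto simp: F)
  qed
  have "((\<lambda>x. integral (cbox 0 1) (f x)) has_derivative blinfun_apply (integral (cbox 0 1) (F x0))) (at x0 within U)"
  proof (rule leibniz_rule)
    show "((\<lambda>x. f x t) has_derivative blinfun_apply (F x t)) (at x within U)" if "x \<in> U" "t \<in> cbox 0 1" for x t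
      using f[of x t] that F[of x t] by (auto intro: has_derivative_at_withinI)
    show "f x integrable_on cbox 0 1" if "x \<in> U" for x
      using f_cont[OF that] by (auto intro: integrable_continuous_real)
    show "continuous_on (U \<times> cbox 0 1) (\<lambda>(x, t). F x t)"
      using F_cont by simp
  qed (use U in auto)
  moreover have eq: "blinfun_apply (integral {0..1} (F x0)) v = integral {0..1} (\<lambda>t. f' x0 t v)" for v
  proof -
    have "continuous_on {0..1} (\<lambda>t. F x0 t)"
    proof -
      have "continuous_on {0..1} (\<lambda>t::real. (x0, t))" by (intro continuous_intros)
      from continuous_on_compose2[OF F_cont this] U(3) show ?thesis by force
    qed
    then have "F x0 integrable_on {0..1}" by (rule integrable_continuous_real)
    from integral_linear[OF this blinfun.bounded_linear_left[of v]]
    have "blinfun_apply (integral {0..1} (F x0)) v = integral {0..1} (\<lambda>t. blinfun_apply (F x0 t) v)"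
      by (simp add: o_def)
    also have "\<dots> = integral {0..1} (\<lambda>t. f' x0 t v)"
      using F[OF U(3)] by (intro integral_cong) simp
    finally show ?thesis by simp
  qed
  moreover have "blinfun_apply (integral {0..1} (F x0)) = (\<lambda>v. integral {0..1} (\<lambda>t. f' x0 t v))"
    by (rule ext) (rule eq)
  ultimately show ?thesis
    by (simp add: at_within_open[OF U(3,1)])
qed

section \<open>Complex linear derivatives and Cauchy's formula on complex lines\<close>

lemma holomorphic_funI:
  assumes "open S" "\<And>z. z \<in> S \<Longrightarrow> (f has_derivative f' z) (at z)"
    "\<And>z c v. z \<in> S \<Longrightarrow> f' z (c *s v) = c * f' z v"
  shows "holomorphic_fun S f"
  using assms unfolding holomorphic_fun_def by blast

lemma holomorphic_fun_open: "holomorphic_fun S f \<Longrightarrow> open S"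
  by (simp add: holomorphic_fun_def)

lemma holomorphic_fun_has_derivative:
  assumes "holomorphic_fun S f" "z \<in> S"
  shows "(f has_derivative frechet_derivative f (at z)) (at z)"
  using assms unfolding holomorphic_fun_def by (metis frechet_derivative_at)

lemma holomorphic_fun_derivative_scale:
  assumes "holomorphic_fun S f" "z \<in> S"
  shows "frechet_derivative f (at z) (c *s v) = c * frechet_derivative f (at z) v"
  using assms unfolding holomorphic_fun_def by (metis frechet_derivative_at)

lemma holomorphic_fun_subset: "holomorphic_fun S f \<Longrightarrow> open T \<Longrightarrow> T \<subseteq> S \<Longrightarrow> holomorphic_fun T f"
  unfolding holomorphic_fun_def by blast

lemma holomorphic_fun_cong:
  assumes "\<And>z. z \<in> S \<Longrightarrow> f z = g z"
  shows "holomorphic_fun S f \<longleftrightarrow> holomorphic_fun S g"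
proof -
  have "(f has_derivative f') (at z) \<longleftrightarrow> (g has_derivative f') (at z)" if "open S" "z \<in> S" for f' z
    using has_derivative_transform_within_open[OF _ that] assms by metis
  then show ?thesis unfolding holomorphic_fun_def by metis
qed

lemma holomorphic_fun_continuous_on: "holomorphic_fun S f \<Longrightarrow> continuous_on S f"
  by (meson continuous_at_imp_continuous_on has_derivative_continuous holomorphic_fun_has_derivative)

lemma bounded_linear_smult_vec: "bounded_linear (\<lambda>c::complex. c *s (v::complex^'n))"
proof -
  have "linear (\<lambda>c::complex. c *s v)"
    by (rule linearI) (simp_all add: vec_eq_iff algebra_simps)
  then show ?thesis by (simp add: linear_conv_bounded_linear)
qed

lemma holomorphic_fun_line:
  assumes f: "holomorphic_fun S f" and z: "z + t *s v \<in> S"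
  shows "((\<lambda>t. f (z + t *s v)) has_field_derivative frechet_derivative f (at (z + t *s v)) v) (at t)"
proof -
  have "((\<lambda>t. z + t *s v) has_derivative (\<lambda>d. d *s v)) (at t)"
    using bounded_linear_imp_has_derivative[OF bounded_linear_smult_vec[of v]]
    by (auto intro!: derivative_eq_intros)
  from has_derivative_compose[OF this holomorphic_fun_has_derivative[OF f z]]
  have "((\<lambda>t. f (z + t *s v)) has_derivative (\<lambda>d. d * frechet_derivative f (at (z + t *s v)) v)) (at t)"
    by (simp add: holomorphic_fun_derivative_scale[OF f z])
  moreover have "(\<lambda>d. d * frechet_derivative f (at (z + t *s v)) v) = (*) (frechet_derivative f (at (z + t *s v)) v)"
    by (auto simp: mult.commute)
  ultimately show ?thesis unfolding has_field_derivative_def by simp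
qed

text \<open>Cauchy's formula in one variable on the complex line through \<open>z\<close> in
  direction \<open>v\<close>, with the circle parametrized by \<open>s\<close>; the factor left over
  from \<open>1 / u^2\<close> and the velocity is \<open>exp (- 2 pi i s) / r\<close>. The
  right-hand side contains values of \<open>f\<close> only, so the derivative inherits the
  regularity of \<open>f\<close>.\<close>

lemma holomorphic_fun_cauchy:
  assumes f: "holomorphic_fun S f" and r: "r > 0" and z: "\<And>t. norm t \<le> r \<Longrightarrow> z + t *s v \<in> S"
  shows "frechet_derivative f (at z) v =
    integral {0..1} (\<lambda>s. f (z + (r * exp (2 * of_real pi * \<i> * of_real s)) *s v) * (exp (- (2 * of_real pi * \<i> * of_real s)) / r))"
proof -
  let ?g = "\<lambda>t. f (z + t *s v)"
  have d: "(?g has_field_derivative frechet_derivative f (at (z + t *s v)) v) (at t)" if "norm t \<le> r" for t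
    using holomorphic_fun_line[OF f z[OF that]] .
  have "continuous_on (cball 0 r) ?g"
    using d by (intro DERIV_continuous_on) (auto intro: DERIV_subset)
  moreover have "?g holomorphic_on ball 0 r"
    unfolding holomorphic_on_def field_differentiable_def
  proof
    fix t :: complex assume "t \<in> ball 0 r"
    then have "norm t \<le> r" by simp
    from has_field_derivative_at_within[OF d[OF this]]
    show "\<exists>f'. (?g has_field_derivative f') (at t within ball 0 r)" by (rule exI)
  qed
  ultimately have "(?g has_field_derivative
      (1 / (2 * of_real pi * \<i>) * contour_integral (circlepath 0 r) (\<lambda>u. ?g u / (u - 0)\<^sup>2))) (at 0)"
    using r by (intro Cauchy_derivative_integral_circlepath) auto
  moreover have "(?g has_field_derivative frechet_derivative f (at z) v) (at 0)"
    using d[of 0] r by simp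
  ultimately have "frechet_derivative f (at z) v = 1 / (2 * of_real pi * \<i>) * contour_integral (circlepath 0 r) (\<lambda>u. ?g u / u\<^sup>2)"
    using DERIV_unique by fastforce
  also have "\<dots> = 1 / (2 * of_real pi * \<i>) * integral {0..1} (\<lambda>s. ?g (circlepath 0 r s) / (circlepath 0 r s)\<^sup>2 *
      vector_derivative (circlepath 0 r) (at s))"
    by (simp add: contour_integral_integral)
  also have "\<dots> = integral {0..1} (\<lambda>s. 1 / (2 * of_real pi * \<i>) * (?g (circlepath 0 r s) / (circlepath 0 r s)\<^sup>2 *
      vector_derivative (circlepath 0 r) (at s)))"
    by (rule integral_mult_right[symmetric])
  also have "\<dots> = integral {0..1} (\<lambda>s. ?g (r * exp (2 * of_real pi * \<i> * of_real s)) * (exp (- (2 * of_real pi * \<i> * of_real s)) / r))"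
  proof (rule integral_cong)
    fix s :: real
    show "1 / (2 * of_real pi * \<i>) * (?g (circlepath 0 r s) / (circlepath 0 r s)\<^sup>2 *
        vector_derivative (circlepath 0 r) (at s)) =
      ?g (r * exp (2 * of_real pi * \<i> * of_real s)) * (exp (- (2 * of_real pi * \<i> * of_real s)) / r)"
      unfolding vector_derivative_circlepath using r
      by (simp add: circlepath exp_minus field_simps power2_eq_square)
  qed
  finally show ?thesis .
qed

text \<open>One radius serves all centres near \<open>z0\<close>, so that Cauchy's formula can be
  treated as an integral over a fixed contour depending on the parameter \<open>z\<close>. Half of
  \<open>d\<close> is spent on moving the centre, half on the disc.\<close>

lemma holomorphic_fun_line_neighbourhood:
  fixes z0 v :: "complex^'n"
  assumes "open S" "z0 \<in> S"
  obtains e r where "e > 0" "r > 0" "\<And>z (t::complex). z \<in> ball z0 e \<Longrightarrow> norm t \<le> r \<Longrightarrow> z + t *s v \<in> S"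
proof -
  obtain d where d: "d > 0" "ball z0 d \<subseteq> S" using assms open_contains_ball by blast
  define r where "r = d / 2 / (norm v + 1)"
  have v: "norm v + 1 > 0" by (simp add: add_nonneg_pos)
  show thesis
  proof
    show "d / 2 > 0" "r > 0" using d v by (auto simp: r_def)
    fix z and t :: complex assume z: "z \<in> ball z0 (d / 2)" and t: "norm t \<le> r"
    have "norm (t *s v) = norm t * norm v"
      by (simp add: norm_vec_def norm_mult L2_set_right_distrib)
    also have "\<dots> \<le> r * (norm v + 1)" using t \<open>r > 0\<close> by (intro mult_mono) auto
    also have "\<dots> = d / 2" unfolding r_def using v by (simp add: field_simps del: distrib_left_numeral)
    finally have "norm (t *s v) \<le> d / 2" .
    moreover have "dist z0 (z + t *s v) \<le> dist z0 z + norm (t *s v)"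
      using dist_triangle[of z0 "z + t *s v" z] by (simp add: dist_norm)
    ultimately show "z + t *s v \<in> S" using z d by auto
  qed
qed

text \<open>Holomorphy demands a complex linear derivative at each point, without continuity.
  Cauchy's formula supplies the continuity, since its integrand is jointly continuous; this is the
  hypothesis for differentiating the same formula under the integral.\<close>

lemma holomorphic_fun_derivative_continuous:
  assumes f: "holomorphic_fun S f"
  shows "continuous_on S (\<lambda>z. frechet_derivative f (at z) v)"
proof (rule continuous_at_imp_continuous_on, rule ballI)
  fix z0 assume "z0 \<in> S"
  then obtain e r where e: "e > 0" "r > 0" and er: "\<And>z t. z \<in> ball z0 e \<Longrightarrow> norm t \<le> r \<Longrightarrow> z + t *s v \<in> S"
    using holomorphic_fun_line_neighbourhood[OF holomorphic_fun_open[OF f]] by metis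
  define g where "g z s = f (z + (r * exp (2 * of_real pi * \<i> * of_real s)) *s v) * (exp (- (2 * of_real pi * \<i> * of_real s)) / r)" for z s
  have "continuous_on (ball z0 e \<times> cbox 0 1) (\<lambda>(z, s). g z s)"
    unfolding g_def split_beta
    by (intro continuous_intros continuous_on_compose2[OF holomorphic_fun_continuous_on[OF f]]
        bounded_linear.continuous_on[OF bounded_linear_smult_vec]) (use e er in \<open>auto simp: norm_mult\<close>)
  then have "continuous_on (ball z0 e) (\<lambda>z. integral (cbox 0 1) (g z))"
    by (rule integral_continuous_on_param)
  moreover have "integral (cbox 0 1) (g z) = frechet_derivative f (at z) v" if "z \<in> ball z0 e" for z
    using holomorphic_fun_cauchy[OF f e(2) er[OF that]] unfolding g_def by simp
  ultimately have "continuous_on (ball z0 e) (\<lambda>z. frechet_derivative f (at z) v)"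
    by (rule continuous_on_eq)
  then show "isCont (\<lambda>z. frechet_derivative f (at z) v) z0"
    using e by (simp add: continuous_on_eq_continuous_at)
qed

text \<open>Cauchy's formula is differentiated under the integral. Complex linearity survives
  because the derivative of \<open>f\<close> at every point of the contour is complex
  linear.\<close>

lemma holomorphic_fun_derivative:
  assumes f: "holomorphic_fun S f"
  shows "holomorphic_fun S (\<lambda>z. frechet_derivative f (at z) v)"
  unfolding holomorphic_fun_def
proof (intro conjI ballI holomorphic_fun_open[OF f])
  fix z0 assume z0: "z0 \<in> S"
  then obtain e r where e: "e > 0" "r > 0" and er: "\<And>z t. z \<in> ball z0 e \<Longrightarrow> norm t \<le> r \<Longrightarrow> z + t *s v \<in> S"
    using holomorphic_fun_line_neighbourhood[OF holomorphic_fun_open[OF f]] by metis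
  define k where "k s = exp (- (2 * of_real pi * \<i> * of_real s)) / r" for s :: real
  define p where "p z s = z + (r * exp (2 * of_real pi * \<i> * of_real s)) *s v" for z and s :: real
  have p: "p z s \<in> S" if "z \<in> ball z0 e" for z s
    unfolding p_def using e by (intro er that) (simp add: norm_mult)
  have p_cont: "continuous_on T (\<lambda>(z, s). p z s)" for T
    unfolding p_def split_beta
    by (intro continuous_intros bounded_linear.continuous_on[OF bounded_linear_smult_vec])
  have k_cont: "continuous_on T (\<lambda>(z, s). k s)" for T :: "((complex^'a) \<times> real) set"
    unfolding k_def split_beta using e by (intro continuous_intros) auto
  have p_cont': "continuous_on T (p z)" and k_cont': "continuous_on T k" for T z
    unfolding p_def k_def using e
    by (intro continuous_intros bounded_linear.continuous_on[OF bounded_linear_smult_vec]; simp)+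
  have "((\<lambda>z. integral {0..1} (\<lambda>s. f (p z s) * k s)) has_derivative
      (\<lambda>u. integral {0..1} (\<lambda>s. frechet_derivative f (at (p z0 s)) u * k s))) (at z0)"
  proof (rule has_derivative_integral_param)
    show "((\<lambda>z. f (p z s) * k s) has_derivative (\<lambda>u. frechet_derivative f (at (p z s)) u * k s)) (at z)"
      if "z \<in> ball z0 e" for z s
    proof (rule has_derivative_mult_left)
      have "((\<lambda>z. p z s) has_derivative (\<lambda>u. u)) (at z)" unfolding p_def by (auto intro!: derivative_eq_intros)
      from has_derivative_compose[OF this holomorphic_fun_has_derivative[OF f p[OF that]]]
      show "((\<lambda>z. f (p z s)) has_derivative (\<lambda>u. frechet_derivative f (at (p z s)) u)) (at z)" .
    qed
    show "continuous_on {0..1} (\<lambda>s. f (p z s) * k s)" if "z \<in> ball z0 e" for z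
      by (intro continuous_intros continuous_on_compose2[OF holomorphic_fun_continuous_on[OF f] p_cont'] k_cont')
        (use p that in auto)
    show "continuous_on (ball z0 e \<times> {0..1}) (\<lambda>(z, s). frechet_derivative f (at (p z s)) u * k s)" for u
      unfolding split_beta
      by (intro continuous_on_mult k_cont[unfolded split_beta]
          continuous_on_compose2[OF holomorphic_fun_derivative_continuous[OF f] p_cont[unfolded split_beta]])
        (use p in auto)
  qed (use e in auto)
  then have "((\<lambda>z. frechet_derivative f (at z) v) has_derivative
      (\<lambda>u. integral {0..1} (\<lambda>s. frechet_derivative f (at (p z0 s)) u * k s))) (at z0)"
  proof (rule has_derivative_transform_within_open[OF _ open_ball])
    show "z0 \<in> ball z0 e" using e by simp
    show "integral {0..1} (\<lambda>s. f (p z s) * k s) = frechet_derivative f (at z) v" if "z \<in> ball z0 e" for z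
      using holomorphic_fun_cauchy[OF f e(2) er[OF that]] unfolding p_def k_def by simp
  qed
  moreover have "integral {0..1} (\<lambda>s. frechet_derivative f (at (p z0 s)) (c *s u) * k s) =
      c * integral {0..1} (\<lambda>s. frechet_derivative f (at (p z0 s)) u * k s)" for c u
    using holomorphic_fun_derivative_scale[OF f p] e by (simp add: mult.assoc)
  ultimately show "\<exists>f'. ((\<lambda>z. frechet_derivative f (at z) v) has_derivative f') (at z0) \<and> (\<forall>c v. f' (c *s v) = c * f' v)"
    by blast
qed

lemma holomorphic_fun_smooth:
  assumes "holomorphic_fun S f"
  shows "smooth_on S f"
  unfolding smooth_on_def
proof (intro conjI allI holomorphic_fun_open[OF assms])
  fix k show "times_differentiable_on k S f"
    using assms
  proof (induction k arbitrary: f)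
    case 0
    then show ?case by (simp add: holomorphic_fun_continuous_on)
  next
    case (Suc k)
    show ?case
      by (rule times_differentiable_on_SucI[OF holomorphic_fun_open[OF Suc.prems]
            holomorphic_fun_has_derivative[OF Suc.prems] Suc.IH[OF holomorphic_fun_derivative[OF Suc.prems]]])
  qed
qed

section \<open>Vector-valued maps, partial derivatives and local inverses\<close>

lemma has_derivative_vecI:
  fixes g :: "'v::real_normed_vector \<Rightarrow> complex^'n"
  assumes "\<And>i. ((\<lambda>z. g z $ i) has_derivative (\<lambda>v. g' v $ i)) (at z)"
  shows "(g has_derivative g') (at z)"
proof -
  have ax: "bounded_linear (\<lambda>c::complex. axis i c :: complex^'n)" for i
  proof -
    have "linear (\<lambda>c::complex. axis i c :: complex^'n)"
      by (rule linearI) (simp_all add: vec_eq_iff axis_def)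
    then show ?thesis by (simp add: linear_conv_bounded_linear)
  qed
  have eq: "x = (\<Sum>i\<in>UNIV. axis i (x $ i))" for x :: "complex^'n"
    by (simp add: vec_eq_iff axis_def)
  have "((\<lambda>z. \<Sum>i\<in>UNIV. axis i (g z $ i)) has_derivative (\<lambda>v. \<Sum>i\<in>UNIV. axis i (g' v $ i))) (at z)"
    by (intro has_derivative_sum bounded_linear.has_derivative[OF ax] assms)
  then show ?thesis by (simp flip: eq)
qed

lemma holomorphic_fun_compose:
  fixes g :: "complex^'m::finite \<Rightarrow> complex^'n::finite"
  assumes f: "holomorphic_fun T f" and g: "\<And>i. holomorphic_fun S (\<lambda>z. g z $ i)"
    and gT: "\<And>z. z \<in> S \<Longrightarrow> g z \<in> T"
  shows "holomorphic_fun S (\<lambda>z. f (g z))"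
proof (rule holomorphic_funI)
  let ?g' = "\<lambda>z v. \<chi> i. frechet_derivative (\<lambda>z. g z $ i) (at z) v"
  show "open S" using g by (rule holomorphic_fun_open)
  fix z assume z: "z \<in> S"
  have "(g has_derivative ?g' z) (at z)"
    by (rule has_derivative_vecI) (use holomorphic_fun_has_derivative[OF g z] in simp)
  then show "((\<lambda>z. f (g z)) has_derivative (\<lambda>v. frechet_derivative f (at (g z)) (?g' z v))) (at z)"
    using holomorphic_fun_has_derivative[OF f gT[OF z]] by (rule has_derivative_compose)
  show "frechet_derivative f (at (g z)) (?g' z (c *s v)) = c * frechet_derivative f (at (g z)) (?g' z v)" for c v
  proof -
    have "?g' z (c *s v) = c *s ?g' z v"
      by (simp add: vec_eq_iff holomorphic_fun_derivative_scale[OF g z])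
    then show ?thesis by (simp add: holomorphic_fun_derivative_scale[OF f gT[OF z]])
  qed
qed

lemma holomorphic_fun_linear:
  fixes f :: "complex^'n \<Rightarrow> complex"
  assumes "open S" "linear f" "\<And>c v. f (c *s v) = c * f v"
  shows "holomorphic_fun S f"
  by (rule holomorphic_funI[OF assms(1), of f "\<lambda>_. f"])
    (use assms in \<open>auto intro: bounded_linear_imp_has_derivative simp: linear_conv_bounded_linear\<close>)

lemma holomorphic_fun_component: "open S \<Longrightarrow> holomorphic_fun S (\<lambda>z. z $ i)"
  by (rule holomorphic_fun_linear) (auto intro!: linearI)

lemma holomorphic_fun_derivative_cpartial:
  assumes f: "holomorphic_fun S f" and z: "z \<in> S"
  shows "frechet_derivative f (at z) (axis i 1) = cpartial i f z"
    and "frechet_derivative f (at z) v = (\<Sum>i\<in>UNIV. v $ i * cpartial i f z)"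
proof -
  show 1: "frechet_derivative f (at z) (axis i 1) = cpartial i f z" for i
    unfolding cpartial_def using DERIV_imp_deriv[OF holomorphic_fun_line[OF f, of z 0]] z by simp
  have lin: "linear (frechet_derivative f (at z))"
    using holomorphic_fun_has_derivative[OF f z] by (rule has_derivative_linear)
  have "v = (\<Sum>i\<in>UNIV. v $ i *s axis i 1)"
    by (simp add: vec_eq_iff axis_def if_distrib cong: if_cong)
  then have "frechet_derivative f (at z) v = frechet_derivative f (at z) (\<Sum>i\<in>UNIV. v $ i *s axis i 1)"
    by simp
  also have "\<dots> = (\<Sum>i\<in>UNIV. v $ i * cpartial i f z)"
    by (simp add: linear_sum[OF lin] holomorphic_fun_derivative_scale[OF f z] 1)
  finally show "frechet_derivative f (at z) v = (\<Sum>i\<in>UNIV. v $ i * cpartial i f z)" .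
qed

lemma holomorphic_fun_cpartial:
  assumes f: "holomorphic_fun S f"
  shows "holomorphic_fun S (cpartial i f)"
proof -
  have "holomorphic_fun S (\<lambda>z. frechet_derivative f (at z) (axis i 1))"
    using f by (rule holomorphic_fun_derivative)
  then show ?thesis
    using holomorphic_fun_cong[of S "\<lambda>z. frechet_derivative f (at z) (axis i 1)" "cpartial i f"]
      holomorphic_fun_derivative_cpartial(1)[OF f] by simp
qed

text \<open>Symmetry of second derivatives is known for real functions, so it is applied to the real
  and imaginary parts; fact \<open>c\<close> moves a real linear functional through both
  derivatives.\<close>

lemma cpartial_commute:
  assumes f: "holomorphic_fun S f" and z: "z \<in> S"
  shows "cpartial i (cpartial j f) z = cpartial j (cpartial i f) z"
proof -
  let ?D = "\<lambda>f v z. frechet_derivative f (at z) v"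
  have c: "h (?D (?D f u) v z) = ?D (?D (\<lambda>z. h (f z)) u) v z" if h: "bounded_linear h" for h :: "complex \<Rightarrow> real" and u v
  proof -
    have 1: "?D (\<lambda>z. h (g z)) w y = h (?D g w y)" if "holomorphic_fun S g" "y \<in> S" for w y and g :: "complex^'a \<Rightarrow> complex"
      using frechet_derivative_at[OF bounded_linear.has_derivative[OF h holomorphic_fun_has_derivative[OF that]]] by metis
    have "?D (?D (\<lambda>z. h (f z)) u) v z = ?D (\<lambda>y. h (?D f u y)) v z"
    proof -
      have "((\<lambda>y. h (?D f u y)) has_derivative (\<lambda>w. h (?D (?D f u) w z))) (at z)"
        by (rule bounded_linear.has_derivative[OF h holomorphic_fun_has_derivative[OF holomorphic_fun_derivative[OF f] z]])
      then have "(?D (\<lambda>z. h (f z)) u has_derivative (\<lambda>w. h (?D (?D f u) w z))) (at z)"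
        by (rule has_derivative_transform_within_open[OF _ holomorphic_fun_open[OF f] z]) (simp add: 1[OF f])
      then show ?thesis
        using 1[OF holomorphic_fun_derivative[OF f] z] by (metis frechet_derivative_at)
    qed
    then show ?thesis using 1[OF holomorphic_fun_derivative[OF f] z] by simp
  qed
  have "h (?D (?D f u) v z) = h (?D (?D f v) u z)" if h: "bounded_linear h" for h :: "complex \<Rightarrow> real" and u v
    unfolding c[OF h] by (rule smooth_on_second_derivative_symmetric[OF smooth_on_linear[OF h holomorphic_fun_smooth[OF f]] z])
  from this[OF bounded_linear_Re] this[OF bounded_linear_Im]
  have sym: "?D (?D f u) v z = ?D (?D f v) u z" for u v
    by (simp add: complex_eq_iff)
  have "cpartial i (cpartial j f) z = ?D (?D f (axis j 1)) (axis i 1) z" for i j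
  proof -
    have "(cpartial j f has_derivative frechet_derivative (?D f (axis j 1)) (at z)) (at z)"
      by (rule has_derivative_transform_within_open[OF holomorphic_fun_has_derivative[OF holomorphic_fun_derivative[OF f] z]
          holomorphic_fun_open[OF f] z]) (rule holomorphic_fun_derivative_cpartial(1)[OF f])
    then show ?thesis
      using holomorphic_fun_derivative_cpartial(1)[OF holomorphic_fun_cpartial[OF f] z]
      by (metis frechet_derivative_at)
  qed
  then show ?thesis using sym by simp
qed

text \<open>The real inverse function theorem gives \<open>h\<close>, whose derivative is the
  inverse of a complex linear map and hence complex linear itself.\<close>

lemma holomorphic_local_inverse:
  fixes g :: "complex^'n \<Rightarrow> complex^'n"
  assumes g: "\<And>i. holomorphic_fun S (\<lambda>z. g z $ i)" and z0: "z0 \<in> S"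
    and inj: "\<And>v. (\<And>i. frechet_derivative (\<lambda>z. g z $ i) (at z0) v = 0) \<Longrightarrow> v = 0"
  obtains U V h where "open U" "U \<subseteq> S" "z0 \<in> U" "open V" "homeomorphism U V g h"
    "\<And>i. holomorphic_fun V (\<lambda>w. h w $ i)"
proof -
  define g' where "g' z v = (\<chi> i. frechet_derivative (\<lambda>z. g z $ i) (at z) v)" for z v
  have S: "open S" using g by (rule holomorphic_fun_open)
  have g': "(g has_derivative g' z) (at z)" if "z \<in> S" for z
    by (rule has_derivative_vecI) (use holomorphic_fun_has_derivative[OF g that] in \<open>simp add: g'_def\<close>)
  define G where "G z = Blinfun (g' z)" for z
  have G: "blinfun_apply (G z) = g' z" if "z \<in> S" for z
    unfolding G_def using g'[OF that] by (intro bounded_linear_Blinfun_apply has_derivative_bounded_linear)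
  have lin: "linear (g' z)" if "z \<in> S" for z
    using g'[OF that] by (rule has_derivative_linear)
  have cont: "continuous_on S G"
  proof (rule continuous_on_blinfun_componentwise)
    fix v :: "complex^'n"
    have "continuous_on S (\<lambda>z. g' z v)"
      unfolding g'_def by (intro continuous_on_vec_lambda holomorphic_fun_derivative_continuous[OF g])
    then show "continuous_on S (\<lambda>z. blinfun_apply (G z) v)"
      by (rule continuous_on_eq) (simp add: G)
  qed
  \<comment> \<open>An injective linear map has a linear left inverse, which is the form of
    invertibility that \<open>inverse_function_theorem\<close> asks for.\<close>
  have "inj (g' z0)"
    unfolding linear_injective_0[OF lin[OF z0]] using inj by (simp add: g'_def vec_eq_iff)
  then obtain k where k: "linear k" "k \<circ> g' z0 = id"
    using linear_injective_left_inverse[OF lin[OF z0]] by blast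
  have G': "(g has_derivative blinfun_apply (G z)) (at z)" if "z \<in> S" for z
    using g'[OF that] G[OF that] by simp
  have k_inv: "Blinfun k o\<^sub>L G z0 = id_blinfun"
  proof (rule blinfun_eqI)
    fix v
    have "blinfun_apply (Blinfun k) = k"
      using k(1) by (intro bounded_linear_Blinfun_apply) (simp add: linear_conv_bounded_linear)
    then show "blinfun_apply (Blinfun k o\<^sub>L G z0) v = blinfun_apply id_blinfun v"
      using k(2) G[OF z0] by (simp add: fun_eq_iff)
  qed
  obtain U V h h' where U: "open U" "U \<subseteq> S" "z0 \<in> U" "open V" "homeomorphism U V g h"
    and h': "\<And>w. w \<in> V \<Longrightarrow> (h has_derivative h' w) (at w)"
    and h'_inv: "\<And>w. w \<in> V \<Longrightarrow> h' w = inv (blinfun_apply (G (h w)))"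
    and bij: "\<And>w. w \<in> V \<Longrightarrow> bij (blinfun_apply (G (h w)))"
    by (rule inverse_function_theorem[OF S G' cont z0 k_inv, of thesis]) (assumption | rule that)+
  have hU: "h w \<in> S" if "w \<in> V" for w
    using U that homeomorphism_image2 by blast
  have "holomorphic_fun V (\<lambda>w. h w $ i)" for i
  proof (rule holomorphic_funI[OF U(4)])
    fix w assume w: "w \<in> V"
    show "((\<lambda>w. h w $ i) has_derivative (\<lambda>v. h' w v $ i)) (at w)"
      by (rule bounded_linear.has_derivative[OF bounded_linear_vec_nth h'[OF w]])
    fix c v
    have G': "g' (h w) (h' w u) = u" for u
      using h'_inv[OF w] bij[OF w] G[OF hU[OF w]] by (simp add: bij_is_surj surj_f_inv_f)
    have "g' (h w) (c *s h' w v) = c *s g' (h w) (h' w v)"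
      by (simp add: g'_def vec_eq_iff holomorphic_fun_derivative_scale[OF g hU[OF w]])
    also have "\<dots> = g' (h w) (h' w (c *s v))" by (simp add: G')
    finally have "c *s h' w v = h' w (c *s v)"
      using bij[OF w] G[OF hU[OF w]] by (metis bij_is_inj injD)
    then show "h' w (c *s v) $ i = c * h' w v $ i" by (metis vector_smult_component)
  qed
  with U show thesis by (rule that)
qed

section \<open>Parallel forms of a flat connection\<close>

text \<open>The solution is the fixed point of the equation integrated along rays,
  \<open>Y x = y0 + \<integral>\<^sub>0\<^sup>1 A (c + t (x - c)) (x - c) (Y (c + t (x - c))) dt\<close>. The defect \<open>DY v - A v Y\<close> of the iterates
  satisfies, by integrability, a contracting recursion.\<close>

lemma frobenius_local:
  fixes J :: "'j set" and a :: "'j \<Rightarrow> 'v::euclidean_space \<Rightarrow> real" and E :: "'j \<Rightarrow> 'v \<Rightarrow> 'm::euclidean_space \<Rightarrow> 'm"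
  defines "A \<equiv> \<lambda>x v y. \<Sum>j\<in>J. a j x *\<^sub>R E j v y"
    and "A' \<equiv> \<lambda>x u v y. \<Sum>j\<in>J. frechet_derivative (a j) (at x) u *\<^sub>R E j v y"
  assumes S: "open S" "c \<in> S"
    and E: "\<And>j. j \<in> J \<Longrightarrow> bounded_bilinear (E j)"
    and a: "\<And>j. j \<in> J \<Longrightarrow> smooth_on S (a j)"
    and integrable: "\<And>x u v y. x \<in> S \<Longrightarrow> A' x u v y + A x v (A x u y) = A' x v u y + A x u (A x v y)"
  obtains r where "r > 0" "ball c r \<subseteq> S"
    "\<And>y0. \<exists>Y. Y c = y0 \<and> (\<forall>x\<in>ball c r. (Y has_derivative (\<lambda>v. A x v (Y x))) (at x))"
proof -
  obtain d where d: "d > 0" "cball c d \<subseteq> S" using S open_contains_cball by blast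
  have "\<forall>j\<in>J. \<exists>B. \<forall>x\<in>cball c d. norm (a j x) \<le> B"
  proof
    fix j assume j: "j \<in> J"
    have "compact (a j ` cball c d)"
      by (rule compact_continuous_image[OF continuous_on_subset[OF smooth_on_continuous_on[OF a[OF j]] d(2)] compact_cball])
    from compact_imp_bounded[OF this] show "\<exists>B. \<forall>x\<in>cball c d. norm (a j x) \<le> B"
      by (simp add: bounded_iff)
  qed
  then obtain B where B: "\<And>j x. j \<in> J \<Longrightarrow> x \<in> cball c d \<Longrightarrow> norm (a j x) \<le> B j"
    by metis
  have "\<forall>j\<in>J. \<exists>K. \<forall>v y. norm (E j v y) \<le> norm v * norm y * K"
    using bounded_bilinear.bounded[OF E] by simp
  then obtain k where k: "\<And>j v y. j \<in> J \<Longrightarrow> norm (E j v y) \<le> norm v * norm y * k j"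
    by metis
  \<comment> \<open>A bound for the bilinear map \<open>A x\<close> that is uniform on the closed
    ball; the summand 1 makes it positive, so that \<open>r\<close> may be defined by
    division.\<close>
  define K where "K = 1 + (\<Sum>j\<in>J. \<bar>B j\<bar> * \<bar>k j\<bar>)"
  have K: "K > 0" unfolding K_def by (simp add: add_pos_nonneg sum_nonneg)
  have A_bound: "norm (A x v y) \<le> K * norm v * norm y" if "x \<in> cball c d" for x v y
  proof -
    have "norm (A x v y) \<le> (\<Sum>j\<in>J. \<bar>B j\<bar> * \<bar>k j\<bar> * (norm v * norm y))"
      unfolding A_def
    proof (rule sum_norm_le)
      fix j assume j: "j \<in> J"
      have "norm (a j x *\<^sub>R E j v y) = norm (a j x) * norm (E j v y)" by simp
      also have "\<dots> \<le> \<bar>B j\<bar> * (norm v * norm y * \<bar>k j\<bar>)"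
      proof (rule mult_mono)
        show "norm (a j x) \<le> \<bar>B j\<bar>" using B[OF j that] by simp
        show "norm (E j v y) \<le> norm v * norm y * \<bar>k j\<bar>"
          by (rule order_trans[OF k[OF j] mult_left_mono[OF abs_ge_self]]) simp
      qed auto
      finally show "norm (a j x *\<^sub>R E j v y) \<le> \<bar>B j\<bar> * \<bar>k j\<bar> * (norm v * norm y)" by (simp add: ac_simps)
    qed
    also have "\<dots> \<le> K * (norm v * norm y)"
      unfolding K_def by (simp add: sum_distrib_right[symmetric] distrib_right)
    finally show ?thesis by (simp add: ac_simps)
  qed
  \<comment> \<open>Makes the integral operator along rays contract by 1/8. In the recursion for the
    defect two such terms add up to 1/4, which leaves room for an inhomogeneous term and still
    yields decay by 1/2.\<close>
  define r where "r = min d (1 / (8 * K))"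
  have r: "r > 0" "K * r \<le> 1 / 8" "ball c r \<subseteq> cball c d"
  proof -
    show "r > 0" using d K by (simp add: r_def)
    have "K * r \<le> K * (1 / (8 * K))" using K by (intro mult_left_mono) (auto simp: r_def)
    then show "K * r \<le> 1 / 8" using K by simp
    show "ball c r \<subseteq> cball c d" by (auto simp: r_def)
  qed
  let ?B = "ball c r"
  have BS: "?B \<subseteq> S" using r d by blast
  define p where "p t x = c + t *\<^sub>R (x - c)" for t :: real and x
  have p: "p t x \<in> ?B" if "x \<in> ?B" "t \<in> {0..1}" for t x
  proof -
    have "\<bar>t\<bar> * norm (x - c) \<le> 1 * norm (x - c)" using that by (intro mult_right_mono) auto
    then show ?thesis using that by (simp add: p_def dist_norm norm_minus_commute)
  qed
  have p_cont: "continuous_on T (\<lambda>(x, t). p t x)" for T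
    unfolding p_def split_beta by (intro continuous_intros)
  have p_cont': "continuous_on T (\<lambda>t. p t x)" for T x
    unfolding p_def by (intro continuous_intros)
  have p_deriv: "(p t has_derivative (\<lambda>v. t *\<^sub>R v)) (at x)" for t x
    unfolding p_def by (auto intro!: derivative_eq_intros)
  have p_deriv': "((\<lambda>t. p t x) has_derivative (\<lambda>s. s *\<^sub>R (x - c))) (at t within T)" for t x T
    unfolding p_def by (auto intro!: derivative_eq_intros)
  note E_add_left = bounded_bilinear.add_left[OF E] and E_add_right = bounded_bilinear.add_right[OF E]
    and E_diff_left = bounded_bilinear.diff_left[OF E] and E_diff_right = bounded_bilinear.diff_right[OF E]
    and E_scaleR_left = bounded_bilinear.scaleR_left[OF E] and E_scaleR_right = bounded_bilinear.scaleR_right[OF E]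
  have A_diff_right: "A x v (y - z) = A x v y - A x v z" for x v y z
    unfolding A_def by (simp add: E_diff_right scaleR_right_diff_distrib sum_subtractf)
  have A_zero_left: "A x 0 y = 0" for x y
    unfolding A_def by (simp add: bounded_bilinear.zero_left[OF E])
  have A_scaleR_right: "A x v (t *\<^sub>R y) = t *\<^sub>R A x v y" for x v y t
    unfolding A_def by (simp add: E_scaleR_right scaleR_sum_right ac_simps)
  have A_scaleR_left: "A x (t *\<^sub>R v) y = t *\<^sub>R A x v y" for x v y t
    unfolding A_def by (simp add: E_scaleR_left scaleR_sum_right ac_simps)
  have A_cont: "continuous_on T (\<lambda>q. A (f q) (g q) (h q))"
    if "continuous_on T f" "continuous_on T g" "continuous_on T h" "f ` T \<subseteq> S" for T f g h
    unfolding A_def using that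
    by (intro continuous_on_sum continuous_on_scaleR bounded_bilinear.continuous_on[OF E]
        continuous_on_compose2[OF smooth_on_continuous_on[OF a]]) auto
  have A'_cont: "continuous_on T (\<lambda>q. A' (f q) v (g q) (h q))"
    if "continuous_on T f" "continuous_on T g" "continuous_on T h" "f ` T \<subseteq> S" for T f g h v
    unfolding A'_def using that
    by (intro continuous_on_sum continuous_on_scaleR bounded_bilinear.continuous_on[OF E]
        continuous_on_compose2[OF smooth_on_continuous_on[OF smooth_on_frechet_derivative[OF a]]]) auto
  have A_deriv: "((\<lambda>q. A (f q) (g q) (h q)) has_derivative
      (\<lambda>s. A' (f q) (f' s) (g q) (h q) + A (f q) (g' s) (h q) + A (f q) (g q) (h' s))) (at q within T)"
    if "(f has_derivative f') (at q within T)" "(g has_derivative g') (at q within T)"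
      "(h has_derivative h') (at q within T)" "f q \<in> S"
    for f f' g g' h h' T and q :: "'b::real_normed_vector"
  proof -
    have "((\<lambda>q. A (f q) (g q) (h q)) has_derivative (\<lambda>s. \<Sum>j\<in>J. a j (f q) *\<^sub>R (E j (g q) (h' s) + E j (g' s) (h q)) +
        frechet_derivative (a j) (at (f q)) (f' s) *\<^sub>R E j (g q) (h q))) (at q within T)"
      unfolding A_def
    proof (rule has_derivative_sum)
      fix j assume j: "j \<in> J"
      have "((\<lambda>q. a j (f q)) has_derivative (\<lambda>s. frechet_derivative (a j) (at (f q)) (f' s))) (at q within T)"
        using has_derivative_compose[OF that(1) smooth_on_has_derivative[OF a[OF j] that(4)]] .
      from bounded_bilinear.FDERIV[OF bounded_bilinear_scaleR this bounded_bilinear.FDERIV[OF E[OF j] that(2,3)]]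
      show "((\<lambda>q. a j (f q) *\<^sub>R E j (g q) (h q)) has_derivative (\<lambda>s. a j (f q) *\<^sub>R (E j (g q) (h' s) + E j (g' s) (h q)) +
        frechet_derivative (a j) (at (f q)) (f' s) *\<^sub>R E j (g q) (h q))) (at q within T)" .
    qed
    then show ?thesis
      unfolding A_def A'_def by (simp add: sum.distrib scaleR_right_distrib ac_simps)
  qed
  have A'_scaleR: "A' x (t *\<^sub>R u) v y = t *\<^sub>R A' x u v y" if "x \<in> S" for x t u v y
  proof -
    have "linear (frechet_derivative (a j) (at x))" if "j \<in> J" for j
      using smooth_on_has_derivative[OF a[OF that] \<open>x \<in> S\<close>] by (rule has_derivative_linear)
    then show ?thesis unfolding A'_def by (simp add: linear_cmul scaleR_sum_right)
  qed

  have "\<exists>Y. Y c = y0 \<and> (\<forall>x\<in>?B. (Y has_derivative (\<lambda>v. A x v (Y x))) (at x))" for y0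
  proof -
    \<comment> \<open>The Picard iterates of the equation along rays, starting from the constant
      \<open>y0\<close>.\<close>
    define f where "f = rec_nat (\<lambda>x. y0) (\<lambda>n fn x. y0 + integral {0..1} (\<lambda>t. A (p t x) (x - c) (fn (p t x))))"
    have f0: "f 0 = (\<lambda>x. y0)" and fSuc: "f (Suc n) = (\<lambda>x. y0 + integral {0..1} (\<lambda>t. A (p t x) (x - c) (f n (p t x))))" for n
      by (simp_all add: f_def)
    \<comment> \<open>The derivative in \<open>x\<close> along \<open>v\<close> of the integrand;
      the factors \<open>t\<close> come from the derivative of \<open>p t\<close>. The derivatives
      \<open>f'\<close> of the iterates get their own recursion, and \<open>C1\<close> proves by one
      induction that they are derivatives and continuous.\<close>
    define h where "h fn fn' x t v = t *\<^sub>R A' (p t x) v (x - c) (fn (p t x)) + A (p t x) v (fn (p t x)) +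
        t *\<^sub>R A (p t x) (x - c) (fn' (p t x) v)"
      for fn :: "'v \<Rightarrow> 'm" and fn' :: "'v \<Rightarrow> 'v \<Rightarrow> 'm" and x t v
    define f' where "f' = rec_nat (\<lambda>x v. 0) (\<lambda>n fn' x v. integral {0..1} (\<lambda>t. h (f n) fn' x t v))"
    have f'0: "f' 0 = (\<lambda>x v. 0)" and f'Suc: "f' (Suc n) = (\<lambda>x v. integral {0..1} (\<lambda>t. h (f n) (f' n) x t v))" for n
      by (simp_all add: f'_def)
    have C1: "(\<forall>x\<in>?B. (f n has_derivative f' n x) (at x)) \<and> (\<forall>v. continuous_on ?B (\<lambda>x. f' n x v))" for n
    proof (induction n)
      case 0
      then show ?case by (simp add: f0 f'0)
    next
      case (Suc n)
      have fn: "(f n has_derivative f' n x) (at x)" if "x \<in> ?B" for x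
        by (rule Suc.IH[THEN conjunct1, rule_format, OF that])
      have fn_cont: "continuous_on ?B (f n)"
        by (rule has_derivative_continuous_on[OF has_derivative_at_withinI[OF fn]])
      have fn'_cont: "continuous_on ?B (\<lambda>x. f' n x v)" for v
        by (rule Suc.IH[THEN conjunct2, rule_format])
      have h_cont: "continuous_on (?B \<times> {0..1}) (\<lambda>(x, t). h (f n) (f' n) x t v)" for v
      proof -
        have pc: "continuous_on (?B \<times> {0..1}) (\<lambda>q. p (snd q) (fst q))"
          using p_cont by (simp add: split_beta)
        have pB: "(\<lambda>q. p (snd q) (fst q)) ` (?B \<times> {0..1}) \<subseteq> ?B" using p by auto
        then have pS: "(\<lambda>q. p (snd q) (fst q)) ` (?B \<times> {0..1}) \<subseteq> S" using BS by blast
        show ?thesis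
          unfolding h_def split_beta
          by (intro continuous_on_add continuous_on_scaleR A_cont A'_cont pc pS continuous_on_compose2[OF fn_cont pc pB]
              continuous_on_compose2[OF fn'_cont pc pB] continuous_intros)
      qed
      have 1: "(f (Suc n) has_derivative f' (Suc n) x) (at x)" if x: "x \<in> ?B" for x
      proof -
        have "((\<lambda>x. integral {0..1} (\<lambda>t. A (p t x) (x - c) (f n (p t x)))) has_derivative
            (\<lambda>v. integral {0..1} (\<lambda>t. h (f n) (f' n) x t v))) (at x)"
        proof (rule has_derivative_integral_param[OF open_ball convex_ball x])
          fix x t assume x: "x \<in> ?B" and t: "t \<in> {0..1::real}"
          have lin: "linear (f' n (p t x))" using fn[OF p[OF x t]] by (rule has_derivative_linear)
          have d1: "((\<lambda>x. f n (p t x)) has_derivative (\<lambda>v. f' n (p t x) (t *\<^sub>R v))) (at x)"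
            by (rule has_derivative_compose[OF p_deriv fn[OF p[OF x t]]])
          have d2: "((\<lambda>x. x - c) has_derivative (\<lambda>v. v)) (at x)" by (auto intro!: derivative_eq_intros)
          have pS: "p t x \<in> S" using p[OF x t] BS by blast
          from A_deriv[OF p_deriv d2 d1 pS]
          show "((\<lambda>x. A (p t x) (x - c) (f n (p t x))) has_derivative h (f n) (f' n) x t) (at x)"
            unfolding h_def A'_scaleR[OF pS] linear_cmul[OF lin] A_scaleR_right .
        next
          fix x assume x: "x \<in> ?B"
          have pB: "(\<lambda>t. p t x) ` {0..1} \<subseteq> ?B" using p x by auto
          then have pS: "(\<lambda>t. p t x) ` {0..1} \<subseteq> S" using BS by blast
          show "continuous_on {0..1} (\<lambda>t. A (p t x) (x - c) (f n (p t x)))"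
            by (intro A_cont p_cont' pS continuous_on_compose2[OF fn_cont p_cont' pB] continuous_intros)
        qed (rule h_cont)
        then show ?thesis
          unfolding fSuc f'Suc using has_derivative_add[OF has_derivative_const[of y0]] by fastforce
      qed
      have 2: "continuous_on ?B (\<lambda>x. f' (Suc n) x v)" for v
        unfolding f'Suc using integral_continuous_on_param[of ?B 0 "1::real" "\<lambda>x t. h (f n) (f' n) x t v"] h_cont[of v]
        by simp
      show ?case by (intro conjI ballI allI 1 2)
    qed
    have fd: "(f n has_derivative f' n x) (at x)" if "x \<in> ?B" for x n
      by (rule C1[THEN conjunct1, rule_format, OF that])
    have f_cont: "continuous_on ?B (f n)" for n
      by (rule has_derivative_continuous_on[OF has_derivative_at_withinI[OF fd]])
    have f'_cont: "continuous_on ?B (\<lambda>x. f' n x v)" for v n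
      by (rule C1[THEN conjunct2, rule_format])
    have line: "continuous_on {0..1} (\<lambda>t. A (p t x) v (g (p t x)))" if "x \<in> ?B" "continuous_on ?B g" for x v g
    proof -
      have pB: "(\<lambda>t. p t x) ` {0..1} \<subseteq> ?B" using p that by auto
      then have pS: "(\<lambda>t. p t x) ` {0..1} \<subseteq> S" using BS by blast
      show ?thesis
        by (intro A_cont p_cont' pS continuous_on_compose2[OF that(2) p_cont' pB] continuous_intros)
    qed
    have line': "continuous_on {0..1} (\<lambda>t. A' (p t x) u v (g (p t x)))" if "x \<in> ?B" "continuous_on ?B g" for x v g u
    proof -
      have pB: "(\<lambda>t. p t x) ` {0..1} \<subseteq> ?B" using p that by auto
      then have pS: "(\<lambda>t. p t x) ` {0..1} \<subseteq> S" using BS by blast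
      show ?thesis
        by (intro A'_cont p_cont' pS continuous_on_compose2[OF that(2) p_cont' pB] continuous_intros)
    qed
    have Kx: "K * norm (x - c) \<le> 1 / 8" if "x \<in> ?B" for x
    proof -
      have "K * norm (x - c) \<le> K * r" using that K by (intro mult_left_mono) (auto simp: dist_norm norm_minus_commute)
      then show ?thesis using r by linarith
    qed
    have A_bound': "norm (A (p t x) v y) \<le> K * norm v * norm y" if "x \<in> ?B" "t \<in> {0..1}" for x t v y
      using A_bound p[OF that] r(3) by blast

    have diff: "norm (f (Suc n) x - f n x) \<le> (1/8) ^ Suc n * norm y0" if "x \<in> ?B" for n x
      using that
    proof (induction n arbitrary: x)
      case 0
      have "norm (integral {0..1} (\<lambda>t. A (p t x) (x - c) y0)) \<le> (1/8 * norm y0) * (1 - 0)"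
      proof (rule integral_bound)
        show "continuous_on {0..1} (\<lambda>t. A (p t x) (x - c) y0)" using line[OF 0, of "\<lambda>_. y0"] by simp
        show "norm (A (p t x) (x - c) y0) \<le> 1/8 * norm y0" if "t \<in> {0..1}" for t
          using A_bound'[OF 0 that, of "x - c" y0] mult_right_mono[OF Kx[OF 0], of "norm y0"] by simp
      qed simp
      then show ?case by (simp add: f0 fSuc)
    next
      case (Suc n)
      have "f (Suc (Suc n)) x - f (Suc n) x = integral {0..1} (\<lambda>t. A (p t x) (x - c) (f (Suc n) (p t x)) - A (p t x) (x - c) (f n (p t x)))"
        unfolding fun_cong[OF fSuc[of "Suc n"], of x] fun_cong[OF fSuc[of n], of x]
        using integral_diff[OF integrable_continuous_real integrable_continuous_real,
            OF line[OF Suc.prems f_cont, of "x - c" "Suc n"] line[OF Suc.prems f_cont, of "x - c" n]] by simp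
      also have "\<dots> = integral {0..1} (\<lambda>t. A (p t x) (x - c) (f (Suc n) (p t x) - f n (p t x)))"
        by (simp add: A_diff_right)
      also have "norm \<dots> \<le> (1/8 * ((1/8) ^ Suc n * norm y0)) * (1 - 0)"
      proof (rule integral_bound)
        show "continuous_on {0..1} (\<lambda>t. A (p t x) (x - c) (f (Suc n) (p t x) - f n (p t x)))"
          by (rule line[OF Suc.prems]) (intro continuous_on_diff f_cont)
        fix t :: real assume t: "t \<in> {0..1}"
        have "norm (A (p t x) (x - c) (f (Suc n) (p t x) - f n (p t x))) \<le> (K * norm (x - c)) * norm (f (Suc n) (p t x) - f n (p t x))"
          by (rule A_bound'[OF Suc.prems t])
        also have "\<dots> \<le> 1/8 * ((1/8) ^ Suc n * norm y0)"
          using Suc.IH[OF p[OF Suc.prems t]] Kx[OF Suc.prems] by (intro mult_mono) auto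
        finally show "norm (A (p t x) (x - c) (f (Suc n) (p t x) - f n (p t x))) \<le> 1/8 * ((1/8) ^ Suc n * norm y0)" .
      qed simp
      finally show ?case by simp
    qed

    \<comment> \<open>The failure of the \<open>n\<close>-th iterate to solve the full system. The
      iteration only enforces the equation along rays, so its decay has to be proved
      separately.\<close>
    define z where "z n x v = f' n x v - A x v (f n x)" for n x v
    have z_cont: "continuous_on ?B (\<lambda>x. z n x v)" for n v
      unfolding z_def using BS by (intro continuous_on_diff f'_cont A_cont f_cont continuous_intros) auto
    have z_rec: "z (Suc n) x v = A x v (f n x - f (Suc n) x) +
        integral {0..1} (\<lambda>t. t *\<^sub>R (A (p t x) (x - c) (z n (p t x) v) - A (p t x) v (z n (p t x) (x - c))))"
      if x: "x \<in> ?B" for n x v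
    proof -
      \<comment> \<open>The \<open>t\<close>-derivative of
        \<open>t *\<^sub>R A (p t x) v (f n (p t x))\<close>. Its integral over the ray is the value
        at \<open>t = 1\<close>, namely \<open>A x v (f n x)\<close>.\<close>
      define q' where "q' t = A (p t x) v (f n (p t x)) +
          t *\<^sub>R (A' (p t x) (x - c) v (f n (p t x)) + A (p t x) v (f' n (p t x) (x - c)))" for t
      have q'_cont: "continuous_on {0..1} q'"
        unfolding q'_def by (intro continuous_intros line line' x f_cont f'_cont)
      have "(q' has_integral (1 *\<^sub>R A (p 1 x) v (f n (p 1 x)) - 0 *\<^sub>R A (p 0 x) v (f n (p 0 x)))) {0..1}"
      proof (rule fundamental_theorem_of_calculus)
        fix t :: real assume t: "t \<in> {0..1}"
        have pS: "p t x \<in> S" using p[OF x t] BS by blast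
        have lin: "linear (f' n (p t x))" using fd[OF p[OF x t]] by (rule has_derivative_linear)
        have "((\<lambda>t. A (p t x) v (f n (p t x))) has_derivative
            (\<lambda>s. A' (p t x) (s *\<^sub>R (x - c)) v (f n (p t x)) + A (p t x) 0 (f n (p t x)) +
              A (p t x) v (f' n (p t x) (s *\<^sub>R (x - c))))) (at t within {0..1})"
          by (intro A_deriv p_deriv' has_derivative_const pS has_derivative_compose[OF p_deriv' fd[OF p[OF x t]]])
        then have "((\<lambda>t. A (p t x) v (f n (p t x))) has_derivative
            (\<lambda>s. s *\<^sub>R (A' (p t x) (x - c) v (f n (p t x)) + A (p t x) v (f' n (p t x) (x - c))))) (at t within {0..1})"
          by (simp add: A'_scaleR[OF pS] A_zero_left linear_cmul[OF lin] A_scaleR_right scaleR_right_distrib)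
        from bounded_bilinear.FDERIV[OF bounded_bilinear_scaleR has_derivative_ident this]
        show "((\<lambda>t. t *\<^sub>R A (p t x) v (f n (p t x))) has_vector_derivative q' t) (at t within {0..1})"
          unfolding has_vector_derivative_def q'_def by (simp add: scaleR_right_distrib ac_simps)
      qed simp
      then have q'_int: "integral {0..1} q' = A x v (f n x)"
        by (simp add: p_def integral_unique)
      have h_eq: "h (f n) (f' n) x t v = q' t +
          t *\<^sub>R (A (p t x) (x - c) (z n (p t x) v) - A (p t x) v (z n (p t x) (x - c)))"
        if t: "t \<in> {0..1}" for t
      proof -
        have pS: "p t x \<in> S" using p[OF x t] BS by blast
        \<comment> \<open>Integrability exchanges the direction \<open>v\<close> with the ray
          direction \<open>x - c\<close>. The derivative of the integrand then becomes
          \<open>q'\<close> plus terms that contain the defect only.\<close>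
        have "A' (p t x) v (x - c) (f n (p t x)) = A' (p t x) (x - c) v (f n (p t x)) +
            A (p t x) v (A (p t x) (x - c) (f n (p t x))) - A (p t x) (x - c) (A (p t x) v (f n (p t x)))"
          using integrable[OF pS, of v "x - c" "f n (p t x)"] by (simp add: algebra_simps)
        then show ?thesis
          unfolding h_def q'_def z_def by (simp only: A_diff_right) (simp add: algebra_simps)
      qed
      have "f' (Suc n) x v = integral {0..1} (\<lambda>t. q' t +
          t *\<^sub>R (A (p t x) (x - c) (z n (p t x) v) - A (p t x) v (z n (p t x) (x - c))))"
        unfolding f'Suc by (rule integral_cong) (rule h_eq)
      also have "\<dots> = integral {0..1} q' +
          integral {0..1} (\<lambda>t. t *\<^sub>R (A (p t x) (x - c) (z n (p t x) v) - A (p t x) v (z n (p t x) (x - c))))"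
        by (intro integral_add integrable_continuous_real q'_cont continuous_intros line x z_cont)
      finally show ?thesis unfolding z_def q'_int by (simp add: A_diff_right)
    qed
    \<comment> \<open>The constant 2 balances the recursion: the term from
      \<open>f n - f (Suc n)\<close> contributes half of the new bound and a quarter of the old
      bound contributes the other half.\<close>
    have z_bound: "norm (z n x v) \<le> 2 * K * norm y0 * (1/2) ^ n * norm v" if "x \<in> ?B" for n x v
      using that
    proof (induction n arbitrary: x v)
      case 0
      have "norm (z 0 x v) \<le> K * norm v * norm y0"
        using A_bound[of x v y0] 0 r(3) by (auto simp: z_def f0 f'0)
      also have "\<dots> \<le> 2 * (K * norm v * norm y0)" using K by simp
      finally show ?case by (simp add: ac_simps)
    next
      case (Suc n)
      let ?C = "2 * K * norm y0 * (1/2) ^ n"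
      have "norm (integral {0..1} (\<lambda>t. t *\<^sub>R (A (p t x) (x - c) (z n (p t x) v) - A (p t x) v (z n (p t x) (x - c)))))
          \<le> (1/4 * (?C * norm v)) * (1 - 0)"
      proof (rule integral_bound)
        show "continuous_on {0..1} (\<lambda>t. t *\<^sub>R (A (p t x) (x - c) (z n (p t x) v) - A (p t x) v (z n (p t x) (x - c))))"
          by (intro continuous_intros line Suc.prems z_cont)
        fix t :: real assume t: "t \<in> {0..1}"
        have 1: "norm (A (p t x) (x - c) (z n (p t x) v)) \<le> 1/8 * (?C * norm v)"
        proof -
          have "norm (A (p t x) (x - c) (z n (p t x) v)) \<le> (K * norm (x - c)) * norm (z n (p t x) v)"
            by (rule A_bound'[OF Suc.prems t])
          also have "\<dots> \<le> 1/8 * (?C * norm v)"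
            using Suc.IH[OF p[OF Suc.prems t]] Kx[OF Suc.prems] by (intro mult_mono) auto
          finally show ?thesis .
        qed
        have 2: "norm (A (p t x) v (z n (p t x) (x - c))) \<le> 1/8 * (?C * norm v)"
        proof -
          have "norm (A (p t x) v (z n (p t x) (x - c))) \<le> (K * norm v) * norm (z n (p t x) (x - c))"
            by (rule A_bound'[OF Suc.prems t])
          also have "\<dots> \<le> (K * norm v) * (?C * norm (x - c))"
            using Suc.IH[OF p[OF Suc.prems t]] K by (intro mult_left_mono) auto
          also have "\<dots> = (K * norm (x - c)) * (?C * norm v)" by simp
          also have "\<dots> \<le> 1/8 * (?C * norm v)"
            using Kx[OF Suc.prems] K by (intro mult_right_mono) auto
          finally show ?thesis .
        qed
        have "norm (t *\<^sub>R (A (p t x) (x - c) (z n (p t x) v) - A (p t x) v (z n (p t x) (x - c))))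
            \<le> 1 * norm (A (p t x) (x - c) (z n (p t x) v) - A (p t x) v (z n (p t x) (x - c)))"
          using t unfolding norm_scaleR by (intro mult_right_mono) auto
        also have "\<dots> \<le> 1/4 * (?C * norm v)"
          using norm_triangle_ineq4[of "A (p t x) (x - c) (z n (p t x) v)" "A (p t x) v (z n (p t x) (x - c))"] 1 2 by linarith
        finally show "norm (t *\<^sub>R (A (p t x) (x - c) (z n (p t x) v) - A (p t x) v (z n (p t x) (x - c)))) \<le> 1/4 * (?C * norm v)" .
      qed simp
      note 1 = this[unfolded diff_0_right mult_1_right]
      have 2: "norm (A x v (f n x - f (Suc n) x)) \<le> K * norm v * ((1/2) ^ Suc n * norm y0)"
      proof -
        have "norm (A x v (f n x - f (Suc n) x)) \<le> K * norm v * norm (f n x - f (Suc n) x)"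
          using A_bound Suc.prems r(3) by blast
        also have "\<dots> \<le> K * norm v * ((1/2) ^ Suc n * norm y0)"
        proof (intro mult_left_mono)
          have "(1/8::real) ^ Suc n \<le> (1/2) ^ Suc n" by (rule power_mono) auto
          then have "(1/8) ^ Suc n * norm y0 \<le> (1/2) ^ Suc n * norm y0" by (intro mult_right_mono) auto
          then show "norm (f n x - f (Suc n) x) \<le> (1/2) ^ Suc n * norm y0"
            using diff[OF Suc.prems, of n] norm_minus_commute[of "f n x" "f (Suc n) x"] by linarith
        qed (use K in auto)
        finally show ?thesis .
      qed
      have "norm (z (Suc n) x v) \<le> K * norm v * ((1/2) ^ Suc n * norm y0) + 1/4 * (?C * norm v)"
        unfolding z_rec[OF Suc.prems] by (intro norm_triangle_le add_mono 1 2)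
      also have "\<dots> = 2 * K * norm y0 * (1/2) ^ Suc n * norm v" by simp
      finally show ?case .
    qed
    have tail: "norm (f (n + m) x - f n x) \<le> (1/2) ^ n * norm y0" if "x \<in> ?B" for n m x
    proof -
      \<comment> \<open>After weakening 1/8 to 1/2 the increments are bounded by the differences of
        consecutive powers of 1/2, so the sum telescopes.\<close>
      have "norm (f (n + m) x - f n x) \<le> ((1/2) ^ n - (1/2) ^ (n + m)) * norm y0"
      proof (induction m)
        case (Suc m)
        have "(1/8::real) ^ Suc (n + m) \<le> (1/2) ^ Suc (n + m)" by (rule power_mono) auto
        then have "(1/8) ^ Suc (n + m) * norm y0 \<le> (1/2) ^ Suc (n + m) * norm y0" by (intro mult_right_mono) auto
        then have "norm (f (Suc (n + m)) x - f (n + m) x) \<le> (1/2) ^ Suc (n + m) * norm y0"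
          using diff[OF that, of "n + m"] by linarith
        moreover have "norm (f (Suc (n + m)) x - f n x) \<le> norm (f (Suc (n + m)) x - f (n + m) x) + norm (f (n + m) x - f n x)"
          using norm_triangle_ineq[of "f (Suc (n + m)) x - f (n + m) x" "f (n + m) x - f n x"] by simp
        ultimately have "norm (f (Suc (n + m)) x - f n x) \<le> (1/2) ^ Suc (n + m) * norm y0 + ((1/2) ^ n - (1/2) ^ (n + m)) * norm y0"
          using Suc.IH by linarith
        also have "\<dots> = ((1/2) ^ n - (1/2) ^ (n + Suc m)) * norm y0" by (simp add: algebra_simps)
        finally show ?case by simp
      qed simp
      also have "\<dots> \<le> (1/2) ^ n * norm y0" by (intro mult_right_mono) auto
      finally show ?thesis .
    qed
    have small: "\<exists>N. \<forall>n\<ge>N. M * (1/2) ^ n < e" if "e > 0" for M e :: real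
    proof -
      have "(\<lambda>n. M * (1/2) ^ n) \<longlonglongrightarrow> M * 0"
        by (intro tendsto_mult tendsto_const LIMSEQ_power_zero) auto
      then have "\<forall>\<^sub>F n in sequentially. M * (1/2) ^ n < e" using that by (intro order_tendstoD(2)) auto
      then show ?thesis by (simp add: eventually_sequentially)
    qed
    have "convergent (\<lambda>n. f n x)" if x: "x \<in> ?B" for x
    proof (rule Cauchy_convergent, rule CauchyI')
      fix e :: real assume "e > 0"
      then obtain N where N: "\<forall>n\<ge>N. norm y0 * (1/2) ^ n < e" using small[OF \<open>e > 0\<close>] by blast
      show "\<exists>M. \<forall>m\<ge>M. \<forall>n>m. dist (f m x) (f n x) < e"
      proof (intro exI[of _ N] allI impI)
        fix m n assume mn: "N \<le> m" "m < n"
        then have "norm (f n x - f m x) \<le> (1/2) ^ m * norm y0" using tail[OF x, of m "n - m"] by simp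
        also have "\<dots> < e" using N mn by (simp add: mult.commute)
        finally show "dist (f m x) (f n x) < e" by (simp add: dist_norm norm_minus_commute)
      qed
    qed
    then have lim: "(\<lambda>n. f n x) \<longlonglongrightarrow> lim (\<lambda>n. f n x)" if "x \<in> ?B" for x
      using that by (simp add: convergent_LIMSEQ_iff)
    have lim_bound: "norm (f n x - lim (\<lambda>n. f n x)) \<le> (1/2) ^ n * norm y0" if x: "x \<in> ?B" for n x
    proof (rule tendsto_upperbound)
      show "(\<lambda>m. norm (f n x - f (m + n) x)) \<longlonglongrightarrow> norm (f n x - lim (\<lambda>n. f n x))"
        by (intro tendsto_norm tendsto_diff tendsto_const LIMSEQ_ignore_initial_segment lim x)
      show "\<forall>\<^sub>F m in sequentially. norm (f n x - f (m + n) x) \<le> (1/2) ^ n * norm y0"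
        using tail[OF x, of n] by (auto simp: norm_minus_commute add.commute)
    qed simp
    \<comment> \<open>The derivatives \<open>f' n x v\<close> converge uniformly to
      \<open>A x v\<close> at the limit: they differ from \<open>A x v (f n x)\<close> by the
      defect, and \<open>f n\<close> from its limit by the tail, both geometrically small on the
      ball.\<close>
    have "\<exists>Y. \<forall>x\<in>?B. (\<lambda>n. f n x) \<longlonglongrightarrow> Y x \<and> (Y has_derivative (\<lambda>v. A x v (lim (\<lambda>n. f n x)))) (at x within ?B)"
    proof (rule has_derivative_sequence[OF convex_ball])
      show "(f n has_derivative f' n x) (at x within ?B)" if "x \<in> ?B" for n x
        using fd[OF that] by (rule has_derivative_at_withinI)
      show "c \<in> ?B" "(\<lambda>n. f n c) \<longlonglongrightarrow> lim (\<lambda>n. f n c)" using r lim by auto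
      fix e :: real assume "e > 0"
      then obtain N where N: "\<forall>n\<ge>N. (3 * K * norm y0) * (1/2) ^ n < e" using small[OF \<open>e > 0\<close>] by blast
      have "norm (f' n x v - A x v (lim (\<lambda>n. f n x))) \<le> e * norm v" if "n \<ge> N" and x: "x \<in> ?B" for n x v
      proof -
        have "norm (A x v (f n x - lim (\<lambda>n. f n x))) \<le> K * norm v * norm (f n x - lim (\<lambda>n. f n x))"
          using A_bound x r(3) by blast
        also have "\<dots> \<le> K * norm v * ((1/2) ^ n * norm y0)"
          using lim_bound[OF x] K by (intro mult_left_mono) auto
        finally have 1: "norm (A x v (f n x - lim (\<lambda>n. f n x))) \<le> K * norm y0 * (1/2) ^ n * norm v" by (simp add: ac_simps)
        have 2: "f' n x v - A x v (lim (\<lambda>n. f n x)) = z n x v + A x v (f n x - lim (\<lambda>n. f n x))"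
          by (simp add: z_def A_diff_right)
        have "norm (f' n x v - A x v (lim (\<lambda>n. f n x))) \<le> 2 * K * norm y0 * (1/2) ^ n * norm v + K * norm y0 * (1/2) ^ n * norm v"
          unfolding 2 by (rule norm_triangle_mono[OF z_bound[OF x] 1])
        also have "\<dots> = ((3 * K * norm y0) * (1/2) ^ n) * norm v" by (simp add: algebra_simps)
        also have "\<dots> \<le> e * norm v" using N that(1) by (intro mult_right_mono) (auto intro: less_imp_le)
        finally show ?thesis .
      qed
      then show "\<forall>\<^sub>F n in sequentially. \<forall>x\<in>?B. \<forall>v. norm (f' n x v - A x v (lim (\<lambda>n. f n x))) \<le> e * norm v"
        unfolding eventually_sequentially by blast
    qed
    then obtain Y where Y: "\<forall>x\<in>?B. (\<lambda>n. f n x) \<longlonglongrightarrow> Y x \<and> (Y has_derivative (\<lambda>v. A x v (lim (\<lambda>n. f n x)))) (at x within ?B)"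
      by (rule exE)
    note Y1 = Y[THEN bspec, THEN conjunct1] and Y2 = Y[THEN bspec, THEN conjunct2]
    \<comment> \<open>At the centre the ray degenerates: \<open>x - c = 0\<close> makes every
      integrand vanish.\<close>
    have "f n c = y0" for n by (cases n) (simp_all add: f0 fSuc A_zero_left)
    then have "(\<lambda>n. f n c) \<longlonglongrightarrow> y0" by simp
    then have Yc: "Y c = y0" using LIMSEQ_unique[OF Y1[of c]] r(1) by simp
    have YD: "(Y has_derivative (\<lambda>v. A x v (Y x))) (at x)" if "x \<in> ?B" for x
      using Y2[OF that] limI[OF Y1[OF that]] at_within_open[OF that open_ball] by simp
    show ?thesis by (intro exI[of _ Y] conjI ballI Yc YD)
  qed
  then show thesis using that r(1) BS by blast
qed

section \<open>Affine functions as real parts of holomorphic functions\<close>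

lemma smult_vec_eq: "c *s v = Re c *\<^sub>R v + Im c *\<^sub>R (\<i> *s v)" for v :: "complex^'n"
  by (simp add: vec_eq_iff complex_eq_iff)

lemma linear_smult_vec: "linear ((*s) c :: complex^'n \<Rightarrow> complex^'n)"
  by (rule linearI) (simp_all add: vec_eq_iff algebra_simps)

text \<open>Structure constants of a bilinear map. They bring the term with \<open>\<Gamma>\<close>
  into the shape demanded by \<open>frobenius_local\<close>: finitely many scalar coefficient
  functions times fixed bilinear maps.\<close>

lemma bilinear_euclidean_expansion:
  fixes T :: "'a::euclidean_space \<Rightarrow> 'b::euclidean_space \<Rightarrow> 'c::euclidean_space"
  assumes "\<And>v. linear (T v)" "\<And>w. linear (\<lambda>v. T v w)"
  shows "(\<Sum>(b1, b2, b3)\<in>Basis \<times> Basis \<times> Basis. (T b1 b2 \<bullet> b3) * ((v \<bullet> b1) * (w \<bullet> b2) * (a \<bullet> b3))) = a \<bullet> T v w"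
proof -
  have 1: "T v w = (\<Sum>b1\<in>Basis. (v \<bullet> b1) *\<^sub>R T b1 w)"
    using linear_sum[OF assms(2), of "\<lambda>b. (v \<bullet> b) *\<^sub>R b" Basis w] linear_cmul[OF assms(2)]
    by (simp add: euclidean_representation)
  have 2: "T b w = (\<Sum>b2\<in>Basis. (w \<bullet> b2) *\<^sub>R T b b2)" for b
    using linear_sum[OF assms(1), of b "\<lambda>b. (w \<bullet> b) *\<^sub>R b" Basis] linear_cmul[OF assms(1)]
    by (simp add: euclidean_representation)
  have "T v w = (\<Sum>b1\<in>Basis. \<Sum>b2\<in>Basis. (v \<bullet> b1) *\<^sub>R (w \<bullet> b2) *\<^sub>R T b1 b2)"
    unfolding 1 by (simp only: 2 scaleR_sum_right)
  then have "a \<bullet> T v w = (\<Sum>b1\<in>Basis. \<Sum>b2\<in>Basis. (v \<bullet> b1) * (w \<bullet> b2) * (a \<bullet> T b1 b2))"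
    by (simp add: inner_sum_right ac_simps)
  also have "\<dots> = (\<Sum>b1\<in>Basis. \<Sum>b2\<in>Basis. \<Sum>b3\<in>Basis. (T b1 b2 \<bullet> b3) * ((v \<bullet> b1) * (w \<bullet> b2) * (a \<bullet> b3)))"
    by (subst euclidean_inner) (simp add: sum_distrib_left ac_simps)
  finally show ?thesis by (simp add: sum.cartesian_product)
qed

text \<open>The pair \<open>(Z, \<alpha>)\<close> with \<open>\<alpha> = Re dZ\<close> solves the linear system
  \<open>dZ v = \<alpha> v - \<i> \<alpha> (\<i>v)\<close>, \<open>d\<alpha> v = \<alpha> \<circ> \<Gamma> v\<close>; the covector \<open>\<alpha>\<close> is represented by a vector through the inner product.\<close>

lemma affine_holomorphic_functions:
  fixes \<Gamma> :: "complex^'n \<Rightarrow> complex^'n \<Rightarrow> complex^'n \<Rightarrow> complex^'n"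
  assumes S: "open S" "c \<in> S"
    and lin: "\<And>x u. x \<in> S \<Longrightarrow> linear (\<Gamma> x u)" "\<And>x v. x \<in> S \<Longrightarrow> linear (\<lambda>u. \<Gamma> x u v)"
    and smooth: "\<And>u v. smooth_on S (\<lambda>x. \<Gamma> x u v)"
    and sym: "\<And>x u v. x \<in> S \<Longrightarrow> \<Gamma> x u v = \<Gamma> x v u"
    and J: "\<And>x u v. x \<in> S \<Longrightarrow> \<Gamma> x u (\<i> *s v) = \<Gamma> x v (\<i> *s u)"
    and flat: "\<And>x u v w. x \<in> S \<Longrightarrow>
      frechet_derivative (\<lambda>y. \<Gamma> y v w) (at x) u + \<Gamma> x u (\<Gamma> x v w) =
      frechet_derivative (\<lambda>y. \<Gamma> y u w) (at x) v + \<Gamma> x v (\<Gamma> x u w)"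
  obtains r where "r > 0" "ball c r \<subseteq> S"
    "\<And>\<alpha>. \<exists>Z. holomorphic_fun (ball c r) Z \<and> (\<forall>w. Re (frechet_derivative Z (at c) w) = \<alpha> \<bullet> w) \<and>
      (\<forall>x\<in>ball c r. \<forall>w. ((\<lambda>x. Re (frechet_derivative Z (at x) w)) has_derivative
        (\<lambda>v. Re (frechet_derivative Z (at x) (\<Gamma> x v w)))) (at x))"
proof -
  \<comment> \<open>\<open>None\<close> indexes the constant part of the system, which expresses
    \<open>dZ\<close> through the covector; \<open>Some (b1, b2, b3)\<close> indexes the structure
    constants of \<open>\<Gamma>\<close>.\<close>
  define J where "J = insert None (Some ` ((Basis :: (complex^'n) set) \<times> (Basis :: (complex^'n) set) \<times> (Basis :: (complex^'n) set)))"
  define a where "a j x = (case j of None \<Rightarrow> 1 | Some (b1, b2, b3) \<Rightarrow> \<Gamma> x b1 b2 \<bullet> b3)" for j and x :: "complex^'n"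
  \<comment> \<open>In the second component the covector is contracted with \<open>b3\<close> and
    the result points along \<open>b2\<close>: this is the adjoint of \<open>\<Gamma> x v\<close>,
    because covectors are represented by vectors.\<close>
  define E where "E j v y = (case j of None \<Rightarrow> (Complex (snd y \<bullet> v) (- (snd y \<bullet> (\<i> *s v))), 0)
      | Some (b1, b2, b3) \<Rightarrow> (0, ((v \<bullet> b1) * (snd y \<bullet> b3)) *\<^sub>R b2))"
    for j :: "((complex^'n) \<times> (complex^'n) \<times> (complex^'n)) option" and v :: "complex^'n" and y :: "complex \<times> (complex^'n)"
  let ?A = "\<lambda>x v y. \<Sum>j\<in>J. a j x *\<^sub>R E j v y"
  let ?A' = "\<lambda>x u v y. \<Sum>j\<in>J. frechet_derivative (a j) (at x) u *\<^sub>R E j v y"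
  let ?D\<Gamma> = "\<lambda>x u v w. frechet_derivative (\<lambda>y. \<Gamma> y v w) (at x) u"
  have Jsum: "(\<Sum>j\<in>J. f j) = f None + (\<Sum>(b1, b2, b3)\<in>Basis \<times> Basis \<times> Basis. f (Some (b1, b2, b3)))"
    for f :: "_ \<Rightarrow> complex \<times> (complex^'n)"
    unfolding J_def by (subst sum.insert) (auto simp: sum.reindex split_beta)
  have D\<Gamma>: "((\<lambda>y. \<Gamma> y v w) has_derivative (\<lambda>u. ?D\<Gamma> x u v w)) (at x)" if "x \<in> S" for x v w
    by (rule smooth_on_has_derivative[OF smooth that])
  \<comment> \<open>Differentiating the linearity identities of \<open>\<Gamma>\<close> in the base
    point keeps both slots linear, so the differentiated term expands over the same structure
    constants.\<close>
  have D\<Gamma>_lin1: "linear (\<lambda>v. ?D\<Gamma> x u v w)" and D\<Gamma>_lin2: "linear (\<lambda>w. ?D\<Gamma> x u v w)" if x: "x \<in> S" for x u v w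
  proof -
    have eq: "?D\<Gamma> x u v w = f' u" if "(f has_derivative f') (at x)" "\<And>y. y \<in> S \<Longrightarrow> f y = \<Gamma> y v w" for f f' v w
    proof -
      have "((\<lambda>y. \<Gamma> y v w) has_derivative f') (at x)"
        using that(1) S(1) x by (rule has_derivative_transform_within_open) (rule that(2))
      then show ?thesis using frechet_derivative_at by metis
    qed
    show "linear (\<lambda>v. ?D\<Gamma> x u v w)"
    proof (rule linearI)
      show "?D\<Gamma> x u (v1 + v2) w = ?D\<Gamma> x u v1 w + ?D\<Gamma> x u v2 w" for v1 v2
        by (rule eq[OF has_derivative_add[OF D\<Gamma>[OF x] D\<Gamma>[OF x]]]) (simp add: linear_add[OF lin(2)])
      show "?D\<Gamma> x u (k *\<^sub>R v1) w = k *\<^sub>R ?D\<Gamma> x u v1 w" for k v1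
        by (rule eq[OF has_derivative_scaleR_right[OF D\<Gamma>[OF x]]]) (simp add: linear_cmul[OF lin(2)])
    qed
    show "linear (\<lambda>w. ?D\<Gamma> x u v w)"
    proof (rule linearI)
      show "?D\<Gamma> x u v (w1 + w2) = ?D\<Gamma> x u v w1 + ?D\<Gamma> x u v w2" for w1 w2
        by (rule eq[OF has_derivative_add[OF D\<Gamma>[OF x] D\<Gamma>[OF x]]]) (simp add: linear_add[OF lin(1)])
      show "?D\<Gamma> x u v (k *\<^sub>R w1) = k *\<^sub>R ?D\<Gamma> x u v w1" for k w1
        by (rule eq[OF has_derivative_scaleR_right[OF D\<Gamma>[OF x]]]) (simp add: linear_cmul[OF lin(1)])
    qed
  qed
  have smooth_a: "smooth_on S (a j)" if "j \<in> J" for j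
    unfolding a_def by (cases j) (auto intro!: smooth_on_const S smooth_on_linear[OF bounded_linear_inner_left] smooth)
  have a': "frechet_derivative (a (Some (b1, b2, b3))) (at x) u = ?D\<Gamma> x u b1 b2 \<bullet> b3" if x: "x \<in> S" for x u b1 b2 b3
    by (simp add: a_def[abs_def] flip: fun_cong[OF frechet_derivative_at[OF has_derivative_inner_left[OF D\<Gamma>[OF x]]]])
  have fstA: "fst (?A x v y) = Complex (snd y \<bullet> v) (- (snd y \<bullet> (\<i> *s v)))" for x v y
    unfolding Jsum by (simp add: fst_sum split_beta a_def E_def)
  have sndA: "snd (?A x v y) \<bullet> w = snd y \<bullet> \<Gamma> x v w" if "x \<in> S" for x v y w
    unfolding Jsum bilinear_euclidean_expansion[OF lin[OF that], symmetric]
    by (auto simp: snd_sum inner_sum_left a_def E_def case_prod_beta inner_commute[of w] mult_ac intro!: sum.cong)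
  have fstA': "fst (?A' x u v y) = 0" for x u v y
    unfolding Jsum by (simp add: fst_sum split_beta E_def) (simp add: a_def[abs_def] frechet_derivative_const)
  have sndA': "snd (?A' x u v y) \<bullet> w = snd y \<bullet> ?D\<Gamma> x u v w" if "x \<in> S" for x u v y w
    unfolding Jsum bilinear_euclidean_expansion[of "?D\<Gamma> x u", OF D\<Gamma>_lin2[OF that] D\<Gamma>_lin1[OF that], symmetric]
    by (auto simp: snd_sum inner_sum_left a'[OF that] E_def case_prod_beta inner_commute[of w] mult_ac intro!: sum.cong)
  have "\<exists>r>0. ball c r \<subseteq> S \<and>
      (\<forall>y0. \<exists>Y. Y c = y0 \<and> (\<forall>x\<in>ball c r. (Y has_derivative (\<lambda>v. ?A x v (Y x))) (at x)))"
  proof (rule frobenius_local[OF S, where J = J and a = a and E = E])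
    show "bounded_bilinear (E j)" for j
    proof -
      have "bilinear (E j)"
        unfolding bilinear_def E_def
        by (cases j) (auto intro!: linearI simp: inner_add_left inner_add_right complex_eq_iff scaleR_add_left
            algebra_simps linear_add[OF linear_smult_vec] linear_cmul[OF linear_smult_vec])
      then show ?thesis by (simp add: bilinear_conv_bounded_bilinear)
    qed
    show "?A' x u v y + ?A x v (?A x u y) = ?A' x v u y + ?A x u (?A x v y)" if x: "x \<in> S" for x u v y
    proof (rule prod_eqI)
      \<comment> \<open>The first components agree by symmetry of \<open>\<Gamma>\<close> and by
        \<open>J\<close>, which say that the real and the imaginary part of \<open>dZ\<close> are
        closed; the second components agree by \<open>flat\<close>.\<close>
      show "fst (?A' x u v y + ?A x v (?A x u y)) = fst (?A' x v u y + ?A x u (?A x v y))"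
        unfolding fst_add fstA fstA' sndA[OF x] using sym[OF x, of u v] J[OF x, of u v] by simp
      show "snd (?A' x u v y + ?A x v (?A x u y)) = snd (?A' x v u y + ?A x u (?A x v y))"
      proof (subst vector_eq_rdot[symmetric], rule allI)
        fix w
        show "snd (?A' x u v y + ?A x v (?A x u y)) \<bullet> w = snd (?A' x v u y + ?A x u (?A x v y)) \<bullet> w"
          unfolding snd_add inner_add_left sndA'[OF x] sndA[OF x]
          using flat[OF x, of v w u] by (simp flip: inner_add_right)
      qed
    qed
    fix r assume "r > 0" "ball c r \<subseteq> S"
      "\<And>y0. \<exists>Y. Y c = y0 \<and> (\<forall>x\<in>ball c r. (Y has_derivative (\<lambda>v. ?A x v (Y x))) (at x))"
    then show ?thesis by (intro exI[of _ r] conjI allI)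
  qed (rule smooth_a)
  then obtain r where r: "r > 0" "ball c r \<subseteq> S" and
    Y: "\<forall>y0. \<exists>Y. Y c = y0 \<and> (\<forall>x\<in>ball c r. (Y has_derivative (\<lambda>v. ?A x v (Y x))) (at x))"
    by (elim exE conjE)
  show thesis
  proof (rule that[OF r])
    fix \<alpha> :: "complex^'n"
    obtain Y where Yc: "Y c = (0, \<alpha>)" and YD: "\<forall>x\<in>ball c r. (Y has_derivative (\<lambda>v. ?A x v (Y x))) (at x)"
      using Y[THEN spec, of "(0, \<alpha>)"] by (elim exE conjE)
    let ?Z = "\<lambda>x. fst (Y x)"
    let ?Z' = "\<lambda>x v. Complex (snd (Y x) \<bullet> v) (- (snd (Y x) \<bullet> (\<i> *s v)))"
    have ZD: "(?Z has_derivative ?Z' x) (at x)" if "x \<in> ball c r" for x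
      using bounded_linear.has_derivative[OF bounded_linear_fst YD[THEN bspec, OF that]] by (simp only: fstA)
    have Z': "frechet_derivative ?Z (at x) = ?Z' x" if "x \<in> ball c r" for x
      using frechet_derivative_at[OF ZD[OF that]] by simp
    \<comment> \<open>For every real linear form its value at \<open>v\<close> minus
      \<open>\<i>\<close> times its value at \<open>\<i> *s v\<close> is complex linear in
      \<open>v\<close>.\<close>
    have hol: "holomorphic_fun (ball c r) ?Z"
    proof (rule holomorphic_funI[OF open_ball ZD])
      fix x k v
      show "?Z' x (k *s v) = k * ?Z' x v"
        unfolding smult_vec_eq[of k v]
        by (simp add: complex_eq_iff inner_add_right algebra_simps linear_add[OF linear_smult_vec] linear_cmul[OF linear_smult_vec])
    qed
    have "((\<lambda>x. Re (frechet_derivative ?Z (at x) w)) has_derivative (\<lambda>v. Re (frechet_derivative ?Z (at x) (\<Gamma> x v w)))) (at x)"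
      if x: "x \<in> ball c r" for x w
    proof -
      have xS: "x \<in> S" using x r by blast
      have "((\<lambda>x. snd (Y x) \<bullet> w) has_derivative (\<lambda>v. snd (?A x v (Y x)) \<bullet> w)) (at x)"
        by (rule has_derivative_inner_left[OF bounded_linear.has_derivative[OF bounded_linear_snd YD[THEN bspec, OF x]]])
      then have "((\<lambda>x. snd (Y x) \<bullet> w) has_derivative (\<lambda>v. Re (frechet_derivative ?Z (at x) (\<Gamma> x v w)))) (at x)"
        by (simp only: sndA[OF xS] Z'[OF x] complex.sel)
      then show ?thesis
        by (rule has_derivative_transform_within_open[OF _ open_ball x]) (simp add: Z')
    qed
    moreover have "Re (frechet_derivative ?Z (at c) w) = \<alpha> \<bullet> w" for w
      using Z'[of c] r Yc by simp
    ultimately show "\<exists>Z. holomorphic_fun (ball c r) Z \<and> (\<forall>w. Re (frechet_derivative Z (at c) w) = \<alpha> \<bullet> w) \<and>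
      (\<forall>x\<in>ball c r. \<forall>w. ((\<lambda>x. Re (frechet_derivative Z (at x) w)) has_derivative
        (\<lambda>v. Re (frechet_derivative Z (at x) (\<Gamma> x v w)))) (at x))"
      using hol by (intro exI[of _ ?Z] conjI allI ballI)
  qed
qed

text \<open>Gram-Schmidt for an indefinite Hermitian form: \<open>W\<close> is its imaginary part
  and \<open>g u v = W (\<i> *s u) v\<close> its real part. The vectors are not normalized, so
  \<open>\<epsilon> i\<close> is an arbitrary nonzero real number, and each summand is
  \<open>\<epsilon> i\<close> times the imaginary part of \<open>L u $ i\<close> times the conjugate
  of \<open>L v $ i\<close>.\<close>

lemma hermitian_diagonalization:
  fixes W :: "complex^'n \<Rightarrow> complex^'n \<Rightarrow> real"
  assumes lin: "\<And>w. linear (\<lambda>u. W u w)" and skew: "\<And>u v. W u v = - W v u"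
    and J: "\<And>u v. W (\<i> *s u) (\<i> *s v) = W u v"
    and nondegenerate: "\<And>v. (\<And>w. W v w = 0) \<Longrightarrow> v = 0"
  obtains L :: "complex^'n \<Rightarrow> complex^'n" and \<epsilon> where "linear L" "\<And>k v. L (k *s v) = k *s L v"
    "\<And>v. L v = 0 \<Longrightarrow> v = 0"
    "\<And>u v. W u v = (\<Sum>i\<in>UNIV. \<epsilon> i * (Im (L u $ i) * Re (L v $ i) - Re (L u $ i) * Im (L v $ i)))"
proof -
  have lin': "linear (W u)" for u
  proof -
    have "W u = (\<lambda>w. - W w u)" by (rule ext) (rule skew)
    then show ?thesis using linear_compose_neg[OF lin[of u]] by simp
  qed
  note W_simps = linear_add[OF lin] linear_diff[OF lin] linear_cmul[OF lin] linear_neg[OF lin] linear_0[OF lin] linear_sum[OF lin]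
    linear_add[OF lin'] linear_diff[OF lin'] linear_cmul[OF lin'] linear_neg[OF lin'] linear_0[OF lin'] linear_sum[OF lin']
  note i_simps = linear_add[OF linear_smult_vec] linear_diff[OF linear_smult_vec] linear_cmul[OF linear_smult_vec]
    linear_neg[OF linear_smult_vec] linear_sum[OF linear_smult_vec]
  define g where "g u v = W (\<i> *s u) v" for u v
  have g_sym: "g u v = g v u" for u v
    using J[of "\<i> *s u" v] skew[of u "\<i> *s v"] by (simp add: g_def W_simps)
  have g_i: "g u (\<i> *s v) = W u v" for u v by (simp add: g_def J)
  have W_i: "W u (\<i> *s v) = - g u v" for u v using g_sym[of u v] skew[of u "\<i> *s v"] by (simp add: g_def)
  have W_self: "W u u = 0" for u using skew[of u u] by simp
  have g_lin: "linear (g u)" for u unfolding g_def[abs_def] by (rule lin')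
  note g_simps = linear_add[OF g_lin] linear_diff[OF g_lin] linear_cmul[OF g_lin] linear_neg[OF g_lin] linear_0[OF g_lin] linear_sum[OF g_lin]

  \<comment> \<open>Hermitian orthogonality means that \<open>g\<close> and \<open>W\<close> both
    vanish. Requiring \<open>g (e i) (e i) \<noteq> 0\<close> makes the projection onto the complex
    span of the family available.\<close>
  define orth where "orth I e \<longleftrightarrow> (\<forall>i\<in>I. g (e i) (e i) \<noteq> 0 \<and> (\<forall>j\<in>I. j \<noteq> i \<longrightarrow> W (e i) (e j) = 0 \<and> g (e i) (e j) = 0))"
    for I :: "'n set" and e
  have "\<exists>e. orth I e" for I :: "'n set"
  proof (induction I rule: finite_induct[OF finite])
    case 1
    then show ?case by (simp add: orth_def)
  next
    case (2 k I)
    then obtain e where e: "orth I e" by blast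
    define P where "P r \<longleftrightarrow> (\<forall>j\<in>I. g r (e j) = 0 \<and> W r (e j) = 0)" for r
    define \<pi> where "\<pi> v = (\<Sum>i\<in>I. (g v (e i) / g (e i) (e i)) *\<^sub>R e i + (W v (e i) / g (e i) (e i)) *\<^sub>R (\<i> *s e i))" for v
    have g\<pi>: "g (e j) (\<pi> v) = g v (e j)" and W\<pi>: "W (\<pi> v) (e j) = W v (e j)" if j: "j \<in> I" for j v
    proof -
      have "g (e j) (\<pi> v) = (\<Sum>i\<in>I. (g v (e i) / g (e i) (e i)) * g (e j) (e i) + (W v (e i) / g (e i) (e i)) * W (e j) (e i))"
        by (simp add: \<pi>_def g_simps g_i)
      also have "\<dots> = (\<Sum>i\<in>I. if i = j then g v (e j) else 0)"
        using e j by (intro sum.cong) (auto simp: orth_def W_self)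
      finally show "g (e j) (\<pi> v) = g v (e j)" using j 2(1) by simp
      have "W (\<pi> v) (e j) = (\<Sum>i\<in>I. (g v (e i) / g (e i) (e i)) * W (e i) (e j) + (W v (e i) / g (e i) (e i)) * g (e i) (e j))"
        by (simp add: \<pi>_def W_simps g_def)
      also have "\<dots> = (\<Sum>i\<in>I. if i = j then W v (e j) else 0)"
        using e j by (intro sum.cong) (auto simp: orth_def W_self)
      finally show "W (\<pi> v) (e j) = W v (e j)" using j 2(1) by simp
    qed
    have P_diff: "P (v - \<pi> v)" for v
      unfolding P_def using g\<pi> W\<pi> g_sym[of "v - \<pi> v"] g_sym[of v] by (auto simp: g_simps W_simps)
    have P_add: "P (r + s)" if "P r" "P s" for r s
      using that unfolding P_def g_def by (simp add: i_simps W_simps)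
    have P_i: "P (\<i> *s r)" if "P r" for r
      using that unfolding P_def g_def by (simp add: W_simps)
    \<comment> \<open>If \<open>g\<close> were isotropic on the orthogonal complement
      \<open>P\<close>, polarization and closure of \<open>P\<close> under \<open>\<i>\<close> would
      make \<open>g\<close> and \<open>W\<close> vanish on it. Then \<open>v - \<pi> v\<close> would
      pair to zero with everything, and nondegeneracy would force \<open>v = \<pi> v\<close> for all
      \<open>v\<close>.\<close>
    have "\<exists>r. P r \<and> g r r \<noteq> 0"
    proof (rule ccontr)
      assume "\<not> ?thesis"
      then have null: "g r r = 0" if "P r" for r using that by blast
      have g0: "g r s = 0" if "P r" "P s" for r s
        using null[OF that(1)] null[OF that(2)] null[OF P_add[OF that]] g_sym[of r s]
        by (simp add: g_def i_simps W_simps)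
      have W0: "W r s = 0" if "P r" "P s" for r s
        using g0[OF P_i[OF that(1)] that(2)] by (simp add: g_def W_simps)
      have \<pi>_id: "v = \<pi> v" for v
      proof -
        have "W (v - \<pi> v) w = 0" for w
        proof -
          let ?r = "v - \<pi> v"
          have r: "P ?r" by (rule P_diff)
          have "W ?r (\<pi> w) = 0"
            using r by (simp add: \<pi>_def W_simps(7-12) W_i P_def)
          moreover have "W ?r (w - \<pi> w) = 0"
            by (rule W0[OF r P_diff])
          ultimately show ?thesis using linear_diff[OF lin', of ?r w "\<pi> w"] by simp
        qed
        then have "v - \<pi> v = 0" by (rule nondegenerate)
        then show ?thesis by simp
      qed
      have \<pi>_span: "\<pi> v \<in> span (e ` I \<union> (\<lambda>i. \<i> *s e i) ` I)" for v
        unfolding \<pi>_def by (intro span_sum span_add span_scale) (auto intro: span_base)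
      have "v \<in> span (e ` I \<union> (\<lambda>i. \<i> *s e i) ` I)" for v
        by (subst \<pi>_id) (rule \<pi>_span)
      then have "UNIV \<subseteq> span (e ` I \<union> (\<lambda>i. \<i> *s e i) ` I)" by (rule subsetI)
      \<comment> \<open>A real dimension count: the whole space has dimension
        \<open>2 * CARD('n)\<close>, but fewer than that many vectors would span it.\<close>
      then have "dim (UNIV :: (complex^'n) set) \<le> card (e ` I \<union> (\<lambda>i. \<i> *s e i) ` I)"
        using 2(1) by (intro dim_le_card) auto
      also have "\<dots> \<le> card (e ` I) + card ((\<lambda>i. \<i> *s e i) ` I)" by (rule card_Un_le)
      also have "\<dots> \<le> card I + card I" using 2(1) by (intro add_mono card_image_le)
      also have "\<dots> < 2 * CARD('n)"
      proof -
        have "card I < CARD('n)" using 2(2) by (intro psubset_card_mono) auto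
        then show ?thesis by simp
      qed
      finally show False by (simp add: mult.commute)
    qed
    then obtain r where r: "P r" "g r r \<noteq> 0" by blast
    have "g (e j) r = 0" "W (e j) r = 0" if "j \<in> I" for j
      using r(1) that g_sym[of "e j" r] skew[of "e j" r] by (simp_all add: P_def)
    then have "orth (insert k I) (e(k := r))"
      using e r 2(2) unfolding orth_def P_def by auto
    then show ?case by blast
  qed
  then obtain e where e: "orth UNIV e" by blast
  define \<epsilon> where "\<epsilon> i = g (e i) (e i)" for i
  have \<epsilon>: "\<epsilon> i \<noteq> 0" for i using e by (simp add: orth_def \<epsilon>_def)
  have ge: "g (e i) (e j) = (if i = j then \<epsilon> i else 0)" and We: "W (e i) (e j) = 0" for i j
    using e W_self by (cases "i = j"; auto simp: orth_def \<epsilon>_def)+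
  \<comment> \<open>The complex coordinates with respect to the orthogonal basis \<open>e\<close>:
    the Hermitian product with \<open>e i\<close> divided by \<open>\<epsilon> i\<close>.\<close>
  define L where "L u = (\<chi> i. Complex (g u (e i) / \<epsilon> i) (W u (e i) / \<epsilon> i))" for u
  have L_lin: "linear L"
    by (rule linearI) (simp_all add: L_def vec_eq_iff complex_eq_iff g_def i_simps W_simps add_divide_distrib)
  have L_smult: "L (k *s v) = k *s L v" for k v
  proof -
    have "L (\<i> *s v) = \<i> *s L v"
      by (simp add: L_def vec_eq_iff complex_eq_iff g_def W_simps)
    then show ?thesis
      unfolding smult_vec_eq[of k] by (simp add: linear_add[OF L_lin] linear_cmul[OF L_lin])
  qed
  have Le: "L (e i) = axis i 1" for i
    using \<epsilon> by (auto simp: L_def vec_eq_iff complex_eq_iff ge We axis_def)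
  have L_sum: "L (\<Sum>i\<in>UNIV. a $ i *s e i) = a" for a
    by (simp add: linear_sum[OF L_lin] L_smult Le vec_eq_iff axis_def if_distrib cong: if_cong)
  then have "surj L" by (rule surjI)
  then have inj: "inj L" by (rule linear_surjective_imp_injective[OF L_lin]) simp
  have repr: "u = (\<Sum>i\<in>UNIV. L u $ i *s e i)" for u
    using L_sum[of "L u"] inj by (metis injD)
  show thesis
  proof (rule that[OF L_lin L_smult])
    show "v = 0" if "L v = 0" for v using that inj linear_0[OF L_lin] by (metis injD)
    fix u v
    have "W u v = W (\<Sum>i\<in>UNIV. L u $ i *s e i) (\<Sum>j\<in>UNIV. L v $ j *s e j)"
      by (simp flip: repr)
    also have "\<dots> = (\<Sum>i\<in>UNIV. \<Sum>j\<in>UNIV. W (L u $ i *s e i) (L v $ j *s e j))"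
      by (simp add: W_simps) (rule sum.swap)
    also have "\<dots> = (\<Sum>i\<in>UNIV. \<Sum>j\<in>UNIV. if j = i then \<epsilon> i * (Im (L u $ i) * Re (L v $ i) - Re (L u $ i) * Im (L v $ i)) else 0)"
    proof (intro sum.cong refl)
      fix i j
      have "W (e i) (\<i> *s e j) = - (if i = j then \<epsilon> i else 0)" "W (\<i> *s e i) (e j) = (if i = j then \<epsilon> i else 0)"
        using W_i ge by (simp_all add: g_def)
      then show "W (L u $ i *s e i) (L v $ j *s e j) =
          (if j = i then \<epsilon> i * (Im (L u $ i) * Re (L v $ i) - Re (L u $ i) * Im (L v $ i)) else 0)"
        unfolding smult_vec_eq[of "L u $ i"] smult_vec_eq[of "L v $ j"]
        by (auto simp: W_simps We J algebra_simps)
    qed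
    finally show "W u v = (\<Sum>i\<in>UNIV. \<epsilon> i * (Im (L u $ i) * Re (L v $ i) - Re (L u $ i) * Im (L v $ i)))" by simp
  qed
qed

text \<open>The primitive is the integral of the form along rays. Closedness turns the derivative of
  its integrand along \<open>v\<close> into the \<open>t\<close>-derivative of
  \<open>t * (\<Sum>i\<in>UNIV. w (p t x) $ i * v $ i)\<close>, which the fundamental theorem
  integrates to the value at \<open>x\<close>.\<close>

lemma holomorphic_poincare:
  fixes w :: "complex^'n \<Rightarrow> complex^'n"
  assumes w: "\<And>i. holomorphic_fun (ball c r) (\<lambda>z. w z $ i)"
    and closed: "\<And>z i j. z \<in> ball c r \<Longrightarrow> cpartial j (\<lambda>z. w z $ i) z = cpartial i (\<lambda>z. w z $ j) z"
  obtains F where "holomorphic_fun (ball c r) F" "\<And>z i. z \<in> ball c r \<Longrightarrow> cpartial i F z = w z $ i"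
proof -
  let ?B = "ball c r"
  let ?D = "\<lambda>i z. frechet_derivative (\<lambda>z. w z $ i) (at z)"
  define p where "p t x = c + t *\<^sub>R (x - c)" for t :: real and x
  have p: "p t x \<in> ?B" if "x \<in> ?B" "t \<in> {0..1}" for t x
  proof -
    have "\<bar>t\<bar> * norm (x - c) \<le> 1 * norm (x - c)" using that by (intro mult_right_mono) auto
    then show ?thesis using that by (simp add: p_def dist_norm norm_minus_commute)
  qed
  have p_cont: "continuous_on T (\<lambda>q. p (snd q) (fst q))" for T
    unfolding p_def by (intro continuous_intros)
  have p_cont': "continuous_on T (\<lambda>t. p t x)" for T x
    unfolding p_def by (intro continuous_intros)
  have w_deriv: "((\<lambda>z. w z $ i) has_derivative ?D i z) (at z)" if "z \<in> ?B" for i z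
    by (rule holomorphic_fun_has_derivative[OF w that])
  have D_lin: "linear (?D i z)" if "z \<in> ?B" for i z
    using w_deriv[OF that] by (rule has_derivative_linear)
  \<comment> \<open>Closedness freed from coordinate indices: the bilinear form given by the
    derivative of \<open>w\<close> is symmetric.\<close>
  have D_sym: "(\<Sum>i\<in>UNIV. ?D i z u * v $ i) = (\<Sum>i\<in>UNIV. ?D i z v * u $ i)" if z: "z \<in> ?B" for z u v
  proof -
    have "(\<Sum>i\<in>UNIV. ?D i z u * v $ i) = (\<Sum>i\<in>UNIV. \<Sum>j\<in>UNIV. u $ j * cpartial j (\<lambda>z. w z $ i) z * v $ i)"
      by (simp add: holomorphic_fun_derivative_cpartial(2)[OF w z] sum_distrib_right)
    also have "\<dots> = (\<Sum>j\<in>UNIV. \<Sum>i\<in>UNIV. u $ j * cpartial j (\<lambda>z. w z $ i) z * v $ i)"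
      by (rule sum.swap)
    also have "\<dots> = (\<Sum>j\<in>UNIV. \<Sum>i\<in>UNIV. v $ i * cpartial i (\<lambda>z. w z $ j) z * u $ j)"
      using closed[OF z] by (intro sum.cong refl) (simp add: ac_simps)
    also have "\<dots> = (\<Sum>i\<in>UNIV. ?D i z v * u $ i)"
      by (simp add: holomorphic_fun_derivative_cpartial(2)[OF w z] sum_distrib_right)
    finally show ?thesis .
  qed
  define F where "F x = integral {0..1} (\<lambda>t. \<Sum>i\<in>UNIV. w (p t x) $ i * (x - c) $ i)" for x
  have FD: "(F has_derivative (\<lambda>v. \<Sum>i\<in>UNIV. w x $ i * v $ i)) (at x)" if x: "x \<in> ?B" for x
  proof -
    let ?f' = "\<lambda>x t v. \<Sum>i\<in>UNIV. w (p t x) $ i * v $ i + t *\<^sub>R ?D i (p t x) v * (x - c) $ i"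
    have "(F has_derivative (\<lambda>v. integral {0..1} (\<lambda>t. ?f' x t v))) (at x)"
      unfolding F_def
    proof (rule has_derivative_integral_param[OF open_ball convex_ball x])
      fix x t assume x: "x \<in> ?B" and t: "t \<in> {0..1::real}"
      show "((\<lambda>x. \<Sum>i\<in>UNIV. w (p t x) $ i * (x - c) $ i) has_derivative ?f' x t) (at x)"
      proof (rule has_derivative_sum)
        fix i
        have "(p t has_derivative (\<lambda>v. t *\<^sub>R v)) (at x)"
          unfolding p_def by (auto intro!: derivative_eq_intros)
        from has_derivative_compose[OF this w_deriv[OF p[OF x t]]]
        have 1: "((\<lambda>x. w (p t x) $ i) has_derivative (\<lambda>v. t *\<^sub>R ?D i (p t x) v)) (at x)"
          by (simp add: linear_cmul[OF D_lin[OF p[OF x t]]])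
        have 2: "((\<lambda>x. (x - c) $ i) has_derivative (\<lambda>v. v $ i)) (at x)"
          by (rule bounded_linear.has_derivative[OF bounded_linear_vec_nth]) (auto intro!: derivative_eq_intros)
        show "((\<lambda>x. w (p t x) $ i * (x - c) $ i) has_derivative
            (\<lambda>v. w (p t x) $ i * v $ i + t *\<^sub>R ?D i (p t x) v * (x - c) $ i)) (at x)"
          by (rule has_derivative_mult[OF 1 2])
      qed
    next
      fix x assume x: "x \<in> ?B"
      show "continuous_on {0..1} (\<lambda>t. \<Sum>i\<in>UNIV. w (p t x) $ i * (x - c) $ i)"
        by (intro continuous_intros continuous_on_compose2[OF holomorphic_fun_continuous_on[OF w] p_cont'])
          (use p x in auto)
    next
      fix v :: "complex^'n"
      show "continuous_on (?B \<times> {0..1}) (\<lambda>(x, t). ?f' x t v)"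
        unfolding split_beta
        by (intro continuous_on_sum continuous_on_add continuous_on_mult continuous_on_scaleR
            continuous_on_compose2[OF holomorphic_fun_continuous_on[OF w] p_cont]
            continuous_on_compose2[OF holomorphic_fun_derivative_continuous[OF w] p_cont] continuous_intros)
          (use p in auto)
    qed
    moreover have "integral {0..1} (\<lambda>t. ?f' x t v) = (\<Sum>i\<in>UNIV. w x $ i * v $ i)" for v
    proof -
      have "((\<lambda>t. ?f' x t v) has_integral
          (1 *\<^sub>R (\<Sum>i\<in>UNIV. w (p 1 x) $ i * v $ i) - 0 *\<^sub>R (\<Sum>i\<in>UNIV. w (p 0 x) $ i * v $ i))) {0..1}"
      proof (rule fundamental_theorem_of_calculus)
        fix t :: real assume t: "t \<in> {0..1}"
        have 1: "((\<lambda>t. \<Sum>i\<in>UNIV. w (p t x) $ i * v $ i) has_derivative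
            (\<lambda>s. \<Sum>i\<in>UNIV. ?D i (p t x) (s *\<^sub>R (x - c)) * v $ i)) (at t within {0..1})"
        proof (intro has_derivative_sum has_derivative_mult_left)
          fix i
          have "((\<lambda>t. p t x) has_derivative (\<lambda>s. s *\<^sub>R (x - c))) (at t within {0..1})"
            unfolding p_def by (auto intro!: derivative_eq_intros)
          from has_derivative_compose[OF this w_deriv[OF p[OF x t]]]
          show "((\<lambda>t. w (p t x) $ i) has_derivative (\<lambda>s. ?D i (p t x) (s *\<^sub>R (x - c)))) (at t within {0..1})" .
        qed
        have 2: "(\<Sum>i\<in>UNIV. ?D i (p t x) (s *\<^sub>R (x - c)) * v $ i) = s *\<^sub>R (\<Sum>i\<in>UNIV. ?D i (p t x) v * (x - c) $ i)" for s
          using D_sym[OF p[OF x t], of v "x - c"]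
          by (simp add: linear_cmul[OF D_lin[OF p[OF x t]]] scaleR_sum_right)
        show "((\<lambda>t. t *\<^sub>R (\<Sum>i\<in>UNIV. w (p t x) $ i * v $ i)) has_vector_derivative ?f' x t v) (at t within {0..1})"
          unfolding has_vector_derivative_def
        proof (rule has_derivative_eq_rhs[OF bounded_bilinear.FDERIV[OF bounded_bilinear_scaleR has_derivative_ident 1]], rule ext)
          fix h
          show "t *\<^sub>R (\<Sum>i\<in>UNIV. ?D i (p t x) (h *\<^sub>R (x - c)) * v $ i) + h *\<^sub>R (\<Sum>i\<in>UNIV. w (p t x) $ i * v $ i) = h *\<^sub>R ?f' x t v"
            unfolding 2 by (simp add: sum.distrib scaleR_right_distrib scaleR_sum_right mult.commute)
        qed
      qed simp
      then show ?thesis by (simp add: p_def integral_unique)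
    qed
    ultimately show ?thesis by simp
  qed
  show thesis
  proof
    show hol: "holomorphic_fun ?B F"
      by (rule holomorphic_funI[OF open_ball FD]) (simp_all add: sum_distrib_left ac_simps)
    show "cpartial i F z = w z $ i" if z: "z \<in> ?B" for z i
    proof -
      have "frechet_derivative F (at z) (axis i 1) = (\<Sum>j\<in>UNIV. w z $ j * axis i 1 $ j)"
        using fun_cong[OF frechet_derivative_at[OF FD[OF z]], of "axis i 1"] by simp
      also have "\<dots> = w z $ i" by (simp add: axis_def if_distrib cong: if_cong)
      finally show ?thesis using holomorphic_fun_derivative_cpartial(1)[OF hol z] by simp
    qed
  qed
qed

section \<open>Smoothness by components\<close>

lemma smooth_on_vec:
  fixes g :: "'v::real_normed_vector \<Rightarrow> complex^'n"
  assumes "open S" "\<And>i. smooth_on S (\<lambda>x. g x $ i)"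
  shows "smooth_on S g"
proof (rule smooth_on_euclidean[OF assms(1)])
  fix b :: "complex^'n" assume "b \<in> Basis"
  then obtain i u where b: "b = axis i u" unfolding Basis_vec_def by blast
  show "smooth_on S (\<lambda>x. g x \<bullet> b)"
    unfolding b inner_axis by (rule smooth_on_linear[OF bounded_linear_inner_left assms(2)])
qed

lemma smooth_on_component: "smooth_on S g \<Longrightarrow> smooth_on S (\<lambda>x. g x $ i)"
  by (rule smooth_on_linear[OF bounded_linear_vec_nth])

lemma linear_euclidean_expansion:
  fixes L :: "'a::euclidean_space \<Rightarrow> 'b::real_normed_vector"
  assumes "linear L"
  shows "L v = (\<Sum>b\<in>Basis. (v \<bullet> b) *\<^sub>R L b)"
proof -
  have "L v = L (\<Sum>b\<in>Basis. (v \<bullet> b) *\<^sub>R b)" by (simp only: euclidean_representation)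
  then show ?thesis by (simp only: linear_sum[OF assms] linear_cmul[OF assms] o_def)
qed

section \<open>Tangent vectors and vector fields in charts\<close>

text \<open>The inverse of \<open>chart_vec\<close> at a point of the chart domain: the components
  of a tangent vector are its values on the coordinate functions, so no representing vector has to
  be chosen.\<close>

definition chart_comp :: "('a, 'n::finite) chart \<Rightarrow> 'a tvec \<Rightarrow> complex^'n" where
  "chart_comp c v = (\<chi> i. Complex (v (\<lambda>p. Re (snd c p $ i))) (v (\<lambda>p. Im (snd c p $ i))))"

context complex_manifold
begin

section \<open>Charts and smooth functions\<close>

lemma chart_subset: "c \<in> A \<Longrightarrow> fst c \<subseteq> topspace M"
  using chart_domain openin_subset by blast

lemma chart_inj: "c \<in> A \<Longrightarrow> inj_on (snd c) (fst c)"
  using homeomorphic_imp_injective_map[OF chart_homeomorphic] chart_subset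
  by (metis inf.absorb_iff2 topspace_subtopology)

lemma inv_chart_left: "c \<in> A \<Longrightarrow> p \<in> fst c \<Longrightarrow> inv_chart c (snd c p) = p"
  by (simp add: chart_inj)

lemma inv_chart_right: "z \<in> snd c ` fst c \<Longrightarrow> snd c (inv_chart c z) = z"
  by (rule f_inv_into_f)

lemma inv_chart_mem: "c \<in> A \<Longrightarrow> W \<subseteq> fst c \<Longrightarrow> z \<in> snd c ` W \<Longrightarrow> inv_chart c z \<in> W"
  using inv_chart_left by auto

lemma chart_exists: "p \<in> topspace M \<Longrightarrow> \<exists>c\<in>A. p \<in> fst c"
  using atlas_covers by blast

lemma open_chart_image:
  assumes c: "c \<in> A" and W: "openin M W"
  shows "open (snd c ` (fst c \<inter> W))"
proof -
  have "openin (subtopology M (fst c)) (fst c \<inter> W)"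
    using W by (auto simp: openin_subtopology Int_commute)
  then have "openin (top_of_set (snd c ` fst c)) (snd c ` (fst c \<inter> W))"
    using homeomorphic_imp_open_map[OF chart_homeomorphic[OF c]] by (simp add: open_map_def)
  then show ?thesis using openin_open_trans chart_image[OF c] by blast
qed

lemma open_chart_image': "c \<in> A \<Longrightarrow> openin M W \<Longrightarrow> W \<subseteq> fst c \<Longrightarrow> open (snd c ` W)"
  using open_chart_image[of c W] by (simp add: Int_absorb1)

lemma openin_chart_preimage:
  assumes c: "c \<in> A" and T: "open T"
  shows "openin M {p \<in> fst c. snd c p \<in> T}"
proof -
  have "continuous_map (subtopology M (fst c)) (top_of_set (snd c ` fst c)) (snd c)"
    by (rule homeomorphic_imp_continuous_map[OF chart_homeomorphic[OF c]])
  then have "continuous_map (subtopology M (fst c)) euclidean (snd c)"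
    by (rule continuous_map_into_fulltopology)
  then have "openin (subtopology M (fst c)) {p \<in> topspace (subtopology M (fst c)). snd c p \<in> T}"
    using T by (intro openin_continuous_map_preimage) auto
  moreover have "{p \<in> topspace (subtopology M (fst c)). snd c p \<in> T} = {p \<in> fst c. snd c p \<in> T}"
    using chart_subset[OF c] by auto
  ultimately show ?thesis
    using openin_open_subtopology[OF chart_domain[OF c]] by auto
qed

lemma transition_smooth:
  assumes "c \<in> A" "d \<in> A"
  shows "smooth_on (snd c ` (fst c \<inter> fst d)) (\<lambda>z. snd d (inv_chart c z))"
  using assms by (intro smooth_on_vec open_chart_image chart_domain holomorphic_fun_smooth transition_holomorphic)

lemma smooth_funD: "smooth_fun M A W f \<Longrightarrow> c \<in> A \<Longrightarrow> smooth_on (snd c ` (fst c \<inter> W)) (\<lambda>z. f (inv_chart c z))"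
  by (simp add: smooth_fun_def)

lemma smooth_funD': "smooth_fun M A W f \<Longrightarrow> c \<in> A \<Longrightarrow> W \<subseteq> fst c \<Longrightarrow> smooth_on (snd c ` W) (\<lambda>z. f (inv_chart c z))"
  using smooth_funD[of W f c] by (simp add: Int_absorb1)

lemma smooth_fun_openin: "smooth_fun M A W f \<Longrightarrow> openin M W"
  by (simp add: smooth_fun_def)

lemma smooth_fun_cong:
  assumes "\<And>p. p \<in> W \<Longrightarrow> f p = g p"
  shows "smooth_fun M A W f \<longleftrightarrow> smooth_fun M A W g"
proof -
  have "smooth_on (snd c ` (fst c \<inter> W)) (\<lambda>z. f (inv_chart c z)) \<longleftrightarrow>
      smooth_on (snd c ` (fst c \<inter> W)) (\<lambda>z. g (inv_chart c z))" if "c \<in> A" for c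
    using inv_chart_mem[OF that, of "fst c \<inter> W"] assms by (intro smooth_on_cong) auto
  then show ?thesis unfolding smooth_fun_def by blast
qed

lemma smooth_fun_subset:
  assumes f: "smooth_fun M A W f" and V: "openin M V" "V \<subseteq> W"
  shows "smooth_fun M A V f"
  unfolding smooth_fun_def
proof (intro conjI ballI V(1))
  fix c assume c: "c \<in> A"
  show "smooth_on (snd c ` (fst c \<inter> V)) (\<lambda>z. f (inv_chart c z))"
    by (rule smooth_on_subset[OF smooth_funD[OF f c] open_chart_image[OF c V(1)]]) (use V in auto)
qed

text \<open>One chart containing \<open>W\<close> decides smoothness, since in any other chart the
  function is composed with a smooth transition map.\<close>

lemma smooth_fun_chartI:
  assumes c: "c \<in> A" and W: "openin M W" "W \<subseteq> fst c" and f: "smooth_on (snd c ` W) (\<lambda>z. f (inv_chart c z))"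
  shows "smooth_fun M A W f"
  unfolding smooth_fun_def
proof (intro conjI ballI W(1))
  fix d assume d: "d \<in> A"
  have mem: "inv_chart d z \<in> fst c \<and> inv_chart d z \<in> W" if "z \<in> snd d ` (fst d \<inter> W)" for z
    using inv_chart_mem[OF d _ that] W(2) by auto
  have "smooth_on (snd d ` (fst d \<inter> W)) (\<lambda>z. f (inv_chart c (snd c (inv_chart d z))))"
  proof (rule smooth_on_compose[OF f])
    show "smooth_on (snd d ` (fst d \<inter> W)) (\<lambda>z. snd c (inv_chart d z))"
      by (rule smooth_on_subset[OF transition_smooth[OF d c] open_chart_image[OF d W(1)]]) (use W in auto)
    show "snd c (inv_chart d z) \<in> snd c ` W" if "z \<in> snd d ` (fst d \<inter> W)" for z
      using mem[OF that] by auto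
  qed
  then show "smooth_on (snd d ` (fst d \<inter> W)) (\<lambda>z. f (inv_chart d z))"
    by (rule smooth_on_cong[THEN iffD1, rotated]) (use mem inv_chart_left[OF c] in auto)
qed

lemma smooth_fun_const: "openin M W \<Longrightarrow> smooth_fun M A W (\<lambda>p. k)"
  by (simp add: smooth_fun_def smooth_on_const open_chart_image)

lemma smooth_fun_add: "smooth_fun M A W f \<Longrightarrow> smooth_fun M A W g \<Longrightarrow> smooth_fun M A W (\<lambda>p. f p + g p)"
  by (simp add: smooth_fun_def smooth_on_add)

lemma smooth_fun_diff: "smooth_fun M A W f \<Longrightarrow> smooth_fun M A W g \<Longrightarrow> smooth_fun M A W (\<lambda>p. f p - g p)"
  by (simp add: smooth_fun_def smooth_on_diff)

lemma smooth_fun_mult: "smooth_fun M A W f \<Longrightarrow> smooth_fun M A W g \<Longrightarrow> smooth_fun M A W (\<lambda>p. f p * g p)"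
  by (simp add: smooth_fun_def smooth_on_mult)

lemma smooth_fun_sum:
  "openin M W \<Longrightarrow> (\<And>i. i \<in> I \<Longrightarrow> smooth_fun M A W (f i)) \<Longrightarrow> smooth_fun M A W (\<lambda>p. \<Sum>i\<in>I. f i p)"
  by (simp add: smooth_fun_def smooth_on_sum open_chart_image)

lemma smooth_nearI: "smooth_fun M A W f \<Longrightarrow> p \<in> W \<Longrightarrow> smooth_near M A p f"
  unfolding smooth_near_def by blast

lemma smooth_near_two:
  assumes "smooth_near M A p f" "smooth_near M A p g"
  obtains W where "p \<in> W" "smooth_fun M A W f" "smooth_fun M A W g"
proof -
  obtain V where V: "p \<in> V" "smooth_fun M A V f" using assms(1) unfolding smooth_near_def by blast
  obtain W where W: "p \<in> W" "smooth_fun M A W g" using assms(2) unfolding smooth_near_def by blast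
  have o: "openin M (V \<inter> W)" by (intro openin_Int smooth_fun_openin[OF V(2)] smooth_fun_openin[OF W(2)])
  show thesis
    by (rule that[OF _ smooth_fun_subset[OF V(2) o] smooth_fun_subset[OF W(2) o]]) (use V W in auto)
qed

lemma smooth_near_cong:
  assumes "openin M W" "p \<in> W" "\<And>q. q \<in> W \<Longrightarrow> f q = g q" "smooth_near M A p f"
  shows "smooth_near M A p g"
proof -
  obtain V where V: "p \<in> V" "smooth_fun M A V f" using assms(4) unfolding smooth_near_def by blast
  have "smooth_fun M A (V \<inter> W) f"
    by (rule smooth_fun_subset[OF V(2) openin_Int[OF smooth_fun_openin[OF V(2)] assms(1)] Int_lower1])
  then have "smooth_fun M A (V \<inter> W) g"
    using smooth_fun_cong[of "V \<inter> W" f g] assms(3) by auto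
  then show ?thesis using V assms(2) by (intro smooth_nearI[of "V \<inter> W"]) auto
qed

lemma smooth_near_has_derivative:
  assumes "smooth_near M A p f" "c \<in> A" "p \<in> fst c"
  shows "((\<lambda>z. f (inv_chart c z)) has_derivative frechet_derivative (\<lambda>z. f (inv_chart c z)) (at (snd c p))) (at (snd c p))"
proof -
  obtain W where W: "p \<in> W" "smooth_fun M A W f" using assms(1) unfolding smooth_near_def by blast
  then show ?thesis
    using assms(2,3) by (intro smooth_on_has_derivative[OF smooth_funD]) auto
qed

section \<open>Tangent vectors and the complex structure in a chart\<close>

lemma chart_vec_smooth:
  "smooth_near M A p f \<Longrightarrow> chart_vec M A c p a f = frechet_derivative (\<lambda>z. f (inv_chart c z)) (at (snd c p)) a"
  by (simp add: chart_vec_def)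

lemma chart_vec_not_smooth: "\<not> smooth_near M A p f \<Longrightarrow> chart_vec M A c p a f = 0"
  by (simp add: chart_vec_def)

lemma chart_vec_linear:
  assumes "c \<in> A" "p \<in> fst c"
  shows "linear (\<lambda>a. chart_vec M A c p a f)"
proof (cases "smooth_near M A p f")
  case True
  then show ?thesis
    using has_derivative_linear[OF smooth_near_has_derivative[OF True assms]] by (simp add: chart_vec_smooth)
next
  case False
  then show ?thesis by (simp add: chart_vec_not_smooth linear_zero)
qed

text \<open>Germ-locality also covers the default value: \<open>f\<close> is smooth near
  \<open>p\<close> exactly if \<open>g\<close> is, so both values are derivatives or both are
  0.\<close>

lemma chart_vec_cong:
  assumes c: "c \<in> A" "p \<in> fst c" and W: "openin M W" "p \<in> W" "\<And>q. q \<in> W \<Longrightarrow> f q = g q"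
  shows "chart_vec M A c p a f = chart_vec M A c p a g"
proof (cases "smooth_near M A p f")
  case True
  have g: "smooth_near M A p g" by (rule smooth_near_cong[OF W True])
  have "((\<lambda>z. g (inv_chart c z)) has_derivative frechet_derivative (\<lambda>z. f (inv_chart c z)) (at (snd c p))) (at (snd c p))"
  proof (rule has_derivative_transform_within_open[OF smooth_near_has_derivative[OF True c]])
    show "open (snd c ` (fst c \<inter> W))" by (rule open_chart_image[OF c(1) W(1)])
    show "f (inv_chart c z) = g (inv_chart c z)" if "z \<in> snd c ` (fst c \<inter> W)" for z
      using inv_chart_mem[OF c(1) _ that] W(3) by auto
  qed (use c W in auto)
  from frechet_derivative_at[OF this] show ?thesis by (simp add: chart_vec_smooth True g)
next
  case False
  then have "\<not> smooth_near M A p g" using smooth_near_cong[OF W(1,2), of g f] W(3) by auto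
  then show ?thesis using False by (simp add: chart_vec_not_smooth)
qed

lemma chart_vec_const: "c \<in> A \<Longrightarrow> p \<in> fst c \<Longrightarrow> chart_vec M A c p a (\<lambda>_. k) = 0"
  by (simp add: chart_vec_def frechet_derivative_const)

lemma chart_vec_add:
  assumes c: "c \<in> A" "p \<in> fst c" and fg: "smooth_near M A p f" "smooth_near M A p g"
  shows "chart_vec M A c p a (\<lambda>q. f q + g q) = chart_vec M A c p a f + chart_vec M A c p a g"
proof -
  obtain W where W: "p \<in> W" "smooth_fun M A W f" "smooth_fun M A W g" using smooth_near_two[OF fg] .
  have s: "smooth_near M A p (\<lambda>q. f q + g q)" by (rule smooth_nearI[OF smooth_fun_add[OF W(2,3)] W(1)])
  show ?thesis
    using fun_cong[OF frechet_derivative_at[OF has_derivative_add[OF smooth_near_has_derivative[OF fg(1) c] smooth_near_has_derivative[OF fg(2) c]]], of a]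
    by (simp add: chart_vec_smooth s fg)
qed

lemma chart_vec_mult:
  assumes c: "c \<in> A" "p \<in> fst c" and fg: "smooth_near M A p f" "smooth_near M A p g"
  shows "chart_vec M A c p a (\<lambda>q. f q * g q) = f p * chart_vec M A c p a g + chart_vec M A c p a f * g p"
proof -
  obtain W where W: "p \<in> W" "smooth_fun M A W f" "smooth_fun M A W g" using smooth_near_two[OF fg] .
  have s: "smooth_near M A p (\<lambda>q. f q * g q)" by (rule smooth_nearI[OF smooth_fun_mult[OF W(2,3)] W(1)])
  show ?thesis
    using fun_cong[OF frechet_derivative_at[OF has_derivative_mult[OF smooth_near_has_derivative[OF fg(1) c] smooth_near_has_derivative[OF fg(2) c]]], of a]
    by (simp add: chart_vec_smooth s fg inv_chart_left[OF c])
qed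

lemma chart_vec_transition:
  assumes c: "c \<in> A" "p \<in> fst c" and d: "d \<in> A" "p \<in> fst d"
  shows "chart_vec M A c p a = chart_vec M A d p (\<chi> i. frechet_derivative (\<lambda>z. snd d (inv_chart c z) $ i) (at (snd c p)) a)"
proof
  fix f
  let ?T = "\<lambda>z. snd d (inv_chart c z)"
  let ?T' = "\<lambda>a. \<chi> i. frechet_derivative (\<lambda>z. ?T z $ i) (at (snd c p)) a"
  show "chart_vec M A c p a f = chart_vec M A d p (?T' a) f"
  proof (cases "smooth_near M A p f")
    case True
    have "(?T has_derivative ?T') (at (snd c p))"
      by (rule has_derivative_vecI) (use c d in \<open>auto intro!: holomorphic_fun_has_derivative[OF transition_holomorphic]\<close>)
    moreover have "?T (snd c p) = snd d p" using inv_chart_left[OF c] by simp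
    ultimately have "((\<lambda>z. f (inv_chart d (?T z))) has_derivative
        (\<lambda>a. frechet_derivative (\<lambda>z. f (inv_chart d z)) (at (snd d p)) (?T' a))) (at (snd c p))"
      using has_derivative_compose[of ?T ?T' "snd c p" UNIV] smooth_near_has_derivative[OF True d] by simp
    then have "((\<lambda>z. f (inv_chart c z)) has_derivative
        (\<lambda>a. frechet_derivative (\<lambda>z. f (inv_chart d z)) (at (snd d p)) (?T' a))) (at (snd c p))"
    proof (rule has_derivative_transform_within_open)
      show "open (snd c ` (fst c \<inter> fst d))" by (rule open_chart_image[OF c(1) chart_domain[OF d(1)]])
      show "f (inv_chart d (?T z)) = f (inv_chart c z)" if "z \<in> snd c ` (fst c \<inter> fst d)" for z
        using inv_chart_mem[OF c(1) _ that] inv_chart_left[OF d(1)] by auto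
    qed (use c d in auto)
    from fun_cong[OF frechet_derivative_at[OF this]] show ?thesis by (simp add: chart_vec_smooth True)
  qed (simp add: chart_vec_not_smooth)
qed

lemma tangent_space_chart:
  assumes "c \<in> A" "p \<in> fst c"
  shows "tangent_space M A p = range (chart_vec M A c p)"
  unfolding tangent_space_def using assms chart_vec_transition[OF _ _ assms] by blast

lemma smooth_fun_chart:
  assumes c: "c \<in> A" and h: "smooth_on T h" "snd c ` fst c \<subseteq> T"
  shows "smooth_fun M A (fst c) (\<lambda>p. h (snd c p))"
proof (rule smooth_fun_chartI[OF c chart_domain[OF c] order_refl])
  have "smooth_on (snd c ` fst c) h" by (rule smooth_on_subset[OF h(1) chart_image[OF c] h(2)])
  then show "smooth_on (snd c ` fst c) (\<lambda>z. h (snd c (inv_chart c z)))"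
    by (rule smooth_on_cong[THEN iffD1, rotated]) (simp add: inv_chart_right)
qed

lemma smooth_fun_chart_open:
  assumes c: "c \<in> A" and h: "smooth_on T h" and W: "openin M W" "W \<subseteq> fst c" "snd c ` W \<subseteq> T"
  shows "smooth_fun M A W (\<lambda>p. h (snd c p))"
proof (rule smooth_fun_chartI[OF c W(1,2)])
  have "smooth_on (snd c ` W) h" by (rule smooth_on_subset[OF h open_chart_image'[OF c W(1,2)] W(3)])
  then show "smooth_on (snd c ` W) (\<lambda>z. h (snd c (inv_chart c z)))"
    by (rule smooth_on_cong[THEN iffD1, rotated]) (use W(2) in \<open>auto simp: inv_chart_right\<close>)
qed

lemma chart_vec_chart:
  assumes c: "c \<in> A" "p \<in> fst c" and h: "smooth_on T h" "snd c p \<in> T"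
  shows "chart_vec M A c p a (\<lambda>p. h (snd c p)) = frechet_derivative h (at (snd c p)) a"
proof -
  let ?W = "{p \<in> fst c. snd c p \<in> T}"
  have s: "smooth_near M A p (\<lambda>p. h (snd c p))"
    by (rule smooth_nearI[OF smooth_fun_chart_open[OF c(1) h(1) openin_chart_preimage[OF c(1) smooth_on_open[OF h(1)]]]])
      (use c h in auto)
  have "((\<lambda>z. h (snd c (inv_chart c z))) has_derivative frechet_derivative h (at (snd c p))) (at (snd c p))"
    by (rule has_derivative_transform_within_open[OF smooth_on_has_derivative[OF h] chart_image[OF c(1)]])
      (use c in \<open>auto simp: inv_chart_right\<close>)
  from fun_cong[OF frechet_derivative_at[OF this]] show ?thesis by (simp add: chart_vec_smooth s)
qed

lemma smooth_coordinates:
  "smooth_on UNIV (\<lambda>z :: complex^'n. Re (z $ i))" "smooth_on UNIV (\<lambda>z :: complex^'n. Im (z $ i))"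
  by (intro smooth_on_linear[OF bounded_linear_Re] smooth_on_linear[OF bounded_linear_Im] smooth_on_component smooth_on_id open_UNIV)+

lemma smooth_fun_coordinates:
  assumes "c \<in> A"
  shows "smooth_fun M A (fst c) (\<lambda>p. Re (snd c p $ i))" "smooth_fun M A (fst c) (\<lambda>p. Im (snd c p $ i))"
  using smooth_fun_chart[OF assms smooth_coordinates(1)] smooth_fun_chart[OF assms smooth_coordinates(2)] by auto

lemma chart_comp_chart_vec:
  assumes "c \<in> A" "p \<in> fst c"
  shows "chart_comp c (chart_vec M A c p a) = a"
proof -
  have "((\<lambda>z :: complex^'n. Re (z $ i)) has_derivative (\<lambda>a. Re (a $ i))) (at x)"
    "((\<lambda>z :: complex^'n. Im (z $ i)) has_derivative (\<lambda>a. Im (a $ i))) (at x)" for x i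
    by (auto intro!: bounded_linear_imp_has_derivative bounded_linear_compose[OF bounded_linear_Re bounded_linear_vec_nth]
        bounded_linear_compose[OF bounded_linear_Im bounded_linear_vec_nth])
  from fun_cong[OF frechet_derivative_at[OF this(1)]] fun_cong[OF frechet_derivative_at[OF this(2)]]
  show ?thesis
    using chart_vec_chart[OF assms smooth_coordinates(1)] chart_vec_chart[OF assms smooth_coordinates(2)]
    by (simp add: chart_comp_def vec_eq_iff complex_eq_iff)
qed

lemma chart_vec_inject:
  "c \<in> A \<Longrightarrow> p \<in> fst c \<Longrightarrow> chart_vec M A c p a = chart_vec M A c p b \<longleftrightarrow> a = b"
  using chart_comp_chart_vec by metis

lemma chart_vec_chart_comp:
  assumes "c \<in> A" "p \<in> fst c" "v \<in> tangent_space M A p"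
  shows "chart_vec M A c p (chart_comp c v) = v"
  using assms tangent_space_chart[OF assms(1,2)] chart_comp_chart_vec[OF assms(1,2)] by auto

text \<open>The definite description is well defined because the derivatives of transition maps are
  complex linear and \<open>chart_vec\<close> is injective at \<open>p\<close>.\<close>

lemma complex_structure_chart_vec:
  assumes c: "c \<in> A" "p \<in> fst c"
  shows "complex_structure M A p (chart_vec M A c p a) = chart_vec M A c p (\<i> *s a)"
  unfolding complex_structure_def
proof (rule the_equality)
  show "\<exists>d b. d \<in> A \<and> p \<in> fst d \<and> chart_vec M A c p a = chart_vec M A d p b \<and>
      chart_vec M A c p (\<i> *s a) = chart_vec M A d p (\<i> *s b)"
    using c by blast
  fix w assume "\<exists>d b. d \<in> A \<and> p \<in> fst d \<and> chart_vec M A c p a = chart_vec M A d p b \<and> w = chart_vec M A d p (\<i> *s b)"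
  then obtain d b where d: "d \<in> A" "p \<in> fst d" and eq: "chart_vec M A c p a = chart_vec M A d p b"
    and w: "w = chart_vec M A d p (\<i> *s b)" by blast
  let ?T' = "\<lambda>a. \<chi> i. frechet_derivative (\<lambda>z. snd c (inv_chart d z) $ i) (at (snd d p)) a"
  have a: "a = ?T' b"
    using eq chart_vec_transition[OF d c, of b] chart_vec_inject[OF c] by simp
  have "?T' (\<i> *s b) = \<i> *s ?T' b"
    using holomorphic_fun_derivative_scale[OF transition_holomorphic[OF d(1) c(1)] imageI, of p] c d
    by (simp add: vec_eq_iff)
  then show "w = chart_vec M A c p (\<i> *s a)"
    using w chart_vec_transition[OF d c, of "\<i> *s b"] a by simp
qed

section \<open>Vector fields and brackets in a chart\<close>

lemma smooth_vfield_openin: "smooth_vfield M A W X \<Longrightarrow> openin M W"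
  by (simp add: smooth_vfield_def)

lemma smooth_vfield_tangent: "smooth_vfield M A W X \<Longrightarrow> p \<in> W \<Longrightarrow> X p \<in> tangent_space M A p"
  by (simp add: smooth_vfield_def)

lemma smooth_vfield_fun: "smooth_vfield M A W X \<Longrightarrow> V \<subseteq> W \<Longrightarrow> smooth_fun M A V f \<Longrightarrow> smooth_fun M A V (\<lambda>p. X p f)"
  by (simp add: smooth_vfield_def)

lemma smooth_vfield_subset: "smooth_vfield M A W X \<Longrightarrow> openin M V \<Longrightarrow> V \<subseteq> W \<Longrightarrow> smooth_vfield M A V X"
  unfolding smooth_vfield_def by blast

lemma smooth_vfield_comp:
  assumes X: "smooth_vfield M A W X" and c: "c \<in> A" and W: "W \<subseteq> fst c"
  shows "smooth_on (snd c ` W) (\<lambda>z. chart_comp c (X (inv_chart c z)))"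
proof (rule smooth_on_vec)
  have o: "openin M W" by (rule smooth_vfield_openin[OF X])
  show "open (snd c ` W)" by (rule open_chart_image'[OF c o W])
  fix i
  have "smooth_on (snd c ` W) (\<lambda>z. X (inv_chart c z) (\<lambda>p. Re (snd c p $ i)))"
    "smooth_on (snd c ` W) (\<lambda>z. X (inv_chart c z) (\<lambda>p. Im (snd c p $ i)))"
    by (intro smooth_funD'[OF _ c W] smooth_vfield_fun[OF X order_refl] smooth_fun_subset[OF _ o W] smooth_fun_coordinates c)+
  then have "smooth_on (snd c ` W) (\<lambda>z. of_real (X (inv_chart c z) (\<lambda>p. Re (snd c p $ i))) +
      \<i> * of_real (X (inv_chart c z) (\<lambda>p. Im (snd c p $ i))))"
    by (intro smooth_on_add smooth_on_linear[OF bounded_linear_of_real] smooth_on_linear[OF bounded_linear_mult_right])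
  then show "smooth_on (snd c ` W) (\<lambda>z. chart_comp c (X (inv_chart c z)) $ i)"
    by (simp add: chart_comp_def Complex_eq)
qed

lemma vfield_apply_chart:
  assumes c: "c \<in> A" "q \<in> fst c" and X: "X q \<in> tangent_space M A q" and f: "smooth_near M A q f"
  shows "X q f = frechet_derivative (\<lambda>z. f (inv_chart c z)) (at (snd c q)) (chart_comp c (X q))"
  using chart_vec_smooth[OF f, of c "chart_comp c (X q)"] chart_vec_chart_comp[OF c X] by simp

text \<open>In the chart \<open>X f\<close> is the sum of the components of \<open>X\<close> times
  partial derivatives of \<open>f\<close>, so smooth components make \<open>X\<close> preserve
  smoothness.\<close>

lemma smooth_vfield_chartI:
  assumes c: "c \<in> A" and W: "openin M W" "W \<subseteq> fst c" and X: "\<And>p. p \<in> W \<Longrightarrow> X p \<in> tangent_space M A p"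
    and smooth: "smooth_on (snd c ` W) (\<lambda>z. chart_comp c (X (inv_chart c z)))"
  shows "smooth_vfield M A W X"
  unfolding smooth_vfield_def
proof (intro conjI ballI allI impI W(1) X)
  fix V f assume V: "V \<subseteq> W \<and> smooth_fun M A V f"
  then have Vo: "openin M V" "V \<subseteq> fst c" using smooth_fun_openin W by auto
  let ?f = "\<lambda>z. f (inv_chart c z)" and ?X = "\<lambda>z. chart_comp c (X (inv_chart c z))"
  have sf: "smooth_on (snd c ` V) ?f" using smooth_funD'[of V f c] V c Vo by blast
  have oV: "open (snd c ` V)" by (rule smooth_on_open[OF sf])
  have sX: "smooth_on (snd c ` V) ?X" using smooth_on_subset[OF smooth oV] V by auto
  have "smooth_on (snd c ` V) (\<lambda>z. \<Sum>b\<in>Basis. (?X z \<bullet> b) *\<^sub>R frechet_derivative ?f (at z) b)"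
    by (intro smooth_on_sum smooth_on_scaleR smooth_on_linear[OF bounded_linear_inner_left] sX smooth_on_frechet_derivative sf oV)
  then have "smooth_on (snd c ` V) (\<lambda>z. X (inv_chart c z) f)"
  proof (rule smooth_on_cong[THEN iffD1, rotated])
    fix z assume z: "z \<in> snd c ` V"
    have q: "inv_chart c z \<in> V" by (rule inv_chart_mem[OF c Vo(2) z])
    have r: "snd c (inv_chart c z) = z" using z Vo by (intro inv_chart_right) auto
    have "X (inv_chart c z) f = frechet_derivative ?f (at z) (?X z)"
      using vfield_apply_chart[OF c, of "inv_chart c z" X f] q Vo V X smooth_nearI[of V f] r by auto
    also have "\<dots> = (\<Sum>b\<in>Basis. (?X z \<bullet> b) *\<^sub>R frechet_derivative ?f (at z) b)"
      by (rule linear_euclidean_expansion[OF has_derivative_linear[OF smooth_on_has_derivative[OF sf z]]])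
    finally show "(\<Sum>b\<in>Basis. (?X z \<bullet> b) *\<^sub>R frechet_derivative ?f (at z) b) = X (inv_chart c z) f" by simp
  qed
  then show "smooth_fun M A V (\<lambda>p. X p f)" by (rule smooth_fun_chartI[OF c Vo])
qed

lemma smooth_vfield_cong:
  assumes "\<And>p. p \<in> W \<Longrightarrow> X p = Y p"
  shows "smooth_vfield M A W X \<longleftrightarrow> smooth_vfield M A W Y"
proof -
  have "smooth_fun M A V (\<lambda>p. X p f) \<longleftrightarrow> smooth_fun M A V (\<lambda>p. Y p f)" if "V \<subseteq> W" for V f
    using assms that by (intro smooth_fun_cong) auto
  then show ?thesis unfolding smooth_vfield_def using assms by auto
qed

text \<open>The product rule for the derivative of \<open>f'\<close> applied to \<open>Y'\<close>,
  after expanding \<open>Y'\<close> over \<open>Basis\<close>. Symmetry of second derivatives moves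
  the direction \<open>u\<close> into the inner slot, where the bracket and the Christoffel symbols
  can use it.\<close>

lemma vfield_derivative_chart:
  assumes Y: "smooth_vfield M A W Y" and W: "p \<in> W" and c: "c \<in> A" "p \<in> fst c" and f: "smooth_near M A p f"
  defines "f' \<equiv> \<lambda>z. f (inv_chart c z)" and "Y' \<equiv> \<lambda>z. chart_comp c (Y (inv_chart c z))" and "x \<equiv> snd c p"
  shows "chart_vec M A c p u (\<lambda>q. Y q f) =
    frechet_derivative (\<lambda>z. frechet_derivative f' (at z) u) (at x) (Y' x) +
    frechet_derivative f' (at x) (frechet_derivative Y' (at x) u)"
    and "smooth_near M A p (\<lambda>q. Y q f)"
proof -
  obtain V0 where V0: "p \<in> V0" "smooth_fun M A V0 f" using f unfolding smooth_near_def by blast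
  define V where "V = V0 \<inter> W \<inter> fst c"
  have V: "openin M V" "p \<in> V" "V \<subseteq> fst c" "V \<subseteq> W"
    using V0 W c smooth_fun_openin[OF V0(2)] smooth_vfield_openin[OF Y] chart_domain[OF c(1)] by (auto simp: V_def)
  have sV: "smooth_fun M A V f" by (rule smooth_fun_subset[OF V0(2) V(1)]) (auto simp: V_def)
  have sYf: "smooth_fun M A V (\<lambda>q. Y q f)" by (rule smooth_vfield_fun[OF Y V(4) sV])
  then show near: "smooth_near M A p (\<lambda>q. Y q f)" using V(2) by (rule smooth_nearI)
  have sf: "smooth_on (snd c ` V) f'" unfolding f'_def by (rule smooth_funD'[OF sV c(1) V(3)])
  have sY: "smooth_on (snd c ` V) Y'" unfolding Y'_def
    by (rule smooth_vfield_comp[OF smooth_vfield_subset[OF Y V(1,4)] c(1) V(3)])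
  have x: "x \<in> snd c ` V" using V by (simp add: x_def)
  have lin: "linear (frechet_derivative f' (at z))" if "z \<in> snd c ` V" for z
    using smooth_on_has_derivative[OF sf that] by (rule has_derivative_linear)
  let ?H = "\<lambda>u v. frechet_derivative (\<lambda>z. frechet_derivative f' (at z) u) (at x) v"
  have H_lin: "linear (?H u)" for u
    using smooth_on_has_derivative[OF smooth_on_frechet_derivative[OF sf] x] by (rule has_derivative_linear)
  have "((\<lambda>z. \<Sum>b\<in>Basis. (Y' z \<bullet> b) *\<^sub>R frechet_derivative f' (at z) b) has_derivative
      (\<lambda>u. \<Sum>b\<in>Basis. (Y' x \<bullet> b) *\<^sub>R ?H b u + (frechet_derivative Y' (at x) u \<bullet> b) *\<^sub>R frechet_derivative f' (at x) b)) (at x)"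
    by (intro has_derivative_sum bounded_bilinear.FDERIV[OF bounded_bilinear_scaleR] has_derivative_inner_left
        smooth_on_has_derivative[OF sY x] smooth_on_has_derivative[OF smooth_on_frechet_derivative[OF sf] x])
  then have "((\<lambda>z. Y (inv_chart c z) f) has_derivative
      (\<lambda>u. \<Sum>b\<in>Basis. (Y' x \<bullet> b) *\<^sub>R ?H b u + (frechet_derivative Y' (at x) u \<bullet> b) *\<^sub>R frechet_derivative f' (at x) b)) (at x)"
  proof (rule has_derivative_transform_within_open[OF _ smooth_on_open[OF sf] x])
    fix z assume z: "z \<in> snd c ` V"
    have q: "inv_chart c z \<in> V" by (rule inv_chart_mem[OF c(1) V(3) z])
    have "snd c (inv_chart c z) = z" using z V by (intro inv_chart_right) auto
    then have "Y (inv_chart c z) f = frechet_derivative f' (at z) (Y' z)"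
      using vfield_apply_chart[OF c(1), of "inv_chart c z" Y f] q V smooth_vfield_tangent[OF Y] smooth_nearI[OF sV]
      by (auto simp: f'_def Y'_def)
    then show "(\<Sum>b\<in>Basis. (Y' z \<bullet> b) *\<^sub>R frechet_derivative f' (at z) b) = Y (inv_chart c z) f"
      by (simp only: linear_euclidean_expansion[OF lin[OF z], of "Y' z", symmetric])
  qed
  from fun_cong[OF frechet_derivative_at[OF this], of u]
  have "chart_vec M A c p u (\<lambda>q. Y q f) =
      (\<Sum>b\<in>Basis. (Y' x \<bullet> b) *\<^sub>R ?H b u) + (\<Sum>b\<in>Basis. (frechet_derivative Y' (at x) u \<bullet> b) *\<^sub>R frechet_derivative f' (at x) b)"
    by (simp add: chart_vec_smooth[OF near] x_def sum.distrib)
  also have "(\<Sum>b\<in>Basis. (Y' x \<bullet> b) *\<^sub>R ?H b u) = (\<Sum>b\<in>Basis. (Y' x \<bullet> b) *\<^sub>R ?H u b)"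
    by (simp only: smooth_on_second_derivative_symmetric[OF sf x, of _ u])
  also have "\<dots> = ?H u (Y' x)" by (rule linear_euclidean_expansion[OF H_lin, symmetric])
  also have "(\<Sum>b\<in>Basis. (frechet_derivative Y' (at x) u \<bullet> b) *\<^sub>R frechet_derivative f' (at x) b) =
      frechet_derivative f' (at x) (frechet_derivative Y' (at x) u)"
    by (rule linear_euclidean_expansion[OF lin[OF x], symmetric])
  finally show "chart_vec M A c p u (\<lambda>q. Y q f) = ?H u (Y' x) + frechet_derivative f' (at x) (frechet_derivative Y' (at x) u)" .
qed

text \<open>The second-order terms of the commutator cancel by symmetry. On functions that are not
  smooth near \<open>p\<close> both sides have the default value 0.\<close>

lemma lie_bracket_chart:
  assumes X: "smooth_vfield M A W X" and Y: "smooth_vfield M A W Y" and W: "p \<in> W" and c: "c \<in> A" "p \<in> fst c"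
  defines "X' \<equiv> \<lambda>z. chart_comp c (X (inv_chart c z))" and "Y' \<equiv> \<lambda>z. chart_comp c (Y (inv_chart c z))" and "x \<equiv> snd c p"
  shows "lie_bracket M A X Y p = chart_vec M A c p (frechet_derivative Y' (at x) (X' x) - frechet_derivative X' (at x) (Y' x))"
proof
  fix f
  show "lie_bracket M A X Y p f = chart_vec M A c p (frechet_derivative Y' (at x) (X' x) - frechet_derivative X' (at x) (Y' x)) f"
  proof (cases "smooth_near M A p f")
    case True
    obtain V where V: "p \<in> V" "smooth_fun M A V f" using True unfolding smooth_near_def by blast
    let ?f = "\<lambda>z. f (inv_chart c z)"
    have x: "x \<in> snd c ` (fst c \<inter> V)" using V c by (simp add: x_def)
    have sf: "smooth_on (snd c ` (fst c \<inter> V)) ?f" by (rule smooth_funD[OF V(2) c(1)])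
    have lin: "linear (frechet_derivative ?f (at x))"
      using smooth_on_has_derivative[OF sf x] by (rule has_derivative_linear)
    have Xp: "X p = chart_vec M A c p (X' x)" and Yp: "Y p = chart_vec M A c p (Y' x)"
      using chart_vec_chart_comp[OF c] smooth_vfield_tangent[OF X W] smooth_vfield_tangent[OF Y W]
      by (simp_all add: X'_def Y'_def x_def inv_chart_left[OF c])
    have "X p (\<lambda>q. Y q f) = frechet_derivative (\<lambda>z. frechet_derivative ?f (at z) (X' x)) (at x) (Y' x) +
        frechet_derivative ?f (at x) (frechet_derivative Y' (at x) (X' x))"
      unfolding Xp using vfield_derivative_chart(1)[OF Y W c True] by (simp add: Y'_def x_def)
    moreover have "Y p (\<lambda>q. X q f) = frechet_derivative (\<lambda>z. frechet_derivative ?f (at z) (Y' x)) (at x) (X' x) +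
        frechet_derivative ?f (at x) (frechet_derivative X' (at x) (Y' x))"
      unfolding Yp using vfield_derivative_chart(1)[OF X W c True] by (simp add: X'_def x_def)
    moreover note smooth_on_second_derivative_symmetric[OF sf x, of "X' x" "Y' x"]
    ultimately show ?thesis
      using True by (simp add: lie_bracket_def chart_vec_smooth linear_diff[OF lin] flip: x_def)
  qed (simp add: lie_bracket_def chart_vec_not_smooth)
qed

lemma lie_bracket_tangent:
  assumes "smooth_vfield M A W X" "smooth_vfield M A W Y" "p \<in> W"
  shows "lie_bracket M A X Y p \<in> tangent_space M A p"
proof -
  obtain c where c: "c \<in> A" "p \<in> fst c"
    using chart_exists assms openin_subset[OF smooth_vfield_openin] by blast
  show ?thesis unfolding lie_bracket_chart[OF assms c] tangent_space_chart[OF c] by blast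
qed

section \<open>Derivation rules for tangent vectors\<close>

lemma tangent_space_combination:
  assumes "p \<in> topspace M" "u \<in> tangent_space M A p" "v \<in> tangent_space M A p"
  shows "(\<lambda>f. r * u f + s * v f) \<in> tangent_space M A p"
proof -
  obtain c where c: "c \<in> A" "p \<in> fst c" using chart_exists[OF assms(1)] by blast
  obtain a b where ab: "u = chart_vec M A c p a" "v = chart_vec M A c p b"
    using assms unfolding tangent_space_chart[OF c] by blast
  have "(\<lambda>f. r * u f + s * v f) = chart_vec M A c p (r *\<^sub>R a + s *\<^sub>R b)"
    by (rule ext) (simp add: ab linear_add[OF chart_vec_linear[OF c]] linear_cmul[OF chart_vec_linear[OF c]])
  then show ?thesis unfolding tangent_space_chart[OF c] by blast
qed

lemma tangent_vec_cong:
  assumes "v \<in> tangent_space M A p" "openin M W" "p \<in> W" "\<And>q. q \<in> W \<Longrightarrow> f q = g q"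
  shows "v f = v g"
proof -
  obtain c a where "c \<in> A" "p \<in> fst c" "v = chart_vec M A c p a" using assms(1) unfolding tangent_space_def by blast
  then show ?thesis using chart_vec_cong[OF _ _ assms(2-4)] by simp
qed

lemma tangent_vec_add:
  assumes "v \<in> tangent_space M A p" "smooth_near M A p f" "smooth_near M A p g"
  shows "v (\<lambda>q. f q + g q) = v f + v g"
proof -
  obtain c a where c: "c \<in> A" "p \<in> fst c" and v: "v = chart_vec M A c p a" using assms(1) unfolding tangent_space_def by blast
  show ?thesis unfolding v by (rule chart_vec_add[OF c assms(2,3)])
qed

lemma tangent_vec_mult:
  assumes "v \<in> tangent_space M A p" "smooth_near M A p f" "smooth_near M A p g"
  shows "v (\<lambda>q. f q * g q) = f p * v g + v f * g p"
proof -
  obtain c a where c: "c \<in> A" "p \<in> fst c" and v: "v = chart_vec M A c p a" using assms(1) unfolding tangent_space_def by blast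
  show ?thesis unfolding v by (rule chart_vec_mult[OF c assms(2,3)])
qed

lemma tangent_vec_const:
  assumes "v \<in> tangent_space M A p"
  shows "v (\<lambda>_. k) = 0"
proof -
  obtain c a where c: "c \<in> A" "p \<in> fst c" and v: "v = chart_vec M A c p a" using assms(1) unfolding tangent_space_def by blast
  show ?thesis unfolding v by (rule chart_vec_const[OF c])
qed

lemma smooth_near_const: "p \<in> topspace M \<Longrightarrow> smooth_near M A p (\<lambda>_. k)"
  by (rule smooth_nearI[OF smooth_fun_const[OF openin_topspace]])

lemma smooth_near_add: "smooth_near M A p f \<Longrightarrow> smooth_near M A p g \<Longrightarrow> smooth_near M A p (\<lambda>q. f q + g q)"
  by (erule (1) smooth_near_two) (rule smooth_nearI[OF smooth_fun_add])

lemma smooth_near_mult: "smooth_near M A p f \<Longrightarrow> smooth_near M A p g \<Longrightarrow> smooth_near M A p (\<lambda>q. f q * g q)"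
  by (erule (1) smooth_near_two) (rule smooth_nearI[OF smooth_fun_mult])

lemma smooth_near_topspace: "smooth_near M A p f \<Longrightarrow> p \<in> topspace M"
  unfolding smooth_near_def using smooth_fun_openin openin_subset by blast

lemma tangent_vec_cmul:
  assumes "v \<in> tangent_space M A p" "smooth_near M A p f"
  shows "v (\<lambda>q. k * f q) = k * v f"
  using tangent_vec_mult[OF assms(1) smooth_near_const[OF smooth_near_topspace[OF assms(2)], of k] assms(2)]
    tangent_vec_const[OF assms(1), of k] by simp

lemma tangent_vec_diff:
  assumes "v \<in> tangent_space M A p" "smooth_near M A p f" "smooth_near M A p g"
  shows "v (\<lambda>q. f q - g q) = v f - v g"
proof -
  have "smooth_near M A p (\<lambda>q. (-1) * g q)"
    using assms by (intro smooth_near_mult smooth_near_const smooth_near_topspace)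
  then show ?thesis
    using tangent_vec_add[OF assms(1,2), of "\<lambda>q. (-1) * g q"] tangent_vec_cmul[OF assms(1,3), of "-1"] by simp
qed

lemma tangent_vec_sum:
  assumes "v \<in> tangent_space M A p" "p \<in> topspace M" "\<And>i. i \<in> I \<Longrightarrow> smooth_near M A p (f i)"
  shows "v (\<lambda>q. \<Sum>i\<in>I. f i q) = (\<Sum>i\<in>I. v (f i))"
proof (cases "finite I")
  case True
  then have "v (\<lambda>q. \<Sum>i\<in>I. f i q) = (\<Sum>i\<in>I. v (f i)) \<and> smooth_near M A p (\<lambda>q. \<Sum>i\<in>I. f i q)"
    using assms(3)
  proof (induction I rule: finite_induct)
    case empty
    then show ?case using tangent_vec_const[OF assms(1)] smooth_near_const[OF assms(2)] by simp
  next
    case (insert i I)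
    then have IH: "v (\<lambda>q. \<Sum>i\<in>I. f i q) = (\<Sum>i\<in>I. v (f i))" "smooth_near M A p (\<lambda>q. \<Sum>i\<in>I. f i q)"
      and i: "smooth_near M A p (f i)" by auto
    show ?case
      using insert(1,2) tangent_vec_add[OF assms(1) i IH(2)] smooth_near_add[OF i IH(2)] IH(1) by simp
  qed
  then show ?thesis by blast
qed (simp add: tangent_vec_const[OF assms(1)])

lemma vfield_apply_near:
  assumes X: "smooth_vfield M A W X" and p: "p \<in> W" and f: "smooth_near M A p f"
  shows "smooth_near M A p (\<lambda>q. X q f)"
proof -
  obtain c where "c \<in> A" "p \<in> fst c"
    using chart_exists[OF smooth_near_topspace[OF f]] by blast
  then show ?thesis by (rule vfield_derivative_chart(2)[OF X p _ _ f])
qed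

end

section \<open>The special Kaehler structure of a potential\<close>

lemma second_countable_euclidean: "second_countable (euclidean :: 'a::second_countable_topology topology)"
proof -
  obtain B :: "'a set set" where B: "countable B" "topological_basis B" using ex_countable_basis by blast
  then show ?thesis
    unfolding second_countable_def using topological_basis_open[OF B(2)] topological_basisE[OF B(2)]
    by (intro exI[of _ B]) (metis open_openin)
qed

lemma complex_manifold_std:
  fixes U :: "(complex^'n) set"
  assumes U: "open U"
  shows "complex_manifold (top_of_set U) (std_atlas U)"
proof
  show "Hausdorff_space (top_of_set U)" by (simp add: Hausdorff_space_subtopology Hausdorff_space_euclidean)
  show "second_countable (top_of_set U)"
    by (rule second_countable_subtopology[OF second_countable_euclidean])
  fix c :: "(complex^'n, 'n) chart" assume c: "c \<in> std_atlas U"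
  then have c_eq: "c = (U, \<lambda>z. z)" by (simp add: std_atlas_def)
  show "openin (top_of_set U) (fst c)" "open (snd c ` fst c)"
    using U by (simp_all add: c_eq)
  show "homeomorphic_map (subtopology (top_of_set U) (fst c)) (top_of_set (snd c ` fst c)) (snd c)"
    using homeomorphic_map_id[of "top_of_set U" "top_of_set U"] by (simp add: c_eq id_def subtopology_subtopology)
  fix d :: "(complex^'n, 'n) chart" and i assume d: "d \<in> std_atlas U"
  then have d_eq: "d = (U, \<lambda>z. z)" by (simp add: std_atlas_def)
  have "holomorphic_fun U (\<lambda>z. inv_into U (\<lambda>z. z) z $ i)"
    by (rule holomorphic_fun_cong[THEN iffD1, OF _ holomorphic_fun_component[OF U, of i]])
      (simp add: f_inv_into_f[of _ "\<lambda>z. z", simplified])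
  then show "holomorphic_fun (snd c ` (fst c \<inter> fst d)) (\<lambda>z. snd d (inv_chart c z) $ i)"
    by (simp add: c_eq d_eq)
next
  show "(\<Union>c\<in>std_atlas U. fst c) = topspace (top_of_set U)" by (simp add: std_atlas_def)
qed

lemma inv_into_identity: "z \<in> U \<Longrightarrow> inv_into U (\<lambda>z. z) z = z"
  using f_inv_into_f[of z "\<lambda>z. z" U] by simp

locale nondegenerate_potential =
  fixes U :: "(complex^'n::finite) set" and F :: "complex^'n \<Rightarrow> complex"
  assumes nondegenerate: "nondegenerate_holomorphic U F"
begin

lemma F_holomorphic: "holomorphic_fun U F"
  using nondegenerate by (simp add: nondegenerate_holomorphic_def)

lemma U_open: "open U"
  using F_holomorphic by (rule holomorphic_fun_open)

end

sublocale nondegenerate_potential \<subseteq> complex_manifold "top_of_set U" "std_atlas U"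
  by (rule complex_manifold_std[OF U_open])

context nondegenerate_potential
begin

abbreviation "MU \<equiv> top_of_set U"
abbreviation "AU \<equiv> std_atlas U"
abbreviation "id_chart \<equiv> (U, \<lambda>z :: complex^'n. z)"

text \<open>The Hessian of \<open>F\<close> acting on a vector, introduced as the differential of
  the momenta \<open>cpartial i F\<close>, so that \<open>(a, hess p a)\<close> is the differential
  of the immersion.\<close>

definition hess :: "complex^'n \<Rightarrow> complex^'n \<Rightarrow> complex^'n" where
  "hess p a = (\<chi> i. frechet_derivative (cpartial i F) (at p) a)"

definition affine_coordinates :: "(complex^'n \<Rightarrow> real) set" where
  "affine_coordinates = range (\<lambda>i p. Re (p $ i)) \<union> range (\<lambda>i p. Re (cpartial i F p))"

lemma id_chart: "id_chart \<in> AU"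
  by (simp add: std_atlas_def)

lemma inv_id_chart: "z \<in> U \<Longrightarrow> inv_chart id_chart z = z"
  by (simp add: inv_into_identity)

lemma openin_MU: "openin MU W \<longleftrightarrow> open W \<and> W \<subseteq> U"
  using openin_open_eq[OF U_open] by blast

lemma tangent_space_U: "p \<in> U \<Longrightarrow> tangent_space MU AU p = range (chart_vec MU AU id_chart p)"
  using tangent_space_chart[OF id_chart] by simp

lemma chart_vec_U:
  assumes "p \<in> U" "smooth_on U h"
  shows "chart_vec MU AU id_chart p a h = frechet_derivative h (at p) a"
  using chart_vec_chart[OF id_chart _ assms(2)] assms(1) by simp

lemma smooth_fun_U: "smooth_on U h \<Longrightarrow> smooth_fun MU AU U h"
  using smooth_fun_chart[OF id_chart, of U h] by simp

lemma smooth_fun_smooth_on: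
  assumes "smooth_fun MU AU W f"
  shows "smooth_on W f"
proof -
  have W: "W \<subseteq> U" using smooth_fun_openin[OF assms] openin_MU by blast
  have "smooth_on W (\<lambda>z. f (inv_chart id_chart z))" using smooth_funD'[OF assms id_chart] W by simp
  then show ?thesis by (rule smooth_on_cong[THEN iffD1, rotated]) (use W inv_id_chart in auto)
qed

section \<open>Derivatives of the coordinates and the Hessian\<close>

lemma w_holomorphic: "holomorphic_fun U (cpartial i F)"
  by (rule holomorphic_fun_cpartial[OF F_holomorphic])

lemma z_holomorphic: "holomorphic_fun U (\<lambda>z. z $ i)"
  by (rule holomorphic_fun_component[OF U_open])

lemma chart_vec_holomorphic:
  assumes "p \<in> U" and f: "holomorphic_fun U f"
  shows "chart_vec MU AU id_chart p a (\<lambda>z. Re (f z)) = Re (frechet_derivative f (at p) a)"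
    "chart_vec MU AU id_chart p a (\<lambda>z. Im (f z)) = Im (frechet_derivative f (at p) a)"
proof -
  note D = holomorphic_fun_has_derivative[OF f assms(1)]
  show "chart_vec MU AU id_chart p a (\<lambda>z. Re (f z)) = Re (frechet_derivative f (at p) a)"
    using chart_vec_U[OF assms(1) smooth_on_linear[OF bounded_linear_Re holomorphic_fun_smooth[OF f]]]
      fun_cong[OF frechet_derivative_at[OF bounded_linear.has_derivative[OF bounded_linear_Re D]], of a] by simp
  show "chart_vec MU AU id_chart p a (\<lambda>z. Im (f z)) = Im (frechet_derivative f (at p) a)"
    using chart_vec_U[OF assms(1) smooth_on_linear[OF bounded_linear_Im holomorphic_fun_smooth[OF f]]]
      fun_cong[OF frechet_derivative_at[OF bounded_linear.has_derivative[OF bounded_linear_Im D]], of a] by simp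
qed

lemma frechet_derivative_component: "frechet_derivative (\<lambda>z :: complex^'n. z $ i) (at p) a = a $ i"
  using fun_cong[OF frechet_derivative_at[OF bounded_linear_imp_has_derivative[OF bounded_linear_vec_nth]], of a] by simp

lemma chart_vec_coordinates:
  assumes "p \<in> U"
  shows "chart_vec MU AU id_chart p a (\<lambda>z. Re (z $ i)) = Re (a $ i)"
    "chart_vec MU AU id_chart p a (\<lambda>z. Im (z $ i)) = Im (a $ i)"
    "chart_vec MU AU id_chart p a (\<lambda>z. Re (cpartial i F z)) = Re (hess p a $ i)"
    "chart_vec MU AU id_chart p a (\<lambda>z. Im (cpartial i F z)) = Im (hess p a $ i)"
  using chart_vec_holomorphic[OF assms z_holomorphic] chart_vec_holomorphic[OF assms w_holomorphic]
  by (simp_all add: frechet_derivative_component hess_def)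

lemma hess_sum: "p \<in> U \<Longrightarrow> hess p a $ i = (\<Sum>j\<in>UNIV. a $ j * cpartial j (cpartial i F) p)"
  by (simp add: hess_def holomorphic_fun_derivative_cpartial(2)[OF w_holomorphic])

lemma hess_smult: "p \<in> U \<Longrightarrow> hess p (k *s a) = k *s hess p a"
  by (simp add: hess_def vec_eq_iff holomorphic_fun_derivative_scale[OF w_holomorphic])

lemma hess_linear: "p \<in> U \<Longrightarrow> linear (hess p)"
  by (rule linearI) (simp_all add: vec_eq_iff hess_sum sum.distrib algebra_simps scaleR_sum_right)

lemma hess_symmetric: "p \<in> U \<Longrightarrow> (\<Sum>i\<in>UNIV. a $ i * hess p b $ i) = (\<Sum>i\<in>UNIV. hess p a $ i * b $ i)"
proof -
  assume p: "p \<in> U"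
  have "(\<Sum>i\<in>UNIV. a $ i * hess p b $ i) = (\<Sum>i\<in>UNIV. \<Sum>j\<in>UNIV. a $ i * (b $ j * cpartial j (cpartial i F) p))"
    by (simp add: hess_sum[OF p] sum_distrib_left)
  also have "\<dots> = (\<Sum>j\<in>UNIV. \<Sum>i\<in>UNIV. a $ i * (b $ j * cpartial j (cpartial i F) p))"
    by (rule sum.swap)
  also have "\<dots> = (\<Sum>j\<in>UNIV. \<Sum>i\<in>UNIV. a $ i * cpartial i (cpartial j F) p * b $ j)"
    using cpartial_commute[OF F_holomorphic p] by (intro sum.cong refl) (simp add: ac_simps)
  also have "\<dots> = (\<Sum>i\<in>UNIV. hess p a $ i * b $ i)"
    by (simp add: hess_sum[OF p] sum_distrib_right)
  finally show ?thesis .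
qed

definition im_hess :: "complex^'n \<Rightarrow> real^'n^'n" where
  "im_hess p = (\<chi> i j. Im (cpartial i (cpartial j F) p))"

lemma im_hess_invertible: "p \<in> U \<Longrightarrow> invertible (im_hess p)"
  using nondegenerate by (simp add: nondegenerate_holomorphic_def im_hess_def)

text \<open>Splitting the complex product into real parts isolates the action of
  \<open>im_hess\<close> on \<open>Im a\<close>; everything else depends on \<open>Re a\<close>
  only.\<close>

lemma Re_hess:
  assumes p: "p \<in> U"
  shows "Re (hess p a $ i) = (\<Sum>j\<in>UNIV. Re (a $ j) * Re (cpartial i (cpartial j F) p)) - (im_hess p *v (\<chi> j. Im (a $ j))) $ i"
  unfolding hess_sum[OF p]
  by (simp add: Re_sum matrix_vector_mult_def im_hess_def cpartial_commute[OF F_holomorphic p, of _ i] sum_subtractf mult.commute)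

text \<open>With \<open>Re a = 0\<close> the remaining condition says that \<open>im_hess p\<close>
  kills \<open>Im a\<close>.\<close>

lemma coordinates_inject:
  assumes p: "p \<in> U" and "\<And>i. Re (a $ i) = 0" "\<And>i. Re (hess p a $ i) = 0"
  shows "a = 0"
proof -
  have "im_hess p *v (\<chi> j. Im (a $ j)) = 0"
    using assms Re_hess[OF p, of a] by (simp add: vec_eq_iff)
  then have "(\<chi> j. Im (a $ j)) = 0"
    using im_hess_invertible[OF p] by (simp add: invertible_left_inverse matrix_left_invertible_ker)
  then show ?thesis using assms by (simp add: vec_eq_iff complex_eq_iff)
qed

text \<open>The tangent vector with prescribed derivatives of the affine coordinates; the imaginary part is
  given by Cramer's rule, which makes its smoothness evident.\<close>

definition rhs :: "complex^'n \<Rightarrow> (real^'n) \<Rightarrow> (real^'n) \<Rightarrow> real^'n" where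
  "rhs p r s = (\<chi> i. (\<Sum>j\<in>UNIV. r $ j * Re (cpartial i (cpartial j F) p)) - s $ i)"

definition lift :: "complex^'n \<Rightarrow> (real^'n) \<Rightarrow> (real^'n) \<Rightarrow> complex^'n" where
  "lift p r s = (\<chi> k. Complex (r $ k)
     (det (\<chi> i j. if j = k then rhs p r s $ i else im_hess p $ i $ j) * inverse (det (im_hess p))))"

lemma lift_coordinates:
  assumes p: "p \<in> U"
  shows "Re (lift p r s $ i) = r $ i" "Re (hess p (lift p r s) $ i) = s $ i"
proof -
  show 1: "Re (lift p r s $ i) = r $ i" for i by (simp add: lift_def)
  have "det (im_hess p) \<noteq> 0" using im_hess_invertible[OF p] by (simp add: invertible_det_nz)
  then have "im_hess p *v (\<chi> k. Im (lift p r s $ k)) = rhs p r s"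
    by (subst cramer) (simp_all add: lift_def divide_inverse)
  then have "(im_hess p *v (\<chi> k. Im (lift p r s $ k))) $ i = rhs p r s $ i" by simp
  then show "Re (hess p (lift p r s) $ i) = s $ i"
    unfolding Re_hess[OF p] by (simp add: 1 rhs_def)
qed

lemma lift_smooth:
  assumes W: "open W" "W \<subseteq> U" and r: "\<And>i. smooth_on W (\<lambda>p. r p $ i)" and s: "\<And>i. smooth_on W (\<lambda>p. s p $ i)"
  shows "smooth_on W (\<lambda>p. lift p (r p) (s p))"
proof (rule smooth_on_vec[OF W(1)])
  fix k
  have F2: "smooth_on W (cpartial i (cpartial j F))" for i j
    by (rule smooth_on_subset[OF holomorphic_fun_smooth[OF holomorphic_fun_cpartial[OF w_holomorphic]] W])
  have im: "smooth_on W (\<lambda>p. im_hess p $ i $ j)" for i j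
    using smooth_on_linear[OF bounded_linear_Im F2] by (simp add: im_hess_def)
  have rhs: "smooth_on W (\<lambda>p. rhs p (r p) (s p) $ i)" for i
    unfolding rhs_def vec_lambda_beta
    by (intro smooth_on_diff smooth_on_sum smooth_on_mult smooth_on_linear[OF bounded_linear_Re F2] r s W)
  have det: "smooth_on W (\<lambda>p. det (\<chi> i j. if j = k then rhs p (r p) (s p) $ i else im_hess p $ i $ j))"
  proof (rule smooth_on_matrix_det[OF W(1)])
    show "smooth_on W (\<lambda>p. (\<chi> i j. if j = k then rhs p (r p) (s p) $ i else im_hess p $ i $ j) $ i $ j)" for i j
      using rhs im by (cases "j = k") simp_all
  qed
  have inv: "smooth_on W (\<lambda>p. inverse (det (im_hess p)))"
    using im_hess_invertible W
    by (intro smooth_on_inverse smooth_on_matrix_det im) (auto simp: invertible_det_nz)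
  have "smooth_on W (\<lambda>p. of_real (r p $ k) +
      \<i> * of_real (det (\<chi> i j. if j = k then rhs p (r p) (s p) $ i else im_hess p $ i $ j) * inverse (det (im_hess p))))"
    by (intro smooth_on_add smooth_on_linear[OF bounded_linear_of_real] smooth_on_linear[OF bounded_linear_mult_right]
        smooth_on_mult r det inv)
  then show "smooth_on W (\<lambda>p. lift p (r p) (s p) $ k)"
    by (simp add: lift_def Complex_eq)
qed

section \<open>Testing tangent vectors on affine coordinates, and the connection\<close>

lemma affine_coordinates_smooth:
  assumes "h \<in> affine_coordinates"
  shows "smooth_fun MU AU U h"
  using assms smooth_fun_U smooth_on_linear[OF bounded_linear_Re holomorphic_fun_smooth[OF z_holomorphic]]
    smooth_on_linear[OF bounded_linear_Re holomorphic_fun_smooth[OF w_holomorphic]]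
  by (auto simp: affine_coordinates_def)

lemma affine_coordinates_near: "h \<in> affine_coordinates \<Longrightarrow> p \<in> U \<Longrightarrow> smooth_near MU AU p h"
  using smooth_nearI affine_coordinates_smooth by blast

text \<open>Agreement on finitely many functions extends to all functions because both functionals
  are tangent vectors; each application has to supply these memberships.\<close>

lemma tangent_vec_eqI:
  assumes p: "p \<in> U" and uv: "u \<in> tangent_space MU AU p" "v \<in> tangent_space MU AU p"
    and eq: "\<And>h. h \<in> affine_coordinates \<Longrightarrow> u h = v h"
  shows "u = v"
proof -
  obtain a b where ab: "u = chart_vec MU AU id_chart p a" "v = chart_vec MU AU id_chart p b"
    using uv tangent_space_U[OF p] by blast
  have "a - b = 0"
  proof (rule coordinates_inject[OF p])
    fix i
    show "Re ((a - b) $ i) = 0"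
      using eq[of "\<lambda>z. Re (z $ i)"] by (simp add: ab chart_vec_coordinates[OF p] affine_coordinates_def)
    show "Re (hess p (a - b) $ i) = 0"
      using eq[of "\<lambda>z. Re (cpartial i F z)"]
      by (simp add: ab chart_vec_coordinates[OF p] affine_coordinates_def linear_diff[OF hess_linear[OF p]])
  qed
  then show ?thesis using ab by simp
qed

text \<open>Built from \<open>lift\<close> at every point for arbitrary fields, smooth or not, so
  its value at a point of \<open>U\<close> is always a tangent vector with prescribed derivatives of
  the affine coordinates.\<close>

definition potential_connection :: "(complex^'n) conn" where
  "potential_connection X Y = (\<lambda>p. chart_vec MU AU id_chart p (lift p
     (\<chi> i. X p (\<lambda>q. Y q (\<lambda>z. Re (z $ i)))) (\<chi> i. X p (\<lambda>q. Y q (\<lambda>z. Re (cpartial i F z))))))"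

lemma potential_connection_tangent:
  "p \<in> U \<Longrightarrow> potential_connection X Y p \<in> tangent_space MU AU p"
  by (simp add: potential_connection_def tangent_space_U)

lemma potential_connection_affine:
  "p \<in> U \<Longrightarrow> h \<in> affine_coordinates \<Longrightarrow> potential_connection X Y p h = X p (\<lambda>q. Y q h)"
  by (auto simp: affine_coordinates_def potential_connection_def chart_vec_coordinates lift_coordinates)

lemma potential_connection_smooth:
  assumes X: "smooth_vfield MU AU W X" and Y: "smooth_vfield MU AU W Y"
  shows "smooth_vfield MU AU W (potential_connection X Y)"
proof (rule smooth_vfield_chartI[OF id_chart])
  have W: "open W" "W \<subseteq> U" using smooth_vfield_openin[OF X] openin_MU by auto
  show "openin MU W" "W \<subseteq> fst id_chart" using W openin_MU by auto
  show "potential_connection X Y p \<in> tangent_space MU AU p" if "p \<in> W" for p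
    using potential_connection_tangent W that by blast
  have XY: "smooth_on W (\<lambda>p. X p (\<lambda>q. Y q h))" if "h \<in> affine_coordinates" for h
    using smooth_fun_subset[OF affine_coordinates_smooth[OF that] smooth_vfield_openin[OF X] W(2)]
    by (intro smooth_fun_smooth_on smooth_vfield_fun[OF X order_refl] smooth_vfield_fun[OF Y order_refl])
  have "smooth_on W (\<lambda>p. lift p (\<chi> i. X p (\<lambda>q. Y q (\<lambda>z. Re (z $ i)))) (\<chi> i. X p (\<lambda>q. Y q (\<lambda>z. Re (cpartial i F z)))))"
    by (intro lift_smooth W) (simp_all add: XY affine_coordinates_def)
  then have "smooth_on W (\<lambda>z. chart_comp id_chart (potential_connection X Y (inv_chart id_chart z)))"
  proof (rule smooth_on_cong[THEN iffD1, rotated])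
    fix z assume "z \<in> W"
    then have z: "z \<in> U" using W by blast
    show "lift z (\<chi> i. X z (\<lambda>q. Y q (\<lambda>z. Re (z $ i)))) (\<chi> i. X z (\<lambda>q. Y q (\<lambda>z. Re (cpartial i F z)))) =
        chart_comp id_chart (potential_connection X Y (inv_chart id_chart z))"
      unfolding inv_id_chart[OF z] potential_connection_def using chart_comp_chart_vec[OF id_chart] z by simp
  qed
  then show "smooth_on (snd id_chart ` W) (\<lambda>z. chart_comp id_chart (potential_connection X Y (inv_chart id_chart z)))"
    by simp
qed

lemma vfield_apply_vfield_near:
  assumes Y: "smooth_vfield MU AU W Y" and p: "p \<in> W" and h: "h \<in> affine_coordinates"
  shows "smooth_near MU AU p (\<lambda>q. Y q h)"
proof -
  have "p \<in> U" using openin_subset[OF smooth_vfield_openin[OF Y]] p by auto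
  then show ?thesis by (rule vfield_apply_near[OF Y p affine_coordinates_near[OF h]])
qed

lemma vf_add_tangent:
  assumes "p \<in> U" "X p \<in> tangent_space MU AU p" "Y p \<in> tangent_space MU AU p"
  shows "vf_add X Y p \<in> tangent_space MU AU p"
  using tangent_space_combination[of p "X p" "Y p" 1 1] assms by (simp add: vf_add_def)

lemma vf_scale_tangent:
  assumes "p \<in> U" "X p \<in> tangent_space MU AU p"
  shows "vf_scale h X p \<in> tangent_space MU AU p"
  using tangent_space_combination[of p "X p" "X p" "h p" 0] assms by (simp add: vf_scale_def)

text \<open>On an affine coordinate \<open>h\<close> the operator acts by \<open>X (Y h)\<close>.
  Curvature and torsion then vanish by the definition of the bracket, and additivity and the Leibniz
  rule are the derivation rules of \<open>X p\<close>.\<close>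

lemma potential_connection_flat_torsionfree:
  "flat_torsionfree_connection MU AU potential_connection"
proof
  let ?D = potential_connection
  have sub: "p \<in> U" if "smooth_vfield MU AU W X" "p \<in> W" for W X p
    using openin_subset[OF smooth_vfield_openin[OF that(1)]] that(2) by auto
  show "smooth_vfield MU AU W (?D X Y)" if "smooth_vfield MU AU W X" "smooth_vfield MU AU W Y" for W X Y
    by (rule potential_connection_smooth[OF that])
  show "?D X Y p = ?D X' Y' p"
    if "smooth_vfield MU AU W X" "smooth_vfield MU AU W Y" "smooth_vfield MU AU W X'" "smooth_vfield MU AU W Y'"
      "\<forall>q\<in>W. X q = X' q" "\<forall>q\<in>W. Y q = Y' q" "p \<in> W" for W X Y X' Y' p
  proof (rule tangent_vec_eqI[OF sub[OF that(1,7)]])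
    fix h assume h: "h \<in> affine_coordinates"
    have "X p (\<lambda>q. Y q h) = X p (\<lambda>q. Y' q h)"
      by (rule tangent_vec_cong[OF smooth_vfield_tangent[OF that(1,7)] smooth_vfield_openin[OF that(1)] that(7)])
        (simp only: that(6)[THEN bspec])
    moreover have "X p = X' p" using that(5,7) by blast
    ultimately show "?D X Y p h = ?D X' Y' p h" using potential_connection_affine[OF sub[OF that(1,7)] h] by simp
  qed (intro potential_connection_tangent sub[OF that(1,7)])+
  show "?D (vf_add X X') Y p = vf_add (?D X Y) (?D X' Y) p"
    if "smooth_vfield MU AU W X" "smooth_vfield MU AU W X'" "smooth_vfield MU AU W Y" "p \<in> W" for W X X' Y p
  proof (rule tangent_vec_eqI[OF sub[OF that(1,4)]])
    fix h assume h: "h \<in> affine_coordinates"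
    show "?D (vf_add X X') Y p h = vf_add (?D X Y) (?D X' Y) p h"
      by (simp only: potential_connection_affine[OF sub[OF that(1,4)] h] vf_add_def)
  qed (intro potential_connection_tangent vf_add_tangent sub[OF that(1,4)])+
  show "?D (vf_scale k X) Y p = vf_scale k (?D X Y) p"
    if "smooth_fun MU AU W k" "smooth_vfield MU AU W X" "smooth_vfield MU AU W Y" "p \<in> W" for W X k Y p
  proof (rule tangent_vec_eqI[OF sub[OF that(2,4)]])
    fix h assume h: "h \<in> affine_coordinates"
    show "?D (vf_scale k X) Y p h = vf_scale k (?D X Y) p h"
      by (simp only: potential_connection_affine[OF sub[OF that(2,4)] h] vf_scale_def)
  qed (intro potential_connection_tangent vf_scale_tangent sub[OF that(2,4)])+
  show "?D X (vf_add Y Y') p = vf_add (?D X Y) (?D X Y') p"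
    if "smooth_vfield MU AU W X" "smooth_vfield MU AU W Y" "smooth_vfield MU AU W Y'" "p \<in> W" for W X Y Y' p
  proof (rule tangent_vec_eqI[OF sub[OF that(1,4)]])
    fix h assume h: "h \<in> affine_coordinates"
    show "?D X (vf_add Y Y') p h = vf_add (?D X Y) (?D X Y') p h"
      using tangent_vec_add[OF smooth_vfield_tangent[OF that(1,4)] vfield_apply_vfield_near[OF that(2,4) h] vfield_apply_vfield_near[OF that(3,4) h]]
      by (simp add: potential_connection_affine sub[OF that(1,4)] h vf_add_def)
  qed (intro potential_connection_tangent vf_add_tangent sub[OF that(1,4)])+
  show "?D X (vf_scale k Y) p = vf_add (vf_scale (\<lambda>q. X q k) Y) (vf_scale k (?D X Y)) p"
    if "smooth_fun MU AU W k" "smooth_vfield MU AU W X" "smooth_vfield MU AU W Y" "p \<in> W" for W X k Y p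
  proof (rule tangent_vec_eqI[OF sub[OF that(2,4)]])
    fix h assume h: "h \<in> affine_coordinates"
    show "?D X (vf_scale k Y) p h = vf_add (vf_scale (\<lambda>q. X q k) Y) (vf_scale k (?D X Y)) p h"
      using tangent_vec_mult[OF smooth_vfield_tangent[OF that(2,4)] smooth_nearI[OF that(1,4)] vfield_apply_vfield_near[OF that(3,4) h]]
      by (simp add: potential_connection_affine sub[OF that(2,4)] h vf_add_def vf_scale_def)
  qed (intro potential_connection_tangent vf_add_tangent vf_scale_tangent sub[OF that(2,4)] smooth_vfield_tangent[OF that(3,4)])+
  show "?D X (?D Y Z) p f - ?D Y (?D X Z) p f - ?D (lie_bracket MU AU X Y) Z p f = 0"
    if "smooth_vfield MU AU W X" "smooth_vfield MU AU W Y" "smooth_vfield MU AU W Z" "p \<in> W" for W X Y Z p f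
  proof -
    have p: "p \<in> U" by (rule sub[OF that(1,4)])
    \<comment> \<open>The coefficients 1 and -1 make the difference an instance of
      \<open>tangent_space_combination\<close>, so that it can be tested as a tangent
      vector.\<close>
    have "(\<lambda>f. 1 * ?D X (?D Y Z) p f + (-1) * ?D Y (?D X Z) p f) = ?D (lie_bracket MU AU X Y) Z p"
    proof (rule tangent_vec_eqI[OF p tangent_space_combination])
      fix h assume h: "h \<in> affine_coordinates"
      \<comment> \<open>The formula for the inner derivative may be used under \<open>A p\<close>
        because it holds on all of \<open>W\<close>, and tangent vectors depend on germs
        only.\<close>
      have *: "A p (\<lambda>q. ?D B Z q h) = A p (\<lambda>q. B q (\<lambda>q. Z q h))" if A: "smooth_vfield MU AU W A" for A B
        by (rule tangent_vec_cong[OF smooth_vfield_tangent[OF A \<open>p \<in> W\<close>] smooth_vfield_openin[OF A] \<open>p \<in> W\<close>])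
          (rule potential_connection_affine[OF sub[OF A] h])
      show "1 * ?D X (?D Y Z) p h + (-1) * ?D Y (?D X Z) p h = ?D (lie_bracket MU AU X Y) Z p h"
        using vfield_apply_vfield_near[OF that(3,4) h]
        by (simp add: potential_connection_affine[OF p h] *[OF that(1)] *[OF that(2)] lie_bracket_def)
    qed (use p potential_connection_tangent in auto)
    from fun_cong[OF this, of f] show ?thesis by simp
  qed
  show "?D X Y p f - ?D Y X p f = lie_bracket MU AU X Y p f"
    if "smooth_vfield MU AU W X" "smooth_vfield MU AU W Y" "p \<in> W" for W X Y p f
  proof -
    have p: "p \<in> U" by (rule sub[OF that(1,3)])
    have "(\<lambda>f. 1 * ?D X Y p f + (-1) * ?D Y X p f) = lie_bracket MU AU X Y p"
    proof (rule tangent_vec_eqI[OF p tangent_space_combination _ _])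
      fix h assume h: "h \<in> affine_coordinates"
      show "1 * ?D X Y p h + (-1) * ?D Y X p h = lie_bracket MU AU X Y p h"
        using affine_coordinates_near[OF h p] by (simp add: potential_connection_affine[OF p h] lie_bracket_def)
    qed (use p potential_connection_tangent lie_bracket_tangent[OF that] in auto)
    from fun_cong[OF this, of f] show ?thesis by simp
  qed
qed

lemma induced_connection_iff:
  "induced_connection MU AU (d_immersion F) D \<longleftrightarrow> flat_torsionfree_connection MU AU D \<and>
    (\<forall>h\<in>affine_coordinates. affine_fun MU AU D h)"
  by (auto simp: induced_connection_def affine_coordinates_def d_immersion_def)

lemma induced_connection_exists: "induced_connection MU AU (d_immersion F) potential_connection"
  unfolding induced_connection_iff affine_fun_def
proof (intro conjI ballI allI impI potential_connection_flat_torsionfree)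
  fix h assume h: "h \<in> affine_coordinates"
  show "smooth_fun MU AU (topspace MU) h" using affine_coordinates_smooth[OF h] by simp
  fix W X Y p assume "smooth_vfield MU AU W X \<and> smooth_vfield MU AU W Y" "p \<in> W"
  then have "p \<in> U" using openin_subset[OF smooth_vfield_openin] by auto
  then show "X p (\<lambda>q. Y q h) - potential_connection X Y p h = 0" using potential_connection_affine h by simp
qed

lemma affine_fun_apply:
  "affine_fun MU AU D h \<Longrightarrow> smooth_vfield MU AU W X \<Longrightarrow> smooth_vfield MU AU W Y \<Longrightarrow> p \<in> W \<Longrightarrow>
    D X Y p h = X p (\<lambda>q. Y q h)"
  unfolding affine_fun_def by (metis eq_iff_diff_eq_0)

text \<open>Affinity of the coordinates fixes the derivatives of \<open>D X Y p\<close> on a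
  separating set of functions. This gives uniqueness of the induced connection and later identifies
  a pushed-forward connection with it.\<close>

lemma induced_connection_eqI:
  assumes D: "induced_connection MU AU (d_immersion F) D" and XY: "smooth_vfield MU AU W X" "smooth_vfield MU AU W Y" "p \<in> W"
    and v: "v \<in> tangent_space MU AU p" "\<And>h. h \<in> affine_coordinates \<Longrightarrow> v h = X p (\<lambda>q. Y q h)"
  shows "D X Y p = v"
proof -
  interpret D: flat_torsionfree_connection MU AU D using D by (simp add: induced_connection_def)
  have p: "p \<in> U" using openin_subset[OF smooth_vfield_openin[OF XY(1)]] XY(3) by auto
  show ?thesis
  proof (rule tangent_vec_eqI[OF p smooth_vfield_tangent[OF D.smooth[OF XY(1,2)] XY(3)] v(1)])
    fix h assume h: "h \<in> affine_coordinates"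
    then show "D X Y p h = v h"
      using affine_fun_apply[OF _ XY] v(2)[OF h] D unfolding induced_connection_iff by simp
  qed
qed

lemma induced_connection_unique:
  assumes "induced_connection MU AU (d_immersion F) D" "induced_connection MU AU (d_immersion F) D'"
  shows "same_connection MU AU D D'"
  unfolding same_connection_def
proof (intro allI impI ballI)
  fix W X Y p assume XY: "smooth_vfield MU AU W X \<and> smooth_vfield MU AU W Y" and p: "p \<in> W"
  interpret D': flat_torsionfree_connection MU AU D' using assms(2) by (simp add: induced_connection_def)
  have XY: "smooth_vfield MU AU W X" "smooth_vfield MU AU W Y" using XY by auto
  show "D X Y p = D' X Y p"
  proof (rule induced_connection_eqI[OF assms(1) XY p])
    show "D' X Y p \<in> tangent_space MU AU p" by (rule smooth_vfield_tangent[OF D'.smooth[OF XY] p])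
    show "D' X Y p h = X p (\<lambda>q. Y q h)" if "h \<in> affine_coordinates" for h
      using affine_fun_apply[OF _ XY p] assms(2) that unfolding induced_connection_iff by simp
  qed
qed

section \<open>The immersion \<open>dF\<close>\<close>

lemma differential_chart_vec:
  "p \<in> U \<Longrightarrow> differential (d_immersion F) (chart_vec MU AU id_chart p a) = (a, hess p a)"
  by (simp add: differential_def d_immersion_def chart_vec_coordinates vec_eq_iff complex_eq_iff)

lemma d_immersion_holomorphic_immersion: "holomorphic_immersion MU AU (d_immersion F)"
  unfolding holomorphic_immersion_def holomorphic_on_manifold_def
proof (intro conjI allI ballI)
  fix i and c :: "(complex^'n, 'n) chart" assume c: "c \<in> AU"
  then have c_eq: "c = id_chart" by (simp add: std_atlas_def)
  have eq: "holomorphic_fun (snd c ` fst c) (\<lambda>p. f (inv_chart c p))" if "holomorphic_fun U f" for f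
  proof -
    have "holomorphic_fun U (\<lambda>p. f (inv_chart id_chart p))"
      by (rule holomorphic_fun_cong[THEN iffD1, OF _ that]) (simp add: inv_into_identity)
    then show ?thesis by (simp add: c_eq)
  qed
  show "holomorphic_fun (snd c ` fst c) (\<lambda>z. fst (d_immersion F (inv_chart c z)) $ i)"
    using eq[OF z_holomorphic] by (simp add: d_immersion_def)
  show "holomorphic_fun (snd c ` fst c) (\<lambda>z. snd (d_immersion F (inv_chart c z)) $ i)"
    using eq[OF w_holomorphic] by (simp add: d_immersion_def)
next
  fix p assume "p \<in> topspace MU"
  then have p: "p \<in> U" by simp
  show "inj_on (differential (d_immersion F)) (tangent_space MU AU p)"
    unfolding tangent_space_U[OF p] inj_on_def using differential_chart_vec[OF p] by auto
qed

text \<open>If \<open>(a, hess p a)\<close> is real, the affine coordinates annihilate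
  \<open>\<i> *s a\<close>, hence \<open>a = 0\<close>.\<close>

lemma d_immersion_totally_complex: "totally_complex MU AU (d_immersion F)"
  unfolding totally_complex_def
proof
  fix p assume "p \<in> topspace MU"
  then have p: "p \<in> U" by simp
  have im: "differential (d_immersion F) ` tangent_space MU AU p = range (\<lambda>a. (a, hess p a))"
    unfolding tangent_space_U[OF p] image_image differential_chart_vec[OF p] ..
  have "a = 0" if "(a, hess p a) \<in> real_points" for a
  proof -
    have im0: "Im (a $ i) = 0" "Im (hess p a $ i) = 0" for i
      using that by (auto simp: real_points_def complex_is_Real_iff)
    have "\<i> *s a = 0"
      by (rule coordinates_inject[OF p]) (simp_all add: hess_smult[OF p] im0)
    then show ?thesis by (simp add: vec_eq_iff)
  qed
  moreover have "hess p 0 = 0" using linear_0[OF hess_linear[OF p]] .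
  moreover have "(0, 0) \<in> real_points" by (simp add: real_points_def)
  ultimately show "real_points \<inter> differential (d_immersion F) ` tangent_space MU AU p = {0}"
    unfolding im zero_prod_def by auto
qed

section \<open>The induced form\<close>

lemma induced_form_eq:
  "induced_form (d_immersion F) p v w = 2 * (\<Sum>i\<in>UNIV. v (\<lambda>z. Re (z $ i)) * w (\<lambda>z. Re (cpartial i F z)) -
    v (\<lambda>z. Re (cpartial i F z)) * w (\<lambda>z. Re (z $ i)))"
  by (simp add: induced_form_def dx_wedge_dy_def differential_def d_immersion_def)

text \<open>Symmetry of the Hessian says that \<open>dF\<close> is Lagrangian for the complex
  symplectic form. The real part of this equates the form built from real parts with the one built
  from imaginary parts, and \<open>J\<close> exchanges these up to sign.\<close>

lemma induced_form_J_invariant: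
  assumes p: "p \<in> U" and v: "v \<in> tangent_space MU AU p" and w: "w \<in> tangent_space MU AU p"
  shows "induced_form (d_immersion F) p (complex_structure MU AU p v) (complex_structure MU AU p w) =
    induced_form (d_immersion F) p v w"
proof -
  obtain a b where v: "v = chart_vec MU AU id_chart p a" and w: "w = chart_vec MU AU id_chart p b"
    using assms tangent_space_U[OF p] by blast
  have J: "complex_structure MU AU p (chart_vec MU AU id_chart p a) = chart_vec MU AU id_chart p (\<i> *s a)" for a
    using complex_structure_chart_vec[OF id_chart] p by simp
  have "Re (\<Sum>i\<in>UNIV. a $ i * hess p b $ i - hess p a $ i * b $ i) = 0"
    using hess_symmetric[OF p, of a b] by (simp add: sum_subtractf)
  then have "(\<Sum>i\<in>UNIV. Im (a $ i) * Im (hess p b $ i) - Im (hess p a $ i) * Im (b $ i)) =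
      (\<Sum>i\<in>UNIV. Re (a $ i) * Re (hess p b $ i) - Re (hess p a $ i) * Re (b $ i))"
    by (simp add: sum_subtractf)
  then show ?thesis
    unfolding v w J induced_form_eq chart_vec_coordinates[OF p] hess_smult[OF p] by simp
qed

text \<open>The product rule in affine coordinates; closedness and parallelism of the form are both
  read off from it.\<close>

lemma induced_form_derivative:
  assumes X: "v \<in> tangent_space MU AU p" and Y: "smooth_vfield MU AU W Y" and Z: "smooth_vfield MU AU W Z" and p: "p \<in> W"
  shows "v (\<lambda>q. induced_form (d_immersion F) q (Y q) (Z q)) = 2 * (\<Sum>i\<in>UNIV.
    (Y p (\<lambda>z. Re (z $ i)) * v (\<lambda>q. Z q (\<lambda>z. Re (cpartial i F z))) +
     v (\<lambda>q. Y q (\<lambda>z. Re (z $ i))) * Z p (\<lambda>z. Re (cpartial i F z))) -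
    (Y p (\<lambda>z. Re (cpartial i F z)) * v (\<lambda>q. Z q (\<lambda>z. Re (z $ i))) +
     v (\<lambda>q. Y q (\<lambda>z. Re (cpartial i F z))) * Z p (\<lambda>z. Re (z $ i))))"
proof -
  have pU: "p \<in> U" "p \<in> topspace MU" using openin_subset[OF smooth_vfield_openin[OF Y]] p by auto
  have x: "(\<lambda>z. Re (z $ i)) \<in> affine_coordinates" and y: "(\<lambda>z. Re (cpartial i F z)) \<in> affine_coordinates" for i
    by (auto simp: affine_coordinates_def)
  note n = vfield_apply_vfield_near[OF Y p] vfield_apply_vfield_near[OF Z p]
  note nn = smooth_near_mult[OF n(1)[OF x] n(2)[OF y]] smooth_near_mult[OF n(1)[OF y] n(2)[OF x]]
  have nd: "smooth_near MU AU p (\<lambda>q. Y q (\<lambda>z. Re (z $ i)) * Z q (\<lambda>z. Re (cpartial i F z)) -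
      Y q (\<lambda>z. Re (cpartial i F z)) * Z q (\<lambda>z. Re (z $ i)))" for i
    using smooth_near_add[OF nn(1) smooth_near_mult[OF smooth_near_const[OF pU(2), of "-1"] nn(2)], of i i] by simp
  have ns: "smooth_near MU AU p (\<lambda>q. \<Sum>i\<in>UNIV. Y q (\<lambda>z. Re (z $ i)) * Z q (\<lambda>z. Re (cpartial i F z)) -
      Y q (\<lambda>z. Re (cpartial i F z)) * Z q (\<lambda>z. Re (z $ i)))"
  proof -
    have o: "openin MU W" by (rule smooth_vfield_openin[OF Y])
    have a: "smooth_fun MU AU W h" if "h \<in> affine_coordinates" for h
      using smooth_fun_subset[OF affine_coordinates_smooth[OF that] o] openin_subset[OF o] by simp
    show ?thesis
      by (rule smooth_nearI[OF _ p], intro smooth_fun_sum o smooth_fun_diff smooth_fun_mult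
          smooth_vfield_fun[OF Y order_refl] smooth_vfield_fun[OF Z order_refl] a x y)
  qed
  show ?thesis
    unfolding induced_form_eq tangent_vec_cmul[OF X ns] tangent_vec_sum[OF X pU(2) nd] tangent_vec_diff[OF X nn]
      tangent_vec_mult[OF X n(1)[OF x] n(2)[OF y]] tangent_vec_mult[OF X n(1)[OF y] n(2)[OF x]] ..
qed

lemma induced_form_symplectic: "symplectic_form MU AU (induced_form (d_immersion F))"
  unfolding symplectic_form_def
proof (intro conjI ballI allI impI)
  fix p u v w r s
  show "induced_form (d_immersion F) p (\<lambda>f. r * u f + s * v f) w =
      r * induced_form (d_immersion F) p u w + s * induced_form (d_immersion F) p v w"
    unfolding induced_form_eq by (simp add: sum_distrib_left sum_subtractf sum.distrib algebra_simps)
  show "induced_form (d_immersion F) p v w = - induced_form (d_immersion F) p w v"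
    unfolding induced_form_eq by (simp add: sum_negf[symmetric] sum_subtractf mult.commute)
next
  fix W X Y assume XY: "smooth_vfield MU AU W X \<and> smooth_vfield MU AU W Y"
  then have X: "smooth_vfield MU AU W X" and Y: "smooth_vfield MU AU W Y" by auto
  have o: "openin MU W" by (rule smooth_vfield_openin[OF X])
  have a: "smooth_fun MU AU W h" if "h \<in> affine_coordinates" for h
    using smooth_fun_subset[OF affine_coordinates_smooth[OF that] o] openin_subset[OF o] by simp
  show "smooth_fun MU AU W (\<lambda>p. induced_form (d_immersion F) p (X p) (Y p))"
    unfolding induced_form_eq
    by (intro smooth_fun_mult smooth_fun_const smooth_fun_sum smooth_fun_diff o
        smooth_vfield_fun[OF X order_refl] smooth_vfield_fun[OF Y order_refl] a) (auto simp: affine_coordinates_def)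
next
  fix p v assume "p \<in> topspace MU" and v: "v \<in> tangent_space MU AU p"
    and null: "\<forall>w\<in>tangent_space MU AU p. induced_form (d_immersion F) p v w = 0"
  then have p: "p \<in> U" by simp
  \<comment> \<open>\<open>lift\<close> provides a tangent vector with arbitrary derivatives
    \<open>r\<close>, \<open>s\<close> of the affine coordinates; unit vectors for \<open>r\<close>
    and \<open>s\<close> then isolate the components of \<open>v\<close>.\<close>
  have ind: "(\<Sum>i\<in>UNIV. v (\<lambda>z. Re (z $ i)) * s $ i - v (\<lambda>z. Re (cpartial i F z)) * r $ i) = 0" for r s
  proof -
    have "chart_vec MU AU id_chart p (lift p r s) \<in> tangent_space MU AU p" by (simp add: tangent_space_U[OF p])
    then show ?thesis
      using null by (auto simp: induced_form_eq chart_vec_coordinates[OF p] lift_coordinates[OF p])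
  qed
  have x: "v (\<lambda>z. Re (z $ i)) = 0" and y: "v (\<lambda>z. Re (cpartial i F z)) = 0" for i
  proof -
    have "(\<Sum>j\<in>UNIV. f j * axis i 1 $ j) = f i" for f :: "'n \<Rightarrow> real"
    proof -
      have "(\<Sum>j\<in>UNIV. f j * axis i 1 $ j) = (\<Sum>j\<in>UNIV. if j = i then f j else 0)"
        by (rule sum.cong) (auto simp: axis_def)
      then show ?thesis by simp
    qed
    then show "v (\<lambda>z. Re (z $ i)) = 0" "v (\<lambda>z. Re (cpartial i F z)) = 0"
      using ind[of "axis i 1" 0] ind[of 0 "axis i 1"] by (simp_all add: sum_negf)
  qed
  have "v = chart_vec MU AU id_chart p 0"
  proof (rule tangent_vec_eqI[OF p v])
    show "chart_vec MU AU id_chart p 0 \<in> tangent_space MU AU p" by (simp add: tangent_space_U[OF p])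
    show "v h = chart_vec MU AU id_chart p 0 h" if "h \<in> affine_coordinates" for h
      using that unfolding affine_coordinates_def
      by (auto simp: x y chart_vec_coordinates[OF p] linear_0[OF hess_linear[OF p]])
  qed
  moreover have "chart_vec MU AU id_chart p 0 f = 0" for f
    using linear_0[OF chart_vec_linear[OF id_chart]] p by simp
  ultimately show "v = (\<lambda>f. 0)" by auto
next
  fix W X Y Z p
  assume "smooth_vfield MU AU W X \<and> smooth_vfield MU AU W Y \<and> smooth_vfield MU AU W Z" and p: "p \<in> W"
  then have X: "smooth_vfield MU AU W X" and Y: "smooth_vfield MU AU W Y" and Z: "smooth_vfield MU AU W Z" by auto
  have pU: "p \<in> U" using openin_subset[OF smooth_vfield_openin[OF Y]] p by auto
  have near: "smooth_near MU AU p (\<lambda>z. Re (z $ i))" "smooth_near MU AU p (\<lambda>z. Re (cpartial i F z))" for i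
    using affine_coordinates_near[OF _ pU] by (auto simp: affine_coordinates_def)
  note t = smooth_vfield_tangent[OF X p] smooth_vfield_tangent[OF Y p] smooth_vfield_tangent[OF Z p]
  show "X p (\<lambda>q. induced_form (d_immersion F) q (Y q) (Z q)) + Y p (\<lambda>q. induced_form (d_immersion F) q (Z q) (X q)) +
      Z p (\<lambda>q. induced_form (d_immersion F) q (X q) (Y q)) -
      induced_form (d_immersion F) p (lie_bracket MU AU X Y p) (Z p) -
      induced_form (d_immersion F) p (lie_bracket MU AU Y Z p) (X p) -
      induced_form (d_immersion F) p (lie_bracket MU AU Z X p) (Y p) = 0"
    \<comment> \<open>The affine coordinates have constant coefficients in the form, so after
      inserting the commutators all terms cancel for each index separately.\<close>
    unfolding induced_form_derivative[OF t(1) Y Z p] induced_form_derivative[OF t(2) Z X p]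
      induced_form_derivative[OF t(3) X Y p]
    unfolding induced_form_eq lie_bracket_def
    by (simp add: near sum_distrib_left flip: sum.distrib sum_subtractf) (rule sum.neutral, simp add: algebra_simps)
qed

section \<open>The complex structure and the special Kaehler axioms\<close>

lemma J_smooth:
  assumes Y: "smooth_vfield MU AU W Y"
  shows "smooth_vfield MU AU W (vf_J MU AU Y)"
proof (rule smooth_vfield_chartI[OF id_chart])
  have W: "open W" "W \<subseteq> U" using smooth_vfield_openin[OF Y] openin_MU by auto
  show "openin MU W" "W \<subseteq> fst id_chart" using W openin_MU by auto
  have J: "vf_J MU AU Y p = chart_vec MU AU id_chart p (\<i> *s chart_comp id_chart (Y p))" if "p \<in> W" for p
    using complex_structure_chart_vec[OF id_chart, of p "chart_comp id_chart (Y p)"]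
      chart_vec_chart_comp[OF id_chart, of p "Y p"] smooth_vfield_tangent[OF Y that] W that
    by (auto simp: vf_J_def)
  show "vf_J MU AU Y p \<in> tangent_space MU AU p" if "p \<in> W" for p
    using J[OF that] tangent_space_U W that by auto
  have "bounded_linear ((*s) \<i> :: complex^'n \<Rightarrow> complex^'n)"
    using linear_smult_vec by (simp add: linear_conv_bounded_linear)
  then have "smooth_on W (\<lambda>z. \<i> *s chart_comp id_chart (Y (inv_chart id_chart z)))"
  proof (rule smooth_on_linear)
    show "smooth_on W (\<lambda>z. chart_comp id_chart (Y (inv_chart id_chart z)))"
      using smooth_vfield_comp[OF Y id_chart] W(2) by simp
  qed
  then have "smooth_on W (\<lambda>z. chart_comp id_chart (vf_J MU AU Y (inv_chart id_chart z)))"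
  proof (rule smooth_on_cong[THEN iffD1, rotated])
    fix z assume z: "z \<in> W"
    then have zU: "z \<in> U" using W by blast
    show "\<i> *s chart_comp id_chart (Y (inv_chart id_chart z)) = chart_comp id_chart (vf_J MU AU Y (inv_chart id_chart z))"
      unfolding inv_id_chart[OF zU] J[OF z] using chart_comp_chart_vec[OF id_chart] zU by simp
  qed
  then show "smooth_on (snd id_chart ` W) (\<lambda>z. chart_comp id_chart (vf_J MU AU Y (inv_chart id_chart z)))"
    by simp
qed

text \<open>The Cauchy-Riemann equations: the derivative of \<open>f\<close> along
  \<open>\<i> *s a\<close> is \<open>\<i>\<close> times that along \<open>a\<close>.\<close>

lemma complex_structure_Re:
  assumes p: "p \<in> U" and v: "v \<in> tangent_space MU AU p" and f: "holomorphic_fun U f"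
  shows "complex_structure MU AU p v (\<lambda>z. Re (f z)) = - v (\<lambda>z. Im (f z))"
proof -
  obtain a where v: "v = chart_vec MU AU id_chart p a" using v tangent_space_U[OF p] by blast
  show ?thesis
    unfolding v using complex_structure_chart_vec[OF id_chart, of p a] p
    by (simp add: chart_vec_holomorphic[OF p f] holomorphic_fun_derivative_scale[OF f p])
qed

lemma complex_structure_tangent:
  "p \<in> U \<Longrightarrow> v \<in> tangent_space MU AU p \<Longrightarrow> complex_structure MU AU p v \<in> tangent_space MU AU p"
  using complex_structure_chart_vec[OF id_chart, of p] tangent_space_U by auto

text \<open>On an affine coordinate \<open>Re g\<close> with \<open>g\<close> holomorphic, the
  derivative of \<open>J\<close> along \<open>X\<close> applied to \<open>Y\<close> gives minus the
  second covariant derivative of \<open>Im g\<close>. This is symmetric in \<open>X\<close> and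
  \<open>Y\<close> since the connection is torsion-free, which is \<open>d_nabla_J\<close>.\<close>

lemma induced_connection_special_kahler:
  assumes D: "induced_connection MU AU (d_immersion F) D"
  shows "special_kahler_manifold MU AU D (induced_form (d_immersion F))"
proof -
  interpret D: flat_torsionfree_connection MU AU D using D by (simp add: induced_connection_def)
  have aff: "D X Y p h = X p (\<lambda>q. Y q h)"
    if "smooth_vfield MU AU W X" "smooth_vfield MU AU W Y" "p \<in> W" "h \<in> affine_coordinates" for W X Y p h
    using affine_fun_apply[OF _ that(1-3)] D that(4) unfolding induced_connection_iff by simp
  show ?thesis
  proof
    fix W X Y p f assume X: "smooth_vfield MU AU W X" and Y: "smooth_vfield MU AU W Y" and p: "p \<in> W"
    have W: "W \<subseteq> U" using openin_subset[OF smooth_vfield_openin[OF X]] by auto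
    then have pU: "p \<in> U" using p by blast
    have DT: "D A B p \<in> tangent_space MU AU p" if "smooth_vfield MU AU W A" "smooth_vfield MU AU W B" for A B
      by (rule smooth_vfield_tangent[OF D.smooth[OF that] p])
    have *: "D X (vf_J MU AU Y) p h - vf_J MU AU (D X Y) p h =
        - (X p (\<lambda>q. Y q (\<lambda>z. Im (g z))) - D X Y p (\<lambda>z. Im (g z)))"
      if X: "smooth_vfield MU AU W X" and Y: "smooth_vfield MU AU W Y" and g: "holomorphic_fun U g"
        and h: "h = (\<lambda>z. Re (g z))" "h \<in> affine_coordinates" for X Y g h
    proof -
      have near: "smooth_near MU AU p (\<lambda>z. Im (g z))"
        using smooth_nearI[OF smooth_fun_U[OF smooth_on_linear[OF bounded_linear_Im holomorphic_fun_smooth[OF g]]] pU] .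
      have "D X (vf_J MU AU Y) p h = X p (\<lambda>q. vf_J MU AU Y q h)"
        by (rule aff[OF X J_smooth[OF Y] p h(2)])
      also have "\<dots> = X p (\<lambda>q. (-1) * Y q (\<lambda>z. Im (g z)))"
        by (rule tangent_vec_cong[OF smooth_vfield_tangent[OF X p] smooth_vfield_openin[OF X] p])
          (use complex_structure_Re[OF _ smooth_vfield_tangent[OF Y] g] W in \<open>auto simp: vf_J_def h\<close>)
      also have "\<dots> = - X p (\<lambda>q. Y q (\<lambda>z. Im (g z)))"
        using tangent_vec_cmul[OF smooth_vfield_tangent[OF X p] vfield_apply_near[OF Y p near], of "-1"] by simp
      finally show ?thesis
        using complex_structure_Re[OF pU DT[OF X Y] g] by (simp add: vf_J_def h)
    qed
    have JT: "vf_J MU AU (D A B) p \<in> tangent_space MU AU p" if "smooth_vfield MU AU W A" "smooth_vfield MU AU W B" for A B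
      using complex_structure_tangent[OF pU DT[OF that]] by (simp add: vf_J_def)
    have T: "(\<lambda>f. 1 * D A (vf_J MU AU B) p f + (-1) * vf_J MU AU (D A B) p f) \<in> tangent_space MU AU p"
      if "smooth_vfield MU AU W A" "smooth_vfield MU AU W B" for A B
      by (rule tangent_space_combination[OF _ DT[OF that(1) J_smooth[OF that(2)]] JT[OF that]]) (use pU in simp)
    have "(\<lambda>f. 1 * D X (vf_J MU AU Y) p f + (-1) * vf_J MU AU (D X Y) p f) =
        (\<lambda>f. 1 * D Y (vf_J MU AU X) p f + (-1) * vf_J MU AU (D Y X) p f)"
    proof (rule tangent_vec_eqI[OF pU T[OF X Y] T[OF Y X]])
      fix h assume h: "h \<in> affine_coordinates"
      then obtain g where g: "holomorphic_fun U g" "h = (\<lambda>z. Re (g z))"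
        using z_holomorphic w_holomorphic by (auto simp: affine_coordinates_def)
      have near: "smooth_near MU AU p (\<lambda>z. Im (g z))"
        using smooth_nearI[OF smooth_fun_U[OF smooth_on_linear[OF bounded_linear_Im holomorphic_fun_smooth[OF g(1)]]] pU] .
      have "D X Y p (\<lambda>z. Im (g z)) - D Y X p (\<lambda>z. Im (g z)) =
          X p (\<lambda>q. Y q (\<lambda>z. Im (g z))) - Y p (\<lambda>q. X q (\<lambda>z. Im (g z)))"
        using D.torsionfree[OF X Y p] near by (simp add: lie_bracket_def)
      then show "1 * D X (vf_J MU AU Y) p h + (-1) * vf_J MU AU (D X Y) p h =
          1 * D Y (vf_J MU AU X) p h + (-1) * vf_J MU AU (D Y X) p h"
        using *[OF X Y g h] *[OF Y X g h] by simp
    qed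
    from fun_cong[OF this, of f]
    show "D X (vf_J MU AU Y) p f - vf_J MU AU (D X Y) p f = D Y (vf_J MU AU X) p f - vf_J MU AU (D Y X) p f" by simp
  next
    show "symplectic_form MU AU (induced_form (d_immersion F))" by (rule induced_form_symplectic)
  next
    fix W X Y Z p
    assume X: "smooth_vfield MU AU W X" and Y: "smooth_vfield MU AU W Y" and Z: "smooth_vfield MU AU W Z" and p: "p \<in> W"
    have x: "(\<lambda>z. Re (z $ i)) \<in> affine_coordinates" and y: "(\<lambda>z. Re (cpartial i F z)) \<in> affine_coordinates" for i
      by (auto simp: affine_coordinates_def)
    show "X p (\<lambda>q. induced_form (d_immersion F) q (Y q) (Z q)) =
        induced_form (d_immersion F) p (D X Y p) (Z p) + induced_form (d_immersion F) p (Y p) (D X Z p)"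
      unfolding induced_form_derivative[OF smooth_vfield_tangent[OF X p] Y Z p]
      unfolding induced_form_eq aff[OF X Y p x] aff[OF X Y p y] aff[OF X Z p x] aff[OF X Z p y]
      by (simp add: sum.distrib sum_subtractf algebra_simps)
  next
    fix p v w assume "p \<in> topspace MU" "v \<in> tangent_space MU AU p" "w \<in> tangent_space MU AU p"
    then show "induced_form (d_immersion F) p (complex_structure MU AU p v) (complex_structure MU AU p w) =
        induced_form (d_immersion F) p v w"
      by (intro induced_form_J_invariant) auto
  qed
qed

end

section \<open>Local existence of the potential\<close>

lemma abs_linear_le:
  fixes L :: "'a::euclidean_space \<Rightarrow> real"
  assumes "linear L" "\<And>b. b \<in> Basis \<Longrightarrow> \<bar>v \<bullet> b\<bar> \<le> k"
  shows "\<bar>L v\<bar> \<le> k * (\<Sum>b\<in>Basis. \<bar>L b\<bar>)"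
proof -
  have "\<bar>L v\<bar> \<le> (\<Sum>b\<in>Basis. \<bar>(v \<bullet> b) *\<^sub>R L b\<bar>)"
    unfolding linear_euclidean_expansion[OF assms(1), of v] by (rule sum_abs)
  also have "\<dots> \<le> (\<Sum>b\<in>Basis. k * \<bar>L b\<bar>)"
    using assms(2) by (intro sum_mono) (simp add: abs_mult mult_right_mono)
  finally show ?thesis by (simp add: sum_distrib_left)
qed

text \<open>A parallel form vanishing at one point vanishes nearby: by the mean value theorem, its maximum
  over a small ball is at most half of itself.\<close>

lemma parallel_form_zero:
  fixes \<delta> :: "'v::euclidean_space \<Rightarrow> 'v \<Rightarrow> 'v \<Rightarrow> real" and \<Gamma> :: "'v \<Rightarrow> 'v \<Rightarrow> 'v \<Rightarrow> 'v"
  assumes S: "open S" "c \<in> S"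
    and lin: "\<And>x v. x \<in> S \<Longrightarrow> linear (\<lambda>u. \<delta> x u v)" "\<And>x u. x \<in> S \<Longrightarrow> linear (\<delta> x u)"
    and \<Gamma>_lin: "\<And>x v. x \<in> S \<Longrightarrow> linear (\<lambda>u. \<Gamma> x u v)"
    and \<Gamma>_cont: "\<And>u v. continuous_on S (\<lambda>x. \<Gamma> x u v)"
    and deriv: "\<And>x u v. x \<in> S \<Longrightarrow> ((\<lambda>x. \<delta> x u v) has_derivative (\<lambda>t. \<delta> x (\<Gamma> x t u) v + \<delta> x u (\<Gamma> x t v))) (at x)"
    and zero: "\<And>u v. \<delta> c u v = 0"
  obtains r where "r > 0" "ball c r \<subseteq> S" "\<And>x u v. x \<in> ball c r \<Longrightarrow> \<delta> x u v = 0"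
proof -
  let ?B = "Basis :: 'v set"
  obtain d where d: "d > 0" "cball c d \<subseteq> S" using S open_contains_cball by blast
  \<comment> \<open>The sum of the absolute structure constants of \<open>\<Gamma>\<close> at
    \<open>x\<close>; its maximum over the compact ball bounds all components of
    \<open>\<Gamma>\<close> uniformly.\<close>
  define C where "C x = (\<Sum>b\<in>?B. \<Sum>b'\<in>?B. \<Sum>b''\<in>?B. \<bar>\<Gamma> x b b' \<bullet> b''\<bar>)" for x
  have C_cont: "continuous_on (cball c d) C"
    unfolding C_def by (intro continuous_intros continuous_on_subset[OF \<Gamma>_cont d(2)])
  have "cball c d \<noteq> {}" using d by simp
  from continuous_attains_sup[OF compact_cball this C_cont]
  obtain xC where xC: "\<forall>x\<in>cball c d. C x \<le> C xC" by (elim bexE)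
  define K where "K = C xC"
  have K0: "K \<ge> 0" unfolding K_def C_def by (intro sum_nonneg) auto
  have \<Gamma>_bound: "\<bar>\<Gamma> x t b \<bullet> b''\<bar> \<le> norm t * K" if x: "x \<in> cball c d" and b: "b \<in> ?B" "b'' \<in> ?B" for x t b b''
  proof -
    have "linear (\<lambda>t. \<Gamma> x t b \<bullet> b'')"
      using linear_compose[OF \<Gamma>_lin[of x b] bounded_linear.linear[OF bounded_linear_inner_left[of b'']]] x d
      by (auto simp: o_def)
    then have "\<bar>\<Gamma> x t b \<bullet> b''\<bar> \<le> norm t * (\<Sum>b3\<in>?B. \<bar>\<Gamma> x b3 b \<bullet> b''\<bar>)"
      by (rule abs_linear_le) (rule Basis_le_norm)
    also have "\<dots> \<le> norm t * C x"
    proof (intro mult_left_mono)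
      have "\<bar>\<Gamma> x b3 b \<bullet> b''\<bar> \<le> (\<Sum>b'\<in>?B. \<Sum>b''\<in>?B. \<bar>\<Gamma> x b3 b' \<bullet> b''\<bar>)" for b3
      proof -
        have "\<bar>\<Gamma> x b3 b \<bullet> b''\<bar> \<le> (\<Sum>b''\<in>?B. \<bar>\<Gamma> x b3 b \<bullet> b''\<bar>)"
          using b by (intro member_le_sum) auto
        also have "\<dots> \<le> (\<Sum>b'\<in>?B. \<Sum>b''\<in>?B. \<bar>\<Gamma> x b3 b' \<bullet> b''\<bar>)"
          using b by (intro member_le_sum[of b ?B "\<lambda>b'. \<Sum>b''\<in>?B. \<bar>\<Gamma> x b3 b' \<bullet> b''\<bar>"]) (auto intro: sum_nonneg)
        finally show ?thesis .
      qed
      then show "(\<Sum>b3\<in>?B. \<bar>\<Gamma> x b3 b \<bullet> b''\<bar>) \<le> C x" unfolding C_def by (intro sum_mono)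
    qed simp
    also have "\<dots> \<le> norm t * K" unfolding K_def by (intro mult_left_mono xC[rule_format] x) simp
    finally show ?thesis .
  qed
  define N where "N = real (card ?B)"
  have N0: "N \<ge> 0" by (simp add: N_def)
  \<comment> \<open>There are \<open>N * N\<close> entries, each of size at most
    \<open>2 * K * r\<close> times the maximum of \<open>m\<close>. This radius makes the sum at
    most half of the maximum; the summand 1 keeps the denominator positive.\<close>
  define r where "r = min d (1 / (4 * (N * N * K + 1)))"
  have pos: "N * N * K + 1 > 0" using N0 K0 by (simp add: add_nonneg_pos)
  have r: "r > 0" "cball c r \<subseteq> cball c d" using d pos by (auto simp: r_def)
  have rK: "4 * (N * N * K) * r \<le> 1"
  proof -
    have "4 * (N * N * K) * r \<le> 4 * (N * N * K + 1) * r" using r by (intro mult_right_mono) auto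
    also have "\<dots> \<le> 4 * (N * N * K + 1) * (1 / (4 * (N * N * K + 1)))"
      using pos by (intro mult_left_mono) (auto simp: r_def)
    also have "\<dots> = 1" using pos by simp
    finally show ?thesis .
  qed
  define m where "m x = (\<Sum>b\<in>?B. \<Sum>b'\<in>?B. \<bar>\<delta> x b b'\<bar>)" for x
  have \<delta>_cont: "continuous_on (cball c r) (\<lambda>x. \<delta> x u v)" for u v
  proof (rule continuous_at_imp_continuous_on, rule ballI)
    fix x assume "x \<in> cball c r"
    then have "x \<in> S" using r d by blast
    then show "isCont (\<lambda>x. \<delta> x u v) x" using deriv has_derivative_continuous by blast
  qed
  have m_cont: "continuous_on (cball c r) m"
    unfolding m_def by (intro continuous_intros \<delta>_cont)
  have "cball c r \<noteq> {}" using r by simp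
  from continuous_attains_sup[OF compact_cball this m_cont]
  obtain y where y1: "y \<in> cball c r" and y2: "\<forall>x\<in>cball c r. m x \<le> m y" by (elim bexE)
  have rS: "cball c r \<subseteq> S" using r(2) d(2) by blast
  have m0: "m x \<ge> 0" for x unfolding m_def by (intro sum_nonneg) auto
  have bound: "\<bar>\<delta> x b b'\<bar> \<le> 2 * (K * m y) * r" if x: "x \<in> cball c r" and b: "b \<in> ?B" "b' \<in> ?B" for x b b'
  proof -
    have "norm (\<delta> x b b' - \<delta> c b b') \<le> (2 * (K * m y)) * norm (x - c)"
    proof (rule differentiable_bound[OF convex_cball])
      fix x assume x: "x \<in> cball c r"
      then have xS: "x \<in> S" "x \<in> cball c d" using r d by blast+
      show "((\<lambda>x. \<delta> x b b') has_derivative (\<lambda>t. \<delta> x (\<Gamma> x t b) b' + \<delta> x b (\<Gamma> x t b'))) (at x within cball c r)"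
        using deriv[OF xS(1)] by (rule has_derivative_at_withinI)
      show "onorm (\<lambda>t. \<delta> x (\<Gamma> x t b) b' + \<delta> x b (\<Gamma> x t b')) \<le> 2 * (K * m y)"
      proof (rule onorm_bound)
        show "0 \<le> 2 * (K * m y)" using K0 m0 by simp
        fix t
        have "\<bar>\<delta> x (\<Gamma> x t b) b'\<bar> \<le> (norm t * K) * (\<Sum>b''\<in>?B. \<bar>\<delta> x b'' b'\<bar>)"
          by (rule abs_linear_le[OF lin(1)[OF xS(1)]]) (rule \<Gamma>_bound[OF xS(2) b(1)])
        also have "\<dots> \<le> (norm t * K) * m y"
        proof (intro mult_left_mono order_trans[OF _ y2[rule_format, OF x]])
          show "(\<Sum>b''\<in>?B. \<bar>\<delta> x b'' b'\<bar>) \<le> m x"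
            unfolding m_def using b by (intro sum_mono member_le_sum) auto
        qed (use K0 in auto)
        finally have 1: "\<bar>\<delta> x (\<Gamma> x t b) b'\<bar> \<le> (norm t * K) * m y" .
        have "\<bar>\<delta> x b (\<Gamma> x t b')\<bar> \<le> (norm t * K) * (\<Sum>b''\<in>?B. \<bar>\<delta> x b b''\<bar>)"
          by (rule abs_linear_le[OF lin(2)[OF xS(1)]]) (rule \<Gamma>_bound[OF xS(2) b(2)])
        also have "\<dots> \<le> (norm t * K) * m y"
        proof (intro mult_left_mono order_trans[OF _ y2[rule_format, OF x]])
          show "(\<Sum>b''\<in>?B. \<bar>\<delta> x b b''\<bar>) \<le> m x"
            unfolding m_def using b by (intro member_le_sum[of b ?B "\<lambda>b. \<Sum>b''\<in>?B. \<bar>\<delta> x b b''\<bar>"]) (auto intro: sum_nonneg)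
        qed (use K0 in auto)
        finally have 2: "\<bar>\<delta> x b (\<Gamma> x t b')\<bar> \<le> (norm t * K) * m y" .
        have "norm (\<delta> x (\<Gamma> x t b) b' + \<delta> x b (\<Gamma> x t b')) \<le> (norm t * K) * m y + (norm t * K) * m y"
          unfolding real_norm_def by (rule order_trans[OF abs_triangle_ineq add_mono[OF 1 2]])
        also have "\<dots> = 2 * (K * m y) * norm t" by (simp add: algebra_simps)
        finally show "norm (\<delta> x (\<Gamma> x t b) b' + \<delta> x b (\<Gamma> x t b')) \<le> 2 * (K * m y) * norm t" .
      qed
    qed (use x r in auto)
    also have "\<dots> \<le> (2 * (K * m y)) * r"
      using x K0 m0[of y] by (intro mult_left_mono) (auto simp: dist_norm norm_minus_commute)
    finally show ?thesis by (simp add: zero)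
  qed
  have "(\<Sum>b\<in>?B. \<Sum>b'\<in>?B. \<bar>\<delta> y b b'\<bar>) \<le> (\<Sum>b\<in>?B. \<Sum>b'\<in>?B. 2 * (K * m y) * r)"
    by (intro sum_mono bound y1)
  then have "m y \<le> (\<Sum>b\<in>?B. \<Sum>b'\<in>?B. 2 * (K * m y) * r)" by (simp only: m_def)
  also have "\<dots> = (4 * (N * N * K) * r) * (m y / 2)" by (simp add: N_def ac_simps)
  also have "\<dots> \<le> 1 * (m y / 2)" using rK m0[of y] by (intro mult_right_mono) auto
  finally have "m y = 0" using m0[of y] by simp
  have "\<delta> x u v = 0" if x: "x \<in> ball c r" for x u v
  proof -
    have xr: "x \<in> cball c r" and xS: "x \<in> S" using x rS ball_subset_cball by blast+
    have b0: "\<delta> x b b' = 0" if "b \<in> ?B" "b' \<in> ?B" for b b'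
      using bound[OF xr that] \<open>m y = 0\<close> by simp
    have b1: "\<delta> x b v = 0" if "b \<in> ?B" for b
    proof -
      have "\<delta> x b v = (\<Sum>b'\<in>?B. (v \<bullet> b') *\<^sub>R \<delta> x b b')" by (rule linear_euclidean_expansion[OF lin(2)[OF xS]])
      also have "\<dots> = 0" using b0 that by (intro sum.neutral) auto
      finally show ?thesis .
    qed
    have "\<delta> x u v = (\<Sum>b\<in>?B. (u \<bullet> b) *\<^sub>R \<delta> x b v)" by (rule linear_euclidean_expansion[OF lin(1)[OF xS]])
    also have "\<dots> = 0" using b1 by (intro sum.neutral) auto
    finally show ?thesis .
  qed
  moreover have "ball c r \<subseteq> S" using rS ball_subset_cball by blast
  ultimately show thesis using that[OF r(1)] by blast
qed

lemma Im_holomorphic_derivative: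
  assumes f: "holomorphic_fun S f" and x: "x \<in> S"
  shows "Im (frechet_derivative f (at x) v) = - Re (frechet_derivative f (at x) (\<i> *s v))"
  using holomorphic_fun_derivative_scale[OF f x, of \<i> v] by simp

lemma cpartial_cong:
  assumes f: "holomorphic_fun S f" and S: "open S" "x \<in> S" and eq: "\<And>y. y \<in> S \<Longrightarrow> f y = g y"
  shows "cpartial i f x = cpartial i g x"
proof -
  have g: "holomorphic_fun S g" using holomorphic_fun_cong[of S f g] eq f by blast
  have "(g has_derivative frechet_derivative f (at x)) (at x)"
    using has_derivative_transform_within_open[OF holomorphic_fun_has_derivative[OF f S(2)] S eq] .
  from frechet_derivative_at[OF this] show ?thesis
    using holomorphic_fun_derivative_cpartial(1)[OF f S(2)] holomorphic_fun_derivative_cpartial(1)[OF g S(2)] by metis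
qed

text \<open>In a chart, the form \<open>2 \<Sum> dx \<and> dy\<close> with \<open>x\<close>,
  \<open>y\<close> the real parts of \<open>Z\<close>, \<open>W\<close>.\<close>

definition coord_form :: "('n::finite \<Rightarrow> complex^'n \<Rightarrow> complex) \<Rightarrow> ('n \<Rightarrow> complex^'n \<Rightarrow> complex) \<Rightarrow>
    complex^'n \<Rightarrow> complex^'n \<Rightarrow> complex^'n \<Rightarrow> real" where
  "coord_form Z W x u v = 2 * (\<Sum>i\<in>UNIV.
     Re (frechet_derivative (Z i) (at x) u) * Re (frechet_derivative (W i) (at x) v) -
     Re (frechet_derivative (W i) (at x) u) * Re (frechet_derivative (Z i) (at x) v))"

lemma special_kahler_affine_coordinates:
  fixes \<Gamma> :: "complex^'n::finite \<Rightarrow> complex^'n \<Rightarrow> complex^'n \<Rightarrow> complex^'n"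
    and \<Omega> :: "complex^'n \<Rightarrow> complex^'n \<Rightarrow> complex^'n \<Rightarrow> real"
  assumes S: "open S" "c \<in> S"
    and lin: "\<And>x u. x \<in> S \<Longrightarrow> linear (\<Gamma> x u)" "\<And>x v. x \<in> S \<Longrightarrow> linear (\<lambda>u. \<Gamma> x u v)"
    and smooth: "\<And>u v. smooth_on S (\<lambda>x. \<Gamma> x u v)"
    and sym: "\<And>x u v. x \<in> S \<Longrightarrow> \<Gamma> x u v = \<Gamma> x v u"
    and J: "\<And>x u v. x \<in> S \<Longrightarrow> \<Gamma> x u (\<i> *s v) = \<Gamma> x v (\<i> *s u)"
    and flat: "\<And>x u v w. x \<in> S \<Longrightarrow>
      frechet_derivative (\<lambda>y. \<Gamma> y v w) (at x) u + \<Gamma> x u (\<Gamma> x v w) =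
      frechet_derivative (\<lambda>y. \<Gamma> y u w) (at x) v + \<Gamma> x v (\<Gamma> x u w)"
    and \<Omega>_lin: "\<And>x v. x \<in> S \<Longrightarrow> linear (\<lambda>u. \<Omega> x u v)"
    and skew: "\<And>x u v. x \<in> S \<Longrightarrow> \<Omega> x u v = - \<Omega> x v u"
    and \<Omega>_J: "\<And>x u v. x \<in> S \<Longrightarrow> \<Omega> x (\<i> *s u) (\<i> *s v) = \<Omega> x u v"
    and nondegenerate: "\<And>x v. x \<in> S \<Longrightarrow> (\<And>w. \<Omega> x v w = 0) \<Longrightarrow> v = 0"
    and parallel: "\<And>x u v. x \<in> S \<Longrightarrow>
      ((\<lambda>x. \<Omega> x u v) has_derivative (\<lambda>t. \<Omega> x (\<Gamma> x t u) v + \<Omega> x u (\<Gamma> x t v))) (at x)"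
  obtains r Z W where "r > 0" "ball c r \<subseteq> S"
    "\<And>i :: 'n. holomorphic_fun (ball c r) (Z i)" "\<And>i :: 'n. holomorphic_fun (ball c r) (W i)"
    "\<And>v. (\<And>i. frechet_derivative (Z i) (at c) v = 0) \<Longrightarrow> v = 0"
    "\<And>i x w. x \<in> ball c r \<Longrightarrow> ((\<lambda>x. Re (frechet_derivative (Z i) (at x) w)) has_derivative
        (\<lambda>v. Re (frechet_derivative (Z i) (at x) (\<Gamma> x v w)))) (at x)"
    "\<And>i x w. x \<in> ball c r \<Longrightarrow> ((\<lambda>x. Re (frechet_derivative (W i) (at x) w)) has_derivative
        (\<lambda>v. Re (frechet_derivative (W i) (at x) (\<Gamma> x v w)))) (at x)"
    "\<And>x u v. x \<in> ball c r \<Longrightarrow> \<Omega> x u v = coord_form Z W x u v"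
proof -
  obtain r1 where r1: "r1 > 0" "ball c r1 \<subseteq> S" and aff:
    "\<And>\<alpha>. \<exists>Z. holomorphic_fun (ball c r1) Z \<and> (\<forall>w. Re (frechet_derivative Z (at c) w) = \<alpha> \<bullet> w) \<and>
      (\<forall>x\<in>ball c r1. \<forall>w. ((\<lambda>x. Re (frechet_derivative Z (at x) w)) has_derivative
        (\<lambda>v. Re (frechet_derivative Z (at x) (\<Gamma> x v w)))) (at x))"
    by (rule affine_holomorphic_functions[where \<Gamma> = \<Gamma>, OF S lin smooth sym J flat]) (assumption | rule that)+
  obtain L :: "complex^'n \<Rightarrow> complex^'n" and \<epsilon> :: "'n \<Rightarrow> real" where L: "linear L" "\<And>k v. L (k *s v) = k *s L v" "\<And>v. L v = 0 \<Longrightarrow> v = 0"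
    and \<Omega>c: "\<And>u v. \<Omega> c u v = (\<Sum>i\<in>UNIV. \<epsilon> i * (Im (L u $ i) * Re (L v $ i) - Re (L u $ i) * Im (L v $ i)))"
    by (rule hermitian_diagonalization[of "\<Omega> c", OF \<Omega>_lin[OF S(2)] skew[OF S(2)] \<Omega>_J[OF S(2)] nondegenerate[OF S(2)]]) (assumption | rule that)+
  \<comment> \<open>\<open>Z\<close> is holomorphic with affine real part whose differential at
    \<open>c\<close> is the prescribed real linear form \<open>f\<close>; \<open>Q_ex\<close>
    converts \<open>f\<close> to the vector representing it.\<close>
  define Q where "Q f Z \<longleftrightarrow> holomorphic_fun (ball c r1) Z \<and> (\<forall>w. Re (frechet_derivative Z (at c) w) = f w) \<and>
      (\<forall>x\<in>ball c r1. \<forall>w. ((\<lambda>x. Re (frechet_derivative Z (at x) w)) has_derivative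
        (\<lambda>v. Re (frechet_derivative Z (at x) (\<Gamma> x v w)))) (at x))" for f and Z :: "complex^'n \<Rightarrow> complex"
  have Q_ex: "\<exists>Z. Q f Z" if "linear f" for f
  proof -
    have "(\<Sum>b\<in>Basis. f b *\<^sub>R b) \<bullet> w = f w" for w
    proof -
      have "(\<Sum>b\<in>Basis. f b *\<^sub>R b) \<bullet> w = (\<Sum>b\<in>Basis. f b * (b \<bullet> w))" by (simp add: inner_sum_left)
      also have "\<dots> = (\<Sum>b\<in>Basis. (w \<bullet> b) *\<^sub>R f b)" by (simp add: inner_commute mult.commute)
      also have "\<dots> = f w" by (rule linear_euclidean_expansion[OF that, symmetric])
      finally show ?thesis .
    qed
    then show ?thesis using aff[of "\<Sum>b\<in>Basis. f b *\<^sub>R b"] by (simp add: Q_def)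
  qed
  have lin1: "linear (\<lambda>w. Re (L w $ i))" and lin2: "linear (\<lambda>w. - (\<epsilon> i / 2) * Im (L w $ i))" for i
    by (rule linearI; simp add: linear_add[OF L(1)] linear_cmul[OF L(1)] algebra_simps)+
  have "\<forall>i. \<exists>Z. Q (\<lambda>w. Re (L w $ i)) Z" by (intro allI Q_ex lin1)
  then obtain Z where QZ: "\<forall>i. Q (\<lambda>w. Re (L w $ i)) (Z i)" by (rule choice[THEN exE])
  have Z: "holomorphic_fun (ball c r1) (Z i)" "Re (frechet_derivative (Z i) (at c) w) = Re (L w $ i)"
    "x \<in> ball c r1 \<Longrightarrow> ((\<lambda>x. Re (frechet_derivative (Z i) (at x) w)) has_derivative
        (\<lambda>v. Re (frechet_derivative (Z i) (at x) (\<Gamma> x v w)))) (at x)" for i x w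
    using QZ[THEN spec, of i] unfolding Q_def by auto
  \<comment> \<open>The factor \<open>- \<epsilon> i / 2\<close> absorbs the 2 of
    \<open>coord_form\<close>, so that the two forms agree at \<open>c\<close>. It amounts to making
    the differential of \<open>W i\<close> at \<open>c\<close> equal to
    \<open>\<i> * \<epsilon> i / 2\<close> times that of \<open>Z i\<close>.\<close>
  have "\<forall>i. \<exists>W. Q (\<lambda>w. - (\<epsilon> i / 2) * Im (L w $ i)) W" by (intro allI Q_ex lin2)
  then obtain W where QW: "\<forall>i. Q (\<lambda>w. - (\<epsilon> i / 2) * Im (L w $ i)) (W i)" by (rule choice[THEN exE])
  have W: "holomorphic_fun (ball c r1) (W i)" "Re (frechet_derivative (W i) (at c) w) = - (\<epsilon> i / 2) * Im (L w $ i)"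
    "x \<in> ball c r1 \<Longrightarrow> ((\<lambda>x. Re (frechet_derivative (W i) (at x) w)) has_derivative
        (\<lambda>v. Re (frechet_derivative (W i) (at x) (\<Gamma> x v w)))) (at x)" for i x w
    using QW[THEN spec, of i] unfolding Q_def by auto
  have cr1: "c \<in> ball c r1" using r1 by simp
  have Zc: "frechet_derivative (Z i) (at c) v = L v $ i" for i v
    using Z(2)[of i v] Im_holomorphic_derivative[OF Z(1) cr1, of i v] Z(2)[of i "\<i> *s v"] by (simp add: complex_eq_iff L)
  define \<delta> where "\<delta> x u v = \<Omega> x u v - coord_form Z W x u v" for x u v
  have d_lin: "linear (frechet_derivative f (at x))" if "holomorphic_fun (ball c r1) f" "x \<in> ball c r1" for f :: "complex^'n \<Rightarrow> complex" and x
    using holomorphic_fun_has_derivative[OF that] by (rule has_derivative_linear)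
  have form_lin: "linear (\<lambda>u. coord_form Z W x u v)" if "x \<in> ball c r1" for x v
    unfolding coord_form_def
    by (rule linearI) (simp_all add: linear_add[OF d_lin[OF Z(1) that]] linear_add[OF d_lin[OF W(1) that]]
        linear_cmul[OF d_lin[OF Z(1) that]] linear_cmul[OF d_lin[OF W(1) that]] algebra_simps sum.distrib sum_subtractf sum_distrib_left)
  have form_skew: "coord_form Z W x u v = - coord_form Z W x v u" for x u v
    unfolding coord_form_def by (simp add: sum_subtractf mult.commute)
  have \<delta>_lin: "linear (\<lambda>u. \<delta> x u v)" if "x \<in> ball c r1" for x v
    unfolding \<delta>_def using that r1 by (intro linear_compose_sub \<Omega>_lin form_lin) auto
  have \<delta>_skew: "\<delta> x u v = - \<delta> x v u" if "x \<in> ball c r1" for x u v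
    unfolding \<delta>_def using skew[of x u v] form_skew[of x u v] that r1 by auto
  have \<delta>_lin': "linear (\<delta> x u)" if "x \<in> ball c r1" for x u
  proof -
    have "\<delta> x u = (\<lambda>v. - \<delta> x v u)" by (rule ext) (rule \<delta>_skew[OF that])
    then show ?thesis using linear_compose_neg[OF \<delta>_lin[OF that, of u]] by simp
  qed
  have \<delta>_deriv: "((\<lambda>x. \<delta> x u v) has_derivative (\<lambda>t. \<delta> x (\<Gamma> x t u) v + \<delta> x u (\<Gamma> x t v))) (at x)"
    if x: "x \<in> ball c r1" for x u v
  proof -
    let ?z = "\<lambda>i x u. Re (frechet_derivative (Z i) (at x) u)" and ?w = "\<lambda>i x u. Re (frechet_derivative (W i) (at x) u)"
    have "((\<lambda>x. coord_form Z W x u v) has_derivative (\<lambda>t. 2 * (\<Sum>i\<in>UNIV.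
        (?z i x u * ?w i x (\<Gamma> x t v) + ?z i x (\<Gamma> x t u) * ?w i x v) -
        (?w i x u * ?z i x (\<Gamma> x t v) + ?w i x (\<Gamma> x t u) * ?z i x v)))) (at x)"
      unfolding coord_form_def
      by (intro has_derivative_mult_right has_derivative_sum has_derivative_diff has_derivative_mult Z(3) W(3) x)
    then have "((\<lambda>x. coord_form Z W x u v) has_derivative (\<lambda>t. coord_form Z W x (\<Gamma> x t u) v + coord_form Z W x u (\<Gamma> x t v))) (at x)"
      by (rule has_derivative_eq_rhs) (simp add: coord_form_def fun_eq_iff sum.distrib sum_subtractf algebra_simps)
    from has_derivative_diff[OF parallel this] x r1
    have "((\<lambda>x. \<delta> x u v) has_derivative (\<lambda>t. \<Omega> x (\<Gamma> x t u) v + \<Omega> x u (\<Gamma> x t v) -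
        (coord_form Z W x (\<Gamma> x t u) v + coord_form Z W x u (\<Gamma> x t v)))) (at x)"
      unfolding \<delta>_def by auto
    then show ?thesis by (rule has_derivative_eq_rhs) (simp add: \<delta>_def fun_eq_iff)
  qed
  have \<delta>_zero: "\<delta> c u v = 0" for u v
    unfolding \<delta>_def \<Omega>c coord_form_def Z(2) W(2) by (simp add: sum_distrib_left sum_subtractf algebra_simps)
  have \<Gamma>_cont: "continuous_on (ball c r1) (\<lambda>x. \<Gamma> x u v)" for u v
    using continuous_on_subset[OF smooth_on_continuous_on[OF smooth] r1(2)] .
  have \<Gamma>_lin: "linear (\<lambda>u. \<Gamma> x u v)" if "x \<in> ball c r1" for x v
    using lin(2) that r1 by blast
  obtain r where r: "r > 0" "ball c r \<subseteq> ball c r1" "\<And>x u v. x \<in> ball c r \<Longrightarrow> \<delta> x u v = 0"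
    by (rule parallel_form_zero[where \<delta> = \<delta> and \<Gamma> = \<Gamma>, OF open_ball cr1 \<delta>_lin \<delta>_lin' \<Gamma>_lin \<Gamma>_cont \<delta>_deriv \<delta>_zero]) (assumption | rule that)+
  show thesis
  proof (rule that[of r Z W])
    show "ball c r \<subseteq> S" using r(2) r1(2) by blast
    show "holomorphic_fun (ball c r) (Z i)" "holomorphic_fun (ball c r) (W i)" for i
      using holomorphic_fun_subset[OF Z(1) open_ball r(2)] holomorphic_fun_subset[OF W(1) open_ball r(2)] .
    show "v = 0" if "\<And>i. frechet_derivative (Z i) (at c) v = 0" for v
    proof (rule L(3))
      show "L v = 0" using that by (simp add: Zc vec_eq_iff)
    qed
    show "\<Omega> x u v = coord_form Z W x u v" if "x \<in> ball c r" for x u v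
      using r(3)[OF that, of u v] by (simp add: \<delta>_def)
    show "((\<lambda>x. Re (frechet_derivative (Z i) (at x) w)) has_derivative
        (\<lambda>v. Re (frechet_derivative (Z i) (at x) (\<Gamma> x v w)))) (at x)"
      "((\<lambda>x. Re (frechet_derivative (W i) (at x) w)) has_derivative
        (\<lambda>v. Re (frechet_derivative (W i) (at x) (\<Gamma> x v w)))) (at x)" if "x \<in> ball c r" for i x w
      using Z(3)[OF subsetD[OF r(2) that]] W(3)[OF subsetD[OF r(2) that]] .
  qed (rule r(1))
qed

text \<open>Since \<open>dZ\<close> is invertible at \<open>c\<close>, the image of
  \<open>(Z, W)\<close> is a graph over \<open>z\<close>-space nearby. Invariance under
  \<open>\<i>\<close> makes it Lagrangian for the complex symplectic form, and a Lagrangian graph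
  over a ball is the graph of a differential.\<close>

lemma special_kahler_potential:
  fixes Z W :: "'n::finite \<Rightarrow> complex^'n \<Rightarrow> complex"
  assumes B: "open B" "c \<in> B"
    and Z: "\<And>i. holomorphic_fun B (Z i)" and W: "\<And>i. holomorphic_fun B (W i)"
    and inj: "\<And>v. (\<And>i. frechet_derivative (Z i) (at c) v = 0) \<Longrightarrow> v = 0"
    and J: "\<And>x u v. x \<in> B \<Longrightarrow> coord_form Z W x (\<i> *s u) (\<i> *s v) = coord_form Z W x u v"
    and nondegenerate: "\<And>x v. x \<in> B \<Longrightarrow> (\<And>w. coord_form Z W x v w = 0) \<Longrightarrow> v = 0"
  obtains G U h F where "open G" "c \<in> G" "G \<subseteq> B" "open U" "homeomorphism G U (\<lambda>x. \<chi> i. Z i x) h"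
    "\<And>i. holomorphic_fun U (\<lambda>y. h y $ i)" "nondegenerate_holomorphic U F"
    "\<And>x i. x \<in> G \<Longrightarrow> cpartial i F (\<chi> i. Z i x) = W i x"
proof -
  let ?z = "\<lambda>x. \<chi> i. Z i x"
  have Z': "holomorphic_fun B (\<lambda>x. ?z x $ i)" for i using Z by simp
  have inj': "v = 0" if "\<And>i. frechet_derivative (\<lambda>x. ?z x $ i) (at c) v = 0" for v
    using that by (intro inj) simp
  obtain U1 V1 h where U1: "open U1" "U1 \<subseteq> B" "c \<in> U1" "open V1" and hom: "homeomorphism U1 V1 ?z h"
    and h: "\<And>i. holomorphic_fun V1 (\<lambda>y. h y $ i)"
    by (rule holomorphic_local_inverse[OF Z' B(2) inj']) (assumption | rule that)+
  have zh: "?z (h y) = y" "h y \<in> U1" if "y \<in> V1" for y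
    using hom that by (auto simp: homeomorphism_def)
  have hz: "h (?z x) = x" "?z x \<in> V1" if "x \<in> U1" for x
    using hom that by (auto simp: homeomorphism_def)
  \<comment> \<open>The potential is found by integration along rays in \<open>z\<close>-space, so
    the target is shrunk to a ball and \<open>G\<close> is the corresponding part of the
    source.\<close>
  obtain \<rho> where \<rho>: "\<rho> > 0" "ball (?z c) \<rho> \<subseteq> V1"
    using open_contains_ball[of V1] U1(4) hz(2)[OF U1(3)] by blast
  define U where "U = ball (?z c) \<rho>"
  define G where "G = h ` U"
  have UV: "U \<subseteq> V1" "open U" using \<rho> by (auto simp: U_def)
  have G_eq: "G = {x \<in> U1. ?z x \<in> U}"
  proof
    show "G \<subseteq> {x \<in> U1. ?z x \<in> U}" unfolding G_def using zh UV by force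
    show "{x \<in> U1. ?z x \<in> U} \<subseteq> G" unfolding G_def using hz(1) by force
  qed
  have "continuous_on U1 ?z" using hom by (simp add: homeomorphism_def)
  then have "open (U1 \<inter> ?z -` U)" using U1(1) UV(2) by (rule continuous_open_preimage)
  moreover have "U1 \<inter> ?z -` U = G" unfolding G_eq by auto
  ultimately have G: "open G" by simp
  have GU1: "G \<subseteq> U1" unfolding G_eq by auto
  have cG: "c \<in> G" unfolding G_eq using U1(3) \<rho>(1) by (simp add: U_def)
  have homG: "homeomorphism G U ?z h"
  proof (rule homeomorphism_of_subsets[OF hom GU1 UV(1)])
    have "?z (h y) = y" if "y \<in> U" for y using zh(1) that UV(1) by blast
    then show "?z ` G = U" unfolding G_def image_image by simp
  qed
  define H where "H y a = (\<chi> i. frechet_derivative (\<lambda>y. h y $ i) (at y) a)" for y a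
  have hD: "(h has_derivative H y) (at y)" if "y \<in> V1" for y
    by (rule has_derivative_vecI) (use holomorphic_fun_has_derivative[OF h that] in \<open>simp add: H_def\<close>)
  have H_smult: "H y (k *s a) = k *s H y a" if "y \<in> V1" for y k a
    by (simp add: H_def vec_eq_iff holomorphic_fun_derivative_scale[OF h that])
  have comp_deriv: "((\<lambda>y. f (h y)) has_derivative (\<lambda>a. frechet_derivative f (at (h y)) (H y a))) (at y)"
    if "holomorphic_fun B f" "y \<in> V1" for f :: "complex^'n \<Rightarrow> complex" and y
    using has_derivative_compose[OF hD[OF that(2)] holomorphic_fun_has_derivative[OF that(1)]] zh(2)[OF that(2)] U1(2) by blast
  have ZH: "frechet_derivative (Z i) (at (h y)) (H y a) = a $ i" if y: "y \<in> V1" for i y a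
  proof -
    have "((\<lambda>y. y $ i) has_derivative (\<lambda>a. frechet_derivative (Z i) (at (h y)) (H y a))) (at y)"
    proof (rule has_derivative_transform_within_open[OF comp_deriv[OF Z y] U1(4) y])
      show "Z i (h y) = y $ i" if "y \<in> V1" for y using zh(1)[OF that] by (metis vec_lambda_beta)
    qed
    then show ?thesis
      using has_derivative_unique[OF _ bounded_linear_imp_has_derivative[OF bounded_linear_vec_nth]] by metis
  qed
  define w where "w y = (\<chi> i. W i (h y))" for y
  have w: "holomorphic_fun U (\<lambda>y. w y $ i)" for i
    unfolding w_def vec_lambda_beta
    by (rule holomorphic_fun_subset[OF holomorphic_fun_compose[OF W h] UV(2,1)]) (use zh U1 in auto)
  have wD: "frechet_derivative (\<lambda>y. w y $ i) (at y) a = frechet_derivative (W i) (at (h y)) (H y a)" if "y \<in> U" for i y a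
  proof -
    have "y \<in> V1" using that UV by blast
    from fun_cong[OF frechet_derivative_at[OF comp_deriv[OF W this]]] show ?thesis by (simp add: w_def)
  qed
  \<comment> \<open>The real part of \<open>\<Sum> dz \<and> dw\<close> is half the difference of
    \<open>coord_form\<close> at \<open>(u, v)\<close> and at \<open>(\<i> *s u, \<i> *s v)\<close>,
    hence 0. By complex linearity the imaginary part is minus the real part at
    \<open>\<i> *s u\<close>, so it vanishes as well.\<close>
  have lagrange: "(\<Sum>i\<in>UNIV. frechet_derivative (Z i) (at x) u * frechet_derivative (W i) (at x) v -
      frechet_derivative (W i) (at x) u * frechet_derivative (Z i) (at x) v) = 0" (is "?C u v = 0")
    if x: "x \<in> B" for x u v
  proof -
    have Re0: "Re (?C u v) = 0" for u v
    proof -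
      have "Re (?C u v) = coord_form Z W x u v / 2 - coord_form Z W x (\<i> *s u) (\<i> *s v) / 2"
      proof -
        have cf: "coord_form Z W x u v / 2 = (\<Sum>i\<in>UNIV.
            Re (frechet_derivative (Z i) (at x) u) * Re (frechet_derivative (W i) (at x) v) -
            Re (frechet_derivative (W i) (at x) u) * Re (frechet_derivative (Z i) (at x) v))" for u v
          by (simp add: coord_form_def)
        show ?thesis unfolding cf
          by (simp add: Im_holomorphic_derivative[OF Z x] Im_holomorphic_derivative[OF W x] sum_subtractf algebra_simps)
      qed
      then show ?thesis using J[OF x] by simp
    qed
    have "?C (\<i> *s u) v = \<i> * ?C u v"
      by (simp add: holomorphic_fun_derivative_scale[OF Z x] holomorphic_fun_derivative_scale[OF W x]
          sum_distrib_left sum_subtractf algebra_simps)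
    then have "Im (?C u v) = - Re (?C (\<i> *s u) v)" by simp
    then show ?thesis using Re0 by (simp add: complex_eq_iff)
  qed
  have D_axis: "(\<Sum>k\<in>UNIV. axis i 1 $ k * g k - f k * axis j 1 $ k) = g i - f j" for f g :: "'n \<Rightarrow> complex" and i j
  proof -
    have "(\<Sum>k\<in>UNIV. axis i 1 $ k * g k - f k * axis j 1 $ k) = (\<Sum>k\<in>UNIV. (if k = i then g k else 0) - (if k = j then f k else 0))"
      by (intro sum.cong) (auto simp: axis_def)
    then show ?thesis by (simp add: sum_subtractf)
  qed
  \<comment> \<open>\<open>H y\<close> inverts the differential of \<open>Z\<close>, so on the
    images of two unit vectors under it the Lagrangian condition is the equality of the mixed
    partial derivatives of \<open>w\<close>.\<close>
  have closed: "cpartial j (\<lambda>y. w y $ i) y = cpartial i (\<lambda>y. w y $ j) y" if y: "y \<in> U" for y i j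
  proof -
    have yV: "y \<in> V1" and hyB: "h y \<in> B" using y UV zh U1 by blast+
    have "frechet_derivative (\<lambda>y. w y $ i) (at y) (axis j 1) - frechet_derivative (\<lambda>y. w y $ j) (at y) (axis i 1) = 0"
      using lagrange[OF hyB, of "H y (axis i 1)" "H y (axis j 1)"]
      by (simp only: ZH[OF yV] wD[OF y] D_axis)
    then show ?thesis using holomorphic_fun_derivative_cpartial(1)[OF w y] by simp
  qed
  obtain F where F: "holomorphic_fun U F" "\<And>y i. y \<in> U \<Longrightarrow> cpartial i F y = w y $ i"
    by (rule holomorphic_poincare[of "?z c" \<rho> w, folded U_def, OF w closed]) (assumption | rule that)+
  have F2: "cpartial i (cpartial j F) y = cpartial i (\<lambda>y. w y $ j) y" if y: "y \<in> U" for y i j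
    using cpartial_cong[OF holomorphic_fun_cpartial[OF F(1)] UV(2) y F(2)] .
  have inv: "invertible ((\<chi> i j. Im (cpartial i (cpartial j F) y)) :: real^'n^'n)" if y: "y \<in> U" for y
  proof -
    let ?T = "(\<chi> i j. Im (cpartial i (cpartial j F) y)) :: real^'n^'n"
    have yV: "y \<in> V1" and hyB: "h y \<in> B" using y UV zh U1 by blast+
    have "a = 0" if a: "?T *v a = 0" for a
    proof -
      let ?a = "\<chi> i. complex_of_real (a $ i)"
      \<comment> \<open>A real kernel vector \<open>a\<close> of the imaginary Hessian, multiplied
        by \<open>\<i>\<close>, has \<open>Re dz = 0\<close> and \<open>Re dw = 0\<close>. The
        corresponding \<open>?u\<close> pairs to zero with everything, so nondegeneracy of the form
        kills it.\<close>
      let ?u = "H y (\<i> *s ?a)"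
      have dz: "Re (frechet_derivative (Z i) (at (h y)) ?u) = 0" for i
        by (simp add: ZH[OF yV])
      have dw: "Re (frechet_derivative (W i) (at (h y)) ?u) = 0" for i
      proof -
        have "frechet_derivative (W i) (at (h y)) ?u = (\<Sum>j\<in>UNIV. (\<i> *s ?a) $ j * cpartial j (\<lambda>y. w y $ i) y)"
          using wD[OF y] holomorphic_fun_derivative_cpartial(2)[OF w y] by metis
        also have "Re \<dots> = - (\<Sum>j\<in>UNIV. Im (cpartial i (cpartial j F) y) * a $ j)"
          using closed[OF y, of _ i] by (simp add: F2[OF y] Re_sum sum_negf mult.commute)
        also have "\<dots> = - ((?T *v a) $ i)" by (simp add: matrix_vector_mult_def)
        finally show ?thesis using a by simp
      qed
      have u0: "?u = 0" by (rule nondegenerate[OF hyB]) (simp add: coord_form_def dz dw)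
      have "(\<i> *s ?a) $ i = 0" for i
        using ZH[OF yV, of i "\<i> *s ?a"] linear_0[OF has_derivative_linear[OF holomorphic_fun_has_derivative[OF Z[of i] hyB]]]
        unfolding u0 by simp
      then show ?thesis by (simp add: vec_eq_iff)
    qed
    then show ?thesis by (simp add: invertible_left_inverse matrix_left_invertible_ker)
  qed
  show thesis
  proof (rule that[OF G cG _ UV(2) homG])
    show "G \<subseteq> B" using GU1 U1(2) by blast
    show "holomorphic_fun U (\<lambda>y. h y $ i)" for i by (rule holomorphic_fun_subset[OF h UV(2,1)])
    show "nondegenerate_holomorphic U F" unfolding nondegenerate_holomorphic_def by (intro conjI ballI F(1) inv)
    show "cpartial i F (?z x) = W i x" if "x \<in> G" for x i
      using that G_eq F(2)[of "?z x" i] hz(1)[of x] by (auto simp: w_def)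
  qed
qed

section \<open>Christoffel symbols\<close>

context complex_manifold
begin

section \<open>Combinations of fields and constant fields in a chart\<close>

lemma smooth_vfield_vf_add:
  assumes X: "smooth_vfield M A W X" and Y: "smooth_vfield M A W Y"
  shows "smooth_vfield M A W (vf_add X Y)"
  unfolding smooth_vfield_def
proof (intro conjI ballI allI impI smooth_vfield_openin[OF X])
  fix p assume p: "p \<in> W"
  then have "p \<in> topspace M" using openin_subset[OF smooth_vfield_openin[OF X]] by blast
  from tangent_space_combination[OF this smooth_vfield_tangent[OF X p] smooth_vfield_tangent[OF Y p], of 1 1]
  show "vf_add X Y p \<in> tangent_space M A p" by (simp add: vf_add_def)
next
  fix V f assume "V \<subseteq> W \<and> smooth_fun M A V f"
  then have V: "V \<subseteq> W" "smooth_fun M A V f" by auto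
  show "smooth_fun M A V (\<lambda>p. vf_add X Y p f)"
    unfolding vf_add_def by (intro smooth_fun_add smooth_vfield_fun[OF X V] smooth_vfield_fun[OF Y V])
qed

lemma smooth_vfield_vf_scale:
  assumes h: "smooth_fun M A W h" and X: "smooth_vfield M A W X"
  shows "smooth_vfield M A W (vf_scale h X)"
  unfolding smooth_vfield_def
proof (intro conjI ballI allI impI smooth_vfield_openin[OF X])
  fix p assume p: "p \<in> W"
  then have "p \<in> topspace M" using openin_subset[OF smooth_vfield_openin[OF X]] by blast
  from tangent_space_combination[OF this smooth_vfield_tangent[OF X p] smooth_vfield_tangent[OF X p], of "h p" 0]
  show "vf_scale h X p \<in> tangent_space M A p" by (simp add: vf_scale_def)
next
  fix V f assume "V \<subseteq> W \<and> smooth_fun M A V f"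
  then have V: "V \<subseteq> W" "smooth_fun M A V f" by auto
  show "smooth_fun M A V (\<lambda>p. vf_scale h X p f)"
    unfolding vf_scale_def
    by (intro smooth_fun_mult smooth_vfield_fun[OF X V] smooth_fun_subset[OF h smooth_fun_openin[OF V(2)] V(1)])
qed

lemma smooth_vfield_zero:
  assumes "openin M W"
  shows "smooth_vfield M A W (\<lambda>p f. 0)"
  unfolding smooth_vfield_def
proof (intro conjI ballI allI impI assms)
  fix p assume "p \<in> W"
  then obtain c where c: "c \<in> A" "p \<in> fst c" using chart_exists openin_subset[OF assms] by blast
  have "chart_vec M A c p 0 = (\<lambda>f. 0)" by (rule ext) (rule linear_0[OF chart_vec_linear[OF c]])
  then show "(\<lambda>f. 0) \<in> tangent_space M A p" unfolding tangent_space_chart[OF c] by (metis rangeI)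
next
  fix V and f :: "'a \<Rightarrow> real" assume "V \<subseteq> W \<and> smooth_fun M A V f"
  then show "smooth_fun M A V (\<lambda>p. 0)" by (intro smooth_fun_const) (auto intro: smooth_fun_openin)
qed

abbreviation const_vfield :: "('a, 'n) chart \<Rightarrow> complex^'n \<Rightarrow> 'a vfield" where
  "const_vfield c u \<equiv> (\<lambda>p. chart_vec M A c p u)"

lemma const_vfield_comp:
  "c \<in> A \<Longrightarrow> z \<in> snd c ` fst c \<Longrightarrow> chart_comp c (const_vfield c u (inv_chart c z)) = u"
  by (rule chart_comp_chart_vec) (auto intro: inv_chart_mem[OF _ order_refl])

lemma const_vfield_comp_derivative:
  assumes c: "c \<in> A" and z: "z \<in> snd c ` fst c"
  shows "frechet_derivative (\<lambda>z. chart_comp c (const_vfield c u (inv_chart c z))) (at z) = (\<lambda>v. 0)"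
proof -
  have "((\<lambda>z. chart_comp c (const_vfield c u (inv_chart c z))) has_derivative (\<lambda>v. 0)) (at z)"
    by (rule has_derivative_transform_within_open[OF has_derivative_const chart_image[OF c] z])
      (rule const_vfield_comp[OF c, symmetric])
  from frechet_derivative_at[OF this] show ?thesis by simp
qed

lemma smooth_const_vfield:
  assumes c: "c \<in> A"
  shows "smooth_vfield M A (fst c) (const_vfield c u)"
proof (rule smooth_vfield_chartI[OF c chart_domain[OF c] order_refl])
  show "const_vfield c u p \<in> tangent_space M A p" if "p \<in> fst c" for p
    unfolding tangent_space_chart[OF c that] by blast
  show "smooth_on (snd c ` fst c) (\<lambda>z. chart_comp c (const_vfield c u (inv_chart c z)))"
    by (rule smooth_on_cong[THEN iffD1, OF _ smooth_on_const[OF chart_image[OF c]]])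
      (rule const_vfield_comp[OF c, symmetric])
qed

lemma chart_vec_zero: "c \<in> A \<Longrightarrow> p \<in> fst c \<Longrightarrow> chart_vec M A c p 0 = (\<lambda>f. 0)"
  by (rule ext) (rule linear_0[OF chart_vec_linear])

lemma lie_bracket_const_vfield:
  assumes c: "c \<in> A" "p \<in> fst c"
  shows "lie_bracket M A (const_vfield c u) (const_vfield c v) p = (\<lambda>f. 0)"
proof -
  have "snd c p \<in> snd c ` fst c" using c by blast
  then show ?thesis
    unfolding lie_bracket_chart[OF smooth_const_vfield[OF c(1)] smooth_const_vfield[OF c(1)] c(2) c]
    by (simp add: const_vfield_comp_derivative[OF c(1)] chart_vec_zero[OF c])
qed

lemma vfield_chart_expansion:
  assumes c: "c \<in> A" "q \<in> fst c" and v: "v \<in> tangent_space M A q"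
  shows "v f = (\<Sum>b\<in>Basis. (chart_comp c v \<bullet> b) * const_vfield c b q f)"
  using linear_euclidean_expansion[OF chart_vec_linear[OF c, of f], of "chart_comp c v"]
    chart_vec_chart_comp[OF c v] by simp

end

context connection
begin

lemma D_tangent: "smooth_vfield M A W X \<Longrightarrow> smooth_vfield M A W Y \<Longrightarrow> p \<in> W \<Longrightarrow> D X Y p \<in> tangent_space M A p"
  by (rule smooth_vfield_tangent[OF smooth])

lemma D_zero_left:
  assumes Y: "smooth_vfield M A W Y" and p: "p \<in> W"
  shows "D (\<lambda>p f. 0) Y p = (\<lambda>f. 0)"
proof -
  have o: "openin M W" by (rule smooth_vfield_openin[OF Y])
  have "vf_scale (\<lambda>_. 0) Y = (\<lambda>p f. 0)" by (simp add: vf_scale_def)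
  then show ?thesis
    using scale_left[OF smooth_fun_const[OF o, of 0] Y Y p] by (simp add: vf_scale_def)
qed

lemma D_zero_right:
  assumes X: "smooth_vfield M A W X" and p: "p \<in> W"
  shows "D X (\<lambda>p f. 0) p = (\<lambda>f. 0)"
proof -
  have o: "openin M W" by (rule smooth_vfield_openin[OF X])
  have "vf_scale (\<lambda>_. 0) X = (\<lambda>p f. 0)" by (simp add: vf_scale_def)
  then show ?thesis
    using Leibniz[OF smooth_fun_const[OF o, of 0] X X p] tangent_vec_const[OF smooth_vfield_tangent[OF X p], of 0]
    by (simp add: vf_scale_def vf_add_def)
qed

text \<open>The axioms of a connection apply to smooth fields only, so smoothness of the partial
  sums has to be carried through the induction.\<close>

lemma D_sum_left:
  assumes "finite I" and Y: "smooth_vfield M A W Y"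
    and h: "\<And>i. i \<in> I \<Longrightarrow> smooth_fun M A W (h i)" and E: "\<And>i. i \<in> I \<Longrightarrow> smooth_vfield M A W (E i)"
  shows "smooth_vfield M A W (\<lambda>q f. \<Sum>i\<in>I. h i q * E i q f)"
    and "p \<in> W \<Longrightarrow> D (\<lambda>q f. \<Sum>i\<in>I. h i q * E i q f) Y p f = (\<Sum>i\<in>I. h i p * D (E i) Y p f)"
proof -
  have "smooth_vfield M A W (\<lambda>q f. \<Sum>i\<in>I. h i q * E i q f) \<and>
      (\<forall>p\<in>W. \<forall>f. D (\<lambda>q f. \<Sum>i\<in>I. h i q * E i q f) Y p f = (\<Sum>i\<in>I. h i p * D (E i) Y p f))"
    using assms(1) h E
  proof (induction I rule: finite_induct)
    case empty
    then show ?case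
      using smooth_vfield_zero[OF smooth_vfield_openin[OF Y]] D_zero_left[OF Y] by simp
  next
    case (insert i I)
    let ?R = "\<lambda>q f. \<Sum>i\<in>I. h i q * E i q f"
    have IH: "smooth_vfield M A W ?R" "\<And>p f. p \<in> W \<Longrightarrow> D ?R Y p f = (\<Sum>i\<in>I. h i p * D (E i) Y p f)"
      using insert by auto
    have hi: "smooth_fun M A W (h i)" and Ei: "smooth_vfield M A W (E i)" using insert.prems by auto
    have s: "smooth_vfield M A W (vf_scale (h i) (E i))" by (rule smooth_vfield_vf_scale[OF hi Ei])
    have eq: "(\<lambda>q f. \<Sum>i\<in>insert i I. h i q * E i q f) = vf_add (vf_scale (h i) (E i)) ?R"
      using insert.hyps by (simp add: vf_add_def vf_scale_def)
    have "D (vf_add (vf_scale (h i) (E i)) ?R) Y p f = (\<Sum>i\<in>insert i I. h i p * D (E i) Y p f)" if p: "p \<in> W" for p f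
      unfolding add_left[OF s IH(1) Y p] using insert.hyps IH(2)[OF p]
      by (simp add: vf_add_def scale_left[OF hi Ei Y p]) (simp add: vf_scale_def)
    then show ?case unfolding eq using smooth_vfield_vf_add[OF s IH(1)] by blast
  qed
  then show "smooth_vfield M A W (\<lambda>q f. \<Sum>i\<in>I. h i q * E i q f)"
    "p \<in> W \<Longrightarrow> D (\<lambda>q f. \<Sum>i\<in>I. h i q * E i q f) Y p f = (\<Sum>i\<in>I. h i p * D (E i) Y p f)" by auto
qed

lemma D_sum_right:
  assumes "finite I" and X: "smooth_vfield M A W X"
    and h: "\<And>i. i \<in> I \<Longrightarrow> smooth_fun M A W (h i)" and E: "\<And>i. i \<in> I \<Longrightarrow> smooth_vfield M A W (E i)"
    and p: "p \<in> W"
  shows "D X (\<lambda>q f. \<Sum>i\<in>I. h i q * E i q f) p f = (\<Sum>i\<in>I. X p (h i) * E i p f + h i p * D X (E i) p f)"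
  using assms(1) h E
proof (induction I rule: finite_induct)
  case empty
  then show ?case using D_zero_right[OF X p] by simp
next
  case (insert i I)
  let ?R = "\<lambda>q f. \<Sum>i\<in>I. h i q * E i q f"
  have IH: "D X ?R p f = (\<Sum>i\<in>I. X p (h i) * E i p f + h i p * D X (E i) p f)"
    using insert by auto
  have R: "smooth_vfield M A W ?R"
    by (rule D_sum_left(1)[OF insert.hyps(1) X]) (use insert.prems in auto)
  have hi: "smooth_fun M A W (h i)" and Ei: "smooth_vfield M A W (E i)" using insert.prems by auto
  have s: "smooth_vfield M A W (vf_scale (h i) (E i))" by (rule smooth_vfield_vf_scale[OF hi Ei])
  have eq: "(\<lambda>q f. \<Sum>i\<in>insert i I. h i q * E i q f) = vf_add (vf_scale (h i) (E i)) ?R"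
    using insert.hyps by (simp add: vf_add_def vf_scale_def)
  show ?case
    unfolding eq add_right[OF X s R p] using insert.hyps
    by (simp add: vf_add_def IH Leibniz[OF hi X Ei p]) (simp add: vf_scale_def)
qed

text \<open>Expanded over \<open>Basis\<close> rather than taken from the fields with components
  \<open>u\<close> and \<open>v\<close>, so that it is bilinear by construction at every
  \<open>x\<close>; \<open>D_const_vfield\<close> recovers the direct description.\<close>

definition christoffel :: "('a, 'n) chart \<Rightarrow> complex^'n \<Rightarrow> complex^'n \<Rightarrow> complex^'n \<Rightarrow> complex^'n" where
  "christoffel c x u v = (\<Sum>b\<in>Basis. \<Sum>b'\<in>Basis. ((u \<bullet> b) * (v \<bullet> b')) *\<^sub>R
     chart_comp c (D (const_vfield c b) (const_vfield c b') (inv_chart c x)))"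

lemma christoffel_linear: "linear (christoffel c x u)" "linear (\<lambda>u. christoffel c x u v)"
  by (rule linearI; simp add: christoffel_def inner_add_left algebra_simps sum.distrib scaleR_add_left scaleR_sum_right)+

lemma christoffel_smooth:
  assumes c: "c \<in> A"
  shows "smooth_on (snd c ` fst c) (\<lambda>x. christoffel c x u v)"
  unfolding christoffel_def
  by (intro smooth_on_sum smooth_on_scaleR smooth_on_const chart_image[OF c]
      smooth_vfield_comp[OF smooth c order_refl] smooth_const_vfield[OF c])

text \<open>Locality replaces both fields by their expansions in constant fields. Linearity in the
  first argument and the Leibniz rule in the second then produce the derivative of the components
  and the Christoffel term.\<close>

lemma D_chart:
  assumes X: "smooth_vfield M A W X" and Y: "smooth_vfield M A W Y" and p: "p \<in> W" and c: "c \<in> A" and W: "W \<subseteq> fst c"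
  defines "X' \<equiv> \<lambda>z. chart_comp c (X (inv_chart c z))" and "Y' \<equiv> \<lambda>z. chart_comp c (Y (inv_chart c z))" and "x \<equiv> snd c p"
  shows "D X Y p = chart_vec M A c p (frechet_derivative Y' (at x) (X' x) + christoffel c x (X' x) (Y' x))"
proof
  fix f
  have cp: "p \<in> fst c" using p W by blast
  have x: "x \<in> snd c ` W" unfolding x_def using p by blast
  have o: "openin M W" by (rule smooth_vfield_openin[OF X])
  have invx: "inv_chart c x = p" unfolding x_def by (rule inv_chart_left[OF c cp])
  let ?g = "\<lambda>b q. chart_comp c (X q) \<bullet> b" and ?h = "\<lambda>b q. chart_comp c (Y q) \<bullet> b"
  let ?E = "\<lambda>b. const_vfield c b"
  have E: "smooth_vfield M A W (?E b)" for b
    by (rule smooth_vfield_subset[OF smooth_const_vfield[OF c] o W])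
  have smooth_comp: "smooth_fun M A W (\<lambda>q. chart_comp c (Z q) \<bullet> b)" if "smooth_vfield M A W Z" for Z b
    by (rule smooth_fun_chartI[OF c o W smooth_on_linear[OF bounded_linear_inner_left smooth_vfield_comp[OF that c W]]])
  have exp: "Z q = (\<lambda>f. \<Sum>b\<in>Basis. (chart_comp c (Z q) \<bullet> b) * ?E b q f)" if "smooth_vfield M A W Z" "q \<in> W" for Z q
    by (rule ext) (rule vfield_chart_expansion[OF c subsetD[OF W that(2)] smooth_vfield_tangent[OF that]])
  have sX: "smooth_vfield M A W (\<lambda>q f. \<Sum>b\<in>Basis. ?g b q * ?E b q f)"
    and sY: "smooth_vfield M A W (\<lambda>q f. \<Sum>b\<in>Basis. ?h b q * ?E b q f)"
    by (rule D_sum_left(1)[OF finite_Basis X smooth_comp[OF X] E] D_sum_left(1)[OF finite_Basis X smooth_comp[OF Y] E])+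
  have "D X Y p = D X (\<lambda>q f. \<Sum>b\<in>Basis. ?h b q * ?E b q f) p"
  proof (rule local[OF X Y X sY _ _ p])
    show "\<forall>q\<in>W. Y q = (\<lambda>f. \<Sum>b\<in>Basis. ?h b q * ?E b q f)" by (intro ballI exp[OF Y])
  qed simp
  then have "D X Y p f = D X (\<lambda>q f. \<Sum>b\<in>Basis. ?h b q * ?E b q f) p f" by simp
  also have "\<dots> = (\<Sum>b'\<in>Basis. X p (?h b') * ?E b' p f + ?h b' p * D X (?E b') p f)"
    by (rule D_sum_right[OF finite_Basis X smooth_comp[OF Y] E p])
  also have "\<dots> = (\<Sum>b'\<in>Basis. (frechet_derivative Y' (at x) (X' x) \<bullet> b') * ?E b' p f +
      ?h b' p * (\<Sum>b\<in>Basis. ?g b p * D (?E b) (?E b') p f))"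
  proof (rule sum.cong[OF refl])
    fix b' :: "complex^'n" assume "b' \<in> Basis"
    have "D X (?E b') p = D (\<lambda>q f. \<Sum>b\<in>Basis. ?g b q * ?E b q f) (?E b') p"
    proof (rule local[OF X E sX E _ _ p])
      show "\<forall>q\<in>W. X q = (\<lambda>f. \<Sum>b\<in>Basis. ?g b q * ?E b q f)" by (intro ballI exp[OF X])
    qed simp
    then have "D X (?E b') p f = D (\<lambda>q f. \<Sum>b\<in>Basis. ?g b q * ?E b q f) (?E b') p f" by simp
    also have "\<dots> = (\<Sum>b\<in>Basis. ?g b p * D (?E b) (?E b') p f)"
      by (rule D_sum_left(2)[OF finite_Basis E smooth_comp[OF X] E p])
    finally have 1: "D X (?E b') p f = (\<Sum>b\<in>Basis. ?g b p * D (?E b) (?E b') p f)" .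
    have sY': "smooth_on (snd c ` W) Y'" unfolding Y'_def by (rule smooth_vfield_comp[OF Y c W])
    have "X p (?h b') = X p (\<lambda>q. Y' (snd c q) \<bullet> b')"
      by (rule tangent_vec_cong[OF smooth_vfield_tangent[OF X p] o p])
        (use W in \<open>auto simp: Y'_def inv_chart_left[OF c]\<close>)
    also have "\<dots> = chart_vec M A c p (X' x) (\<lambda>q. Y' (snd c q) \<bullet> b')"
      using chart_vec_chart_comp[OF c cp smooth_vfield_tangent[OF X p]] by (simp add: X'_def invx)
    also have "\<dots> = frechet_derivative (\<lambda>x. Y' x \<bullet> b') (at x) (X' x)"
      using chart_vec_chart[OF c cp smooth_on_linear[OF bounded_linear_inner_left sY']] x by (simp add: x_def)
    also have "\<dots> = frechet_derivative Y' (at x) (X' x) \<bullet> b'"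
    proof -
      have "((\<lambda>x. Y' x \<bullet> b') has_derivative (\<lambda>u. frechet_derivative Y' (at x) u \<bullet> b')) (at x)"
        by (rule has_derivative_inner_left[OF smooth_on_has_derivative[OF sY' x]])
      from fun_cong[OF frechet_derivative_at[OF this], of "X' x"] show ?thesis by simp
    qed
    finally show "X p (?h b') * ?E b' p f + ?h b' p * D X (?E b') p f =
        (frechet_derivative Y' (at x) (X' x) \<bullet> b') * ?E b' p f + ?h b' p * (\<Sum>b\<in>Basis. ?g b p * D (?E b) (?E b') p f)"
      using 1 by simp
  qed
  also have "\<dots> = chart_vec M A c p (frechet_derivative Y' (at x) (X' x)) f + chart_vec M A c p (christoffel c x (X' x) (Y' x)) f"
  proof -
    have lin: "linear (\<lambda>a. chart_vec M A c p a f)" by (rule chart_vec_linear[OF c cp])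
    have "chart_vec M A c p (christoffel c x (X' x) (Y' x)) f =
        (\<Sum>b\<in>Basis. \<Sum>b'\<in>Basis. ((X' x \<bullet> b) * (Y' x \<bullet> b')) * D (?E b) (?E b') p f)"
      unfolding christoffel_def invx
      by (simp add: linear_sum[OF lin] linear_cmul[OF lin] chart_vec_chart_comp[OF c cp D_tangent[OF E E p]])
    also have "\<dots> = (\<Sum>b'\<in>Basis. \<Sum>b\<in>Basis. ((X' x \<bullet> b) * (Y' x \<bullet> b')) * D (?E b) (?E b') p f)"
      by (rule sum.swap)
    also have "\<dots> = (\<Sum>b'\<in>Basis. ?h b' p * (\<Sum>b\<in>Basis. ?g b p * D (?E b) (?E b') p f))"
      by (simp add: X'_def Y'_def invx sum_distrib_left ac_simps)
    finally show ?thesis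
      by (simp add: linear_euclidean_expansion[OF lin, of "frechet_derivative Y' (at x) (X' x)"] sum.distrib)
  qed
  also have "\<dots> = chart_vec M A c p (frechet_derivative Y' (at x) (X' x) + christoffel c x (X' x) (Y' x)) f"
    by (simp add: linear_add[OF chart_vec_linear[OF c cp]])
  finally show "D X Y p f = chart_vec M A c p (frechet_derivative Y' (at x) (X' x) + christoffel c x (X' x) (Y' x)) f" .
qed

lemma D_const_vfield:
  assumes c: "c \<in> A" "p \<in> fst c"
  shows "D (const_vfield c u) (const_vfield c v) p = chart_vec M A c p (christoffel c (snd c p) u v)"
proof -
  have x: "snd c p \<in> snd c ` fst c" using c by blast
  show ?thesis
    using D_chart[OF smooth_const_vfield[OF c(1)] smooth_const_vfield[OF c(1)] c(2) c(1) order_refl]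
    by (simp add: const_vfield_comp[OF c(1) x] const_vfield_comp_derivative[OF c(1) x])
qed

end

context flat_torsionfree_connection
begin

lemma christoffel_symmetric:
  assumes c: "c \<in> A" and x: "x \<in> snd c ` fst c"
  shows "christoffel c x u v = christoffel c x v u"
proof -
  obtain p where p: "p \<in> fst c" "x = snd c p" using x by blast
  have "chart_vec M A c p (christoffel c x u v) = chart_vec M A c p (christoffel c x v u)"
  proof
    fix f
    show "chart_vec M A c p (christoffel c x u v) f = chart_vec M A c p (christoffel c x v u) f"
      using torsionfree[OF smooth_const_vfield[OF c, of u] smooth_const_vfield[OF c, of v] p(1), of f]
      by (simp add: D_const_vfield[OF c p(1)] lie_bracket_const_vfield[OF c p(1)] p(2))
  qed
  then show ?thesis by (simp add: chart_vec_inject[OF c p(1)])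
qed

text \<open>The curvature equation on constant fields: by \<open>D_chart\<close> the two iterated
  derivatives are the two sides, and the bracket term disappears.\<close>

lemma christoffel_flat:
  assumes c: "c \<in> A" and x: "x \<in> snd c ` fst c"
  shows "frechet_derivative (\<lambda>y. christoffel c y v w) (at x) u + christoffel c x u (christoffel c x v w) =
    frechet_derivative (\<lambda>y. christoffel c y u w) (at x) v + christoffel c x v (christoffel c x u w)"
proof -
  obtain p where p: "p \<in> fst c" "x = snd c p" using x by blast
  let ?E = "\<lambda>u. const_vfield c u"
  have E: "smooth_vfield M A (fst c) (?E u)" for u by (rule smooth_const_vfield[OF c])
  have comp: "chart_comp c (D (?E v) (?E w) (inv_chart c z)) = christoffel c z v w" if "z \<in> snd c ` fst c" for z v w
  proof -
    have q: "inv_chart c z \<in> fst c" by (rule inv_chart_mem[OF c order_refl that])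
    show ?thesis
      using D_const_vfield[OF c q] chart_comp_chart_vec[OF c q] inv_chart_right[OF that] by simp
  qed
  have DD: "D (?E u) (D (?E v) (?E w)) p = chart_vec M A c p
      (frechet_derivative (\<lambda>y. christoffel c y v w) (at x) u + christoffel c x u (christoffel c x v w))" for u v w
  proof -
    have "((\<lambda>z. chart_comp c (D (?E v) (?E w) (inv_chart c z))) has_derivative
        frechet_derivative (\<lambda>y. christoffel c y v w) (at x)) (at x)"
      by (rule has_derivative_transform_within_open[OF smooth_on_has_derivative[OF christoffel_smooth[OF c] x] chart_image[OF c] x])
        (rule comp[symmetric])
    from frechet_derivative_at[OF this]
    show ?thesis
      using D_chart[OF E smooth[OF E E] p(1) c order_refl, of u v w]
      by (simp add: const_vfield_comp[OF c x] comp[OF x] flip: p(2))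
  qed
  \<comment> \<open>The bracket is known to vanish on the chart domain only, so locality is what
    permits replacing it by the zero field.\<close>
  have "D (lie_bracket M A (?E u) (?E v)) (?E w) p = D (\<lambda>p f. 0) (?E w) p"
  proof (rule local[OF _ E smooth_vfield_zero[OF chart_domain[OF c]] E _ _ p(1)])
    show "smooth_vfield M A (fst c) (lie_bracket M A (?E u) (?E v))"
      by (rule smooth_vfield_cong[THEN iffD2, OF _ smooth_vfield_zero[OF chart_domain[OF c]]])
        (rule lie_bracket_const_vfield[OF c])
  qed (simp_all add: lie_bracket_const_vfield[OF c])
  then have L: "D (lie_bracket M A (?E u) (?E v)) (?E w) p = (\<lambda>f. 0)" using D_zero_left[OF E p(1)] by simp
  have "D (?E u) (D (?E v) (?E w)) p = D (?E v) (D (?E u) (?E w)) p"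
  proof
    fix f show "D (?E u) (D (?E v) (?E w)) p f = D (?E v) (D (?E u) (?E w)) p f"
      using flat[OF E E E p(1), of u v w f] unfolding L by simp
  qed
  then show ?thesis unfolding DD chart_vec_inject[OF c p(1)] .
qed

text \<open>In the chart \<open>X (Y f)\<close> is the Hessian of \<open>f\<close> on the components
  plus \<open>df\<close> of the derivative of \<open>Y\<close>. Hypothesis \<open>affine\<close>
  turns the Hessian into \<open>df\<close> of the Christoffel term, and the sum is \<open>df\<close>
  of \<open>D X Y\<close>.\<close>

lemma affine_chart:
  assumes c: "c \<in> A" and G: "G \<subseteq> snd c ` fst c" and f: "smooth_on G f"
    and affine: "\<And>x w. x \<in> G \<Longrightarrow> ((\<lambda>x. frechet_derivative f (at x) w) has_derivative
      (\<lambda>t. frechet_derivative f (at x) (christoffel c x t w))) (at x)"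
    and X: "smooth_vfield M A W X" and Y: "smooth_vfield M A W Y" and W: "W \<subseteq> fst c" "snd c ` W \<subseteq> G" and p: "p \<in> W"
  shows "D X Y p (\<lambda>q. f (snd c q)) = X p (\<lambda>q. Y q (\<lambda>q. f (snd c q)))"
proof -
  let ?X = "\<lambda>z. chart_comp c (X (inv_chart c z))" and ?Y = "\<lambda>z. chart_comp c (Y (inv_chart c z))" and ?x = "snd c p"
  have cp: "p \<in> fst c" and xG: "?x \<in> G" and xS: "?x \<in> snd c ` fst c" using W p by auto
  have o: "openin M W" by (rule smooth_vfield_openin[OF X])
  have near: "smooth_near M A p (\<lambda>q. f (snd c q))"
    by (rule smooth_nearI[OF smooth_fun_chart_open[OF c f o W] p])
  have eq: "((\<lambda>z. f (snd c (inv_chart c z))) has_derivative f') (at z) \<longleftrightarrow> (f has_derivative f') (at z)" if "z \<in> G" for f' z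
  proof -
    have e: "f (snd c (inv_chart c y)) = f y" if "y \<in> G" for y using that G inv_chart_right[of y c] by auto
    show ?thesis
      by (intro iffI; erule has_derivative_transform_within_open[OF _ smooth_on_open[OF f] that]) (simp_all add: e)
  qed
  then have F: "frechet_derivative (\<lambda>z. f (snd c (inv_chart c z))) (at z) = frechet_derivative f (at z)" if "z \<in> G" for z
    using that unfolding frechet_derivative_def by simp
  have "((\<lambda>z. frechet_derivative (\<lambda>z. f (snd c (inv_chart c z))) (at z) u) has_derivative
      (\<lambda>t. frechet_derivative f (at ?x) (christoffel c ?x t u))) (at ?x)" for u
    by (rule has_derivative_transform_within_open[OF affine[OF xG] smooth_on_open[OF f] xG]) (simp add: F)
  from fun_cong[OF frechet_derivative_at[OF this]]
  have H: "frechet_derivative (\<lambda>z. frechet_derivative (\<lambda>z. f (snd c (inv_chart c z))) (at z) u) (at ?x) v =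
      frechet_derivative f (at ?x) (christoffel c ?x v u)" for u v by simp
  have lin: "linear (frechet_derivative f (at ?x))"
    using smooth_on_has_derivative[OF f xG] by (rule has_derivative_linear)
  have "X p (\<lambda>q. Y q (\<lambda>q. f (snd c q))) = chart_vec M A c p (?X ?x) (\<lambda>q. Y q (\<lambda>q. f (snd c q)))"
    using chart_vec_chart_comp[OF c cp smooth_vfield_tangent[OF X p]] inv_chart_left[OF c cp] by simp
  also have "\<dots> = frechet_derivative f (at ?x) (christoffel c ?x (?Y ?x) (?X ?x)) +
      frechet_derivative f (at ?x) (frechet_derivative ?Y (at ?x) (?X ?x))"
    unfolding vfield_derivative_chart(1)[OF Y p c cp near] H F[OF xG] ..
  also have "\<dots> = frechet_derivative f (at ?x) (frechet_derivative ?Y (at ?x) (?X ?x) + christoffel c ?x (?X ?x) (?Y ?x))"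
    by (simp add: linear_add[OF lin] christoffel_symmetric[OF c xS, of "?Y ?x"])
  also have "\<dots> = D X Y p (\<lambda>q. f (snd c q))"
    unfolding D_chart[OF X Y p c W(1)] using chart_vec_chart[OF c cp f xG] by simp
  finally show ?thesis by simp
qed

end

context special_complex_manifold
begin

text \<open>\<open>J\<close> maps constant fields to constant fields, so \<open>d_nabla_J\<close>
  becomes an equation between Christoffel symbols; its terms
  \<open>\<i> *s christoffel c x u v\<close> cancel by symmetry.\<close>

lemma christoffel_i:
  assumes c: "c \<in> A" and x: "x \<in> snd c ` fst c"
  shows "christoffel c x u (\<i> *s v) = christoffel c x v (\<i> *s u)"
proof -
  obtain p where p: "p \<in> fst c" "x = snd c p" using x by blast
  let ?E = "\<lambda>u. const_vfield c u"
  have E: "smooth_vfield M A (fst c) (?E u)" for u by (rule smooth_const_vfield[OF c])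
  have JE: "vf_J M A (?E v) q = ?E (\<i> *s v) q" if "q \<in> fst c" for v q
    by (simp add: vf_J_def complex_structure_chart_vec[OF c that])
  have "D (?E u) (vf_J M A (?E v)) p = D (?E u) (?E (\<i> *s v)) p" for u v
  proof (rule local[OF E _ E E _ _ p(1)])
    show "smooth_vfield M A (fst c) (vf_J M A (?E v))"
      by (rule smooth_vfield_cong[THEN iffD2, OF JE E])
  qed (simp_all add: JE)
  then have 1: "D (?E u) (vf_J M A (?E v)) p = chart_vec M A c p (christoffel c x u (\<i> *s v))" for u v
    by (simp add: D_const_vfield[OF c p(1)] p(2))
  have 2: "vf_J M A (D (?E u) (?E v)) p = chart_vec M A c p (\<i> *s christoffel c x u v)" for u v
    by (simp add: vf_J_def D_const_vfield[OF c p(1)] complex_structure_chart_vec[OF c p(1)] p(2))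
  have "chart_vec M A c p (christoffel c x u (\<i> *s v)) = chart_vec M A c p (christoffel c x v (\<i> *s u))"
  proof
    fix f
    show "chart_vec M A c p (christoffel c x u (\<i> *s v)) f = chart_vec M A c p (christoffel c x v (\<i> *s u)) f"
      using d_nabla_J[OF E E p(1), of u v f] unfolding 1 2 christoffel_symmetric[OF c x, of u v] by simp
  qed
  then show ?thesis by (simp add: chart_vec_inject[OF c p(1)])
qed

end

context special_kahler_manifold
begin

definition chart_form :: "('a, 'n) chart \<Rightarrow> complex^'n \<Rightarrow> complex^'n \<Rightarrow> complex^'n \<Rightarrow> real" where
  "chart_form c x u v = \<omega> (inv_chart c x) (const_vfield c u (inv_chart c x)) (const_vfield c v (inv_chart c x))"

text \<open>Stated in the order in which \<open>special_kahler_affine_coordinates\<close> requires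
  them. The last one is parallelism on constant fields, whose covariant derivatives are the
  Christoffel symbols.\<close>

lemma chart_form_properties:
  assumes c: "c \<in> A" and x: "x \<in> snd c ` fst c"
  shows "linear (\<lambda>u. chart_form c x u v)" "chart_form c x u v = - chart_form c x v u"
    "chart_form c x (\<i> *s u) (\<i> *s v) = chart_form c x u v"
    "(\<And>w. chart_form c x u w = 0) \<Longrightarrow> u = 0"
    "((\<lambda>x. chart_form c x u v) has_derivative
      (\<lambda>t. chart_form c x (christoffel c x t u) v + chart_form c x u (christoffel c x t v))) (at x)"
proof -
  obtain p where p: "p \<in> fst c" "x = snd c p" using x by blast
  have inv: "inv_chart c x = p" using p inv_chart_left[OF c p(1)] by simp
  have pM: "p \<in> topspace M" using p chart_subset[OF c] by blast
  have T: "chart_vec M A c p u \<in> tangent_space M A p" for u using tangent_space_chart[OF c p(1)] by blast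
  note S = symplectic[unfolded symplectic_form_def]
  have bil: "\<omega> p (\<lambda>f. r * u f + s * v f) w = r * \<omega> p u w + s * \<omega> p v w"
    if "u \<in> tangent_space M A p" "v \<in> tangent_space M A p" "w \<in> tangent_space M A p" for u v w r s
    using S[THEN conjunct1, THEN bspec, OF pM] that by blast
  note cl = chart_vec_linear[OF c p(1)]
  have comb: "chart_vec M A c p (r *\<^sub>R u + s *\<^sub>R v) = (\<lambda>f. r * chart_vec M A c p u f + s * chart_vec M A c p v f)" for r s u v
    by (rule ext) (simp add: linear_add[OF cl] linear_cmul[OF cl])
  show "linear (\<lambda>u. chart_form c x u v)"
  proof (rule linearI)
    show "chart_form c x (u1 + u2) v = chart_form c x u1 v + chart_form c x u2 v" for u1 u2
      using bil[OF T T T, of 1 u1 1 u2 v] comb[of 1 u1 1 u2] by (simp add: chart_form_def inv)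
    show "chart_form c x (k *\<^sub>R u1) v = k *\<^sub>R chart_form c x u1 v" for k u1
      using bil[OF T T T, of k u1 0 0 v] comb[of k u1 0 0] by (simp add: chart_form_def inv)
  qed
  show "chart_form c x u v = - chart_form c x v u"
    unfolding chart_form_def inv using S[THEN conjunct2, THEN conjunct1] pM T by blast
  show "chart_form c x (\<i> *s u) (\<i> *s v) = chart_form c x u v"
    unfolding chart_form_def inv using J_invariant[OF pM T T, of u v] by (simp add: complex_structure_chart_vec[OF c p(1)])
  show "u = 0" if null: "\<And>w. chart_form c x u w = 0"
  proof -
    have "\<omega> p (chart_vec M A c p u) w = 0" if "w \<in> tangent_space M A p" for w
      using null chart_vec_chart_comp[OF c p(1) that] unfolding chart_form_def inv by metis
    then have "chart_vec M A c p u = (\<lambda>f. 0)"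
      using S[THEN conjunct2, THEN conjunct2, THEN conjunct2, THEN conjunct1] pM T by blast
    then have "chart_vec M A c p u = chart_vec M A c p 0" by (simp add: chart_vec_zero[OF c p(1)])
    then show ?thesis by (simp add: chart_vec_inject[OF c p(1)])
  qed
  let ?E = "\<lambda>u. const_vfield c u"
  have E: "smooth_vfield M A (fst c) (?E u)" for u by (rule smooth_const_vfield[OF c])
  have sm: "smooth_fun M A (fst c) (\<lambda>q. \<omega> q (?E u q) (?E v q))"
    using S[THEN conjunct2, THEN conjunct2, THEN conjunct1] E by blast
  have so: "smooth_on (snd c ` fst c) (\<lambda>z. chart_form c z u v)"
    unfolding chart_form_def using smooth_funD'[OF sm c order_refl] .
  have "frechet_derivative (\<lambda>x. chart_form c x u v) (at x) t =
      chart_form c x (christoffel c x t u) v + chart_form c x u (christoffel c x t v)" for t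
  proof -
    have "frechet_derivative (\<lambda>x. chart_form c x u v) (at x) t = ?E t p (\<lambda>q. \<omega> q (?E u q) (?E v q))"
      using chart_vec_smooth[OF smooth_nearI[OF sm p(1)]] by (simp add: chart_form_def p(2))
    also have "\<dots> = \<omega> p (D (?E t) (?E u) p) (?E v p) + \<omega> p (?E u p) (D (?E t) (?E v) p)"
      by (rule parallel[OF E E E p(1)])
    finally show ?thesis
      unfolding D_const_vfield[OF c p(1)] p(2)[symmetric] by (simp only: chart_form_def inv)
  qed
  then have "frechet_derivative (\<lambda>x. chart_form c x u v) (at x) =
      (\<lambda>t. chart_form c x (christoffel c x t u) v + chart_form c x u (christoffel c x t v))" by (rule ext)
  then show "((\<lambda>x. chart_form c x u v) has_derivative
      (\<lambda>t. chart_form c x (christoffel c x t u) v + chart_form c x u (christoffel c x t v))) (at x)"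
    using smooth_on_has_derivative[OF so x] by simp
qed

end

section \<open>The isomorphism with the potential chart\<close>

context complex_manifold
begin

context
  fixes W assumes W: "openin M W"
begin

section \<open>Restriction to an open submanifold\<close>

lemma inv_chart_restrict:
  assumes c: "c \<in> A" and z: "z \<in> snd c ` (fst c \<inter> W)"
  shows "inv_chart (fst c \<inter> W, snd c) z = inv_chart c z"
proof -
  obtain p where p: "p \<in> fst c" "p \<in> W" "z = snd c p" using z by blast
  have "inj_on (snd c) (fst c \<inter> W)" using chart_inj[OF c] by (rule inj_on_subset) simp
  then have "inv_into (fst c \<inter> W) (snd c) (snd c p) = p" using p by simp
  then show ?thesis using inv_chart_left[OF c p(1)] p(3) by simp
qed

lemma smooth_fun_restrict:
  "smooth_fun (subtopology M W) (restrict_atlas W A) V f \<longleftrightarrow> V \<subseteq> W \<and> smooth_fun M A V f"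
proof (cases "V \<subseteq> W")
  case True
  have "smooth_on (snd c ` (fst c \<inter> W \<inter> V)) (\<lambda>z. f (inv_chart (fst c \<inter> W, snd c) z)) \<longleftrightarrow>
      smooth_on (snd c ` (fst c \<inter> V)) (\<lambda>z. f (inv_chart c z))" if c: "c \<in> A" for c
  proof -
    have eq: "fst c \<inter> W \<inter> V = fst c \<inter> V" using True by blast
    show ?thesis
      unfolding eq
    proof (rule smooth_on_cong)
      fix z assume "z \<in> snd c ` (fst c \<inter> V)"
      then have "z \<in> snd c ` (fst c \<inter> W)" using True by blast
      then show "f (inv_chart (fst c \<inter> W, snd c) z) = f (inv_chart c z)"
        using inv_chart_restrict[OF c] by simp
    qed
  qed
  then show ?thesis
    unfolding smooth_fun_def restrict_atlas_def using True openin_open_subtopology[OF W] by auto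
next
  case False
  then show ?thesis unfolding smooth_fun_def using openin_open_subtopology[OF W] by blast
qed

lemma smooth_near_restrict:
  assumes p: "p \<in> W"
  shows "smooth_near (subtopology M W) (restrict_atlas W A) p f \<longleftrightarrow> smooth_near M A p f"
proof
  assume "smooth_near M A p f"
  then obtain V where V: "p \<in> V" "smooth_fun M A V f" unfolding smooth_near_def by blast
  have "smooth_fun M A (V \<inter> W) f"
    by (rule smooth_fun_subset[OF V(2) openin_Int[OF smooth_fun_openin[OF V(2)] W] Int_lower1])
  then have "smooth_fun (subtopology M W) (restrict_atlas W A) (V \<inter> W) f" by (simp add: smooth_fun_restrict)
  then show "smooth_near (subtopology M W) (restrict_atlas W A) p f"
    unfolding smooth_near_def using V(1) p by blast
next
  assume "smooth_near (subtopology M W) (restrict_atlas W A) p f"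
  then show "smooth_near M A p f" unfolding smooth_near_def smooth_fun_restrict by blast
qed

text \<open>Being germ-local, the tangent vectors at a point of \<open>W\<close> are the same
  functionals for \<open>M\<close> and for the open submanifold; this is why \<open>D\<close> and
  \<open>\<omega>\<close> can be used there unchanged.\<close>

lemma chart_vec_restrict:
  assumes c: "c \<in> A" "p \<in> fst c" and p: "p \<in> W"
  shows "chart_vec (subtopology M W) (restrict_atlas W A) (fst c \<inter> W, snd c) p a = chart_vec M A c p a"
proof
  fix f
  show "chart_vec (subtopology M W) (restrict_atlas W A) (fst c \<inter> W, snd c) p a f = chart_vec M A c p a f"
  proof (cases "smooth_near M A p f")
    case True
    have "((\<lambda>z. f (inv_chart (fst c \<inter> W, snd c) z)) has_derivative
        frechet_derivative (\<lambda>z. f (inv_chart c z)) (at (snd c p))) (at (snd c p))"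
    proof (rule has_derivative_transform_within_open[OF smooth_near_has_derivative[OF True c] open_chart_image[OF c(1) W]])
      show "snd c p \<in> snd c ` (fst c \<inter> W)" using c p by blast
      show "f (inv_chart c z) = f (inv_chart (fst c \<inter> W, snd c) z)" if "z \<in> snd c ` (fst c \<inter> W)" for z
        unfolding inv_chart_restrict[OF c(1) that] ..
    qed
    from frechet_derivative_at[OF this] show ?thesis
      using True by (simp add: chart_vec_def smooth_near_restrict[OF p])
  qed (simp add: chart_vec_def smooth_near_restrict[OF p])
qed

lemma tangent_space_restrict:
  assumes p: "p \<in> W"
  shows "tangent_space (subtopology M W) (restrict_atlas W A) p = tangent_space M A p"
proof
  show "tangent_space (subtopology M W) (restrict_atlas W A) p \<subseteq> tangent_space M A p"
  proof
    fix v assume "v \<in> tangent_space (subtopology M W) (restrict_atlas W A) p"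
    then obtain c a where c: "c \<in> A" "p \<in> fst c"
      and v: "v = chart_vec (subtopology M W) (restrict_atlas W A) (fst c \<inter> W, snd c) p a"
      unfolding tangent_space_def restrict_atlas_def by auto
    show "v \<in> tangent_space M A p"
      unfolding v chart_vec_restrict[OF c p] tangent_space_chart[OF c] by blast
  qed
  show "tangent_space M A p \<subseteq> tangent_space (subtopology M W) (restrict_atlas W A) p"
  proof
    fix v assume "v \<in> tangent_space M A p"
    then obtain c a where c: "c \<in> A" "p \<in> fst c" and v: "v = chart_vec M A c p a"
      unfolding tangent_space_def by blast
    have "(fst c \<inter> W, snd c) \<in> restrict_atlas W A" "p \<in> fst (fst c \<inter> W, snd c)"
      using c p by (auto simp: restrict_atlas_def)
    then show "v \<in> tangent_space (subtopology M W) (restrict_atlas W A) p"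
      unfolding v chart_vec_restrict[OF c p, symmetric] tangent_space_def by blast
  qed
qed

lemma smooth_vfield_restrict:
  assumes X: "smooth_vfield (subtopology M W) (restrict_atlas W A) V X"
  shows "V \<subseteq> W" "smooth_vfield M A V X"
proof -
  have o: "openin M V" and V: "V \<subseteq> W"
    using X openin_open_subtopology[OF W] unfolding smooth_vfield_def by blast+
  then show "V \<subseteq> W" by blast
  show "smooth_vfield M A V X"
    unfolding smooth_vfield_def
  proof (intro conjI ballI allI impI o)
    show "X p \<in> tangent_space M A p" if "p \<in> V" for p
    proof -
      have "p \<in> W" using V that by blast
      from tangent_space_restrict[OF this] show ?thesis using X that unfolding smooth_vfield_def by blast
    qed
    fix V' f assume V': "V' \<subseteq> V \<and> smooth_fun M A V' f"
    then have "smooth_fun (subtopology M W) (restrict_atlas W A) V' f"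
      using V by (auto simp: smooth_fun_restrict)
    then have "smooth_fun (subtopology M W) (restrict_atlas W A) V' (\<lambda>p. X p f)"
      using X V' unfolding smooth_vfield_def by blast
    then show "smooth_fun M A V' (\<lambda>p. X p f)" by (simp add: smooth_fun_restrict)
  qed
qed

end

end

text \<open>The outcome of the local construction, expressed through \<open>z\<close> and
  \<open>F\<close> alone: \<open>cpartial i F (z x)\<close> stands for the function
  \<open>W i\<close>. Affinity and the form are given as identities for real derivatives in the
  chart \<open>c\<close>, ready for \<open>affine_chart\<close> and
  \<open>induced_form_eq\<close>.\<close>

locale potential_chart = special_kahler_manifold M A D \<omega> + pot: nondegenerate_potential U F
  for M :: "'a topology" and A :: "('a, 'n::finite) atlas" and D :: "'a conn" and \<omega> :: "'a two_form"
    and U :: "(complex^'n) set" and F :: "complex^'n \<Rightarrow> complex" +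
  fixes c :: "('a, 'n) chart" and G :: "(complex^'n) set" and z h :: "complex^'n \<Rightarrow> complex^'n"
  assumes c: "c \<in> A" and G: "open G" "G \<subseteq> snd c ` fst c" and hom: "homeomorphism G U z h"
    and z_holomorphic: "\<And>i. holomorphic_fun G (\<lambda>x. z x $ i)"
    and h_holomorphic: "\<And>i. holomorphic_fun U (\<lambda>y. h y $ i)"
    and z_affine: "\<And>x i w. x \<in> G \<Longrightarrow>
      ((\<lambda>x. frechet_derivative (\<lambda>x. Re (z x $ i)) (at x) w) has_derivative
        (\<lambda>t. frechet_derivative (\<lambda>x. Re (z x $ i)) (at x) (christoffel c x t w))) (at x)"
    and w_affine: "\<And>x i w. x \<in> G \<Longrightarrow>
      ((\<lambda>x. frechet_derivative (\<lambda>x. Re (cpartial i F (z x))) (at x) w) has_derivative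
        (\<lambda>t. frechet_derivative (\<lambda>x. Re (cpartial i F (z x))) (at x) (christoffel c x t w))) (at x)"
    and form: "\<And>x u v. x \<in> G \<Longrightarrow> chart_form c x u v = 2 * (\<Sum>i\<in>UNIV.
      frechet_derivative (\<lambda>x. Re (z x $ i)) (at x) u * frechet_derivative (\<lambda>x. Re (cpartial i F (z x))) (at x) v -
      frechet_derivative (\<lambda>x. Re (cpartial i F (z x))) (at x) u * frechet_derivative (\<lambda>x. Re (z x $ i)) (at x) v)"
begin

section \<open>Transport along \<open>\<psi>\<close>\<close>

definition "chart_dom = {p \<in> fst c. snd c p \<in> G}"

definition "\<psi> p = z (snd c p)"

definition "dz x a = (\<chi> i. frechet_derivative (\<lambda>x. z x $ i) (at x) a)"

lemma chart_dom_openin: "openin M chart_dom"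
  unfolding chart_dom_def by (rule openin_chart_preimage[OF c G(1)])

lemma chart_dom_subset: "chart_dom \<subseteq> fst c"
  by (auto simp: chart_dom_def)

lemma zh: "y \<in> U \<Longrightarrow> z (h y) = y" "y \<in> U \<Longrightarrow> h y \<in> G"
  and hz: "x \<in> G \<Longrightarrow> h (z x) = x" "x \<in> G \<Longrightarrow> z x \<in> U"
  using hom by (auto simp: homeomorphism_def)

lemma \<psi>_dom: "p \<in> chart_dom \<Longrightarrow> \<psi> p \<in> U" "p \<in> chart_dom \<Longrightarrow> snd c p \<in> G" "p \<in> chart_dom \<Longrightarrow> p \<in> fst c"
  using hz by (auto simp: chart_dom_def \<psi>_def)

lemma inv_mem: "y \<in> U \<Longrightarrow> snd c (inv_chart c (h y)) = h y" "y \<in> U \<Longrightarrow> inv_chart c (h y) \<in> chart_dom"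
proof -
  assume y: "y \<in> U"
  then have hy: "h y \<in> snd c ` fst c" using zh(2) G(2) by blast
  show 1: "snd c (inv_chart c (h y)) = h y" by (rule inv_chart_right[OF hy])
  show "inv_chart c (h y) \<in> chart_dom"
    using inv_chart_mem[OF c order_refl hy] zh(2)[OF y] 1 by (simp add: chart_dom_def)
qed

lemma \<psi>_inv: "y \<in> U \<Longrightarrow> \<psi> (inv_chart c (h y)) = y"
  using inv_mem(1) zh(1) by (simp add: \<psi>_def)

lemma inv_\<psi>: "p \<in> chart_dom \<Longrightarrow> inv_chart c (h (\<psi> p)) = p"
  using hz(1) \<psi>_dom(2,3) inv_chart_left[OF c] by (simp add: \<psi>_def)

lemma \<psi>_inj: "inj_on \<psi> chart_dom"
  using inv_\<psi> by (metis inj_onI)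

lemma \<psi>_image: "\<psi> ` chart_dom = U"
proof
  show "\<psi> ` chart_dom \<subseteq> U" using \<psi>_dom(1) by blast
  show "U \<subseteq> \<psi> ` chart_dom" using \<psi>_inv inv_mem(2) by (metis image_eqI subsetI)
qed

lemma inv_into_\<psi>: "y \<in> U \<Longrightarrow> inv_into chart_dom \<psi> y = inv_chart c (h y)"
  using inv_into_f_f[OF \<psi>_inj inv_mem(2)[of y]] \<psi>_inv[of y] by simp

lemma topspace_chart_dom: "topspace (subtopology M chart_dom) = chart_dom"
  using openin_subset[OF chart_dom_openin] by auto

lemma z_smooth: "smooth_on G z"
  by (rule smooth_on_vec[OF G(1) holomorphic_fun_smooth[OF z_holomorphic]])

lemma h_smooth: "smooth_on U h"
  by (rule smooth_on_vec[OF pot.U_open holomorphic_fun_smooth[OF h_holomorphic]])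

lemma open_z_preimage: "open T \<Longrightarrow> open (G \<inter> z -` T)"
  by (rule continuous_open_preimage[OF smooth_on_continuous_on[OF z_smooth] G(1)])

lemma open_h_preimage: "open T \<Longrightarrow> open (U \<inter> h -` T)"
  by (rule continuous_open_preimage[OF smooth_on_continuous_on[OF h_smooth] pot.U_open])

lemma pot_smooth_funI: "smooth_on T g \<Longrightarrow> T \<subseteq> U \<Longrightarrow> smooth_fun pot.MU pot.AU T g"
  using pot.smooth_fun_chart_open[OF pot.id_chart, of T g T] smooth_on_open[of T g] by (simp add: pot.openin_MU)

lemma smooth_pullback:
  assumes g: "smooth_on T g" and T: "T \<subseteq> U"
  shows "smooth_on (G \<inter> z -` T) (\<lambda>x. g (z x))"
    and "smooth_fun M A {p \<in> chart_dom. \<psi> p \<in> T} (\<lambda>p. g (\<psi> p))"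
proof -
  have o: "open (G \<inter> z -` T)" by (rule open_z_preimage[OF smooth_on_open[OF g]])
  show s: "smooth_on (G \<inter> z -` T) (\<lambda>x. g (z x))"
    by (rule smooth_on_compose[OF g smooth_on_subset[OF z_smooth o]]) auto
  have eq: "{p \<in> chart_dom. \<psi> p \<in> T} = {p \<in> fst c. snd c p \<in> G \<inter> z -` T}" by (auto simp: chart_dom_def \<psi>_def)
  show "smooth_fun M A {p \<in> chart_dom. \<psi> p \<in> T} (\<lambda>p. g (\<psi> p))"
    unfolding eq unfolding \<psi>_def by (rule smooth_fun_chart_open[OF c s openin_chart_preimage[OF c o]]) auto
qed

text \<open>An equivalence is wanted: a pushed vector must also take the default value 0 on
  functions that are not smooth near the image point, as tangent vectors do.\<close>

lemma smooth_near_pullback: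
  assumes p: "p \<in> chart_dom"
  shows "smooth_near M A p (\<lambda>q. g (\<psi> q)) \<longleftrightarrow> smooth_near pot.MU pot.AU (\<psi> p) g"
proof
  assume "smooth_near pot.MU pot.AU (\<psi> p) g"
  then obtain T where T: "\<psi> p \<in> T" "smooth_fun pot.MU pot.AU T g" unfolding smooth_near_def by blast
  have TU: "T \<subseteq> U" using pot.smooth_fun_openin[OF T(2)] pot.openin_MU by blast
  show "smooth_near M A p (\<lambda>q. g (\<psi> q))"
    by (rule smooth_nearI[OF smooth_pullback(2)[OF pot.smooth_fun_smooth_on[OF T(2)] TU]]) (use p T(1) in auto)
next
  assume "smooth_near M A p (\<lambda>q. g (\<psi> q))"
  then obtain V where V: "p \<in> V" "smooth_fun M A V (\<lambda>q. g (\<psi> q))" unfolding smooth_near_def by blast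
  let ?S = "snd c ` (fst c \<inter> V)"
  have s: "smooth_on ?S (\<lambda>x. g (\<psi> (inv_chart c x)))" by (rule smooth_funD[OF V(2) c])
  have o: "open (U \<inter> h -` ?S)" by (rule open_h_preimage[OF smooth_on_open[OF s]])
  have "smooth_on (U \<inter> h -` ?S) (\<lambda>y. g (\<psi> (inv_chart c (h y))))"
    by (rule smooth_on_compose[OF s smooth_on_subset[OF h_smooth o]]) auto
  then have "smooth_on (U \<inter> h -` ?S) g"
    by (rule smooth_on_cong[THEN iffD1, rotated]) (simp add: \<psi>_inv)
  then have "smooth_fun pot.MU pot.AU (U \<inter> h -` ?S) g" by (rule pot_smooth_funI) simp
  moreover have "\<psi> p \<in> U \<inter> h -` ?S"
    using \<psi>_dom[OF p] hz(1)[OF \<psi>_dom(2)[OF p]] V(1) by (auto simp: \<psi>_def)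
  ultimately show "smooth_near pot.MU pot.AU (\<psi> p) g" by (rule pot.smooth_nearI)
qed

lemma z_derivative: "x \<in> G \<Longrightarrow> (z has_derivative dz x) (at x)"
  by (rule has_derivative_vecI) (use holomorphic_fun_has_derivative[OF z_holomorphic] in \<open>simp add: dz_def\<close>)

lemma push_chart_vec:
  assumes p: "p \<in> chart_dom"
  shows "push_vec \<psi> (chart_vec M A c p a) = chart_vec pot.MU pot.AU pot.id_chart (\<psi> p) (dz (snd c p) a)"
proof
  fix g
  note pd = \<psi>_dom[OF p]
  show "push_vec \<psi> (chart_vec M A c p a) g = chart_vec pot.MU pot.AU pot.id_chart (\<psi> p) (dz (snd c p) a) g"
  proof (cases "smooth_near pot.MU pot.AU (\<psi> p) g")
    case True
    then obtain T where T: "\<psi> p \<in> T" "smooth_fun pot.MU pot.AU T g" unfolding smooth_near_def by blast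
    have TU: "T \<subseteq> U" using pot.smooth_fun_openin[OF T(2)] pot.openin_MU by blast
    have g: "smooth_on T g" by (rule pot.smooth_fun_smooth_on[OF T(2)])
    have x: "snd c p \<in> G \<inter> z -` T" using pd T(1) by (simp add: \<psi>_def)
    have "chart_vec M A c p a (\<lambda>q. g (\<psi> q)) = frechet_derivative (\<lambda>x. g (z x)) (at (snd c p)) a"
      unfolding \<psi>_def by (rule chart_vec_chart[OF c pd(3) smooth_pullback(1)[OF g TU] x])
    also have "((\<lambda>x. g (z x)) has_derivative (\<lambda>a. frechet_derivative g (at (\<psi> p)) (dz (snd c p) a))) (at (snd c p))"
      using has_derivative_compose[OF z_derivative[OF pd(2)] smooth_on_has_derivative[OF g]] T(1) by (simp add: \<psi>_def)
    then have "frechet_derivative (\<lambda>x. g (z x)) (at (snd c p)) a = frechet_derivative g (at (\<psi> p)) (dz (snd c p) a)"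
      by (rule fun_cong[OF frechet_derivative_at, symmetric])
    also have "\<dots> = chart_vec pot.MU pot.AU pot.id_chart (\<psi> p) (dz (snd c p) a) g"
      using pot.chart_vec_chart[OF pot.id_chart _ g] pd(1) T(1) by simp
    finally show ?thesis by (simp add: push_vec_def)
  next
    case False
    then show ?thesis
      using chart_vec_not_smooth pot.chart_vec_not_smooth smooth_near_pullback[OF p, of g] by (simp add: push_vec_def)
  qed
qed

lemma push_tangent:
  assumes p: "p \<in> chart_dom" and v: "v \<in> tangent_space M A p"
  shows "push_vec \<psi> v = chart_vec pot.MU pot.AU pot.id_chart (\<psi> p) (dz (snd c p) (chart_comp c v))"
    and "push_vec \<psi> v \<in> tangent_space pot.MU pot.AU (\<psi> p)"
proof -
  show 1: "push_vec \<psi> v = chart_vec pot.MU pot.AU pot.id_chart (\<psi> p) (dz (snd c p) (chart_comp c v))"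
    using push_chart_vec[OF p, of "chart_comp c v"] chart_vec_chart_comp[OF c \<psi>_dom(3)[OF p] v] by simp
  show "push_vec \<psi> v \<in> tangent_space pot.MU pot.AU (\<psi> p)"
    unfolding 1 pot.tangent_space_U[OF \<psi>_dom(1)[OF p]] by blast
qed

lemma \<psi>_image_eq:
  assumes V: "V \<subseteq> chart_dom"
  shows "\<psi> ` V = U \<inter> h -` (snd c ` V)"
proof
  show "\<psi> ` V \<subseteq> U \<inter> h -` (snd c ` V)"
  proof
    fix y assume "y \<in> \<psi> ` V"
    then obtain p where p: "p \<in> V" "y = \<psi> p" by blast
    then have pd: "p \<in> chart_dom" using V by blast
    then show "y \<in> U \<inter> h -` (snd c ` V)"
      using \<psi>_dom[OF pd] hz(1)[of "snd c p"] p by (auto simp: \<psi>_def)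
  qed
  show "U \<inter> h -` (snd c ` V) \<subseteq> \<psi> ` V"
  proof
    fix y assume "y \<in> U \<inter> h -` (snd c ` V)"
    then obtain p where y: "y \<in> U" and p: "p \<in> V" "h y = snd c p" by blast
    have "\<psi> p = y" using p(2) zh(1)[OF y] by (simp add: \<psi>_def flip: p(2))
    then show "y \<in> \<psi> ` V" using p(1) by blast
  qed
qed

lemma openin_\<psi>_image:
  assumes V: "openin M V" "V \<subseteq> chart_dom"
  shows "openin pot.MU (\<psi> ` V)"
  unfolding \<psi>_image_eq[OF V(2)] pot.openin_MU
  using open_h_preimage[OF open_chart_image'[OF c V(1)]] V(2) chart_dom_subset by auto

lemma push_vfield_apply:
  assumes "y \<in> U"
  shows "push_vfield (subtopology M chart_dom) \<psi> X y = push_vec \<psi> (X (inv_chart c (h y)))"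
  unfolding push_vfield_def topspace_chart_dom inv_into_\<psi>[OF assms] ..

text \<open>The components of the pushed field are \<open>dz (h y)\<close> applied to the components
  of \<open>X\<close>. Expanding over \<open>Basis\<close> separates the varying linear map from the
  varying vector.\<close>

lemma push_vfield_smooth:
  assumes X: "smooth_vfield M A V X" and V: "V \<subseteq> chart_dom"
  shows "smooth_vfield pot.MU pot.AU (\<psi> ` V) (push_vfield (subtopology M chart_dom) \<psi> X)"
proof (rule pot.smooth_vfield_chartI[OF pot.id_chart])
  have oV: "openin M V" by (rule smooth_vfield_openin[OF X])
  have Vc: "V \<subseteq> fst c" using V chart_dom_subset by blast
  show o: "openin pot.MU (\<psi> ` V)" by (rule openin_\<psi>_image[OF oV V])
  then have oU: "open (\<psi> ` V)" "\<psi> ` V \<subseteq> U" using pot.openin_MU by auto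
  then show "\<psi> ` V \<subseteq> fst pot.id_chart" by simp
  have inv: "inv_chart c (h y) \<in> V" if "y \<in> \<psi> ` V" for y
    using that inv_\<psi> V by auto
  have eq: "push_vfield (subtopology M chart_dom) \<psi> X y = chart_vec pot.MU pot.AU pot.id_chart y (dz (h y) (chart_comp c (X (inv_chart c (h y)))))"
    if y: "y \<in> \<psi> ` V" for y
  proof -
    have yU: "y \<in> U" using y oU by blast
    show ?thesis
      using push_tangent(1)[OF subsetD[OF V inv[OF y]] smooth_vfield_tangent[OF X inv[OF y]]]
      by (simp add: push_vfield_apply[OF yU] \<psi>_inv[OF yU] inv_mem(1)[OF yU])
  qed
  show "push_vfield (subtopology M chart_dom) \<psi> X y \<in> tangent_space pot.MU pot.AU y" if "y \<in> \<psi> ` V" for y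
  proof -
    have "y \<in> U" using that oU by blast
    then show ?thesis unfolding eq[OF that] pot.tangent_space_U[OF \<open>y \<in> U\<close>] by blast
  qed
  have hV: "smooth_on (\<psi> ` V) h" by (rule smooth_on_subset[OF h_smooth oU])
  have hmem: "h y \<in> snd c ` V" "h y \<in> G" if "y \<in> \<psi> ` V" for y
    using that zh(2) \<psi>_image_eq[OF V] by auto
  have X': "smooth_on (\<psi> ` V) (\<lambda>y. chart_comp c (X (inv_chart c (h y))))"
    by (rule smooth_on_compose[OF smooth_vfield_comp[OF X c Vc] hV hmem(1)])
  have dz_smooth: "smooth_on (\<psi> ` V) (\<lambda>y. dz (h y) b)" for b
  proof (rule smooth_on_compose[OF _ hV hmem(2)])
    show "smooth_on G (\<lambda>x. dz x b)"
      by (rule smooth_on_derivative[OF z_smooth z_derivative])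
  qed
  have "smooth_on (\<psi> ` V) (\<lambda>y. \<Sum>b\<in>Basis. (chart_comp c (X (inv_chart c (h y))) \<bullet> b) *\<^sub>R dz (h y) b)"
    by (intro smooth_on_sum smooth_on_scaleR smooth_on_linear[OF bounded_linear_inner_left] X' dz_smooth oU(1))
  then have "smooth_on (\<psi> ` V) (\<lambda>y. chart_comp pot.id_chart (push_vfield (subtopology M chart_dom) \<psi> X (inv_chart pot.id_chart y)))"
  proof (rule smooth_on_cong[THEN iffD1, rotated])
    fix y assume y: "y \<in> \<psi> ` V"
    then have yU: "y \<in> U" using oU by blast
    show "(\<Sum>b\<in>Basis. (chart_comp c (X (inv_chart c (h y))) \<bullet> b) *\<^sub>R dz (h y) b) =
        chart_comp pot.id_chart (push_vfield (subtopology M chart_dom) \<psi> X (inv_chart pot.id_chart y))"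
      unfolding pot.inv_id_chart[OF yU] eq[OF y]
      using pot.chart_comp_chart_vec[OF pot.id_chart, of y] yU
        linear_euclidean_expansion[OF has_derivative_linear[OF z_derivative[OF hmem(2)[OF y]]], of "chart_comp c (X (inv_chart c (h y)))"]
      by simp
  qed
  then show "smooth_on (snd pot.id_chart ` \<psi> ` V) (\<lambda>y. chart_comp pot.id_chart (push_vfield (subtopology M chart_dom) \<psi> X (inv_chart pot.id_chart y)))"
    by simp
qed

lemma D_affine_coordinate:
  assumes X: "smooth_vfield M A V X" and Y: "smooth_vfield M A V Y" and V: "V \<subseteq> chart_dom" and p: "p \<in> V"
    and g: "g \<in> pot.affine_coordinates"
  shows "D X Y p (\<lambda>q. g (\<psi> q)) = X p (\<lambda>q. Y q (\<lambda>q. g (\<psi> q)))"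
proof -
  have Vc: "V \<subseteq> fst c" "snd c ` V \<subseteq> G" using V by (auto simp: chart_dom_def)
  have gs: "smooth_on U g" by (rule pot.smooth_fun_smooth_on[OF pot.affine_coordinates_smooth[OF g]])
  have "G \<inter> z -` U = G" using hz(2) by blast
  then have "smooth_on G (\<lambda>x. g (z x))" using smooth_pullback(1)[OF gs order_refl] by simp
  moreover have "((\<lambda>x. frechet_derivative (\<lambda>x. g (z x)) (at x) w) has_derivative
      (\<lambda>t. frechet_derivative (\<lambda>x. g (z x)) (at x) (christoffel c x t w))) (at x)" if "x \<in> G" for x w
    using g z_affine[OF that] w_affine[OF that] by (auto simp: pot.affine_coordinates_def)
  ultimately show ?thesis
    unfolding \<psi>_def by (rule affine_chart[OF c G(2) _ _ X Y Vc p])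
qed

lemma biholomorphic: "biholomorphic_map (subtopology M chart_dom) (restrict_atlas chart_dom A) pot.MU pot.AU \<psi>"
  unfolding biholomorphic_map_def topspace_chart_dom holomorphic_map_def
proof (intro conjI ballI allI)
  show "bij_betw \<psi> chart_dom (topspace pot.MU)"
    using \<psi>_inj \<psi>_image by (simp add: bij_betw_def)
  show "continuous_map (subtopology M chart_dom) pot.MU \<psi>"
    unfolding continuous_map_def topspace_chart_dom
  proof (intro conjI allI impI)
    show "\<psi> \<in> chart_dom \<rightarrow> topspace pot.MU" using \<psi>_dom(1) by auto
    fix T assume "openin pot.MU T"
    then have "open T" using pot.openin_MU by blast
    have "{p \<in> chart_dom. \<psi> p \<in> T} = {p \<in> fst c. snd c p \<in> G \<inter> z -` T}" by (auto simp: chart_dom_def \<psi>_def)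
    then have "openin M {p \<in> chart_dom. \<psi> p \<in> T}"
      using openin_chart_preimage[OF c open_z_preimage[OF \<open>open T\<close>]] by simp
    then show "openin (subtopology M chart_dom) {p \<in> chart_dom. \<psi> p \<in> T}"
      using openin_open_subtopology[OF chart_dom_openin] by auto
  qed
  show "continuous_map pot.MU (subtopology M chart_dom) (inv_into chart_dom \<psi>)"
    unfolding continuous_map_def topspace_chart_dom
  proof (intro conjI allI impI)
    show "inv_into chart_dom \<psi> \<in> topspace pot.MU \<rightarrow> chart_dom" using inv_into_\<psi> inv_mem(2) by auto
    fix V assume "openin (subtopology M chart_dom) V"
    then have V: "openin M V" "V \<subseteq> chart_dom" using openin_open_subtopology[OF chart_dom_openin] by auto
    have "{y \<in> topspace pot.MU. inv_into chart_dom \<psi> y \<in> V} = \<psi> ` V"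
    proof
      show "\<psi> ` V \<subseteq> {y \<in> topspace pot.MU. inv_into chart_dom \<psi> y \<in> V}"
      proof (rule image_subsetI)
        fix p assume p: "p \<in> V"
        then have "p \<in> chart_dom" using V(2) by blast
        then show "\<psi> p \<in> {y \<in> topspace pot.MU. inv_into chart_dom \<psi> y \<in> V}"
          using p \<psi>_dom(1) inv_into_f_f[OF \<psi>_inj] by simp
      qed
      show "{y \<in> topspace pot.MU. inv_into chart_dom \<psi> y \<in> V} \<subseteq> \<psi> ` V"
      proof
        fix y assume y: "y \<in> {y \<in> topspace pot.MU. inv_into chart_dom \<psi> y \<in> V}"
        then have "\<psi> (inv_into chart_dom \<psi> y) = y" using \<psi>_image by (intro f_inv_into_f) simp
        then show "y \<in> \<psi> ` V" using y by (metis (no_types, lifting) imageI mem_Collect_eq)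
      qed
    qed
    then show "openin pot.MU {y \<in> topspace pot.MU. inv_into chart_dom \<psi> y \<in> V}"
      using openin_\<psi>_image[OF V] by simp
  qed
next
  fix e' d i assume "e' \<in> restrict_atlas chart_dom A" "d \<in> pot.AU"
  then obtain e where e: "e \<in> A" "e' = (fst e \<inter> chart_dom, snd e)" and d: "d = pot.id_chart"
    by (auto simp: restrict_atlas_def std_atlas_def)
  have set1: "snd e' ` {p \<in> fst e'. \<psi> p \<in> fst d} = snd e ` (fst e \<inter> chart_dom)"
    using \<psi>_dom(1) by (auto simp: e d)
  have o1: "open (snd e ` (fst e \<inter> chart_dom))" by (rule open_chart_image[OF e(1) chart_dom_openin])
  have mem: "inv_chart e x \<in> chart_dom" if "x \<in> snd e ` (fst e \<inter> chart_dom)" for x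
    using inv_chart_mem[OF e(1) _ that] by auto
  have "holomorphic_fun (snd e ` (fst e \<inter> chart_dom)) (\<lambda>x. z (snd c (inv_chart e x)) $ i)"
  proof (rule holomorphic_fun_compose[OF z_holomorphic])
    show "holomorphic_fun (snd e ` (fst e \<inter> chart_dom)) (\<lambda>x. snd c (inv_chart e x) $ i)" for i
      by (rule holomorphic_fun_subset[OF transition_holomorphic[OF e(1) c] o1]) (use chart_dom_subset in auto)
    show "snd c (inv_chart e x) \<in> G" if "x \<in> snd e ` (fst e \<inter> chart_dom)" for x
      using \<psi>_dom(2)[OF mem[OF that]] .
  qed
  then show "holomorphic_fun (snd e' ` {p \<in> fst e'. \<psi> p \<in> fst d}) (\<lambda>x. snd d (\<psi> (inv_chart e' x)) $ i)"
    unfolding set1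
  proof (rule holomorphic_fun_cong[THEN iffD1, rotated])
    show "z (snd c (inv_chart e x)) $ i = snd d (\<psi> (inv_chart e' x)) $ i"
      if "x \<in> snd e ` (fst e \<inter> chart_dom)" for x
      unfolding e(2) inv_chart_restrict[OF chart_dom_openin e(1) that] by (simp add: d \<psi>_def)
  qed
next
  fix d e' i assume "d \<in> pot.AU" "e' \<in> restrict_atlas chart_dom A"
  then obtain e where e: "e \<in> A" "e' = (fst e \<inter> chart_dom, snd e)" and d: "d = pot.id_chart"
    by (auto simp: restrict_atlas_def std_atlas_def)
  let ?S = "snd c ` (fst c \<inter> fst e)"
  have set2: "snd d ` {y \<in> fst d. inv_into chart_dom \<psi> y \<in> fst e'} = U \<inter> h -` ?S"
  proof -
    have "inv_into chart_dom \<psi> y \<in> fst e' \<longleftrightarrow> h y \<in> ?S" if y: "y \<in> U" for y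
    proof
      assume "inv_into chart_dom \<psi> y \<in> fst e'"
      then have "inv_chart c (h y) \<in> fst c \<inter> fst e"
        using inv_mem(2)[OF y] chart_dom_subset by (auto simp: e inv_into_\<psi>[OF y])
      then have "snd c (inv_chart c (h y)) \<in> ?S" by (rule imageI)
      then show "h y \<in> ?S" by (simp only: inv_mem(1)[OF y])
    next
      assume "h y \<in> ?S"
      then have "inv_chart c (h y) \<in> fst c \<inter> fst e" by (intro inv_chart_mem[OF c]) auto
      then show "inv_into chart_dom \<psi> y \<in> fst e'"
        using inv_mem(2)[OF y] by (simp add: e inv_into_\<psi>[OF y])
    qed
    then show ?thesis by (auto simp: d)
  qed
  have o2: "open (U \<inter> h -` ?S)" by (rule open_h_preimage[OF open_chart_image[OF c chart_domain[OF e(1)]]])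
  have "holomorphic_fun (U \<inter> h -` ?S) (\<lambda>y. snd e (inv_chart c (h y)) $ i)"
  proof (rule holomorphic_fun_compose[OF transition_holomorphic[OF c e(1)]])
    show "holomorphic_fun (U \<inter> h -` ?S) (\<lambda>y. h y $ i)" for i
      by (rule holomorphic_fun_subset[OF h_holomorphic o2]) auto
  qed auto
  then show "holomorphic_fun (snd d ` {y \<in> fst d. inv_into chart_dom \<psi> y \<in> fst e'})
      (\<lambda>y. snd e' (inv_into chart_dom \<psi> (inv_chart d y)) $ i)"
    unfolding set2
    by (rule holomorphic_fun_cong[THEN iffD1, rotated])
      (simp add: e(2) d inv_into_identity inv_into_\<psi>)
qed

lemma push_affine:
  assumes p: "p \<in> chart_dom" and v: "v \<in> tangent_space M A p"
  shows "push_vec \<psi> v (\<lambda>y. Re (y $ i)) = frechet_derivative (\<lambda>x. Re (z x $ i)) (at (snd c p)) (chart_comp c v)"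
    "push_vec \<psi> v (\<lambda>y. Re (cpartial i F y)) = frechet_derivative (\<lambda>x. Re (cpartial i F (z x))) (at (snd c p)) (chart_comp c v)"
proof -
  have eq: "push_vec \<psi> v g = frechet_derivative (\<lambda>x. g (z x)) (at (snd c p)) (chart_comp c v)" if g: "g \<in> pot.affine_coordinates" for g
  proof -
    have gs: "smooth_on U g" by (rule pot.smooth_fun_smooth_on[OF pot.affine_coordinates_smooth[OF g]])
    have x: "snd c p \<in> G \<inter> z -` U" using \<psi>_dom[OF p] by (simp add: \<psi>_def)
    have "v (\<lambda>q. g (\<psi> q)) = chart_vec M A c p (chart_comp c v) (\<lambda>q. g (z (snd c q)))"
      using chart_vec_chart_comp[OF c \<psi>_dom(3)[OF p] v] by (simp add: \<psi>_def)
    also have "\<dots> = frechet_derivative (\<lambda>x. g (z x)) (at (snd c p)) (chart_comp c v)"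
      by (rule chart_vec_chart[OF c \<psi>_dom(3)[OF p] smooth_pullback(1)[OF gs order_refl] x])
    finally show ?thesis by (simp add: push_vec_def)
  qed
  show "push_vec \<psi> v (\<lambda>y. Re (y $ i)) = frechet_derivative (\<lambda>x. Re (z x $ i)) (at (snd c p)) (chart_comp c v)"
    "push_vec \<psi> v (\<lambda>y. Re (cpartial i F y)) = frechet_derivative (\<lambda>x. Re (cpartial i F (z x))) (at (snd c p)) (chart_comp c v)"
    by (rule eq, simp add: pot.affine_coordinates_def)+
qed

text \<open>For the connections both sides need only be compared on affine coordinates
  \<open>g\<close>, where each is \<open>X\<close> applied to \<open>Y\<close> of the pullback of
  \<open>g\<close>. The forms agree because \<open>push_affine\<close> turns the induced form into
  the expression in \<open>form\<close>.\<close>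

lemma isomorphism:
  "special_kahler_isomorphism (subtopology M chart_dom) (restrict_atlas chart_dom A) D \<omega>
    pot.MU pot.AU pot.potential_connection (induced_form (d_immersion F)) \<psi>"
  unfolding special_kahler_isomorphism_def
proof (intro conjI allI impI ballI biholomorphic)
  fix V X Y p
  assume "smooth_vfield (subtopology M chart_dom) (restrict_atlas chart_dom A) V X \<and>
    smooth_vfield (subtopology M chart_dom) (restrict_atlas chart_dom A) V Y" and p: "p \<in> V"
  then have X: "smooth_vfield M A V X" and Y: "smooth_vfield M A V Y" and V: "V \<subseteq> chart_dom"
    using smooth_vfield_restrict[OF chart_dom_openin] by blast+
  have pd: "p \<in> chart_dom" using p V by blast
  let ?P = "push_vfield (subtopology M chart_dom) \<psi>"
  have push_p: "?P Z (\<psi> q) = push_vec \<psi> (Z q)" if "q \<in> chart_dom" for Z q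
    unfolding push_vfield_apply[OF \<psi>_dom(1)[OF that]] inv_\<psi>[OF that] ..
  show "push_vec \<psi> (D X Y p) = pot.potential_connection (?P X) (?P Y) (\<psi> p)"
  proof (rule pot.induced_connection_eqI[OF pot.induced_connection_exists push_vfield_smooth[OF X V] push_vfield_smooth[OF Y V], symmetric])
    show "\<psi> p \<in> \<psi> ` V" using p by blast
    show "push_vec \<psi> (D X Y p) \<in> tangent_space pot.MU pot.AU (\<psi> p)"
      by (rule push_tangent(2)[OF pd D_tangent[OF X Y p]])
    fix g assume g: "g \<in> pot.affine_coordinates"
    have "?P X (\<psi> p) (\<lambda>y. ?P Y y g) = X p (\<lambda>q. ?P Y (\<psi> q) g)"
      by (simp add: push_p[OF pd] push_vec_def)
    also have "\<dots> = X p (\<lambda>q. Y q (\<lambda>q. g (\<psi> q)))"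
    proof (rule tangent_vec_cong[OF smooth_vfield_tangent[OF X p] smooth_vfield_openin[OF X] p])
      show "?P Y (\<psi> q) g = Y q (\<lambda>q. g (\<psi> q))" if "q \<in> V" for q
        unfolding push_p[OF subsetD[OF V that]] push_vec_def ..
    qed
    also have "\<dots> = D X Y p (\<lambda>q. g (\<psi> q))" by (rule D_affine_coordinate[OF X Y V p g, symmetric])
    finally show "push_vec \<psi> (D X Y p) g = ?P X (\<psi> p) (\<lambda>y. ?P Y y g)" by (simp add: push_vec_def)
  qed
next
  fix p v w assume "p \<in> topspace (subtopology M chart_dom)"
    and v: "v \<in> tangent_space (subtopology M chart_dom) (restrict_atlas chart_dom A) p"
    and w: "w \<in> tangent_space (subtopology M chart_dom) (restrict_atlas chart_dom A) p"
  then have p: "p \<in> chart_dom" using topspace_chart_dom by blast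
  have vw: "v \<in> tangent_space M A p" "w \<in> tangent_space M A p"
    using v w tangent_space_restrict[OF chart_dom_openin p] by auto
  have "induced_form (d_immersion F) (\<psi> p) (push_vec \<psi> v) (push_vec \<psi> w) =
      chart_form c (snd c p) (chart_comp c v) (chart_comp c w)"
    unfolding pot.induced_form_eq push_affine[OF p vw(1)] push_affine[OF p vw(2)] form[OF \<psi>_dom(2)[OF p]] ..
  also have "\<dots> = \<omega> p v w"
    unfolding chart_form_def inv_chart_left[OF c \<psi>_dom(3)[OF p]]
    using chart_vec_chart_comp[OF c \<psi>_dom(3)[OF p]] vw by simp
  finally show "induced_form (d_immersion F) (\<psi> p) (push_vec \<psi> v) (push_vec \<psi> w) = \<omega> p v w" .
qed

end

text \<open>The construction yields real parts of complex derivatives, while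
  \<open>potential_chart\<close> speaks of derivatives of real functions such as
  \<open>Re (cpartial i F (z x))\<close>. These agree on the open set \<open>G\<close>, and so do
  their further derivatives.\<close>

lemma affine_transfer:
  assumes f: "holomorphic_fun B f" and G: "open G" "G \<subseteq> B" and eq: "\<And>x. x \<in> G \<Longrightarrow> g x = Re (f x)" and x: "x \<in> G"
  shows "frechet_derivative g (at x) = (\<lambda>v. Re (frechet_derivative f (at x) v))"
    and "((\<lambda>x. Re (frechet_derivative f (at x) w)) has_derivative (\<lambda>v. Re (frechet_derivative f (at x) (\<Gamma> v)))) (at x) \<Longrightarrow>
      ((\<lambda>x. frechet_derivative g (at x) w) has_derivative (\<lambda>v. frechet_derivative g (at x) (\<Gamma> v))) (at x)"
proof -
  have 1: "frechet_derivative g (at x) = (\<lambda>v. Re (frechet_derivative f (at x) v))" if x: "x \<in> G" for x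
  proof -
    have "(g has_derivative (\<lambda>v. Re (frechet_derivative f (at x) v))) (at x)"
      by (rule has_derivative_transform_within_open[OF bounded_linear.has_derivative[OF bounded_linear_Re
            holomorphic_fun_has_derivative[OF f subsetD[OF G(2) x]]] G(1) x]) (simp add: eq)
    from frechet_derivative_at[OF this] show ?thesis by simp
  qed
  then show "frechet_derivative g (at x) = (\<lambda>v. Re (frechet_derivative f (at x) v))" using x .
  assume "((\<lambda>x. Re (frechet_derivative f (at x) w)) has_derivative (\<lambda>v. Re (frechet_derivative f (at x) (\<Gamma> v)))) (at x)"
  then have "((\<lambda>x. frechet_derivative g (at x) w) has_derivative (\<lambda>v. Re (frechet_derivative f (at x) (\<Gamma> v)))) (at x)"
    by (rule has_derivative_transform_within_open[OF _ G(1) x]) (simp add: 1)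
  then show "((\<lambda>x. frechet_derivative g (at x) w) has_derivative (\<lambda>v. frechet_derivative g (at x) (\<Gamma> v))) (at x)"
    by (simp add: 1[OF x])
qed

lemma (in special_kahler_manifold) local_potential:
  assumes p: "p \<in> topspace M"
  shows "\<exists>W (U :: (complex^'n) set) F D' \<psi>. openin M W \<and> p \<in> W \<and> open U \<and> nondegenerate_holomorphic U F \<and>
    induced_connection (top_of_set U) (std_atlas U) (d_immersion F) D' \<and>
    special_kahler_isomorphism (subtopology M W) (restrict_atlas W A) D \<omega>
      (top_of_set U) (std_atlas U) D' (induced_form (d_immersion F)) \<psi>"
proof -
  obtain c where c: "c \<in> A" "p \<in> fst c" using chart_exists[OF p] by blast
  let ?S = "snd c ` fst c" and ?x = "snd c p"
  have xS: "?x \<in> ?S" using c(2) by blast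
  note form_props = chart_form_properties[OF c(1)]
  obtain r Z W where r: "r > 0" "ball ?x r \<subseteq> ?S"
    and Z: "\<And>i :: 'n. holomorphic_fun (ball ?x r) (Z i)" and W: "\<And>i :: 'n. holomorphic_fun (ball ?x r) (W i)"
    and inj: "\<And>v. (\<And>i. frechet_derivative (Z i) (at ?x) v = 0) \<Longrightarrow> v = 0"
    and Z_aff: "\<And>i x w. x \<in> ball ?x r \<Longrightarrow> ((\<lambda>x. Re (frechet_derivative (Z i) (at x) w)) has_derivative
        (\<lambda>v. Re (frechet_derivative (Z i) (at x) (christoffel c x v w)))) (at x)"
    and W_aff: "\<And>i x w. x \<in> ball ?x r \<Longrightarrow> ((\<lambda>x. Re (frechet_derivative (W i) (at x) w)) has_derivative
        (\<lambda>v. Re (frechet_derivative (W i) (at x) (christoffel c x v w)))) (at x)"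
    and form: "\<And>x u v. x \<in> ball ?x r \<Longrightarrow> chart_form c x u v = coord_form Z W x u v"
  proof (rule special_kahler_affine_coordinates[of ?S ?x "christoffel c" "chart_form c",
        OF chart_image[OF c(1)] xS christoffel_linear christoffel_smooth[OF c(1)] christoffel_symmetric[OF c(1)]
        christoffel_i[OF c(1)] christoffel_flat[OF c(1)] form_props])
    fix r :: real and Z W :: "'n \<Rightarrow> complex^'n \<Rightarrow> complex"
    assume "0 < r" "ball ?x r \<subseteq> ?S" "\<And>i. holomorphic_fun (ball ?x r) (Z i)" "\<And>i. holomorphic_fun (ball ?x r) (W i)"
      "\<And>v. (\<And>i. frechet_derivative (Z i) (at ?x) v = 0) \<Longrightarrow> v = 0"
      "\<And>i x w. x \<in> ball ?x r \<Longrightarrow> ((\<lambda>x. Re (frechet_derivative (Z i) (at x) w)) has_derivative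
        (\<lambda>v. Re (frechet_derivative (Z i) (at x) (christoffel c x v w)))) (at x)"
      "\<And>i x w. x \<in> ball ?x r \<Longrightarrow> ((\<lambda>x. Re (frechet_derivative (W i) (at x) w)) has_derivative
        (\<lambda>v. Re (frechet_derivative (W i) (at x) (christoffel c x v w)))) (at x)"
      "\<And>x u v. x \<in> ball ?x r \<Longrightarrow> chart_form c x u v = coord_form Z W x u v"
    then show thesis by (rule that)
  qed (assumption+)
  have J: "coord_form Z W x (\<i> *s u) (\<i> *s v) = coord_form Z W x u v" if "x \<in> ball ?x r" for x u v
    using form_props(3)[of x u v] form[OF that] that r(2) by auto
  have nd: "v = 0" if x: "x \<in> ball ?x r" and "\<And>w. coord_form Z W x v w = 0" for x v
    by (rule form_props(4)[OF subsetD[OF r(2) x]]) (simp add: form[OF x] that(2))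
  have xB: "?x \<in> ball ?x r" using r(1) by simp
  obtain G U h F where G: "open G" "?x \<in> G" "G \<subseteq> ball ?x r" and U: "open U"
    and hom: "homeomorphism G U (\<lambda>x. \<chi> i. Z i x) h" and h: "\<And>i. holomorphic_fun U (\<lambda>y. h y $ i)"
    and F: "nondegenerate_holomorphic U F" and FW: "\<And>x i. x \<in> G \<Longrightarrow> cpartial i F (\<chi> i. Z i x) = W i x"
    by (rule special_kahler_potential[OF open_ball xB Z W inj J nd]) (assumption | rule that)+
  let ?z = "\<lambda>x. \<chi> i. Z i x"
  have z_eq: "Re (?z x $ i) = Re (Z i x)" for x i by simp
  have w_eq: "Re (cpartial i F (?z x)) = Re (W i x)" if "x \<in> G" for x i using FW[OF that] by simp
  have z_deriv: "frechet_derivative (\<lambda>x. Re (?z x $ i)) (at x) = (\<lambda>v. Re (frechet_derivative (Z i) (at x) v))"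
    if "x \<in> G" for x i
    by (rule affine_transfer(1)[OF Z G(1,3) z_eq that])
  have w_deriv: "frechet_derivative (\<lambda>x. Re (cpartial i F (?z x))) (at x) = (\<lambda>v. Re (frechet_derivative (W i) (at x) v))"
    if "x \<in> G" for x i
    by (rule affine_transfer(1)[OF W G(1,3) w_eq that])
  have GB: "x \<in> ball ?x r" if "x \<in> G" for x using G(3) that by blast
  interpret chart: potential_chart M A D \<omega> U F c G ?z h
  proof
    show "nondegenerate_holomorphic U F" by (rule F)
    show "c \<in> A" by (rule c(1))
    show "open G" by (rule G(1))
    show "G \<subseteq> ?S" using G(3) r(2) by blast
    show "homeomorphism G U ?z h" by (rule hom)
    show "holomorphic_fun G (\<lambda>x. ?z x $ i)" for i
      using holomorphic_fun_subset[OF Z G(1,3)] by simp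
    show "holomorphic_fun U (\<lambda>y. h y $ i)" for i by (rule h)
    show "((\<lambda>x. frechet_derivative (\<lambda>x. Re (?z x $ i)) (at x) w) has_derivative
        (\<lambda>t. frechet_derivative (\<lambda>x. Re (?z x $ i)) (at x) (christoffel c x t w))) (at x)" if "x \<in> G" for x i w
      by (rule affine_transfer(2)[OF Z G(1,3) z_eq that Z_aff[OF GB[OF that]]])
    show "((\<lambda>x. frechet_derivative (\<lambda>x. Re (cpartial i F (?z x))) (at x) w) has_derivative
        (\<lambda>t. frechet_derivative (\<lambda>x. Re (cpartial i F (?z x))) (at x) (christoffel c x t w))) (at x)" if "x \<in> G" for x i w
      by (rule affine_transfer(2)[OF W G(1,3) w_eq that W_aff[OF GB[OF that]]])
    show "chart_form c x u v = 2 * (\<Sum>i\<in>UNIV.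
      frechet_derivative (\<lambda>x. Re (?z x $ i)) (at x) u * frechet_derivative (\<lambda>x. Re (cpartial i F (?z x))) (at x) v -
      frechet_derivative (\<lambda>x. Re (cpartial i F (?z x))) (at x) u * frechet_derivative (\<lambda>x. Re (?z x $ i)) (at x) v)"
      if "x \<in> G" for x u v
      unfolding form[OF GB[OF that]] coord_form_def z_deriv[OF that] w_deriv[OF that] ..
  qed
  show ?thesis
  proof (intro exI conjI)
    show "openin M chart.chart_dom" by (rule chart.chart_dom_openin)
    show "p \<in> chart.chart_dom" using c(2) G(2) by (simp add: chart.chart_dom_def)
    show "open U" by (rule U)
    show "nondegenerate_holomorphic U F" by (rule F)
    show "induced_connection (top_of_set U) (std_atlas U) (d_immersion F) chart.pot.potential_connection"
      by (rule chart.pot.induced_connection_exists)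
    show "special_kahler_isomorphism (subtopology M chart.chart_dom) (restrict_atlas chart.chart_dom A) D \<omega>
      (top_of_set U) (std_atlas U) chart.pot.potential_connection (induced_form (d_immersion F)) chart.\<psi>"
      by (rule chart.isomorphism)
  qed
qed

theorem corollary4:
  shows
    "(\<forall>(U :: (complex^'n::finite) set) F.
        open U \<and> nondegenerate_holomorphic U F \<longrightarrow>
          holomorphic_immersion (top_of_set U) (std_atlas U) (d_immersion F) \<and>
          totally_complex (top_of_set U) (std_atlas U) (d_immersion F) \<and>
          (\<exists>D. induced_connection (top_of_set U) (std_atlas U) (d_immersion F) D) \<and>
          (\<forall>D D'. induced_connection (top_of_set U) (std_atlas U) (d_immersion F) D \<and>
                  induced_connection (top_of_set U) (std_atlas U) (d_immersion F) D' \<longrightarrow>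
                  same_connection (top_of_set U) (std_atlas U) D D') \<and>
          (\<forall>D. induced_connection (top_of_set U) (std_atlas U) (d_immersion F) D \<longrightarrow>
               special_kahler_manifold (top_of_set U) (std_atlas U) D (induced_form (d_immersion F)))) \<and>
     (\<forall>(M :: 'a topology) (A :: ('a, 'n) atlas) D \<omega>.
        special_kahler_manifold M A D \<omega> \<longrightarrow>
          (\<forall>p\<in>topspace M. \<exists>W (U :: (complex^'n) set) F D' \<psi>.
             openin M W \<and> p \<in> W \<and>
             open U \<and> nondegenerate_holomorphic U F \<and>
             induced_connection (top_of_set U) (std_atlas U) (d_immersion F) D' \<and>
             special_kahler_isomorphism
               (subtopology M W) (restrict_atlas W A) D \<omega>
               (top_of_set U) (std_atlas U) D' (induced_form (d_immersion F)) \<psi>))"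
proof (intro conjI allI impI)
  fix U :: "(complex^'n) set" and F assume "open U \<and> nondegenerate_holomorphic U F"
  then interpret nondegenerate_potential U F by unfold_locales simp
  show "holomorphic_immersion (top_of_set U) (std_atlas U) (d_immersion F)"
    by (rule d_immersion_holomorphic_immersion)
  show "totally_complex (top_of_set U) (std_atlas U) (d_immersion F)"
    by (rule d_immersion_totally_complex)
  show "\<exists>D. induced_connection (top_of_set U) (std_atlas U) (d_immersion F) D"
    by (rule exI) (rule induced_connection_exists)
  show "same_connection (top_of_set U) (std_atlas U) D D'"
    if "induced_connection (top_of_set U) (std_atlas U) (d_immersion F) D \<and>
      induced_connection (top_of_set U) (std_atlas U) (d_immersion F) D'" for D D'
    using that by (intro induced_connection_unique) auto
  show "special_kahler_manifold (top_of_set U) (std_atlas U) D (induced_form (d_immersion F))"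
    if "induced_connection (top_of_set U) (std_atlas U) (d_immersion F) D" for D
    by (rule induced_connection_special_kahler[OF that])
next
  fix M :: "'a topology" and A :: "('a, 'n) atlas" and D \<omega>
  assume "special_kahler_manifold M A D \<omega>"
  then show "\<forall>p\<in>topspace M. \<exists>W (U :: (complex^'n) set) F D' \<psi>.
             openin M W \<and> p \<in> W \<and>
             open U \<and> nondegenerate_holomorphic U F \<and>
             induced_connection (top_of_set U) (std_atlas U) (d_immersion F) D' \<and>
             special_kahler_isomorphism
               (subtopology M W) (restrict_atlas W A) D \<omega>
               (top_of_set U) (std_atlas U) D' (induced_form (d_immersion F)) \<psi>"
    by (intro ballI special_kahler_manifold.local_potential)
qed

end
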